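(* Assume that either $1<p\le2$ and $0<a\le\pi$, or $p>2$ and $0<a<\pi$. Then, for every $u_0\in C([0,a])$ with $u_0>0$ in $[0,a]$, the solution $u(t,x)$ of $$ \begin{cases} u_t=u^p(u_{xx}+u-\bar u), & 0<t<T_{\max},\ 0<x<a,\\ u_x(t,0)=u_x(t,a)=0, & 0<t<T_{\max},\\ u(0,x)=u_0(x), & 0<x<a, \end{cases} $$ where $\bar u(t)=\frac1a\int_0^a u(t,x)\,dx$ and $T_{\max}\le+\infty$ is the maximal existence time, converges to some nonnegative steady state of this problem in $C([0,a])$ as $t\to+\infty$ (in particular it exists for all $t>0$).
   Context: A solution means the positive solution $u>0$ on $[0,T_{\max})\times[0,a]$, continuous up to $t=0$ and classical ($C^1$ in $t$, $C^2$ in $x$) for $0<t<T_{\max}$. Positivity of $u_0$ guarantees positivity of the solution on $0<t<T_{\max}$. A nonnegative steady state is a time-independent solution, i.e. a nonnegative function $u^*\in C^2([0,a])$ with $(u^* )^p\left((u^* )''+u^*-\overline{u^*}\right)=0$ in $(0,a)$ and $(u^* )'(0)=(u^* )'(a)=0$, where $\overline{u^*}=\frac1a\int_0^a u^*\,dx$. *)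

theory Defs
  imports "HOL-Analysis.Analysis"
begin

definition mean :: "real \<Rightarrow> (real \<Rightarrow> real) \<Rightarrow> real" where
  "mean a v = (1 / a) * integral {0..a} v"

(* The times 0 \<le> t < T, where T \<le> \<infinity>. *)
definition times :: "ereal \<Rightarrow> real set" where
  "times T = {t. 0 \<le> t \<and> ereal t < T}"

definition pos_times :: "ereal \<Rightarrow> real set" where
  "pos_times T = {t. 0 < t \<and> ereal t < T}"

(* Positive classical solution on [0,T) x [0,a], written u t x. The functions ut, ux, uxx are the
   partial derivatives. Their joint continuity on (0,T) x [0,a] says that u is C^1 in t and C^2 in x
   there; x-derivatives are one-sided at x = 0 and x = a. *)
definition is_solution ::
  "real \<Rightarrow> real \<Rightarrow> (real \<Rightarrow> real) \<Rightarrow> ereal \<Rightarrow> (real \<Rightarrow> real \<Rightarrow> real) \<Rightarrow> bool" where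
  "is_solution p a u0 T u \<longleftrightarrow>
     0 < T \<and>
     continuous_on (times T \<times> {0..a}) (\<lambda>(t, x). u t x) \<and>
     (\<forall>t\<in>times T. \<forall>x\<in>{0..a}. 0 < u t x) \<and>
     (\<forall>x\<in>{0<..<a}. u 0 x = u0 x) \<and>
     (\<exists>ut ux uxx :: real \<Rightarrow> real \<Rightarrow> real.
        continuous_on (pos_times T \<times> {0..a}) (\<lambda>(t, x). ut t x) \<and>
        continuous_on (pos_times T \<times> {0..a}) (\<lambda>(t, x). ux t x) \<and>
        continuous_on (pos_times T \<times> {0..a}) (\<lambda>(t, x). uxx t x) \<and>
        (\<forall>t\<in>pos_times T. \<forall>x\<in>{0..a}.
           ((\<lambda>s. u s x) has_real_derivative ut t x) (at t) \<and>
           (u t has_real_derivative ux t x) (at x within {0..a}) \<and>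
           (ux t has_real_derivative uxx t x) (at x within {0..a})) \<and>
        (\<forall>t\<in>pos_times T. \<forall>x\<in>{0<..<a}.
           ut t x = u t x powr p * (uxx t x + u t x - mean a (u t))) \<and>
        (\<forall>t\<in>pos_times T. ux t 0 = 0 \<and> ux t a = 0))"

(* A solution that cannot be continued: T is its maximal existence time. *)
definition maximal_solution ::
  "real \<Rightarrow> real \<Rightarrow> (real \<Rightarrow> real) \<Rightarrow> ereal \<Rightarrow> (real \<Rightarrow> real \<Rightarrow> real) \<Rightarrow> bool" where
  "maximal_solution p a u0 T u \<longleftrightarrow>
     is_solution p a u0 T u \<and>
     \<not> (\<exists>T' v. T < T' \<and> is_solution p a u0 T' v \<and>
              (\<forall>t\<in>times T. \<forall>x\<in>{0..a}. v t x = u t x))"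

(* The functions v' and v'' are the derivatives of v, one-sided at the end points;
   continuity of v'' says that v is C^2 on [0,a]. *)
definition nonneg_steady_state :: "real \<Rightarrow> real \<Rightarrow> (real \<Rightarrow> real) \<Rightarrow> bool" where
  "nonneg_steady_state p a v \<longleftrightarrow>
     (\<forall>x\<in>{0..a}. 0 \<le> v x) \<and>
     (\<exists>v' v'' :: real \<Rightarrow> real.
        (\<forall>x\<in>{0..a}. (v has_real_derivative v' x) (at x within {0..a}) \<and>
                    (v' has_real_derivative v'' x) (at x within {0..a})) \<and>
        continuous_on {0..a} v'' \<and>
        (\<forall>x\<in>{0<..<a}. v x powr p * (v'' x + v x - mean a v) = 0) \<and>
        v' 0 = 0 \<and> v' a = 0)"

end

theory Submission
  imports Defs "HOL-Complex_Analysis.Great_Picard" "HOL-Library.Diagonal_Subsequence"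
begin

text \<open>Put \<open>E = \<integral> ux^2 - \<integral> (u - mean u)^2\<close>, which is nonnegative for a at most pi by the
  Wirtinger inequality. Along the flow E decreases with \<open>E' = - 2 \<integral> u^p (uxx + u - mean u)^2\<close>,
  while \<open>\<integral> u^(1 - p)\<close> is conserved, and so is \<open>\<integral> u^(1 - p) cos x\<close> if a = pi. The distance of u
  to b + c cos x (to the constants b if a is less than pi) is bounded by the square root of E, so
  the conserved quantities forbid b and c to be large. Thus u is bounded and exists for all times,
  and Cauchy--Schwarz gives \<open>E' \<le> - k E^2\<close>, hence E tends to 0. Finally the increments of
  \<open>u^(1 - p)\<close> are orthogonal to 1 and to the cosine mode; tested with the increments of u they
  therefore only see the part of u controlled by E. As \<open>u^(1 - p)\<close> is strictly monotone in u, this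
  makes u Cauchy in L2 and forces b and c to converge.

  Existence is shown by discretising space. The nonlinear semidiscrete system is solved by Picard
  iteration, comparison keeps it between positive bounds, and weighted energy estimates that do not
  see the regularity of the initial value give equicontinuity for positive times; barriers that only
  use the modulus of continuity of the initial value give continuity at time 0.\<close>

text \<open>In terms of \<open>u powr (1 - p)\<close> the equation says that this density moves with
  velocity \<open>(1 - p) * (uxx + u - mean u)\<close>, which is linear in u. The operator w
  \<mapsto> w'' + w - mean w with Neumann conditions is symmetric, so its kernel supplies the
  conserved weights: the constants and, at a = pi, also cos x. At a = pi the Wirtinger inequality is
  an equality on that mode, so E says nothing about its amplitude; this information has to come from
  the conserved quantities. The other obstacle is the degeneracy at u = 0: no lower bound uniform in
  time is established, and the limit is only shown to be nonnegative. Therefore uniqueness,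
  continuation and convergence rest on an upper bound M alone. The density has the monotonicity
  constant \<open>(p - 1) * M powr (- p)\<close>, and the time of local existence depends on the
  initial value only through M. Positive lower bounds enter only the regularity constants of one
  fixed local solution.\<close>

lemma first_touch:
  fixes f f' :: "real \<Rightarrow> 'b::topological_space \<Rightarrow> real"
  assumes X: "compact X" and cont: "continuous_on ({0..B} \<times> X) (\<lambda>(t, x). f t x)"
    and init: "\<And>x. x \<in> X \<Longrightarrow> f 0 x < 0"
    and der: "\<And>t x. 0 < t \<Longrightarrow> t < B \<Longrightarrow> x \<in> X \<Longrightarrow> ((\<lambda>s. f s x) has_real_derivative f' t x) (at t)"
    and touch: "\<And>t x. 0 < t \<Longrightarrow> t < B \<Longrightarrow> x \<in> X \<Longrightarrow> f t x = 0 \<Longrightarrow> (\<And>y. y \<in> X \<Longrightarrow> f t y \<le> 0) \<Longrightarrow> f' t x < 0"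
    and t: "0 \<le> t" "t < B" and x: "x \<in> X"
  shows "f t x < 0"
proof (rule ccontr)
  assume neg: "\<not> f t x < 0"
  \<comment> \<open>The projection of this compact set to the time axis has a least element s, the
    first time at which f reaches 0. There f vanishes at a spatial maximum, so its time derivative
    is negative, although f was negative just before.\<close>
  define S where "S = {(s, y) \<in> {0..t} \<times> X. 0 \<le> f s y}"
  have cont': "continuous_on ({0..t} \<times> X) (\<lambda>(t, x). f t x)"
    by (rule continuous_on_subset[OF cont]) (use t in auto)
  have cmp: "compact ({0..t} \<times> X)" by (intro compact_Times X) auto
  have cl: "closedin (top_of_set ({0..t} \<times> X)) (({0..t} \<times> X) \<inter> (\<lambda>(t, x). f t x) -` {0..})"
    by (rule continuous_closedin_preimage[OF cont']) auto
  have "S = ({0..t} \<times> X) \<inter> (\<lambda>(t, x). f t x) -` {0..}" unfolding S_def by auto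
  with cl cmp have "compact S"
    using closedin_compact by metis
  then have cS: "compact (fst ` S)"
    by (intro compact_continuous_image continuous_intros)
  have ne: "fst ` S \<noteq> {}" using neg t x unfolding S_def by force
  obtain s where s: "s \<in> fst ` S" "\<And>r. r \<in> fst ` S \<Longrightarrow> s \<le> r"
    using compact_attains_inf[OF cS ne] by blast
  then obtain y where y: "y \<in> X" "0 \<le> s" "s \<le> t" "0 \<le> f s y" unfolding S_def by auto
  have before: "f r z < 0" if "0 \<le> r" "r < s" "z \<in> X" for r z
  proof (rule ccontr)
    assume "\<not> f r z < 0"
    then have "(r, z) \<in> S" using that y unfolding S_def by auto
    then have "r \<in> fst ` S" by force
    with s(2) that show False by fastforce
  qed
  have s0: "0 < s" using init[of y] y by (cases "s = 0") auto
  have le: "f s z \<le> 0" if z: "z \<in> X" for z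
  proof -
    have c: "continuous_on {0..s} (\<lambda>r. f r z)"
      using continuous_on_compose2[OF cont', of "{0..s}" "\<lambda>r. (r, z)"] z y
      by (force intro!: continuous_intros)
    have "\<forall>r\<in>{0..<s}. f r z \<le> 0" using before z by fastforce
    moreover have "closure {0..<s} = {0..s}" using s0 by simp
    ultimately show ?thesis
      using continuous_le_on_closure[of "{0..<s}" "\<lambda>r. f r z" s 0] c s0
      by (metis atLeastAtMost_iff order_less_imp_le order_refl)
  qed
  have eq: "f s y = 0" using le[OF y(1)] y(4) by simp
  have sB: "s < B" using y t by simp
  have d: "((\<lambda>r. f r y) has_real_derivative f' s y) (at s)" using der s0 sB y by auto
  have n: "f' s y < 0" using touch[OF s0 sB y(1) eq le] .
  obtain e where e: "e > 0" "\<And>h. 0 < h \<Longrightarrow> h < e \<Longrightarrow> f s y < f (s - h) y"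
    using DERIV_neg_dec_left[OF d n] by blast
  define h where "h = min (e/2) (s/2)"
  have "0 < h" "h < e" "h < s" using e s0 unfolding h_def by auto
  then have "f s y < f (s - h) y" "f (s - h) y < 0" using e(2) before y by auto
  with eq show False by simp
qed

lemma nonincreasing_from_deriv:
  fixes f :: "real \<Rightarrow> real"
  assumes "a \<le> b" "continuous_on {a..b} f"
    "\<And>x. a < x \<Longrightarrow> x < b \<Longrightarrow> (f has_real_derivative f' x) (at x)"
    "\<And>x. a < x \<Longrightarrow> x < b \<Longrightarrow> f' x \<le> 0"
  shows "f b \<le> f a"
  by (rule DERIV_nonpos_imp_decreasing_open) (use assms in blast)+

section \<open>Lattice Laplacian with Neumann condition\<close>

text \<open>Finite-volume Laplacian on the cells 0, ..., n: the difference of the fluxes through the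
  two faces of a cell, with zero flux through the outer faces. This is the Neumann condition; no
  ghost values occur, and summation by parts has no boundary terms.\<close>

definition lap :: "real \<Rightarrow> nat \<Rightarrow> (nat \<Rightarrow> real) \<Rightarrow> nat \<Rightarrow> real" where
  "lap h n f i = ((if i < n then f (Suc i) - f i else 0) - (if 0 < i then f i - f (i - 1) else 0)) / h\<^sup>2"

text \<open>h times the sum of the squared difference quotients, that is, the discrete integral of
  ux^2.\<close>

definition dir :: "real \<Rightarrow> nat \<Rightarrow> (nat \<Rightarrow> real) \<Rightarrow> real" where
  "dir h n f = (\<Sum>i<n. (f (Suc i) - f i)\<^sup>2) / h"

definition nsum :: "real \<Rightarrow> nat \<Rightarrow> (nat \<Rightarrow> real) \<Rightarrow> real" where
  "nsum h n f = h * (\<Sum>i\<le>n. f i)"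

lemma green:
  "(\<Sum>i\<le>n. g i * lap h n f i) = - (\<Sum>i<n. (g (Suc i) - g i) * (f (Suc i) - f i)) / h\<^sup>2"
proof -
  have 1: "(\<Sum>i\<le>n. g i * (if i < n then f (Suc i) - f i else 0)) = (\<Sum>i<n. g i * (f (Suc i) - f i))"
  proof -
    have "(\<Sum>i\<le>n. g i * (if i < n then f (Suc i) - f i else 0))
        = (\<Sum>i<n. g i * (if i < n then f (Suc i) - f i else 0))"
      by (simp flip: lessThan_Suc_atMost)
    then show ?thesis by simp
  qed
  have 2: "(\<Sum>i\<le>n. g i * (if 0 < i then f i - f (i - 1) else 0)) = (\<Sum>i<n. g (Suc i) * (f (Suc i) - f i))"
    by (simp flip: lessThan_Suc_atMost add: sum.lessThan_Suc_shift del: sum.lessThan_Suc)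
  have "(\<Sum>i\<le>n. g i * lap h n f i) =
     ((\<Sum>i\<le>n. g i * (if i < n then f (Suc i) - f i else 0))
      - (\<Sum>i\<le>n. g i * (if 0 < i then f i - f (i - 1) else 0))) / h\<^sup>2"
    unfolding lap_def by (simp add: sum_subtractf[symmetric] sum_divide_distrib algebra_simps diff_divide_distrib)
  also have "\<dots> = - (\<Sum>i<n. (g (Suc i) - g i) * (f (Suc i) - f i)) / h\<^sup>2"
    unfolding 1 2 by (simp add: sum_subtractf[symmetric] sum_negf[symmetric] algebra_simps)
  finally show ?thesis .
qed

lemma green_nsum:
  "nsum h n (\<lambda>i. g i * lap h n f i) = - (\<Sum>i<n. (g (Suc i) - g i) * (f (Suc i) - f i)) / h"
  unfolding nsum_def green by (simp add: power2_eq_square)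

lemma green_self: "nsum h n (\<lambda>i. f i * lap h n f i) = - dir h n f"
  unfolding green_nsum dir_def by (simp add: power2_eq_square)

lemma dir_nonneg: "0 \<le> h \<Longrightarrow> 0 \<le> dir h n f"
  unfolding dir_def by (simp add: sum_nonneg)

lemma nsum_mono: "0 \<le> h \<Longrightarrow> (\<And>i. i \<le> n \<Longrightarrow> f i \<le> g i) \<Longrightarrow> nsum h n f \<le> nsum h n g"
  unfolding nsum_def by (intro mult_left_mono sum_mono) auto

lemma nsum_nonneg: "0 \<le> h \<Longrightarrow> (\<And>i. i \<le> n \<Longrightarrow> 0 \<le> f i) \<Longrightarrow> 0 \<le> nsum h n f"
  unfolding nsum_def by (intro mult_nonneg_nonneg sum_nonneg) auto

lemma nsum_add: "nsum h n (\<lambda>i. f i + g i) = nsum h n f + nsum h n g"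
  unfolding nsum_def by (simp add: sum.distrib algebra_simps)

lemma nsum_diff: "nsum h n (\<lambda>i. f i - g i) = nsum h n f - nsum h n g"
  unfolding nsum_def by (simp add: sum_subtractf algebra_simps)

lemma nsum_cmult: "nsum h n (\<lambda>i. c * f i) = c * nsum h n f"
  unfolding nsum_def by (simp add: sum_distrib_left algebra_simps)

lemma nsum_const: "nsum h n (\<lambda>i. c) = h * real (Suc n) * c"
  unfolding nsum_def by simp

lemma sum_abs_diff_ivl:
  fixes g :: "nat \<Rightarrow> real"
  assumes "i \<le> n" "j \<le> n"
  shows "\<bar>g i - g j\<bar> \<le> (\<Sum>k<n. \<bar>g (Suc k) - g k\<bar>)"
proof -
  have main: "\<bar>g j - g i\<bar> \<le> (\<Sum>k<n. \<bar>g (Suc k) - g k\<bar>)" if "i \<le> j" "j \<le> n" for i j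
  proof -
    have "g j - g i = (\<Sum>k = i..<j. g (Suc k) - g k)"
      using that by (simp add: sum_Suc_diff')
    also have "\<bar>\<dots>\<bar> \<le> (\<Sum>k = i..<j. \<bar>g (Suc k) - g k\<bar>)" by (rule sum_abs)
    also have "\<dots> \<le> (\<Sum>k<n. \<bar>g (Suc k) - g k\<bar>)"
      by (rule sum_mono2) (use that in auto)
    finally show ?thesis .
  qed
  show ?thesis
    using main[of i j] main[of j i] assms by (cases "i \<le> j") (auto simp: abs_minus_commute)
qed

text \<open>Discrete embedding of H1 into C with a free weight. Young's inequality on each increment
  of f^2 bounds its total variation, and averaging over j supplies a reference value. A large l
  makes the Dirichlet part cheap, which later turns L2 continuity in time into uniform
  continuity.\<close>

lemma agmon:
  fixes f :: "nat \<Rightarrow> real"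
  assumes h: "0 < h" and l: "0 < l" and i: "i \<le> n"
  shows "(f i)\<^sup>2 \<le> (1 / (h * real (Suc n)) + l) * nsum h n (\<lambda>i. (f i)\<^sup>2) + dir h n f / l"
proof -
  define R where "R = l * nsum h n (\<lambda>i. (f i)\<^sup>2) + dir h n f / l"
  have step: "\<bar>(f (Suc k))\<^sup>2 - (f k)\<^sup>2\<bar> \<le> (f (Suc k) - f k)\<^sup>2 / (l * h) + l * h / 2 * ((f (Suc k))\<^sup>2 + (f k)\<^sup>2)" for k
  proof -
    define d s where "d = \<bar>f (Suc k) - f k\<bar>" and "s = \<bar>f (Suc k) + f k\<bar>"
    define c where "c = l * h"
    have c: "0 < c" using h l unfolding c_def by simp
    have "\<bar>(f (Suc k))\<^sup>2 - (f k)\<^sup>2\<bar> = d * s"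
      unfolding d_def s_def abs_mult[symmetric] by (rule arg_cong[of _ _ abs]) (simp add: power2_eq_square algebra_simps)
    also have "\<dots> \<le> d\<^sup>2 / c + c / 4 * s\<^sup>2"
    proof -
      have "0 \<le> (d - c / 2 * s)\<^sup>2 / c" using c by simp
      also have "\<dots> = d\<^sup>2 / c + c / 4 * s\<^sup>2 - d * s" using c by (simp add: power2_eq_square field_simps)
      finally show ?thesis by simp
    qed
    also have "s\<^sup>2 \<le> 2 * ((f (Suc k))\<^sup>2 + (f k)\<^sup>2)"
      unfolding s_def using zero_le_power2[of "f (Suc k) - f k"] by (simp add: power2_eq_square algebra_simps)
    then have "c / 4 * s\<^sup>2 \<le> c / 2 * ((f (Suc k))\<^sup>2 + (f k)\<^sup>2)" using c mult_left_mono[of "s\<^sup>2" _ "c/4"] by simp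
    finally show ?thesis unfolding d_def c_def by simp
  qed
  have "(\<Sum>k<n. \<bar>(f (Suc k))\<^sup>2 - (f k)\<^sup>2\<bar>) \<le>
      (\<Sum>k<n. (f (Suc k) - f k)\<^sup>2 / (l * h) + l * h / 2 * ((f (Suc k))\<^sup>2 + (f k)\<^sup>2))"
    by (rule sum_mono) (rule step)
  also have "\<dots> = dir h n f / l + l * h / 2 * ((\<Sum>k<n. (f (Suc k))\<^sup>2) + (\<Sum>k<n. (f k)\<^sup>2))"
    unfolding dir_def by (simp add: sum.distrib sum_distrib_left[symmetric] sum_divide_distrib[symmetric])
  also have "\<dots> \<le> R"
  proof -
    have "(\<Sum>k<n. (f (Suc k))\<^sup>2) \<le> (\<Sum>k\<le>n. (f k)\<^sup>2)"
      by (simp flip: lessThan_Suc_atMost add: sum.lessThan_Suc_shift del: sum.lessThan_Suc)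
    moreover have "(\<Sum>k<n. (f k)\<^sup>2) \<le> (\<Sum>k\<le>n. (f k)\<^sup>2)"
      by (simp flip: lessThan_Suc_atMost)
    ultimately have "l * h / 2 * ((\<Sum>k<n. (f (Suc k))\<^sup>2) + (\<Sum>k<n. (f k)\<^sup>2)) \<le> l * h / 2 * (2 * (\<Sum>k\<le>n. (f k)\<^sup>2))"
      using h l by (intro mult_left_mono) auto
    then show ?thesis unfolding R_def nsum_def by simp
  qed
  finally have R: "(\<Sum>k<n. \<bar>(f (Suc k))\<^sup>2 - (f k)\<^sup>2\<bar>) \<le> R" .
  have "(f i)\<^sup>2 \<le> (f j)\<^sup>2 + R" if "j \<le> n" for j
    using sum_abs_diff_ivl[OF i that, of "\<lambda>i. (f i)\<^sup>2"] R by linarith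
  then have "(\<Sum>j\<le>n. (f i)\<^sup>2) \<le> (\<Sum>j\<le>n. (f j)\<^sup>2 + R)" by (intro sum_mono) auto
  then have "real (Suc n) * (f i)\<^sup>2 \<le> (\<Sum>j\<le>n. (f j)\<^sup>2) + real (Suc n) * R" by (simp add: sum.distrib)
  then have "(f i)\<^sup>2 \<le> (\<Sum>j\<le>n. (f j)\<^sup>2) / real (Suc n) + R" by (simp add: field_simps)
  also have "(\<Sum>j\<le>n. (f j)\<^sup>2) / real (Suc n) = 1 / (h * real (Suc n)) * nsum h n (\<lambda>i. (f i)\<^sup>2)"
    unfolding nsum_def using h by simp
  finally show ?thesis unfolding R_def by (simp add: algebra_simps)
qed

text \<open>Cauchy--Schwarz over the edges between i and j: a bounded discrete Dirichlet energy
  gives Hoelder exponent 1/2 uniformly in the mesh.\<close>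

lemma grid_holder:
  assumes h: "0 < h" and ij: "i \<le> n" "j \<le> n"
  shows "(f i - f j)\<^sup>2 \<le> dir h n f * (h * \<bar>real i - real j\<bar>)"
proof -
  have main: "(f j - f i)\<^sup>2 \<le> dir h n f * (h * (real j - real i))" if "i \<le> j" "j \<le> n" for i j
  proof -
    have "f j - f i = (\<Sum>k = i..<j. (f (Suc k) - f k) * 1)"
      using that by (simp add: sum_Suc_diff')
    then have "(f j - f i)\<^sup>2 \<le> (\<Sum>k = i..<j. (f (Suc k) - f k)\<^sup>2) * (\<Sum>k = i..<j. 1\<^sup>2)"
      using Cauchy_Schwarz_ineq_sum[of "\<lambda>k. f (Suc k) - f k" "\<lambda>k. 1" "{i..<j}"] by simp
    also have "\<dots> = (\<Sum>k = i..<j. (f (Suc k) - f k)\<^sup>2) * (real j - real i)" using that by (simp add: of_nat_diff)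
    also have "\<dots> \<le> (\<Sum>k<n. (f (Suc k) - f k)\<^sup>2) * (real j - real i)"
      by (intro mult_right_mono sum_mono2) (use that in auto)
    finally show ?thesis using h unfolding dir_def by simp
  qed
  show ?thesis
    using main[of i j] main[of j i] ij by (cases "i \<le> j") (auto simp: power2_commute abs_if)
qed

section \<open>Method of lines\<close>

text \<open>Measured with the weight \<open>exp (2 * L * t)\<close>, the Picard map contracts by 1/2
  on all of \<open>[0, B]\<close>, so a global Lipschitz constant yields the whole interval without
  continuation in small steps.\<close>

lemma picard_grid:
  fixes F :: "(nat \<Rightarrow> real) \<Rightarrow> nat \<Rightarrow> real"
  assumes B: "0 \<le> B" and L: "0 < L"
    and lip: "\<And>x y d i. (\<And>j. j \<le> n \<Longrightarrow> \<bar>x j - y j\<bar> \<le> d) \<Longrightarrow> i \<le> n \<Longrightarrow> \<bar>F x i - F y i\<bar> \<le> L * d"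
  obtains y where "\<And>i. i \<le> n \<Longrightarrow> y i 0 = y0 i"
    "\<And>i t. i \<le> n \<Longrightarrow> t \<in> {0..B} \<Longrightarrow> (y i has_real_derivative F (\<lambda>j. y j t) i) (at t within {0..B})"
proof -
  have contF: "continuous_on {0..B} (\<lambda>s. F (\<lambda>j. w j s) i)"
    if w: "\<And>j. j \<le> n \<Longrightarrow> continuous_on {0..B} (w j)" and i: "i \<le> n" for w i
    unfolding continuous_on
  proof
    fix s assume s: "s \<in> {0..B}"
    have "((\<lambda>r. F (\<lambda>j. w j r) i - F (\<lambda>j. w j s) i) \<longlongrightarrow> 0) (at s within {0..B})"
    proof (rule Lim_null_comparison)
      show "\<forall>\<^sub>F r in at s within {0..B}. norm (F (\<lambda>j. w j r) i - F (\<lambda>j. w j s) i)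
              \<le> L * (\<Sum>j\<le>n. \<bar>w j r - w j s\<bar>)"
      proof (rule always_eventually, rule allI)
        fix r
        have "\<bar>w j r - w j s\<bar> \<le> (\<Sum>j\<le>n. \<bar>w j r - w j s\<bar>)" if "j \<le> n" for j
          using that by (intro member_le_sum) auto
        then show "norm (F (\<lambda>j. w j r) i - F (\<lambda>j. w j s) i) \<le> L * (\<Sum>j\<le>n. \<bar>w j r - w j s\<bar>)"
          using lip[of "\<lambda>j. w j r" "\<lambda>j. w j s"] i by simp
      qed
      have "((\<lambda>r. L * (\<Sum>j\<le>n. \<bar>w j r - w j s\<bar>)) \<longlongrightarrow> L * (\<Sum>j\<le>n. \<bar>w j s - w j s\<bar>)) (at s within {0..B})"
        by (intro tendsto_intros) (use w s in \<open>auto simp: continuous_on\<close>)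
      then show "((\<lambda>r. L * (\<Sum>j\<le>n. \<bar>w j r - w j s\<bar>)) \<longlongrightarrow> 0) (at s within {0..B})" by simp
    qed
    then show "((\<lambda>r. F (\<lambda>j. w j r) i) \<longlongrightarrow> F (\<lambda>j. w j s) i) (at s within {0..B})"
      by (rule LIM_zero_cancel)
  qed
  define z :: "nat \<Rightarrow> nat \<Rightarrow> real \<Rightarrow> real" where "z = rec_nat (\<lambda>i t. y0 i) (\<lambda>k w i t. y0 i + integral {0..t} (\<lambda>s. F (\<lambda>j. w j s) i))"
  have z0: "z 0 = (\<lambda>i t. y0 i)" and zS: "\<And>k. z (Suc k) = (\<lambda>i t. y0 i + integral {0..t} (\<lambda>s. F (\<lambda>j. z k j s) i))"
    unfolding z_def by auto
  have zc: "continuous_on {0..B} (z k i)" if "i \<le> n" for k i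
    using that
  proof (induction k arbitrary: i)
    case 0 then show ?case by (simp add: z0)
  next
    case (Suc k)
    show ?case unfolding zS
      by (intro continuous_intros indefinite_integral_continuous_1 integrable_continuous_real contF Suc)
  qed
  have zint: "(\<lambda>s. F (\<lambda>j. z k j s) i) integrable_on {0..t}" if "i \<le> n" "t \<in> {0..B}" for k i t
    by (rule integrable_continuous_real, rule continuous_on_subset[OF contF]) (use that zc in auto)
  \<comment> \<open>Chosen so that the first increment \<open>t * F y0 i\<close> is at most
    \<open>Q * (2 * L * t)\<close> in absolute value, hence at most
    \<open>Q * exp (2 * L * t)\<close>.\<close>
  define Q where "Q = (\<Sum>i\<le>n. \<bar>F y0 i\<bar>) / (2 * L)"
  have Q: "0 \<le> Q" unfolding Q_def using L by (intro divide_nonneg_nonneg sum_nonneg) auto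
  have bound: "\<bar>z (Suc k) i t - z k i t\<bar> \<le> Q * (1/2)^k * exp (2 * L * t)" if "i \<le> n" "t \<in> {0..B}" for k i t
    using that
  proof (induction k arbitrary: i t)
    case 0
    have "\<bar>F y0 i\<bar> \<le> 2 * L * Q" unfolding Q_def using L 0
      by (simp add: member_le_sum[of i "{..n}" "\<lambda>i. \<bar>F y0 i\<bar>"])
    moreover have "z (Suc 0) i t - z 0 i t = t * F y0 i" using 0 by (simp add: zS z0)
    ultimately have "\<bar>z (Suc 0) i t - z 0 i t\<bar> \<le> t * (2 * L * Q)"
      using 0 by (simp add: abs_mult mult_left_mono)
    also have "\<dots> = Q * (2 * L * t)" by simp
    also have "\<dots> \<le> Q * exp (2 * L * t)"
      using Q exp_ge_add_one_self[of "2 * L * t"] by (intro mult_left_mono) linarith+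
    finally show ?case by simp
  next
    case (Suc k)
    define c where "c = L * (Q * (1/2)^k)"
    have c0: "0 \<le> c" unfolding c_def using L Q by simp
    \<comment> \<open>Integrating the weight divides by \<open>2 * L\<close> while the Lipschitz
      bound multiplies by L: this is the contraction factor 1/2.\<close>
    have I: "((\<lambda>s. c * exp (2 * L * s)) has_integral c / (2 * L) * exp (2 * L * t) - c / (2 * L) * exp (2 * L * 0)) {0..t}"
    proof (rule fundamental_theorem_of_calculus)
      fix s assume "s \<in> {0..t}"
      have "((\<lambda>s. c / (2 * L) * exp (2 * L * s)) has_real_derivative c * exp (2 * L * s)) (at s within {0..t})"
        using L by (auto intro!: derivative_eq_intros)
      then show "((\<lambda>s. c / (2 * L) * exp (2 * L * s)) has_vector_derivative c * exp (2 * L * s)) (at s within {0..t})"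
        by (simp add: has_real_derivative_iff_has_vector_derivative)
    qed (use Suc in auto)
    have "z (Suc (Suc k)) i t - z (Suc k) i t = integral {0..t} (\<lambda>s. F (\<lambda>j. z (Suc k) j s) i - F (\<lambda>j. z k j s) i)"
    proof -
      have "z (Suc (Suc k)) i t = y0 i + integral {0..t} (\<lambda>s. F (\<lambda>j. z (Suc k) j s) i)"
        "z (Suc k) i t = y0 i + integral {0..t} (\<lambda>s. F (\<lambda>j. z k j s) i)"
        by (subst zS, rule refl)+
      then show ?thesis using integral_diff[OF zint zint, of i t i "Suc k" k] Suc.prems by linarith
    qed
    also have "norm \<dots> \<le> integral {0..t} (\<lambda>s. c * exp (2 * L * s))"
    proof (rule integral_norm_bound_integral)
      show "(\<lambda>s. F (\<lambda>j. z (Suc k) j s) i - F (\<lambda>j. z k j s) i) integrable_on {0..t}"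
        using zint Suc.prems by (intro integrable_diff)
      show "(\<lambda>s. c * exp (2 * L * s)) integrable_on {0..t}" using I by blast
      fix s assume s: "s \<in> {0..t}"
      show "norm (F (\<lambda>j. z (Suc k) j s) i - F (\<lambda>j. z k j s) i) \<le> c * exp (2 * L * s)"
        using lip[of "\<lambda>j. z (Suc k) j s" "\<lambda>j. z k j s" "Q * (1/2)^k * exp (2 * L * s)" i] Suc s
        by (auto simp: c_def mult.assoc)
    qed
    also have "\<dots> = c / (2 * L) * exp (2 * L * t) - c / (2 * L) * exp (2 * L * 0)"
      using I by (rule integral_unique)
    also have "\<dots> \<le> c / (2 * L) * exp (2 * L * t)" using c0 L by simp
    also have "\<dots> = Q * (1/2)^(Suc k) * exp (2 * L * t)" unfolding c_def using L by simp
    finally show ?case by simp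
  qed
  define y where "y = (\<lambda>i t. y0 i + (\<Sum>k. z (Suc k) i t - z k i t))"
  have tele: "(\<Sum>k<m. z (Suc k) i t - z k i t) = z m i t - y0 i" for m i t
    using sum_lessThan_telescope[of "\<lambda>k. z k i t" m] by (simp add: z0)
  have unif: "uniform_limit {0..B} (\<lambda>m t. z m i t) (y i) sequentially" if i: "i \<le> n" for i
  proof -
    have "uniform_limit {0..B} (\<lambda>m t. \<Sum>k<m. z (Suc k) i t - z k i t) (\<lambda>t. \<Sum>k. z (Suc k) i t - z k i t) sequentially"
    proof (rule Weierstrass_m_test)
      fix k t assume t: "t \<in> {0..B}"
      have "\<bar>z (Suc k) i t - z k i t\<bar> \<le> Q * (1/2)^k * exp (2 * L * t)" using bound i t by blast
      also have "\<dots> \<le> Q * (1/2)^k * exp (2 * L * B)" using Q L t by (intro mult_left_mono) auto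
      finally show "norm (z (Suc k) i t - z k i t) \<le> Q * (1/2)^k * exp (2 * L * B)" by simp
    next
      show "summable (\<lambda>k. Q * (1/2)^k * exp (2 * L * B))"
        by (intro summable_mult summable_mult2) (simp add: summable_geometric)
    qed
    then have "uniform_limit {0..B} (\<lambda>m t. y0 i + (\<Sum>k<m. z (Suc k) i t - z k i t)) (y i) sequentially"
      unfolding y_def by (intro uniform_limit_intros)
    then show ?thesis by (simp add: tele)
  qed
  have yc: "continuous_on {0..B} (y i)" if "i \<le> n" for i
    by (rule uniform_limit_theorem[OF _ unif]) (use zc that in auto)
  have yeq: "y i t = y0 i + integral {0..t} (\<lambda>s. F (\<lambda>j. y j s) i)" if i: "i \<le> n" and t: "t \<in> {0..B}" for i t
  proof -
    \<comment> \<open>Uniform convergence of the iterates passes through the Lipschitz map and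
      through the integral, which turns the recursion into the integral equation.\<close>
    have "uniform_limit {0..t} (\<lambda>m s. F (\<lambda>j. z m j s) i) (\<lambda>s. F (\<lambda>j. y j s) i) sequentially"
    proof (rule uniform_limitI)
      fix e :: real assume e: "0 < e"
      have "\<forall>j\<in>{..n}. \<forall>\<^sub>F m in sequentially. \<forall>s\<in>{0..B}. dist (z m j s) (y j s) < e / (2 * L)"
        using unif e L by (auto simp: uniform_limit_iff)
      then have "\<forall>\<^sub>F m in sequentially. \<forall>j\<in>{..n}. \<forall>s\<in>{0..B}. dist (z m j s) (y j s) < e / (2 * L)"
        by (simp add: eventually_ball_finite)
      then show "\<forall>\<^sub>F m in sequentially. \<forall>s\<in>{0..t}. dist (F (\<lambda>j. z m j s) i) (F (\<lambda>j. y j s) i) < e"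
      proof eventually_elim
        case (elim m)
        show ?case
        proof
          fix s assume s: "s \<in> {0..t}"
          have "\<bar>F (\<lambda>j. z m j s) i - F (\<lambda>j. y j s) i\<bar> \<le> L * (e / (2 * L))"
            by (rule lip) (use elim i s t in \<open>force simp: dist_real_def\<close>)+
          also have "\<dots> < e" using L e by simp
          finally show "dist (F (\<lambda>j. z m j s) i) (F (\<lambda>j. y j s) i) < e" by (simp add: dist_real_def)
        qed
      qed
    qed
    moreover have "continuous_on {0..t} (\<lambda>s. F (\<lambda>j. z m j s) i)" for m
      by (rule continuous_on_subset[OF contF]) (use zc i t in auto)
    ultimately obtain I J where IJ: "\<And>m. ((\<lambda>s. F (\<lambda>j. z m j s) i) has_integral I m) {0..t}"
      "((\<lambda>s. F (\<lambda>j. y j s) i) has_integral J) {0..t}" "I \<longlonglongrightarrow> J"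
      by (rule uniform_limit_integral) auto
    have "(\<lambda>m. z (Suc m) i t) \<longlonglongrightarrow> y0 i + J"
      unfolding zS using integral_unique[OF IJ(1)] IJ(3) by (auto intro: tendsto_intros)
    moreover have "(\<lambda>m. z (Suc m) i t) \<longlonglongrightarrow> y i t"
      using LIMSEQ_Suc[OF tendsto_uniform_limitI[OF unif[OF i] t]] .
    ultimately have "y i t = y0 i + J" using LIMSEQ_unique by blast
    then show ?thesis using IJ(2) by (simp add: integral_unique)
  qed
  show ?thesis
  proof
    show "y i 0 = y0 i" if "i \<le> n" for i using yeq[OF that, of 0] B by simp
    fix i t assume i: "i \<le> n" and t: "t \<in> {0..B}"
    have "((\<lambda>t. integral {0..t} (\<lambda>s. F (\<lambda>j. y j s) i)) has_real_derivative F (\<lambda>j. y j t) i) (at t within {0..B})"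
      by (rule integral_has_real_derivative) (use contF[of y] yc i t in auto)
    then have "((\<lambda>t. y0 i + integral {0..t} (\<lambda>s. F (\<lambda>j. y j s) i)) has_real_derivative F (\<lambda>j. y j t) i) (at t within {0..B})"
      by (auto intro!: derivative_eq_intros)
    then show "(y i has_real_derivative F (\<lambda>j. y j t) i) (at t within {0..B})"
      by (rule has_field_derivative_transform_within[where d = 1]) (use yeq i t in auto)
  qed
qed

section \<open>The semidiscrete flow and its comparison principle\<close>

definition avg :: "nat \<Rightarrow> (nat \<Rightarrow> real) \<Rightarrow> real" where
  "avg n f = (\<Sum>i\<le>n. f i) / real (Suc n)"

definition vel :: "real \<Rightarrow> real \<Rightarrow> nat \<Rightarrow> (nat \<Rightarrow> real) \<Rightarrow> nat \<Rightarrow> real" where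
  "vel p h n f i = f i powr p * (lap h n f i + f i - avg n f)"

definition lattice_sol ::
  "real \<Rightarrow> real \<Rightarrow> nat \<Rightarrow> real \<Rightarrow> real \<Rightarrow> real \<Rightarrow> (nat \<Rightarrow> real \<Rightarrow> real) \<Rightarrow> bool" where
  "lattice_sol p h n B lo hi u \<longleftrightarrow>
     (\<forall>i\<le>n. continuous_on {0..B} (u i)) \<and>
     (\<forall>i\<le>n. \<forall>t\<in>{0..B}. lo \<le> u i t \<and> u i t \<le> hi) \<and>
     (\<forall>i\<le>n. \<forall>t. 0 < t \<longrightarrow> t < B \<longrightarrow> (u i has_real_derivative vel p h n (\<lambda>j. u j t) i) (at t))"

lemma lap_nonpos_at_max:
  assumes "i \<le> n" "\<And>j. j \<le> n \<Longrightarrow> f j \<le> f i"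
  shows "lap h n f i \<le> 0"
proof -
  \<comment> \<open>For i = 0 truncated subtraction makes this trivial.\<close>
  have "f (i - 1) \<le> f i" using assms by simp
  moreover have "i < n \<Longrightarrow> f (Suc i) \<le> f i" using assms(2)[of "Suc i"] by simp
  ultimately show ?thesis unfolding lap_def by (intro divide_nonpos_nonneg) auto
qed

lemma lap_diff: "lap h n (\<lambda>j. f j - g j) i = lap h n f i - lap h n g i"
  unfolding lap_def by (simp add: diff_divide_distrib[symmetric])

lemma lap_minus: "lap h n (\<lambda>j. - f j) i = - lap h n f i"
  unfolding lap_def minus_divide_left by (rule arg_cong2[of _ _ _ _ "(/)"]) auto

lemma avg_bounds:
  assumes "\<And>i. i \<le> n \<Longrightarrow> lo \<le> f i" "\<And>i. i \<le> n \<Longrightarrow> f i \<le> hi"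
  shows "lo \<le> avg n f" "avg n f \<le> hi"
proof -
  have "(\<Sum>i\<le>n. lo) \<le> (\<Sum>i\<le>n. f i)" "(\<Sum>i\<le>n. f i) \<le> (\<Sum>i\<le>n. hi)"
    by (rule sum_mono, use assms in simp)+
  then have "real (Suc n) * lo \<le> (\<Sum>i\<le>n. f i)" "(\<Sum>i\<le>n. f i) \<le> real (Suc n) * hi" by simp_all
  then show "lo \<le> avg n f" "avg n f \<le> hi" unfolding avg_def
    by (simp_all add: pos_le_divide_eq pos_divide_le_eq mult.commute del: of_nat_Suc)
qed

lemma avg_diff: "avg n (\<lambda>j. f j - g j) = avg n f - avg n g"
  unfolding avg_def by (simp add: sum_subtractf diff_divide_distrib)

lemma powr_lipschitz:
  fixes p :: real
  assumes p: "1 \<le> p" and x: "0 < x" "x \<le> hi" and y: "0 < y" "y \<le> hi"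
  shows "\<bar>x powr p - y powr p\<bar> \<le> p * hi powr (p - 1) * \<bar>x - y\<bar>"
proof -
  have "norm (x powr p - y powr p) \<le> p * hi powr (p - 1) * norm (x - y)"
  proof (rule field_differentiable_bound[of "{0<..hi}"])
    show "convex {0<..hi}" by simp
    fix z assume z: "z \<in> {0<..hi}"
    show "((\<lambda>x. x powr p) has_field_derivative p * z powr (p - 1)) (at z within {0<..hi})"
      using z by (auto intro!: derivative_eq_intros)
    show "norm (p * z powr (p - 1)) \<le> p * hi powr (p - 1)"
      using z p by (simp add: powr_mono2)
  qed (use x y in auto)
  then show ?thesis by simp
qed

text \<open>Clamping to \<open>[lo, hi]\<close> is 1-Lipschitz and keeps both factors of
  \<open>vel\<close> bounded, which makes the field globally Lipschitz. The constant blows up with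
  the mesh; that is harmless, because it only serves existence on a fixed grid.\<close>

lemma clamped_vel_lipschitz:
  assumes p: "1 \<le> p" and lo: "0 < lo" and hi: "lo \<le> hi" and h: "0 < h"
  obtains L where "0 < L"
    "\<And>(x :: nat \<Rightarrow> real) y d i. (\<And>j. j \<le> n \<Longrightarrow> \<bar>x j - y j\<bar> \<le> d) \<Longrightarrow> i \<le> n \<Longrightarrow>
       \<bar>vel p h n (\<lambda>j. max lo (min hi (x j))) i - vel p h n (\<lambda>j. max lo (min hi (y j))) i\<bar> \<le> L * d"
proof -
  \<comment> \<open>Product rule: the first summand bounds the change of the bracket in
    \<open>vel\<close> times the power, the second the size of the bracket times the change of the
    power.\<close>
  define L where "L = hi powr p * (4 / h\<^sup>2 + 2) + (4 * hi / h\<^sup>2 + 2 * hi) * (p * hi powr (p - 1))"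
  have hi0: "0 < hi" using lo hi by simp
  have lap_bd: "\<bar>lap h n f i\<bar> \<le> 4 * c / h\<^sup>2" if "\<And>j. j \<le> n \<Longrightarrow> \<bar>f j\<bar> \<le> c" "i \<le> n" for f c i
  proof -
    have "\<bar>(if i < n then f (Suc i) - f i else 0) - (if 0 < i then f i - f (i - 1) else 0)\<bar> \<le> 4 * c"
    proof -
      have "\<bar>f (i - 1)\<bar> \<le> c" "\<bar>f i\<bar> \<le> c" "i < n \<Longrightarrow> \<bar>f (Suc i)\<bar> \<le> c" using that by auto
      then show ?thesis by auto
    qed
    then show ?thesis unfolding lap_def using h by (simp add: abs_divide divide_right_mono)
  qed
  have avg_bd: "\<bar>avg n f\<bar> \<le> c" if "\<And>j. j \<le> n \<Longrightarrow> \<bar>f j\<bar> \<le> c" for f c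
    proof -
      have "- c \<le> f j" "f j \<le> c" if "j \<le> n" for j using \<open>\<And>j. j \<le> n \<Longrightarrow> \<bar>f j\<bar> \<le> c\<close>[OF that] by (auto simp: abs_le_iff)
      then show ?thesis using avg_bounds[of n "-c" f c] by (simp add: abs_le_iff)
    qed
  show ?thesis
  proof
    show "0 < L" unfolding L_def using hi0 h p by (intro add_pos_nonneg mult_pos_pos) auto
    fix x y :: "nat \<Rightarrow> real" and d i assume d: "\<And>j. j \<le> n \<Longrightarrow> \<bar>x j - y j\<bar> \<le> d" and i: "i \<le> n"
    define X Y where "X = (\<lambda>j. max lo (min hi (x j)))" and "Y = (\<lambda>j. max lo (min hi (y j)))"
    have XY: "\<bar>X j - Y j\<bar> \<le> d" if "j \<le> n" for j using d[OF that] unfolding X_def Y_def by (auto simp: max_def min_def)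
    have X: "lo \<le> X j" "X j \<le> hi" and Y: "lo \<le> Y j" "Y j \<le> hi" for j unfolding X_def Y_def using hi by auto
    define P Q where "P = lap h n X i + X i - avg n X" and "Q = lap h n Y i + Y i - avg n Y"
    have PQ: "\<bar>P - Q\<bar> \<le> (4 / h\<^sup>2 + 2) * d"
    proof -
      have "P - Q = lap h n (\<lambda>j. X j - Y j) i + (X i - Y i) - avg n (\<lambda>j. X j - Y j)"
        unfolding P_def Q_def by (simp add: lap_diff avg_diff)
      also have "\<bar>\<dots>\<bar> \<le> 4 * d / h\<^sup>2 + d + d"
        using lap_bd[of "\<lambda>j. X j - Y j" d, OF XY i] avg_bd[of "\<lambda>j. X j - Y j" d, OF XY] XY[OF i] by linarith
      finally show ?thesis by (simp add: algebra_simps)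
    qed
    have Q: "\<bar>Q\<bar> \<le> 4 * hi / h\<^sup>2 + 2 * hi"
    proof -
      have Yh: "\<bar>Y j\<bar> \<le> hi" for j using Y[of j] lo by simp
      show ?thesis unfolding Q_def using lap_bd[of Y hi, OF Yh i] avg_bd[of Y hi, OF Yh] Yh[of i] by linarith
    qed
    have pl: "\<bar>X i powr p - Y i powr p\<bar> \<le> p * hi powr (p - 1) * d"
    proof -
      have "\<bar>X i powr p - Y i powr p\<bar> \<le> p * hi powr (p - 1) * \<bar>X i - Y i\<bar>"
        using X[of i] Y[of i] lo p by (intro powr_lipschitz) auto
      also have "\<dots> \<le> p * hi powr (p - 1) * d" using XY[OF i] p by (intro mult_left_mono) auto
      finally show ?thesis .
    qed
    have "X i powr p * P - Y i powr p * Q = X i powr p * (P - Q) + Q * (X i powr p - Y i powr p)"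
      by (simp add: algebra_simps)
    also have "\<bar>\<dots>\<bar> \<le> \<bar>X i powr p\<bar> * \<bar>P - Q\<bar> + \<bar>Q\<bar> * \<bar>X i powr p - Y i powr p\<bar>"
      by (metis abs_mult abs_triangle_ineq)
    also have "\<dots> \<le> hi powr p * ((4 / h\<^sup>2 + 2) * d) + (4 * hi / h\<^sup>2 + 2 * hi) * (p * hi powr (p - 1) * d)"
      using X[of i] lo p PQ Q pl hi0 by (intro add_mono mult_mono) (auto intro: powr_mono2)
    also have "\<dots> = L * d" unfolding L_def by (simp add: algebra_simps)
    finally show "\<bar>vel p h n (\<lambda>j. max lo (min hi (x j))) i - vel p h n (\<lambda>j. max lo (min hi (y j))) i\<bar> \<le> L * d"
      unfolding vel_def P_def Q_def X_def Y_def .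
  qed
qed

text \<open>\<open>first_touch\<close> treats the grid as a compact space; with the discrete
  topology joint continuity reduces to finitely many closed slices.\<close>

lemma continuous_on_grid:
  fixes f :: "nat \<Rightarrow> real \<Rightarrow> real"
  assumes "\<And>i. i \<le> n \<Longrightarrow> continuous_on {0..B} (f i)"
  shows "continuous_on ({0..B} \<times> {..n}) (\<lambda>(t, i). f i t :: real)"
proof -
  have "continuous_on ({0..B} \<times> {i}) (\<lambda>(t, i). f i t)" if "i \<le> n" for i
  proof -
    have "continuous_on ({0..B} \<times> {i}) (\<lambda>x. f i (fst x))"
      by (rule continuous_on_compose2[OF assms[OF that]]) (auto intro!: continuous_intros)
    then show ?thesis by (rule continuous_on_eq) auto
  qed
  then have "continuous_on (\<Union>i\<in>{..n}. {0..B} \<times> {i}) (\<lambda>(t, i). f i t)"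
    by (intro continuous_on_closed_Union closed_Times closed_atLeastAtMost) auto
  moreover have "(\<Union>i\<in>{..n}. {0..B} \<times> {i}) = {0..B} \<times> {..n}" by auto
  ultimately show ?thesis by simp
qed

text \<open>The right-hand side is clamped to the box between lo and hi; comparison with the barriers
  \<open>M + t K'\<close> and \<open>(c / 2) exp (- K t)\<close> shows that the clamp is never active.\<close>
lemma lattice_sol_exists:
  assumes p: "1 \<le> p" and M: "0 < M" and c: "0 < c" and h: "0 < h"
    and y0: "\<And>i. i \<le> n \<Longrightarrow> c \<le> y0 i" "\<And>i. i \<le> n \<Longrightarrow> y0 i \<le> M"
    and B: "B = M / ((2 * M) powr p * (2 * M) + 1)"
    and lo: "lo = c / 2 * exp (- ((2 * M) powr p + 1) * B)"
  obtains u where "lattice_sol p h n B lo (2 * M) u" "\<And>i. i \<le> n \<Longrightarrow> u i 0 = y0 i"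
proof -
  define hi K K' where "hi = 2 * M" and "K = hi powr p + 1" and "K' = hi powr p * hi + 1"
  have hi0: "0 < hi" unfolding hi_def using M by simp
  have K: "0 < K" "0 < K'" unfolding K_def K'_def using hi0 by (auto simp: add_pos_pos intro: add_nonneg_pos)
  have Bpos: "0 < B" unfolding B using M by (simp add: add_nonneg_pos)
  \<comment> \<open>The length B lets the upper barrier climb from M exactly to the upper clamp
    \<open>2 * M\<close>. It does not involve c.\<close>
  have BK: "K' * B = M" unfolding B K'_def hi_def using M by (simp add: add_nonneg_pos less_imp_neq[symmetric])
  have lo': "lo = c / 2 * exp (- K * B)" unfolding lo K_def hi_def ..
  have lo0: "0 < lo" unfolding lo using c by simp
  have "lo \<le> c / 2 * 1" unfolding lo' using c K Bpos by (intro mult_left_mono) auto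
  moreover have cM: "c \<le> M" using y0[of 0] by simp
  ultimately have lohi: "lo \<le> hi" unfolding hi_def using c M by linarith
  define cl where "cl = (\<lambda>x. max lo (min hi x))"
  have cl: "lo \<le> cl x" "cl x \<le> hi" for x unfolding cl_def using lohi by auto
  have cl_mono: "x \<le> y \<Longrightarrow> cl x \<le> cl y" for x y unfolding cl_def by auto
  obtain L where L: "0 < L" "\<And>(x :: nat \<Rightarrow> real) y d i. (\<And>j. j \<le> n \<Longrightarrow> \<bar>x j - y j\<bar> \<le> d) \<Longrightarrow> i \<le> n \<Longrightarrow>
       \<bar>vel p h n (\<lambda>j. max lo (min hi (x j))) i - vel p h n (\<lambda>j. max lo (min hi (y j))) i\<bar> \<le> L * d"
    using clamped_vel_lipschitz[OF p lo0 lohi h] by blast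
  define F where "F = (\<lambda>x i. vel p h n (\<lambda>j. cl (x j)) i)"
  obtain u where u: "\<And>i. i \<le> n \<Longrightarrow> u i 0 = y0 i"
    "\<And>i t. i \<le> n \<Longrightarrow> t \<in> {0..B} \<Longrightarrow> (u i has_real_derivative F (\<lambda>j. u j t) i) (at t within {0..B})"
    by (rule picard_grid[of B L n F y0]) (use Bpos L in \<open>auto simp: F_def cl_def\<close>)
  have uc: "continuous_on {0..B} (u i)" if "i \<le> n" for i
    using u(2)[OF that] by (rule DERIV_continuous_on)
  have ud: "(u i has_real_derivative F (\<lambda>j. u j t) i) (at t)" if "i \<le> n" "0 < t" "t < B" for i t
    using u(2)[OF that(1), of t] that by (simp add: at_within_Icc_at)
  have avg: "0 \<le> avg n (\<lambda>j. cl (x j))" "avg n (\<lambda>j. cl (x j)) \<le> hi" for x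
    using avg_bounds[of n lo "\<lambda>j. cl (x j)" hi] cl lo0 by (auto intro: order_trans less_imp_le)
  \<comment> \<open>The slack e makes the inequality strict at time 0, as \<open>first_touch\<close>
    demands; it is sent to 0 afterwards.\<close>
  have upper0: "u i t < M + e + K' * t" if i: "i \<le> n" and t: "0 \<le> t" "t < B" and e: "0 < e" for i t e
  proof -
    have "u i t - (M + e + K' * t) < 0"
    proof (rule first_touch[of "{..n}" B "\<lambda>t i. u i t - (M + e + K' * t)" "\<lambda>t i. F (\<lambda>j. u j t) i - K'"])
      show "compact {..n}" by (simp add: finite_imp_compact)
      show "continuous_on ({0..B} \<times> {..n}) (\<lambda>(t, i). u i t - (M + e + K' * t))"
        by (rule continuous_on_grid) (intro continuous_intros uc)
      show "\<And>i. i \<in> {..n} \<Longrightarrow> u i 0 - (M + e + K' * 0) < 0"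
        using y0(2) u(1) e by (force simp: algebra_simps)
      show "((\<lambda>s. u i s - (M + e + K' * s)) has_real_derivative F (\<lambda>j. u j t) i - K') (at t)"
        if "0 < t" "t < B" "i \<in> {..n}" for t i
        using ud[of i t] that by (auto intro!: derivative_eq_intros)
      fix t i assume t: "0 < t" "t < B" and i: "i \<in> {..n}" and eq: "u i t - (M + e + K' * t) = 0"
        and le: "\<And>j. j \<in> {..n} \<Longrightarrow> u j t - (M + e + K' * t) \<le> 0"
      \<comment> \<open>The clamp is monotone, so a maximum of u is also a maximum of the clamped
        values.\<close>
      have "lap h n (\<lambda>j. cl (u j t)) i \<le> 0"
        by (rule lap_nonpos_at_max) (use i eq le cl_mono in force)+
      then have "F (\<lambda>j. u j t) i \<le> cl (u i t) powr p * hi"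
        unfolding F_def vel_def using cl[of "u i t"] avg(1)[of "\<lambda>j. u j t"] by (intro mult_left_mono) auto
      also have "\<dots> \<le> hi powr p * hi"
        using cl[of "u i t"] lo0 p hi0 by (intro mult_right_mono powr_mono2) auto
      finally show "F (\<lambda>j. u j t) i - K' < 0" unfolding K'_def by simp
    qed (use i t in auto)
    then show ?thesis by simp
  qed
  have lower0: "c / 2 * exp (- K * t) < u i t" if i: "i \<le> n" and t: "0 \<le> t" "t < B" for i t
  proof -
    have "c / 2 * exp (- K * t) - u i t < 0"
    proof (rule first_touch[of "{..n}" B "\<lambda>t i. c / 2 * exp (- K * t) - u i t" "\<lambda>t i. - K * (c / 2 * exp (- K * t)) - F (\<lambda>j. u j t) i"])
      show "compact {..n}" by (simp add: finite_imp_compact)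
      show "continuous_on ({0..B} \<times> {..n}) (\<lambda>(t, i). c / 2 * exp (- K * t) - u i t)"
        by (rule continuous_on_grid) (intro continuous_intros uc)
      show "\<And>i. i \<in> {..n} \<Longrightarrow> c / 2 * exp (- K * 0) - u i 0 < 0"
        using y0(1) u(1) c by force
      show "((\<lambda>s. c / 2 * exp (- K * s) - u i s) has_real_derivative - K * (c / 2 * exp (- K * t)) - F (\<lambda>j. u j t) i) (at t)"
        if "0 < t" "t < B" "i \<in> {..n}" for t i
        using ud[of i t] that by (auto intro!: derivative_eq_intros)
      fix t i assume t: "0 < t" "t < B" and i: "i \<in> {..n}" and eq: "c / 2 * exp (- K * t) - u i t = 0"
        and le: "\<And>j. j \<in> {..n} \<Longrightarrow> c / 2 * exp (- K * t) - u j t \<le> 0"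
      have "lap h n (\<lambda>j. - cl (u j t)) i \<le> 0"
        by (rule lap_nonpos_at_max) (use i eq le cl_mono in force)+
      then have lap: "0 \<le> lap h n (\<lambda>j. cl (u j t)) i" by (simp add: lap_minus)
      have ui: "u i t = c / 2 * exp (- K * t)" using eq by simp
      have "lo \<le> u i t" unfolding ui lo' using c K t by (intro mult_left_mono) auto
      moreover have "u i t \<le> c / 2 * 1" unfolding ui using c K t by (intro mult_left_mono) auto
      then have uhi: "u i t \<le> hi" using cM M c unfolding hi_def by linarith
      \<comment> \<open>At the touching point the clamp is inactive, so the degenerate factor in F
        is the true power of u.\<close>
      ultimately have clu: "cl (u i t) = u i t" unfolding cl_def by auto
      have upos: "0 < u i t" unfolding ui using c by simp
      have "F (\<lambda>j. u j t) i \<ge> u i t powr p * (0 + 0 - hi)"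
        unfolding F_def vel_def clu using lap upos avg(2)[of "\<lambda>j. u j t"] by (intro mult_left_mono add_mono diff_mono) auto
      \<comment> \<open>As p is at least 1, the downward drift is at most linear in u, and therefore
        an exponential with rate K stays below the solution.\<close>
      moreover have "u i t powr p * hi \<le> u i t * hi powr p"
      proof -
        have "u i t powr p * hi = u i t * (u i t powr (p - 1) * hi)"
          using upos by (simp add: powr_diff)
        also have "\<dots> \<le> u i t * (hi powr (p - 1) * hi)"
          using upos uhi p hi0 by (intro mult_left_mono mult_right_mono powr_mono2) auto
        also have "hi powr (p - 1) * hi = hi powr p" using hi0 by (simp add: powr_diff)
        finally show ?thesis .
      qed
      moreover have "K * u i t = u i t * hi powr p + u i t" unfolding K_def by (simp add: algebra_simps)
      ultimately show "- K * (c / 2 * exp (- K * t)) - F (\<lambda>j. u j t) i < 0" using ui upos by auto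
    qed (use i t in auto)
    then show ?thesis by simp
  qed
  have cl_half: "closure {0..<B} = {0..B}" using Bpos by simp
  have upper: "u i t \<le> hi" if i: "i \<le> n" and t: "t \<in> {0..B}" for i t
  proof (rule continuous_le_on_closure[of "{0..<B}" "u i"])
    show "continuous_on (closure {0..<B}) (u i)" using uc[OF i] cl_half by simp
    show "t \<in> closure {0..<B}" using t cl_half by simp
    fix s assume s: "s \<in> {0..<B}"
    have "u i s \<le> M + K' * s"
      by (rule field_le_epsilon) (use upper0[OF i, of s] s in \<open>force simp: algebra_simps\<close>)
    also have "\<dots> \<le> M + K' * B" using s K by auto
    finally show "u i s \<le> hi" using BK unfolding hi_def by simp
  qed
  have lower: "lo \<le> u i t" if i: "i \<le> n" and t: "t \<in> {0..B}" for i t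
  proof (rule continuous_ge_on_closure[of "{0..<B}" "u i"])
    show "continuous_on (closure {0..<B}) (u i)" using uc[OF i] cl_half by simp
    show "t \<in> closure {0..<B}" using t cl_half by simp
    fix s assume s: "s \<in> {0..<B}"
    have "lo \<le> c / 2 * exp (- K * s)" unfolding lo' using c K s by (intro mult_left_mono) auto
    also have "\<dots> \<le> u i s" using lower0[OF i, of s] s by simp
    finally show "lo \<le> u i s" .
  qed
  have "F (\<lambda>j. u j t) i = vel p h n (\<lambda>j. u j t) i" if "i \<le> n" "t \<in> {0..B}" for i t
  proof -
    have eq: "cl (u j t) = u j t" if "j \<le> n" for j
      using upper[OF that] lower[OF that] \<open>t \<in> {0..B}\<close> unfolding cl_def by auto
    have "avg n (\<lambda>j. cl (u j t)) = avg n (\<lambda>j. u j t)" unfolding avg_def using eq by simp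
    moreover have "lap h n (\<lambda>j. cl (u j t)) i = lap h n (\<lambda>j. u j t) i"
      unfolding lap_def using eq that(1) by simp
    ultimately show ?thesis unfolding F_def vel_def using eq that(1) by simp
  qed
  then have "lattice_sol p h n B lo hi u"
    unfolding lattice_sol_def using uc upper lower ud by auto
  then show ?thesis using that u(1) unfolding hi_def by blast
qed

text \<open>Moved up or down with the constant speed K, a profile with bounded discrete Laplacian is
  a barrier, since \<open>vel\<close> cannot reach that speed in the outward direction at a touching
  point. The bound involves only b and hi, so it survives the limit in the mesh and yields
  continuity at time 0.\<close>

lemma lattice_barrier:
  assumes sol: "lattice_sol p h n B lo hi u" and p: "0 \<le> p" and lo: "0 < lo" "lo \<le> hi" and b: "0 \<le> b"
    and phi: "\<And>i. i \<le> n \<Longrightarrow> \<bar>lap h n \<phi> i\<bar> \<le> b"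
    and init: "\<And>i. i \<le> n \<Longrightarrow> \<bar>u i 0 - \<phi> i\<bar> \<le> e"
    and i: "i \<le> n" and t: "0 \<le> t" "t < B"
  shows "\<bar>u i t - \<phi> i\<bar> \<le> e + (hi powr p * (b + hi) + 1) * t"
proof -
  define K where "K = hi powr p * (b + hi) + 1"
  have uc: "continuous_on {0..B} (u i)" and ubd: "\<And>t. t \<in> {0..B} \<Longrightarrow> lo \<le> u i t \<and> u i t \<le> hi"
    and ud: "\<And>t. 0 < t \<Longrightarrow> t < B \<Longrightarrow> (u i has_real_derivative vel p h n (\<lambda>j. u j t) i) (at t)" if "i \<le> n" for i
    using sol that unfolding lattice_sol_def by auto
  have avg: "0 \<le> avg n (\<lambda>j. u j t)" "avg n (\<lambda>j. u j t) \<le> hi" if "t \<in> {0..B}" for t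
    using avg_bounds[of n lo "\<lambda>j. u j t" hi] ubd lo that by auto
  have upper: "u i t - \<phi> i < e + d + K * t" if d: "0 < d" for d
  proof -
    have "u i t - (\<phi> i + e + d + K * t) < 0"
    proof (rule first_touch[of "{..n}" B "\<lambda>t i. u i t - (\<phi> i + e + d + K * t)" "\<lambda>t i. vel p h n (\<lambda>j. u j t) i - K"])
      show "compact {..n}" by (simp add: finite_imp_compact)
      show "continuous_on ({0..B} \<times> {..n}) (\<lambda>(t, i). u i t - (\<phi> i + e + d + K * t))"
        by (rule continuous_on_grid) (intro continuous_intros uc)
      show "\<And>i. i \<in> {..n} \<Longrightarrow> u i 0 - (\<phi> i + e + d + K * 0) < 0"
        using init d by (force simp: abs_le_iff)
      show "((\<lambda>s. u i s - (\<phi> i + e + d + K * s)) has_real_derivative vel p h n (\<lambda>j. u j t) i - K) (at t)"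
        if "0 < t" "t < B" "i \<in> {..n}" for t i
        using ud[of i t] that by (auto intro!: derivative_eq_intros)
      fix t i assume t: "0 < t" "t < B" and i: "i \<in> {..n}" and eq: "u i t - (\<phi> i + e + d + K * t) = 0"
        and le: "\<And>j. j \<in> {..n} \<Longrightarrow> u j t - (\<phi> j + e + d + K * t) \<le> 0"
      have "lap h n (\<lambda>j. u j t - \<phi> j) i \<le> 0"
        by (rule lap_nonpos_at_max) (use i eq le in force)+
      then have "lap h n (\<lambda>j. u j t) i \<le> b" using phi[of i] i by (simp add: lap_diff)
      then have "vel p h n (\<lambda>j. u j t) i \<le> u i t powr p * (b + hi)"
        unfolding vel_def using ubd[of i t] avg[of t] i t by (intro mult_left_mono) auto
      also have "\<dots> \<le> hi powr p * (b + hi)"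
        using ubd[of i t] i t lo p b by (intro mult_right_mono powr_mono2) auto
      finally show "vel p h n (\<lambda>j. u j t) i - K < 0" unfolding K_def by simp
    qed (use i t in auto)
    then show ?thesis by simp
  qed
  have lower: "\<phi> i - u i t < e + d + K * t" if d: "0 < d" for d
  proof -
    have "\<phi> i - e - d - K * t - u i t < 0"
    proof (rule first_touch[of "{..n}" B "\<lambda>t i. \<phi> i - e - d - K * t - u i t" "\<lambda>t i. - vel p h n (\<lambda>j. u j t) i - K"])
      show "compact {..n}" by (simp add: finite_imp_compact)
      show "continuous_on ({0..B} \<times> {..n}) (\<lambda>(t, i). \<phi> i - e - d - K * t - u i t)"
        by (rule continuous_on_grid) (intro continuous_intros uc)
      show "\<And>i. i \<in> {..n} \<Longrightarrow> \<phi> i - e - d - K * 0 - u i 0 < 0"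
        using init d by (force simp: abs_le_iff)
      show "((\<lambda>s. \<phi> i - e - d - K * s - u i s) has_real_derivative - vel p h n (\<lambda>j. u j t) i - K) (at t)"
        if "0 < t" "t < B" "i \<in> {..n}" for t i
        using ud[of i t] that by (auto intro!: derivative_eq_intros)
      fix t i assume t: "0 < t" "t < B" and i: "i \<in> {..n}" and eq: "\<phi> i - e - d - K * t - u i t = 0"
        and le: "\<And>j. j \<in> {..n} \<Longrightarrow> \<phi> j - e - d - K * t - u j t \<le> 0"
      have "lap h n (\<lambda>j. \<phi> j - u j t) i \<le> 0"
        by (rule lap_nonpos_at_max) (use i eq le in force)+
      then have "- b \<le> lap h n (\<lambda>j. u j t) i" using phi[of i] i by (simp add: lap_diff)
      then have "u i t powr p * (- (b + hi)) \<le> vel p h n (\<lambda>j. u j t) i"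
        unfolding vel_def using ubd[of i t] avg[of t] i t lo by (intro mult_left_mono) auto
      moreover have "u i t powr p * (b + hi) \<le> hi powr p * (b + hi)"
        using ubd[of i t] i t lo p b by (intro mult_right_mono powr_mono2) auto
      moreover have "u i t powr p * (- (b + hi)) = - (u i t powr p * (b + hi))" by (rule mult_minus_right)
      ultimately show "- vel p h n (\<lambda>j. u j t) i - K < 0" unfolding K_def by linarith
    qed (use i t in auto)
    then show ?thesis by simp
  qed
  have "u i t - \<phi> i \<le> e + K * t"
    by (rule field_le_epsilon) (use upper in \<open>force simp: algebra_simps\<close>)
  moreover have "\<phi> i - u i t \<le> e + K * t"
    by (rule field_le_epsilon) (use lower in \<open>force simp: algebra_simps\<close>)
  ultimately show ?thesis unfolding K_def by simp
qed

section \<open>Smoothing estimates uniform in the mesh\<close>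

text \<open>Mean value theorem, with the derivative bounded below by its value at lo. Combined with
  summation by parts it bounds the sum of \<open>u powr p\<close> times the Laplacian of u by a
  negative multiple of the Dirichlet energy.\<close>

lemma powr_diff_mult_ge:
  fixes p :: real
  assumes p: "1 \<le> p" and lo: "0 < lo" and x: "lo \<le> x" and y: "lo \<le> y"
  shows "p * lo powr (p - 1) * (x - y)\<^sup>2 \<le> (x powr p - y powr p) * (x - y)"
proof -
  have main: "p * lo powr (p - 1) * (x - y)\<^sup>2 \<le> (x powr p - y powr p) * (x - y)"
    if x: "lo \<le> x" and y: "lo \<le> y" and xy: "y < x" for x y
  proof -
    obtain z where z: "y < z" "z < x" "x powr p - y powr p = (x - y) * (p * z powr (p - 1))"
    proof -
      have "((\<lambda>x. x powr p) has_real_derivative p * z powr (p - 1)) (at z)" if "y \<le> z" "z \<le> x" for z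
        using that y lo by (intro has_real_derivative_powr) linarith
      from MVT2[OF xy this] that show ?thesis by blast
    qed
    have "p * lo powr (p - 1) \<le> p * z powr (p - 1)"
      using z y lo p by (intro mult_left_mono powr_mono2) auto
    then have "p * lo powr (p - 1) * (x - y)\<^sup>2 \<le> p * z powr (p - 1) * (x - y)\<^sup>2"
      by (intro mult_right_mono) auto
    then show ?thesis unfolding z(3) by (simp add: power2_eq_square algebra_simps)
  qed
  show ?thesis
    using main[OF x y] main[OF y x] by (cases x y rule: linorder_cases) (auto simp: power2_commute algebra_simps)
qed

lemma dir_has_derivative:
  assumes "\<And>i. i \<le> n \<Longrightarrow> (f i has_real_derivative f' i) (at t)"
  shows "((\<lambda>t. dir h n (\<lambda>i. f i t)) has_real_derivative - 2 * nsum h n (\<lambda>i. f' i * lap h n (\<lambda>j. f j t) i)) (at t)"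
proof -
  have "((\<lambda>t. dir h n (\<lambda>i. f i t)) has_real_derivative
      (\<Sum>i<n. 2 * (f (Suc i) t - f i t) * (f' (Suc i) - f' i)) / h) (at t)"
    unfolding dir_def
    by (intro DERIV_cdivide DERIV_sum) (auto intro!: derivative_eq_intros assms simp: algebra_simps)
  moreover have "(\<Sum>i<n. 2 * (f (Suc i) t - f i t) * (f' (Suc i) - f' i)) / h
      = - 2 * nsum h n (\<lambda>i. f' i * lap h n (\<lambda>j. f j t) i)"
    unfolding green_nsum by (simp add: sum_distrib_left sum_negf[symmetric] sum_divide_distrib) (simp add: algebra_simps)
  ultimately show ?thesis by simp
qed

lemma nsum_has_derivative:
  assumes "\<And>i. i \<le> n \<Longrightarrow> (f i has_real_derivative f' i) (at t)"
  shows "((\<lambda>t. nsum h n (\<lambda>i. f i t)) has_real_derivative nsum h n f') (at t)"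
  unfolding nsum_def by (auto intro!: derivative_eq_intros DERIV_sum assms)

lemma lap_has_derivative:
  assumes "\<And>j. j \<le> n \<Longrightarrow> (f j has_real_derivative f' j) (at t)" "i \<le> n"
  shows "((\<lambda>t. lap h n (\<lambda>j. f j t) i) has_real_derivative lap h n f' i) (at t)"
proof -
  have "((\<lambda>t. if i < n then f (Suc i) t - f i t else 0) has_real_derivative (if i < n then f' (Suc i) - f' i else 0)) (at t)"
    using assms by (cases "i < n") (auto intro!: DERIV_diff)
  moreover have "((\<lambda>t. if 0 < i then f i t - f (i - 1) t else 0) has_real_derivative (if 0 < i then f' i - f' (i - 1) else 0)) (at t)"
    using assms by (cases "0 < i") (auto intro!: DERIV_diff)
  ultimately show ?thesis unfolding lap_def by (intro DERIV_cdivide DERIV_diff)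
qed

text \<open>A differential inequality with quadratic growth is integrated on the part of \<open>[0, B]\<close>
  after \<epsilon>, since there F has a bounded antiderivative; the initial value of F does not enter.\<close>
lemma smoothing_quadratic:
  fixes F F' Z Z' :: "real \<Rightarrow> real"
  assumes e: "0 < e" and K: "0 \<le> K" and c: "0 \<le> c"
    and F: "continuous_on {0..B} F" "\<And>t. t \<in> {0..B} \<Longrightarrow> 0 \<le> F t"
      "\<And>t. 0 < t \<Longrightarrow> t < B \<Longrightarrow> (F has_real_derivative F' t) (at t)"
      "\<And>t. 0 < t \<Longrightarrow> t < B \<Longrightarrow> F' t \<le> K * (F t + (F t)\<^sup>2)"
    and Z: "continuous_on {0..B} Z" "\<And>t. t \<in> {0..B} \<Longrightarrow> \<bar>Z t\<bar> \<le> c"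
      "\<And>t. 0 < t \<Longrightarrow> t < B \<Longrightarrow> (Z has_real_derivative Z' t) (at t)"
      "\<And>t. 0 < t \<Longrightarrow> t < B \<Longrightarrow> Z' t \<le> - 2 * t * F t"
    and t: "2 * e \<le> t" "t \<le> B"
  shows "F t \<le> exp (K * c / (2 * e)) * c / e\<^sup>2 * exp (K * (B + c / (2 * e)))"
proof -
  \<comment> \<open>For times after e the bound on Z' gives P' \<ge> F, so P plays the role of the
    antiderivative of F, and it stays within \<open>c / (2 * e)\<close>.\<close>
  define P where "P = (\<lambda>t. - Z t / (2 * e))"
  \<comment> \<open>Integrating factor for \<open>F' \<le> K * F * (1 + F)\<close>, with 1 + F
    replaced by the larger 1 + P'; hence X is nonincreasing.\<close>
  define X where "X = (\<lambda>t. F t * exp (- K * (t + P t)))"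
  define b where "b = exp (K * c / (2 * e))"
  have P: "\<bar>P s\<bar> \<le> c / (2 * e)" if "s \<in> {0..B}" for s
    using Z(2)[OF that] e unfolding P_def by (simp add: field_simps)
  have Xb: "X s \<le> F s * b" if s: "s \<in> {0..B}" for s
  proof -
    have "- K * (s + P s) \<le> K * c / (2 * e)"
    proof -
      have "- K * (s + P s) = K * (- s - P s)" by (simp add: algebra_simps)
      also have "\<dots> \<le> K * (c / (2 * e))" using P[OF s] s K by (intro mult_left_mono) auto
      finally show ?thesis by simp
    qed
    then show ?thesis unfolding X_def b_def using F(2)[OF s] by (intro mult_left_mono) auto
  qed
  define X' where "X' = (\<lambda>s. (F' s - K * F s * (1 - Z' s / (2 * e))) * exp (- K * (s + P s)))"
  \<comment> \<open>The weight t - e removes the unknown value of X at e. Differentiating it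
    produces X, which is at most \<open>b * F\<close> and is paid for by
    \<open>- b * P\<close>.\<close>
  have "(t - e) * X t - b * P t \<le> (e - e) * X e - b * P e"
  proof (rule nonincreasing_from_deriv[where f = "\<lambda>t. (t - e) * X t - b * P t"
        and f' = "\<lambda>s. X s + (s - e) * X' s + b * Z' s / (2 * e)"])
    show "e \<le> t" using t e by simp
    show "continuous_on {e..t} (\<lambda>t. (t - e) * X t - b * P t)"
      unfolding X_def P_def
      by (intro continuous_intros continuous_on_subset[OF F(1)] continuous_on_subset[OF Z(1)]) (use e t in auto)
    fix s assume s: "e < s" "s < t"
    then have s': "0 < s" "s < B" "s \<in> {0..B}" using e t by auto
    have dP: "(P has_real_derivative - Z' s / (2 * e)) (at s)"
      unfolding P_def using Z(3)[OF s'(1,2)] e by (auto intro!: derivative_eq_intros)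
    have deriv_Icc: "(X has_real_derivative X' s) (at s)"
      unfolding X_def X'_def by (auto intro!: derivative_eq_intros F(3)[OF s'(1,2)] dP simp: algebra_simps)
    show "((\<lambda>t. (t - e) * X t - b * P t) has_real_derivative (X s + (s - e) * X' s + b * Z' s / (2 * e))) (at s)"
      by (auto intro!: derivative_eq_intros deriv_Icc dP)
    have ZF: "Z' s / (2 * e) \<le> - F s"
    proof -
      have "Z' s \<le> - 2 * s * F s" using Z(4) s' by simp
      also have "\<dots> \<le> - (2 * e) * F s" using F(2)[OF s'(3)] s by (simp add: mult_right_mono)
      finally show ?thesis using e by (simp add: field_simps)
    qed
    have "F' s \<le> K * (F s + (F s)\<^sup>2)" using F(4) s' by simp
    also have "\<dots> = K * F s * (1 + F s)" by (simp add: power2_eq_square algebra_simps)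
    also have "\<dots> \<le> K * F s * (1 - Z' s / (2 * e))" using ZF K F(2)[OF s'(3)] by (intro mult_left_mono) auto
    finally have "X' s \<le> 0" unfolding X'_def by (simp add: mult_nonpos_nonneg)
    then have "(s - e) * X' s \<le> 0" using s by (simp add: mult_nonneg_nonpos)
    moreover have "b * (Z' s / (2 * e)) \<le> b * (- F s)" using ZF unfolding b_def by (intro mult_left_mono) auto
    ultimately show "X s + (s - e) * X' s + b * Z' s / (2 * e) \<le> 0"
      using Xb[OF s'(3)] by (simp add: algebra_simps)
  qed
  then have "(t - e) * X t \<le> b * (P t - P e)" by (simp add: algebra_simps)
  also have "\<dots> \<le> b * (c / e)"
  proof (rule mult_left_mono)
    have "P t - P e \<le> c / (2 * e) + c / (2 * e)" using P[of t] P[of e] t e by auto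
    then show "P t - P e \<le> c / e" by simp
  qed (simp add: b_def)
  finally have 1: "(t - e) * X t \<le> b * (c / e)" .
  have X0: "0 \<le> X t" unfolding X_def using F(2)[of t] t e by simp
  have "e * X t \<le> b * (c / e)" using 1 mult_right_mono[of e "t - e" "X t"] X0 t by linarith
  then have Xt: "X t \<le> b * c / e\<^sup>2" using e by (simp add: field_simps power2_eq_square)
  have "F t = X t * exp (K * (t + P t))" unfolding X_def by (simp add: exp_add[symmetric] mult.assoc)
  also have "\<dots> \<le> (b * c / e\<^sup>2) * exp (K * (B + c / (2 * e)))"
  proof (rule mult_mono)
    show "exp (K * (t + P t)) \<le> exp (K * (B + c / (2 * e)))"
      using P[of t] t e K by (auto intro!: mult_left_mono add_mono)
  qed (use Xt c in \<open>auto simp: b_def\<close>)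
  finally show ?thesis unfolding b_def by simp
qed

text \<open>For linear growth no integrating factor is needed: the weight
  \<open>t - \<alpha>\<close> removes the initial value of G, and the decrease of the bounded
  functional Z pays for the terms in G.\<close>

lemma smoothing_linear:
  fixes G G' Z Z' :: "real \<Rightarrow> real"
  assumes e: "0 < e" and K: "0 \<le> K" and ab: "0 \<le> \<alpha>"
    and G: "continuous_on {\<alpha>..B} G" "\<And>t. t \<in> {\<alpha>..B} \<Longrightarrow> 0 \<le> G t"
      "\<And>t. \<alpha> < t \<Longrightarrow> t < B \<Longrightarrow> (G has_real_derivative G' t) (at t)"
      "\<And>t. \<alpha> < t \<Longrightarrow> t < B \<Longrightarrow> G' t \<le> K * (1 + G t)"
    and Z: "continuous_on {\<alpha>..B} Z" "\<And>t. t \<in> {\<alpha>..B} \<Longrightarrow> \<bar>Z t\<bar> \<le> c"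
      "\<And>t. \<alpha> < t \<Longrightarrow> t < B \<Longrightarrow> (Z has_real_derivative Z' t) (at t)"
      "\<And>t. \<alpha> < t \<Longrightarrow> t < B \<Longrightarrow> Z' t \<le> - G t"
    and t: "\<alpha> + e \<le> t" "t \<le> B"
  shows "G t \<le> ((1 + B * K) * (2 * c) + B * K * B) / e"
proof -
  \<comment> \<open>\<open>(t - \<alpha>) * G'\<close> is at most \<open>B * K * (1 + G)\<close>; K1
    collects the multiples of G, to be paid by Z, and K2 the constants.\<close>
  define K1 K2 where "K1 = 1 + B * K" and "K2 = B * K"
  have B: "0 \<le> B" using t ab e by simp
  have K12: "0 \<le> K1" "0 \<le> K2" unfolding K1_def K2_def using B K by auto
  have "(t - \<alpha>) * G t + K1 * Z t - K2 * t \<le> (\<alpha> - \<alpha>) * G \<alpha> + K1 * Z \<alpha> - K2 * \<alpha>"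
  proof (rule nonincreasing_from_deriv[where f = "\<lambda>t. (t - \<alpha>) * G t + K1 * Z t - K2 * t"
        and f' = "\<lambda>s. G s + (s - \<alpha>) * G' s + K1 * Z' s - K2"])
    show "\<alpha> \<le> t" using t e by simp
    show "continuous_on {\<alpha>..t} (\<lambda>t. (t - \<alpha>) * G t + K1 * Z t - K2 * t)"
      by (intro continuous_intros continuous_on_subset[OF G(1)] continuous_on_subset[OF Z(1)]) (use t in auto)
    fix s assume s: "\<alpha> < s" "s < t"
    then have s': "\<alpha> < s" "s < B" "s \<in> {\<alpha>..B}" using t by auto
    show "((\<lambda>t. (t - \<alpha>) * G t + K1 * Z t - K2 * t) has_real_derivative G s + (s - \<alpha>) * G' s + K1 * Z' s - K2) (at s)"
      by (auto intro!: derivative_eq_intros G(3)[OF s'(1,2)] Z(3)[OF s'(1,2)])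
    have "(s - \<alpha>) * G' s \<le> (s - \<alpha>) * (K * (1 + G s))" using G(4) s' by (intro mult_left_mono) auto
    also have "\<dots> \<le> B * (K * (1 + G s))" using G(2)[OF s'(3)] s' ab K by (intro mult_right_mono) auto
    finally have 1: "(s - \<alpha>) * G' s \<le> B * (K * (1 + G s))" .
    have "K1 * Z' s \<le> K1 * (- G s)" using Z(4) s' K12 by (intro mult_left_mono) auto
    with 1 show "G s + (s - \<alpha>) * G' s + K1 * Z' s - K2 \<le> 0"
      unfolding K1_def K2_def by (simp add: algebra_simps)
  qed
  then have "(t - \<alpha>) * G t \<le> K1 * (Z \<alpha> - Z t) + K2 * (t - \<alpha>)" by (simp add: algebra_simps)
  also have "\<dots> \<le> K1 * (2 * c) + K2 * B"
    using Z(2)[of \<alpha>] Z(2)[of t] t e ab K12 by (intro add_mono mult_left_mono) auto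
  finally have "(t - \<alpha>) * G t \<le> K1 * (2 * c) + K2 * B" .
  moreover have "e * G t \<le> (t - \<alpha>) * G t" using t e G(2)[of t] by (intro mult_right_mono) auto
  ultimately have "e * G t \<le> K1 * (2 * c) + K2 * B" by simp
  then show ?thesis unfolding K1_def K2_def using e by (simp add: field_simps)
qed

section \<open>Energy estimates for one lattice solution, uniform in the mesh\<close>

locale lattice =
  fixes p a B lo hi :: real and n :: nat and u :: "nat \<Rightarrow> real \<Rightarrow> real"
  assumes p: "1 \<le> p" and a: "0 < a" and lo: "0 < lo" and lohi: "lo \<le> hi" and B: "0 < B"
    and sol: "lattice_sol p (a / real (Suc n)) n B lo hi u"
begin

definition "h = a / real (Suc n)"
abbreviation "S \<equiv> nsum h n"
abbreviation "D \<equiv> dir h n"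
definition "v i t = vel p h n (\<lambda>j. u j t) i"
text \<open>The second time derivative of u. Its first term is \<open>p * u powr (p - 1) * v\<close>
  times the bracket of \<open>vel\<close>, with the bracket expressed through v.\<close>

definition "w i t = p * (v i t)\<^sup>2 / u i t + u i t powr p * (lap h n (\<lambda>j. v j t) i + v i t - avg n (\<lambda>j. v j t))"

lemma h: "0 < h" and ha: "h * real (Suc n) = a"
  unfolding h_def using a by auto

lemma hi: "0 < hi" using lo lohi by simp

lemma u_cont: "i \<le> n \<Longrightarrow> continuous_on {0..B} (u i)"
  and u_bd: "i \<le> n \<Longrightarrow> t \<in> {0..B} \<Longrightarrow> lo \<le> u i t" "i \<le> n \<Longrightarrow> t \<in> {0..B} \<Longrightarrow> u i t \<le> hi"
  and u_deriv: "i \<le> n \<Longrightarrow> 0 < t \<Longrightarrow> t < B \<Longrightarrow> (u i has_real_derivative v i t) (at t)"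
  using sol unfolding lattice_sol_def v_def h_def by auto

lemma u_pos: "i \<le> n \<Longrightarrow> t \<in> {0..B} \<Longrightarrow> 0 < u i t"
  using u_bd lo by fastforce

lemma avg_S: "avg n f = S f / a"
proof -
  have "S f / a = (h / a) * (\<Sum>i\<le>n. f i)" unfolding nsum_def by simp
  also have "h / a = 1 / real (Suc n)" unfolding h_def using a by simp
  finally show ?thesis unfolding avg_def by simp
qed

lemma cont_nsum: "(\<And>i. i \<le> n \<Longrightarrow> continuous_on X (f i)) \<Longrightarrow> continuous_on X (\<lambda>t. S (\<lambda>i. f i t))"
  unfolding nsum_def by (intro continuous_intros) auto

lemma cont_dir: "(\<And>i. i \<le> n \<Longrightarrow> continuous_on X (f i)) \<Longrightarrow> continuous_on X (\<lambda>t. D (\<lambda>i. f i t))"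
  unfolding dir_def using h by (intro continuous_intros) auto

lemma v_cont: assumes "i \<le> n" shows "continuous_on {0..B} (v i)"
proof -
  have "continuous_on {0..B} (\<lambda>t. lap h n (\<lambda>j. u j t) i)"
    unfolding lap_def using h assms
    by (cases "i < n"; cases "0 < i") (auto intro!: continuous_intros u_cont)
  moreover have "continuous_on {0..B} (\<lambda>t. avg n (\<lambda>j. u j t))"
    unfolding avg_def by (intro continuous_intros u_cont) auto
  ultimately show ?thesis
    unfolding v_def vel_def using assms u_pos[OF assms]
    by (intro continuous_intros u_cont) (auto simp: less_imp_neq[symmetric])
qed

lemma v_deriv: assumes i: "i \<le> n" and t: "0 < t" "t < B" shows "(v i has_real_derivative w i t) (at t)"
proof -
  have d: "(u j has_real_derivative v j t) (at t)" if "j \<le> n" for j using u_deriv that t by simp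
  have pos: "0 < u i t" using u_pos i t by auto
  define q where "q = lap h n (\<lambda>j. u j t) i + u i t - avg n (\<lambda>j. u j t)"
  have vq: "v i t = u i t powr p * q" unfolding v_def vel_def q_def ..
  have veq: "v i = (\<lambda>t. u i t powr p * (lap h n (\<lambda>j. u j t) i + u i t - avg n (\<lambda>j. u j t)))"
    by (rule ext) (simp only: v_def vel_def)
  have 1: "((\<lambda>t. avg n (\<lambda>j. u j t)) has_real_derivative avg n (\<lambda>j. v j t)) (at t)"
    unfolding avg_def by (intro DERIV_cdivide DERIV_sum d) auto
  have 2: "((\<lambda>t. u i t powr p) has_real_derivative p * u i t powr (p - 1) * v i t) (at t)"
    using DERIV_chain2[OF has_real_derivative_powr[OF pos] d[OF i], of p] .
  have 3: "((\<lambda>t. lap h n (\<lambda>j. u j t) i) has_real_derivative lap h n (\<lambda>j. v j t) i) (at t)"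
    by (rule lap_has_derivative) (use d i in auto)
  have "((\<lambda>t. u i t powr p * (lap h n (\<lambda>j. u j t) i + u i t - avg n (\<lambda>j. u j t))) has_real_derivative
      p * u i t powr (p - 1) * v i t * q + u i t powr p * (lap h n (\<lambda>j. v j t) i + v i t - avg n (\<lambda>j. v j t))) (at t)"
    using DERIV_mult[OF 2 DERIV_diff[OF DERIV_add[OF 3 d[OF i]] 1]] unfolding q_def by (simp add: mult.commute)
  then have "(v i has_real_derivative
      p * u i t powr (p - 1) * v i t * q + u i t powr p * (lap h n (\<lambda>j. v j t) i + v i t - avg n (\<lambda>j. v j t))) (at t)"
    unfolding veq[symmetric] .
  moreover have "p * u i t powr (p - 1) * v i t * q = p * (v i t)\<^sup>2 / u i t"
    using pos unfolding vq by (simp add: powr_diff power2_eq_square field_simps)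
  ultimately show ?thesis unfolding w_def by simp
qed

text \<open>With the weight \<open>u powr (- p)\<close> this is the exact dissipation rate of the
  discrete energy E in \<open>first_energy\<close>.\<close>

definition "Y t = S (\<lambda>i. u i t powr (- p) * (v i t)\<^sup>2)"

lemma S_v2: assumes "t \<in> {0..B}" shows "S (\<lambda>i. (v i t)\<^sup>2) \<le> hi powr p * Y t"
proof -
  have "S (\<lambda>i. (v i t)\<^sup>2) \<le> S (\<lambda>i. hi powr p * (u i t powr (- p) * (v i t)\<^sup>2))"
  proof (rule nsum_mono)
    fix i assume i: "i \<le> n"
    have "u i t powr p \<le> hi powr p" using u_bd[OF i assms] u_pos[OF i assms] p by (intro powr_mono2) auto
    then have "1 \<le> hi powr p * u i t powr (- p)"
      using u_pos[OF i assms] by (simp add: powr_minus field_simps)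
    then show "(v i t)\<^sup>2 \<le> hi powr p * (u i t powr (- p) * (v i t)\<^sup>2)"
      using mult_right_mono[of 1 "hi powr p * u i t powr (- p)" "(v i t)\<^sup>2"] by (simp add: mult.assoc)
  qed (use h in auto)
  then show ?thesis unfolding Y_def nsum_cmult .
qed

lemma Y_nonneg: "0 \<le> Y t"
  unfolding Y_def using h by (intro nsum_nonneg) auto

lemma v_div: assumes "i \<le> n" "t \<in> {0..B}"
  shows "u i t powr (- p) * v i t = lap h n (\<lambda>j. u j t) i + u i t - avg n (\<lambda>j. u j t)"
  unfolding v_def vel_def using u_pos[OF assms] by (simp add: mult.assoc[symmetric] powr_add[symmetric])

text \<open>The initial Dirichlet energy need not be bounded uniformly in the mesh, so E is
  multiplied by t. Differentiating this factor leaves E, whose Dirichlet part is not yet controlled.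
  But \<open>S u\<close> decreases at least at the rate \<open>\<kappa> * D u\<close> up to a
  constant, so adding \<open>S u / (2 * \<kappa>)\<close> cancels it. The resulting Z is bounded,
  and its decrease controls \<open>t * Y t\<close>.\<close>

lemma first_energy:
  defines "\<kappa> \<equiv> p * lo powr (p - 1)"
  defines "K \<equiv> a * hi\<^sup>2 / 2 + a * (hi powr p * hi) / (2 * \<kappa>)"
  defines "c \<equiv> a * hi / (2 * \<kappa>) + B * K + B * (a * hi\<^sup>2)"
  obtains Z Z' where "continuous_on {0..B} Z"
    "\<And>t. 0 < t \<Longrightarrow> t < B \<Longrightarrow> (Z has_real_derivative Z' t) (at t)"
    "\<And>t. 0 < t \<Longrightarrow> t < B \<Longrightarrow> Z' t \<le> - t * Y t"
    "\<And>t. t \<in> {0..B} \<Longrightarrow> \<bar>Z t\<bar> \<le> c"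
    "\<And>t. t \<in> {0..B} \<Longrightarrow> t * D (\<lambda>i. u i t) \<le> 2 * c"
proof -
  have kap: "0 < \<kappa>" unfolding \<kappa>_def using p lo by simp
  have K0: "0 \<le> K" unfolding K_def using a hi kap by simp
  define E where "E = (\<lambda>t. D (\<lambda>i. u i t) / 2 - S (\<lambda>i. (u i t)\<^sup>2) / 2 + (S (\<lambda>i. u i t))\<^sup>2 / (2 * a))"
  define Z where "Z = (\<lambda>t. t * E t + S (\<lambda>i. u i t) / (2 * \<kappa>) - K * t)"
  define Z' where "Z' = (\<lambda>t. E t - t * Y t + S (\<lambda>i. v i t) / (2 * \<kappa>) - K)"
  have D0: "0 \<le> D (\<lambda>i. u i t)" for t using h by (intro dir_nonneg) auto
  have bounds: "0 \<le> S (\<lambda>i. (u i t)\<^sup>2)" "S (\<lambda>i. (u i t)\<^sup>2) \<le> a * hi\<^sup>2"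
     "0 \<le> S (\<lambda>i. u i t)" "S (\<lambda>i. u i t) \<le> a * hi" if "t \<in> {0..B}" for t
  proof -
    show "0 \<le> S (\<lambda>i. (u i t)\<^sup>2)" "0 \<le> S (\<lambda>i. u i t)"
      using u_pos that h by (auto intro!: nsum_nonneg simp: less_imp_le)
    have "S (\<lambda>i. (u i t)\<^sup>2) \<le> S (\<lambda>i. hi\<^sup>2)"
      using u_pos u_bd that h by (intro nsum_mono power_mono) (auto simp: less_imp_le)
    then show "S (\<lambda>i. (u i t)\<^sup>2) \<le> a * hi\<^sup>2" using ha by (simp add: nsum_const)
    have "S (\<lambda>i. u i t) \<le> S (\<lambda>i. hi)" using u_bd that h by (intro nsum_mono) auto
    then show "S (\<lambda>i. u i t) \<le> a * hi" using ha by (simp add: nsum_const)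
  qed
  have E_up: "E t \<le> D (\<lambda>i. u i t) / 2 + a * hi\<^sup>2 / 2" and E_lo: "D (\<lambda>i. u i t) / 2 - a * hi\<^sup>2 / 2 \<le> E t"
    if t: "t \<in> {0..B}" for t
  proof -
    have "(S (\<lambda>i. u i t))\<^sup>2 \<le> (a * hi)\<^sup>2" using bounds[OF t] by (intro power_mono) auto
    then have "(S (\<lambda>i. u i t))\<^sup>2 / (2 * a) \<le> (a * hi)\<^sup>2 / (2 * a)" using a by (intro divide_right_mono) auto
    also have "\<dots> = a * hi\<^sup>2 / 2" using a by (simp add: power2_eq_square)
    finally show "E t \<le> D (\<lambda>i. u i t) / 2 + a * hi\<^sup>2 / 2" unfolding E_def using bounds(1)[OF t] by linarith
    have "0 \<le> (S (\<lambda>i. u i t))\<^sup>2 / (2 * a)" using a by simp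
    then show "D (\<lambda>i. u i t) / 2 - a * hi\<^sup>2 / 2 \<le> E t" unfolding E_def using bounds(2)[OF t] by linarith
  qed
  have dE: "(E has_real_derivative - Y t) (at t)" if t: "0 < t" "t < B" for t
  proof -
    have d: "(u j has_real_derivative v j t) (at t)" if "j \<le> n" for j using u_deriv that t by simp
    have "(E has_real_derivative - S (\<lambda>i. v i t * lap h n (\<lambda>j. u j t) i) - S (\<lambda>i. u i t * v i t) + S (\<lambda>i. u i t) * S (\<lambda>i. v i t) / a) (at t)"
    proof -
      have 1: "((\<lambda>t. S (\<lambda>i. (u i t)\<^sup>2)) has_real_derivative S (\<lambda>i. 2 * (u i t * v i t))) (at t)"
        by (rule nsum_has_derivative) (auto intro!: derivative_eq_intros d)
      have 2: "((\<lambda>t. S (\<lambda>i. u i t)) has_real_derivative S (\<lambda>i. v i t)) (at t)"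
        by (rule nsum_has_derivative) (rule d)
      have 3: "((\<lambda>t. D (\<lambda>i. u i t)) has_real_derivative - 2 * S (\<lambda>i. v i t * lap h n (\<lambda>j. u j t) i)) (at t)"
        by (rule dir_has_derivative) (rule d)
      have "(E has_real_derivative - 2 * S (\<lambda>i. v i t * lap h n (\<lambda>j. u j t) i) / 2 - S (\<lambda>i. 2 * (u i t * v i t)) / 2
           + (2 * S (\<lambda>i. u i t) * S (\<lambda>i. v i t)) / (2 * a)) (at t)"
        unfolding E_def using DERIV_power[OF 2, of 2]
        by (intro DERIV_add DERIV_diff DERIV_cdivide 1 3) (simp add: mult.assoc mult.commute mult.left_commute)
      then show ?thesis by (simp add: nsum_cmult)
    qed
    moreover have "Y t = S (\<lambda>i. v i t * lap h n (\<lambda>j. u j t) i) + S (\<lambda>i. u i t * v i t) - S (\<lambda>i. u i t) * S (\<lambda>i. v i t) / a"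
    proof -
      have "Y t = S (\<lambda>i. (v i t * lap h n (\<lambda>j. u j t) i + u i t * v i t) - (S (\<lambda>i. u i t) / a) * v i t)"
        unfolding Y_def nsum_def
      proof (rule arg_cong[of _ _ "(*) h"], rule sum.cong)
        fix i assume i: "i \<in> {..n}"
        have "u i t powr (- p) * (v i t)\<^sup>2 = (u i t powr (- p) * v i t) * v i t" by (simp add: power2_eq_square)
        also have "\<dots> = (lap h n (\<lambda>j. u j t) i + u i t - S (\<lambda>j. u j t) / a) * v i t"
          using v_div[of i t] i t by (simp add: avg_S)
        finally show "u i t powr (- p) * (v i t)\<^sup>2 = v i t * lap h n (\<lambda>j. u j t) i + u i t * v i t - (h * (\<Sum>i\<le>n. u i t)) / a * v i t"
          unfolding nsum_def by (simp add: algebra_simps)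
      qed simp
      then show ?thesis unfolding nsum_diff nsum_add nsum_cmult by simp
    qed
    ultimately show ?thesis by (simp only: minus_diff_eq minus_add_distrib) (simp add: algebra_simps)
  qed
  \<comment> \<open>The equation tested with 1: monotonicity of \<open>u powr p\<close> turns the
    diffusion into a negative multiple of D.\<close>
  have Sv: "S (\<lambda>i. v i t) \<le> - \<kappa> * D (\<lambda>i. u i t) + a * (hi powr p * hi)" if t: "t \<in> {0..B}" for t
  proof -
    have "S (\<lambda>i. v i t) = S (\<lambda>i. u i t powr p * lap h n (\<lambda>j. u j t) i) + S (\<lambda>i. u i t powr p * (u i t - avg n (\<lambda>j. u j t)))"
      unfolding v_def vel_def nsum_add[symmetric] by (simp add: algebra_simps)
    also have "S (\<lambda>i. u i t powr p * lap h n (\<lambda>j. u j t) i) \<le> - \<kappa> * D (\<lambda>i. u i t)"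
    proof -
      have "\<kappa> * (\<Sum>i<n. (u (Suc i) t - u i t)\<^sup>2) \<le> (\<Sum>i<n. (u (Suc i) t powr p - u i t powr p) * (u (Suc i) t - u i t))"
        unfolding sum_distrib_left \<kappa>_def
        by (intro sum_mono powr_diff_mult_ge p lo u_bd t) auto
      then show ?thesis unfolding green_nsum dir_def using h by (simp add: field_simps)
    qed
    also have "S (\<lambda>i. u i t powr p * (u i t - avg n (\<lambda>j. u j t))) \<le> S (\<lambda>i. hi powr p * hi)"
    proof (rule nsum_mono)
      fix i assume i: "i \<le> n"
      have "0 \<le> avg n (\<lambda>j. u j t)" using avg_bounds(1)[of n 0 "\<lambda>j. u j t" hi] u_pos u_bd t by (force simp: less_imp_le)
      then have "u i t powr p * (u i t - avg n (\<lambda>j. u j t)) \<le> u i t powr p * hi"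
        using u_bd(2)[OF i t] by (intro mult_left_mono) auto
      also have "\<dots> \<le> hi powr p * hi" using u_bd(2)[OF i t] u_pos[OF i t] p hi by (intro mult_right_mono powr_mono2) auto
      finally show "u i t powr p * (u i t - avg n (\<lambda>j. u j t)) \<le> hi powr p * hi" .
    qed (use h in auto)
    also have "S (\<lambda>i. hi powr p * hi) = a * (hi powr p * hi)" using ha by (simp add: nsum_const)
    finally show ?thesis by simp
  qed
  have Ec: "continuous_on {0..B} E"
    unfolding E_def using a by (intro continuous_intros cont_dir cont_nsum u_cont) auto
  have Zc: "continuous_on {0..B} Z"
    unfolding Z_def using kap by (intro continuous_intros Ec cont_nsum u_cont) auto
  have dZ: "(Z has_real_derivative Z' t) (at t)" if t: "0 < t" "t < B" for t
  proof -
    have 2: "((\<lambda>t. S (\<lambda>i. u i t)) has_real_derivative S (\<lambda>i. v i t)) (at t)"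
      by (rule nsum_has_derivative) (use u_deriv t in auto)
    show ?thesis unfolding Z_def Z'_def
      using kap by (auto intro!: derivative_eq_intros dE[OF t] 2)
  qed
  have Z': "Z' t \<le> - t * Y t" if t: "t \<in> {0..B}" for t
  proof -
    have "S (\<lambda>i. v i t) / (2 * \<kappa>) \<le> (- \<kappa> * D (\<lambda>i. u i t) + a * (hi powr p * hi)) / (2 * \<kappa>)"
      using Sv[OF t] kap by (intro divide_right_mono) auto
    also have "\<dots> = - D (\<lambda>i. u i t) / 2 + a * (hi powr p * hi) / (2 * \<kappa>)" using kap by (simp add: field_simps)
    finally show ?thesis unfolding Z'_def K_def using E_up[OF t] by simp
  qed
  have Zdec: "Z t \<le> Z 0" if t: "t \<in> {0..B}" for t
  proof (rule nonincreasing_from_deriv[where f = Z and f' = Z'])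
    show "continuous_on {0..t} Z" by (rule continuous_on_subset[OF Zc]) (use t in auto)
    fix s assume s: "0 < s" "s < t"
    then show "(Z has_real_derivative Z' s) (at s)" using dZ t by simp
    have "0 \<le> s * Y s" using s Y_nonneg by simp
    then show "Z' s \<le> 0" using Z'[of s] s t by auto
  qed (use t in auto)
  \<comment> \<open>The factor t removes \<open>E 0\<close>, so no derivative of the initial value
    enters.\<close>
  have Z0: "Z 0 \<le> a * hi / (2 * \<kappa>)"
    unfolding Z_def using bounds(4)[of 0] B kap by (simp add: divide_right_mono)
  have tK: "K * t \<le> B * K" if "t \<in> {0..B}" for t using that K0 mult_right_mono[of t B K] by (simp add: mult.commute)
  have tA: "t * (a * hi\<^sup>2 / 2) \<le> B * (a * hi\<^sup>2) / 2" if "t \<in> {0..B}" for t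
    using that a mult_right_mono[of t B "a * hi\<^sup>2 / 2"] by simp
  have Zlow: "t * (D (\<lambda>i. u i t) / 2) \<le> Z t + B * (a * hi\<^sup>2) / 2 + B * K" if t: "t \<in> {0..B}" for t
  proof -
    have "t * (D (\<lambda>i. u i t) / 2 - a * hi\<^sup>2 / 2) \<le> t * E t" using E_lo[OF t] t by (intro mult_left_mono) auto
    moreover have "0 \<le> S (\<lambda>i. u i t) / (2 * \<kappa>)" using bounds(3)[OF t] kap by simp
    ultimately show ?thesis unfolding Z_def using tK[OF t] tA[OF t] by (simp add: algebra_simps)
  qed
  have pos: "0 \<le> a * hi / (2 * \<kappa>)" "0 \<le> B * (a * hi\<^sup>2)" "0 \<le> B * K" using a hi kap B K0 by auto
  show ?thesis
  proof
    show "continuous_on {0..B} Z" by fact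
    show "\<And>t. 0 < t \<Longrightarrow> t < B \<Longrightarrow> (Z has_real_derivative Z' t) (at t)" by fact
    show "\<And>t. 0 < t \<Longrightarrow> t < B \<Longrightarrow> Z' t \<le> - t * Y t" using Z' by auto
    fix t assume t: "t \<in> {0..B}"
    have "0 \<le> t * (D (\<lambda>i. u i t) / 2)" using t D0[of t] by simp
    then show "\<bar>Z t\<bar> \<le> c" using Zlow[OF t] Zdec[OF t] Z0 pos unfolding c_def by (auto simp: abs_le_iff)
    show "t * D (\<lambda>i. u i t) \<le> 2 * c" using Zlow[OF t] Zdec[OF t] Z0 pos unfolding c_def by (auto simp: algebra_simps)
  qed
qed

lemma sup_v: assumes "i \<le> n"
  shows "(v i t)\<^sup>2 \<le> (1 / a + 1) * S (\<lambda>i. (v i t)\<^sup>2) + D (\<lambda>i. v i t)"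
  using agmon[OF h zero_less_one assms, of "\<lambda>i. v i t"] ha by simp

text \<open>Differentiating Y yields \<open>- D v\<close> and a cubic term, which comes from the
  weight and from the power in \<open>vel\<close>. One factor v is bounded by its supremum, hence by
  \<open>sqrt R\<close>; Young's inequality then costs half of \<open>D v\<close> and leaves a
  square of Y. This quadratic growth is what \<open>smoothing_quadratic\<close> is made for.\<close>

lemma second_energy:
  defines "k \<equiv> p / 2 * lo powr (- p - 1)"
  defines "K \<equiv> (3 / 2 + 1 / (2 * a)) * (2 * hi powr p) + k\<^sup>2 / 2 * (2 * hi powr p)\<^sup>2"
  assumes t: "0 < t" "t < B"
  obtains F' where "((\<lambda>t. Y t / 2) has_real_derivative F') (at t)"
    "F' \<le> - D (\<lambda>i. v i t) / 2 + K * (Y t / 2 + (Y t / 2)\<^sup>2)"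
proof -
  have tB: "t \<in> {0..B}" using t by auto
  define s where "s = S (\<lambda>i. (v i t)\<^sup>2)"
  define d where "d = D (\<lambda>i. v i t)"
  define F' where "F' = S (\<lambda>i. u i t powr (- p) * v i t * w i t - p / 2 * (u i t powr (- p - 1) * (v i t)^3))"
  have dY: "((\<lambda>t. Y t / 2) has_real_derivative F') (at t)"
  proof -
    have "((\<lambda>t. Y t) has_real_derivative S (\<lambda>i. 2 * (u i t powr (- p) * v i t * w i t - p / 2 * (u i t powr (- p - 1) * (v i t)^3)))) (at t)"
      unfolding Y_def
    proof (rule nsum_has_derivative)
      fix i assume i: "i \<le> n"
      have pos: "0 < u i t" using u_pos i t by auto
      have 1: "((\<lambda>t. u i t powr (- p)) has_real_derivative - p * u i t powr (- p - 1) * v i t) (at t)"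
        using DERIV_chain2[OF has_real_derivative_powr[OF pos] u_deriv[OF i t], of "- p"] .
      show "((\<lambda>t. u i t powr (- p) * (v i t)\<^sup>2) has_real_derivative
          2 * (u i t powr (- p) * v i t * w i t - p / 2 * (u i t powr (- p - 1) * (v i t)^3))) (at t)"
        using DERIV_mult[OF 1 DERIV_power[OF v_deriv[OF i t], of 2]]
        by (simp add: power2_eq_square power3_eq_cube algebra_simps)
    qed
    then show ?thesis unfolding F'_def nsum_cmult by (auto intro!: derivative_eq_intros)
  qed
  have wdiv: "u i t powr (- p) * w i t = p * (u i t powr (- p - 1) * (v i t)\<^sup>2) + lap h n (\<lambda>j. v j t) i + v i t - avg n (\<lambda>j. v j t)"
    if i: "i \<le> n" for i
  proof -
    have pos: "0 < u i t" using u_pos i t by auto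
    have 1: "u i t powr (- p) * (u i t powr p * q) = q" for q
      using pos by (simp add: mult.assoc[symmetric] powr_add[symmetric])
    have 2: "u i t powr (- p - 1) = u i t powr (- p) / u i t" using pos by (simp add: powr_diff)
    show ?thesis unfolding w_def distrib_left 1 2 by simp
  qed
  have F'eq: "F' = S (\<lambda>i. v i t * lap h n (\<lambda>j. v j t) i) + s - (S (\<lambda>i. v i t))\<^sup>2 / a + p / 2 * S (\<lambda>i. u i t powr (- p - 1) * (v i t)^3)"
  proof -
    have "F' = S (\<lambda>i. v i t * lap h n (\<lambda>j. v j t) i + (v i t)\<^sup>2 - (S (\<lambda>i. v i t) / a) * v i t + p / 2 * (u i t powr (- p - 1) * (v i t)^3))"
      unfolding F'_def nsum_def
    proof (rule arg_cong[of _ _ "(*) h"], rule sum.cong)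
      fix i assume i: "i \<in> {..n}"
      have "u i t powr (- p) * v i t * w i t = v i t * (u i t powr (- p) * w i t)" by simp
      also have "\<dots> = v i t * (p * (u i t powr (- p - 1) * (v i t)\<^sup>2) + lap h n (\<lambda>j. v j t) i + v i t - S (\<lambda>j. v j t) / a)"
        using wdiv[of i] i by (simp add: avg_S)
      finally show "u i t powr (- p) * v i t * w i t - p / 2 * (u i t powr (- p - 1) * (v i t)^3) =
         v i t * lap h n (\<lambda>j. v j t) i + (v i t)\<^sup>2 - (h * (\<Sum>i\<le>n. v i t) / a) * v i t + p / 2 * (u i t powr (- p - 1) * (v i t)^3)"
        unfolding nsum_def by (simp add: power2_eq_square power3_eq_cube algebra_simps)
    qed simp
    then show ?thesis unfolding nsum_add nsum_diff nsum_cmult s_def by (simp add: power2_eq_square)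
  qed
  have s0: "0 \<le> s" unfolding s_def using h by (intro nsum_nonneg) auto
  have d0: "0 \<le> d" unfolding d_def using h by (intro dir_nonneg) auto
  define R where "R = (1 / a + 1) * s + d"
  have R0: "0 \<le> R" unfolding R_def using s0 d0 a by simp
  have vR: "\<bar>v i t\<bar> \<le> sqrt R" if "i \<le> n" for i
    using sup_v[OF that, of t] unfolding R_def s_def d_def by (simp add: real_le_rsqrt)
  have "p / 2 * S (\<lambda>i. u i t powr (- p - 1) * (v i t)^3) = S (\<lambda>i. p / 2 * (u i t powr (- p - 1) * (v i t)^3))"
    by (rule nsum_cmult[symmetric])
  also have "\<dots> \<le> S (\<lambda>i. (k * sqrt R) * (v i t)\<^sup>2)"
  proof (rule nsum_mono)
    fix i assume i: "i \<le> n"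
    have "u i t powr (- p - 1) \<le> lo powr (- p - 1)"
      using u_bd(1)[OF i tB] lo p by (intro powr_mono2') auto
    then have 1: "p / 2 * u i t powr (- p - 1) \<le> k" unfolding k_def using p by (intro mult_left_mono) auto
    have "p / 2 * (u i t powr (- p - 1) * (v i t)^3) = (p / 2 * u i t powr (- p - 1)) * v i t * (v i t)\<^sup>2"
      by (simp add: power2_eq_square power3_eq_cube)
    also have "\<dots> \<le> (p / 2 * u i t powr (- p - 1)) * sqrt R * (v i t)\<^sup>2"
      using vR[OF i] p by (intro mult_right_mono mult_left_mono) auto
    also have "\<dots> \<le> k * sqrt R * (v i t)\<^sup>2"
      using 1 R0 by (intro mult_right_mono) auto
    finally show "p / 2 * (u i t powr (- p - 1) * (v i t)^3) \<le> (k * sqrt R) * (v i t)\<^sup>2" .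
  qed (use h in auto)
  also have "\<dots> = sqrt R * (k * s)" unfolding nsum_cmult s_def by simp
  also have "\<dots> \<le> (R + k\<^sup>2 * s\<^sup>2) / 2"
    using sum_squares_bound[of "sqrt R" "k * s"] R0 by (simp add: power_mult_distrib)
  finally have cub: "p / 2 * S (\<lambda>i. u i t powr (- p - 1) * (v i t)^3) \<le> (R + k\<^sup>2 * s\<^sup>2) / 2" .
  have "S (\<lambda>i. v i t * lap h n (\<lambda>j. v j t) i) = - d" unfolding d_def by (rule green_self)
  moreover have "0 \<le> (S (\<lambda>i. v i t))\<^sup>2 / a" using a by simp
  \<comment> \<open>The coefficient of s is 1 from the linear term plus half of
    \<open>1 / a + 1\<close> from R.\<close>
  ultimately have F'1: "F' \<le> - d / 2 + (3 / 2 + 1 / (2 * a)) * s + k\<^sup>2 / 2 * s\<^sup>2"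
    using F'eq cub unfolding R_def by (simp add: algebra_simps)
  have sF: "s \<le> 2 * hi powr p * (Y t / 2)" unfolding s_def using S_v2[OF tB] by simp
  have "F' \<le> - d / 2 + (3 / 2 + 1 / (2 * a)) * (2 * hi powr p * (Y t / 2)) + k\<^sup>2 / 2 * (2 * hi powr p * (Y t / 2))\<^sup>2"
  proof -
    have "(3 / 2 + 1 / (2 * a)) * s \<le> (3 / 2 + 1 / (2 * a)) * (2 * hi powr p * (Y t / 2))"
      using sF a by (intro mult_left_mono) auto
    moreover have "k\<^sup>2 / 2 * s\<^sup>2 \<le> k\<^sup>2 / 2 * (2 * hi powr p * (Y t / 2))\<^sup>2"
      using sF s0 by (intro mult_left_mono power_mono) auto
    ultimately show ?thesis using F'1 by linarith
  qed
  also have "\<dots> \<le> - d / 2 + K * (Y t / 2 + (Y t / 2)\<^sup>2)"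
  proof -
    define y where "y = Y t / 2"
    have y: "0 \<le> y" unfolding y_def using Y_nonneg by simp
    define A1 A2 where "A1 = (3 / 2 + 1 / (2 * a)) * (2 * hi powr p)" and "A2 = k\<^sup>2 / 2 * (2 * hi powr p)\<^sup>2"
    have A: "0 \<le> A1" "0 \<le> A2" unfolding A1_def A2_def using a by auto
    have "A1 * y + A2 * y\<^sup>2 \<le> (A1 + A2) * (y + y\<^sup>2)"
      using A y by (simp add: algebra_simps)
    then show ?thesis unfolding y_def[symmetric] A1_def A2_def K_def
      by (simp add: power_mult_distrib algebra_simps)
  qed
  finally show ?thesis using that dY unfolding d_def by blast
qed

text \<open>The derivative of \<open>D v / 2\<close> is minus the sum of w times the Laplacian of v.
  Solving the definition of w for that Laplacian gives \<open>u powr (- p) * w\<close> minus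
  lower-order terms; the weight is at least \<open>2 * k\<close>, and half of it pays for Young's
  inequality. Since the sum of v^2 is already bounded by s, the quartic remainder needs only one
  supremum of v^2, so the growth is linear in \<open>D v\<close>.\<close>

lemma third_energy:
  defines "k \<equiv> hi powr (- p) / 2"
  assumes t: "0 < t" "t < B" and s: "S (\<lambda>i. (v i t)\<^sup>2) \<le> s"
  defines "A \<equiv> 4 * a / (2 * k) + p\<^sup>2 * lo powr (2 * (- p - 1)) / (2 * k) * s"
  defines "K \<equiv> A * ((1 / a + 1) * s + 2)"
  obtains G' where "((\<lambda>t. D (\<lambda>i. v i t) / 2) has_real_derivative G') (at t)"
    "G' \<le> - k * S (\<lambda>i. (w i t)\<^sup>2) + K * (1 + D (\<lambda>i. v i t) / 2)"
proof
  have tB: "t \<in> {0..B}" using t by auto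
  define d where "d = D (\<lambda>i. v i t)"
  have k0: "0 < k" unfolding k_def using hi by simp
  have s1: "0 \<le> S (\<lambda>i. (v i t)\<^sup>2)" using h by (intro nsum_nonneg) auto
  have s0: "0 \<le> s" using s s1 by simp
  have d0: "0 \<le> d" unfolding d_def using h by (intro dir_nonneg) auto
  define R where "R = (1 / a + 1) * s + d"
  have R0: "0 \<le> R" unfolding R_def using s0 d0 a by simp
  have vR: "(v i t)\<^sup>2 \<le> R" if "i \<le> n" for i
    using sup_v[OF that, of t] mult_left_mono[OF s, of "1 / a + 1"] a unfolding R_def d_def by simp
  then have vR': "\<bar>v i t\<bar> \<le> sqrt R" if "i \<le> n" for i using that by (simp add: real_le_rsqrt)
  have avR: "\<bar>avg n (\<lambda>j. v j t)\<bar> \<le> sqrt R"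
    using avg_bounds[of n "- sqrt R" "\<lambda>j. v j t" "sqrt R"] vR' by (force simp: abs_le_iff)
  show "((\<lambda>t. D (\<lambda>i. v i t) / 2) has_real_derivative - S (\<lambda>i. w i t * lap h n (\<lambda>j. v j t) i)) (at t)"
  proof -
    have "((\<lambda>t. D (\<lambda>i. v i t)) has_real_derivative - 2 * S (\<lambda>i. w i t * lap h n (\<lambda>j. v j t) i)) (at t)"
      by (rule dir_has_derivative) (use v_deriv t in auto)
    then show ?thesis by (auto intro!: derivative_eq_intros)
  qed
  define q where "q = p\<^sup>2 * lo powr (2 * (- p - 1)) / (2 * k)"
  have q0: "0 \<le> q" unfolding q_def using k0 by simp
  have "- S (\<lambda>i. w i t * lap h n (\<lambda>j. v j t) i) = S (\<lambda>i. (-1) * (w i t * lap h n (\<lambda>j. v j t) i))"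
    unfolding nsum_cmult by simp
  also have "\<dots> \<le> S (\<lambda>i. - k * (w i t)\<^sup>2 + (4 * R / (2 * k) + q * R * (v i t)\<^sup>2))"
  proof (rule nsum_mono)
    fix i assume i: "i \<le> n"
    have pos: "0 < u i t" using u_pos i t by auto
    define W V U where "W = w i t" and "V = v i t - avg n (\<lambda>j. v j t)" and "U = p * (u i t powr (- p - 1) * (v i t)\<^sup>2)"
    have lapeq: "lap h n (\<lambda>j. v j t) i = u i t powr (- p) * W - V - U"
    proof -
      have 1: "u i t powr (- p) * (u i t powr p * q) = q" for q
        using pos by (simp add: mult.assoc[symmetric] powr_add[symmetric])
      have 2: "u i t powr (- p - 1) = u i t powr (- p) / u i t" using pos by (simp add: powr_diff)
      have "u i t powr (- p) * W = U + (lap h n (\<lambda>j. v j t) i + V)"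
        unfolding W_def V_def U_def w_def distrib_left 1 2 by simp
      then show ?thesis by simp
    qed
    have young: "x * y \<le> k / 2 * x\<^sup>2 + y\<^sup>2 / (2 * k)" for x y :: real
    proof -
      have "0 \<le> (k * x - y)\<^sup>2 / (2 * k)" using k0 by simp
      also have "\<dots> = k / 2 * x\<^sup>2 + y\<^sup>2 / (2 * k) - x * y" using k0 by (simp add: power2_eq_square field_simps)
      finally show ?thesis by simp
    qed
    have "2 * k \<le> u i t powr (- p)"
      unfolding k_def using pos u_bd(2)[OF i tB] p by (simp add: powr_mono2')
    then have "2 * k * W\<^sup>2 \<le> u i t powr (- p) * W\<^sup>2" by (intro mult_right_mono) auto
    moreover have "W * V \<le> k / 2 * W\<^sup>2 + V\<^sup>2 / (2 * k)" "W * U \<le> k / 2 * W\<^sup>2 + U\<^sup>2 / (2 * k)" by (rule young)+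
    ultimately have 1: "(-1) * (W * (u i t powr (- p) * W - V - U)) \<le> - k * W\<^sup>2 + (V\<^sup>2 / (2 * k) + U\<^sup>2 / (2 * k))"
      by (simp add: power2_eq_square algebra_simps)
    have "\<bar>V\<bar> \<le> 2 * sqrt R" unfolding V_def using vR'[OF i] avR by linarith
    then have "\<bar>V\<bar>\<^sup>2 \<le> (2 * sqrt R)\<^sup>2" by (intro power_mono) auto
    then have "V\<^sup>2 \<le> 4 * R" using R0 by (simp add: power_mult_distrib)
    then have 2: "V\<^sup>2 / (2 * k) \<le> 4 * R / (2 * k)" using k0 by (intro divide_right_mono) auto
    have "U\<^sup>2 = p\<^sup>2 * ((u i t powr (- p - 1))\<^sup>2 * ((v i t)\<^sup>2 * (v i t)\<^sup>2))" unfolding U_def by (simp add: power_mult_distrib power2_eq_square)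
    \<comment> \<open>One factor v^2 is replaced by its supremum R, the other is kept for the
      summation over i.\<close>
    also have "\<dots> \<le> p\<^sup>2 * ((lo powr (- p - 1))\<^sup>2 * (R * (v i t)\<^sup>2))"
    proof -
      have "u i t powr (- p - 1) \<le> lo powr (- p - 1)"
        using u_bd(1)[OF i tB] lo p by (intro powr_mono2') auto
      then have "(u i t powr (- p - 1))\<^sup>2 \<le> (lo powr (- p - 1))\<^sup>2" by (intro power_mono) auto
      then show ?thesis using vR[OF i] R0 by (intro mult_left_mono mult_mono) auto
    qed
    also have "(lo powr (- p - 1))\<^sup>2 = lo powr (2 * (- p - 1))" using lo by (simp add: powr_add[symmetric] power2_eq_square)
    finally have "U\<^sup>2 / (2 * k) \<le> p\<^sup>2 * (lo powr (2 * (- p - 1)) * (R * (v i t)\<^sup>2)) / (2 * k)"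
      using k0 by (intro divide_right_mono) auto
    then have 3: "U\<^sup>2 / (2 * k) \<le> q * R * (v i t)\<^sup>2" unfolding q_def by simp
    show "(-1) * (w i t * lap h n (\<lambda>j. v j t) i) \<le> - k * (w i t)\<^sup>2 + (4 * R / (2 * k) + q * R * (v i t)\<^sup>2)"
      using 1 2 3 unfolding lapeq W_def[symmetric] by linarith
  qed (use h in auto)
  also have "\<dots> = - k * S (\<lambda>i. (w i t)\<^sup>2) + (a * (4 * R / (2 * k)) + q * R * S (\<lambda>i. (v i t)\<^sup>2))"
    unfolding nsum_add nsum_cmult nsum_const using ha by simp
  also have "\<dots> \<le> - k * S (\<lambda>i. (w i t)\<^sup>2) + K * (1 + d / 2)"
  proof -
    have "q * R * S (\<lambda>i. (v i t)\<^sup>2) \<le> q * R * s" using s q0 R0 by (intro mult_left_mono) auto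
    then have "a * (4 * R / (2 * k)) + q * R * S (\<lambda>i. (v i t)\<^sup>2) \<le> A * R"
      unfolding A_def q_def by (simp add: algebra_simps)
    also have "\<dots> \<le> A * (((1 / a + 1) * s + 2) * (1 + d / 2))"
    proof (rule mult_left_mono)
      have "0 \<le> (1 / a + 1) * s * (d / 2)" using a s0 d0 by simp
      then show "R \<le> ((1 / a + 1) * s + 2) * (1 + d / 2)" unfolding R_def by (simp add: algebra_simps)
      show "0 \<le> A" unfolding A_def using a k0 s0 by simp
    qed
    finally show ?thesis unfolding K_def by (simp add: mult.assoc)
  qed
  finally show "- S (\<lambda>i. w i t * lap h n (\<lambda>j. v j t) i) \<le> - k * S (\<lambda>i. (w i t)\<^sup>2) + K * (1 + D (\<lambda>i. v i t) / 2)"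
    unfolding d_def .
qed

end

text \<open>K is fixed before n and u, which expresses uniformity in the mesh. Each energy supplies
  the bounded functional for the next: Z controls Y, Y controls the Dirichlet energy of v, and the
  dissipation of the latter controls w and thereby the modulus of continuity of v in time.\<close>

lemma lattice_smoothing:
  assumes p: "1 \<le> p" and a: "0 < a" and lo: "0 < lo" "lo \<le> hi" and B: "0 < B" and e: "0 < e"
  obtains K where "0 < K"
    "\<And>n u t. lattice p a B lo hi n u \<Longrightarrow> t \<in> {e..B} \<Longrightarrow> dir (lattice.h a n) n (\<lambda>i. u i t) \<le> K"
    "\<And>n u t. lattice p a B lo hi n u \<Longrightarrow> t \<in> {e..B} \<Longrightarrow> dir (lattice.h a n) n (\<lambda>i. lattice.v p a n u i t) \<le> K"
    "\<And>n u t i. lattice p a B lo hi n u \<Longrightarrow> t \<in> {e..B} \<Longrightarrow> i \<le> n \<Longrightarrow> \<bar>lattice.v p a n u i t\<bar> \<le> K"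
    "\<And>n u s t. lattice p a B lo hi n u \<Longrightarrow> e \<le> s \<Longrightarrow> s \<le> t \<Longrightarrow> t \<le> B \<Longrightarrow>
       nsum (lattice.h a n) n (\<lambda>i. (lattice.v p a n u i t - lattice.v p a n u i s)\<^sup>2) \<le> K * (t - s)"
proof -
  \<comment> \<open>Waiting times: Y is bounded after \<open>2 * \<epsilon>\<close> and the
    Dirichlet energy of v after \<open>3 * \<epsilon>\<close>, which is still before e.\<close>
  define \<epsilon> where "\<epsilon> = e / 4"
  have eps: "0 < \<epsilon>" "3 * \<epsilon> \<le> e" unfolding \<epsilon>_def using e by auto
  define \<kappa> where "\<kappa> = p * lo powr (p - 1)"
  \<comment> \<open>The constants from here to K3 copy the expressions in the energy and smoothing
    lemmas, so that their conclusions match by unfolding.\<close>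
  define K1 where "K1 = a * hi\<^sup>2 / 2 + a * (hi powr p * hi) / (2 * \<kappa>)"
  define c1 where "c1 = a * hi / (2 * \<kappa>) + B * K1 + B * (a * hi\<^sup>2)"
  define k2 where "k2 = p / 2 * lo powr (- p - 1)"
  define K2 where "K2 = (3 / 2 + 1 / (2 * a)) * (2 * hi powr p) + k2\<^sup>2 / 2 * (2 * hi powr p)\<^sup>2"
  define C2 where "C2 = exp (K2 * c1 / (2 * \<epsilon>)) * c1 / \<epsilon>\<^sup>2 * exp (K2 * (B + c1 / (2 * \<epsilon>)))"
  define L2 where "L2 = K2 * (C2 + C2\<^sup>2)"
  define c2 where "c2 = 2 * C2 + 2 * L2 * B"
  define s where "s = hi powr p * (2 * C2)"
  define k3 where "k3 = hi powr (- p) / 2"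
  define A where "A = 4 * a / (2 * k3) + p\<^sup>2 * lo powr (2 * (- p - 1)) / (2 * k3) * s"
  define K3 where "K3 = A * ((1 / a + 1) * s + 2)"
  define C3 where "C3 = ((1 + B * K3) * (2 * c2) + B * K3 * B) / \<epsilon>"
  define L3 where "L3 = K3 * (1 + C3) / k3"
  define c3 where "c3 = L3 * B + C3 / k3"
  define K where "K = 1 + 2 * c1 / e + 2 * C3 + ((1 / a + 1) * s + 2 * C3) + 2 * exp 1 * c3"
  have hi: "0 < hi" using lo by simp
  have pos: "0 < \<kappa>" "0 \<le> K1" "0 \<le> c1" "0 \<le> K2" "0 \<le> C2" "0 \<le> L2" "0 \<le> c2" "0 \<le> s" "0 < k3" "0 \<le> A" "0 \<le> K3" "0 \<le> C3" "0 \<le> L3" "0 \<le> c3"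
  proof -
    show 1: "0 < \<kappa>" unfolding \<kappa>_def using p lo by simp
    show 2: "0 \<le> K1" unfolding K1_def using a hi 1 by simp
    show 3: "0 \<le> c1" unfolding c1_def using a hi 1 2 B by simp
    show 4: "0 \<le> K2" unfolding K2_def using a by simp
    show 5: "0 \<le> C2" unfolding C2_def using 3 by simp
    show 6: "0 \<le> L2" unfolding L2_def using 4 5 by simp
    show 7: "0 \<le> c2" unfolding c2_def using 5 6 B by simp
    show 8: "0 \<le> s" unfolding s_def using 5 by simp
    show 9: "0 < k3" unfolding k3_def using hi by simp
    show 10: "0 \<le> A" unfolding A_def using a 8 9 by simp
    show 11: "0 \<le> K3" unfolding K3_def using 10 8 a by simp
    show 12: "0 \<le> C3" unfolding C3_def using 11 7 B eps by simp
    show 13: "0 \<le> L3" unfolding L3_def using 11 12 9 by simp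
    show "0 \<le> c3" unfolding c3_def using 13 12 9 B by simp
  qed
  have parts: "0 \<le> 2 * c1 / e" "0 \<le> 2 * C3" "0 \<le> (1 / a + 1) * s + 2 * C3" "0 \<le> 2 * exp 1 * c3"
    using pos e a by (auto intro!: add_nonneg_nonneg mult_nonneg_nonneg)
  have main: "(\<forall>t\<in>{e..B}. dir (lattice.h a n) n (\<lambda>i. u i t) \<le> 2 * c1 / e \<and>
      dir (lattice.h a n) n (\<lambda>i. lattice.v p a n u i t) \<le> 2 * C3 \<and>
      (\<forall>i\<le>n. (lattice.v p a n u i t)\<^sup>2 \<le> (1 / a + 1) * s + 2 * C3)) \<and>
    (\<forall>r t. e \<le> r \<longrightarrow> r \<le> t \<longrightarrow> t \<le> B \<longrightarrow>
       nsum (lattice.h a n) n (\<lambda>i. (lattice.v p a n u i t - lattice.v p a n u i r)\<^sup>2) \<le> 2 * exp 1 * c3 * (t - r))"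
    if lat: "lattice p a B lo hi n u" for n u
  proof -
    interpret lattice p a B lo hi n u by fact
    obtain Z Z' where Z: "continuous_on {0..B} Z"
      "\<And>t. 0 < t \<Longrightarrow> t < B \<Longrightarrow> (Z has_real_derivative Z' t) (at t)"
      "\<And>t. 0 < t \<Longrightarrow> t < B \<Longrightarrow> Z' t \<le> - t * Y t"
      "\<And>t. t \<in> {0..B} \<Longrightarrow> \<bar>Z t\<bar> \<le> c1"
      "\<And>t. t \<in> {0..B} \<Longrightarrow> t * D (\<lambda>i. u i t) \<le> 2 * c1"
      using first_energy unfolding c1_def K1_def \<kappa>_def by blast
    have Du: "D (\<lambda>i. u i t) \<le> 2 * c1 / e" if t: "t \<in> {e..B}" for t
    proof -
      have "e * D (\<lambda>i. u i t) \<le> t * D (\<lambda>i. u i t)" using t h by (intro mult_right_mono dir_nonneg) auto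
      also have "\<dots> \<le> 2 * c1" using Z(5)[of t] t e by auto
      finally show ?thesis using e by (simp add: field_simps)
    qed
    have "\<forall>t. \<exists>F'. 0 < t \<longrightarrow> t < B \<longrightarrow> ((\<lambda>t. Y t / 2) has_real_derivative F') (at t) \<and>
      F' \<le> - D (\<lambda>i. v i t) / 2 + K2 * (Y t / 2 + (Y t / 2)\<^sup>2)"
      using second_energy unfolding K2_def k2_def by blast
    then obtain F' where F': "\<And>t. 0 < t \<Longrightarrow> t < B \<Longrightarrow> ((\<lambda>t. Y t / 2) has_real_derivative F' t) (at t)"
      "\<And>t. 0 < t \<Longrightarrow> t < B \<Longrightarrow> F' t \<le> - D (\<lambda>i. v i t) / 2 + K2 * (Y t / 2 + (Y t / 2)\<^sup>2)"
      by metis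
    have Yc: "continuous_on {0..B} Y"
    proof -
      have "continuous_on {0..B} (\<lambda>t. u i t powr (- p) * (v i t)\<^sup>2)" if i: "i \<le> n" for i
        using u_pos[OF i] by (intro continuous_intros u_cont v_cont i) (auto simp: less_imp_neq[symmetric])
      then show ?thesis unfolding Y_def by (rule cont_nsum)
    qed
    have Dv0: "0 \<le> D (\<lambda>i. v i t)" for t using h by (intro dir_nonneg) auto
    have F: "Y t / 2 \<le> C2" if t: "t \<in> {2 * \<epsilon>..B}" for t
      unfolding C2_def
    proof (rule smoothing_quadratic[of \<epsilon> K2 c1 B "\<lambda>t. Y t / 2" F' Z Z' t])
      show "continuous_on {0..B} (\<lambda>t. Y t / 2)" using Yc by (intro continuous_intros) auto
      show "\<And>t. 0 < t \<Longrightarrow> t < B \<Longrightarrow> F' t \<le> K2 * (Y t / 2 + (Y t / 2)\<^sup>2)"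
        using F'(2) Dv0 by (smt (verit) divide_minus_left divide_nonneg_nonneg)
    qed (use eps pos Z F' Y_nonneg t in auto)
    have S2: "S (\<lambda>i. (v i t)\<^sup>2) \<le> s" if t: "t \<in> {2 * \<epsilon>..B}" for t
    proof -
      have "S (\<lambda>i. (v i t)\<^sup>2) \<le> hi powr p * Y t" using S_v2[of t] t eps by auto
      also have "\<dots> \<le> hi powr p * (2 * C2)" using F[OF t] by (intro mult_left_mono) auto
      finally show ?thesis unfolding s_def .
    qed
    define G where "G = (\<lambda>t. D (\<lambda>i. v i t) / 2)"
    have G0: "0 \<le> G t" for t unfolding G_def using Dv0 by simp
    have "\<forall>t. \<exists>G'. 2 * \<epsilon> < t \<longrightarrow> t < B \<longrightarrow> (G has_real_derivative G') (at t) \<and>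
      G' \<le> - k3 * S (\<lambda>i. (w i t)\<^sup>2) + K3 * (1 + G t)"
    proof
      fix t
      show "\<exists>G'. 2 * \<epsilon> < t \<longrightarrow> t < B \<longrightarrow> (G has_real_derivative G') (at t) \<and>
        G' \<le> - k3 * S (\<lambda>i. (w i t)\<^sup>2) + K3 * (1 + G t)"
      proof (cases "2 * \<epsilon> < t \<and> t < B")
        case True
        then have "0 < t" "t < B" "S (\<lambda>i. (v i t)\<^sup>2) \<le> s" using eps S2[of t] by auto
        from third_energy[OF this] show ?thesis
          unfolding G_def k3_def A_def K3_def by blast
      qed auto
    qed
    then obtain G' where G': "\<And>t. 2 * \<epsilon> < t \<Longrightarrow> t < B \<Longrightarrow> (G has_real_derivative G' t) (at t)"
      "\<And>t. 2 * \<epsilon> < t \<Longrightarrow> t < B \<Longrightarrow> G' t \<le> - k3 * S (\<lambda>i. (w i t)\<^sup>2) + K3 * (1 + G t)"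
      by metis
    have Gc: "continuous_on {0..B} G"
      unfolding G_def by (intro continuous_intros cont_dir v_cont) auto
    have Sw0: "0 \<le> S (\<lambda>i. (w i t)\<^sup>2)" for t using h by (intro nsum_nonneg) auto
    \<comment> \<open>By \<open>second_energy\<close> the bounded quantity Y serves as the
      functional for G: once its admissible growth \<open>2 * L2\<close> is subtracted, its decrease
      dominates G.\<close>
    define Z2 where "Z2 = (\<lambda>t. 2 * (Y t / 2) - 2 * L2 * t)"
    have G: "G t \<le> C3" if t: "t \<in> {3 * \<epsilon>..B}" for t
      unfolding C3_def
    proof (rule smoothing_linear[where e = \<epsilon> and G = G and t = t and K = K3 and c = c2 and B = B and \<alpha> = "2 * \<epsilon>" and G' = G' and Z = Z2 and Z' = "\<lambda>t. 2 * F' t - 2 * L2"])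
      show "continuous_on {2 * \<epsilon>..B} G" by (rule continuous_on_subset[OF Gc]) (use eps in auto)
      show "continuous_on {2 * \<epsilon>..B} Z2" unfolding Z2_def
        by (intro continuous_intros continuous_on_subset[OF Yc]) (use eps in auto)
      show "\<bar>Z2 t\<bar> \<le> c2" if t: "t \<in> {2 * \<epsilon>..B}" for t
      proof -
        have "0 \<le> L2 * t" "L2 * t \<le> L2 * B" using t eps pos by (auto intro: mult_left_mono)
        moreover have "0 \<le> Y t / 2" using Y_nonneg by simp
        ultimately show ?thesis unfolding Z2_def c2_def using F[OF t] by linarith
      qed
      fix t assume t: "2 * \<epsilon> < t" "t < B"
      then have t': "0 < t" using eps by simp
      show "(Z2 has_real_derivative 2 * F' t - 2 * L2) (at t)"
        using DERIV_diff[OF DERIV_cmult[OF F'(1)[OF t' t(2)], of 2] DERIV_cmult[OF DERIV_ident, of "2 * L2"]]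
        unfolding Z2_def by simp
      have y: "0 \<le> Y t / 2" "Y t / 2 \<le> C2" using F[of t] t Y_nonneg by auto
      have "K2 * (Y t / 2 + (Y t / 2)\<^sup>2) \<le> L2"
        unfolding L2_def using y pos by (intro mult_left_mono add_mono power_mono) auto
      then show "2 * F' t - 2 * L2 \<le> - G t" using F'(2)[OF t' t(2)] Dv0[of t] unfolding G_def by simp
      have "0 \<le> k3 * S (\<lambda>i. (w i t)\<^sup>2)" using pos Sw0 by simp
      then show "G' t \<le> K3 * (1 + G t)" using G'(2)[OF t] by simp
    qed (use eps pos G' G0 t in auto)
    \<comment> \<open>Bounded, with a derivative dominating the sum of w^2; it stands in for the
      time integral of that sum.\<close>
    define Z3 where "Z3 = (\<lambda>t. L3 * t - G t / k3)"
    have Z3: "\<bar>Z3 t\<bar> \<le> c3" if t: "t \<in> {3 * \<epsilon>..B}" for t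
    proof -
      have "0 \<le> L3 * t" "L3 * t \<le> L3 * B" using t eps pos by (auto intro: mult_left_mono)
      moreover have "0 \<le> G t / k3" "G t / k3 \<le> C3 / k3" using G0[of t] G[OF t] pos by (auto intro: divide_right_mono)
      ultimately show ?thesis unfolding Z3_def c3_def by linarith
    qed
    have Z3d: "(Z3 has_real_derivative (L3 - G' t / k3)) (at t)" "S (\<lambda>i. (w i t)\<^sup>2) \<le> L3 - G' t / k3"
      if t: "3 * \<epsilon> < t" "t < B" for t
    proof -
      have t': "2 * \<epsilon> < t" using t eps by simp
      show "(Z3 has_real_derivative (L3 - G' t / k3)) (at t)"
        unfolding Z3_def using pos by (auto intro!: derivative_eq_intros G'(1)[OF t' t(2)])
      have "K3 * (1 + G t) \<le> K3 * (1 + C3)" using G[of t] t pos by (intro mult_left_mono) auto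
      then have "G' t \<le> - k3 * S (\<lambda>i. (w i t)\<^sup>2) + K3 * (1 + C3)" using G'(2)[OF t' t(2)] by simp
      then have "G' t / k3 \<le> (- k3 * S (\<lambda>i. (w i t)\<^sup>2) + K3 * (1 + C3)) / k3" using pos by (intro divide_right_mono) auto
      also have "\<dots> = - S (\<lambda>i. (w i t)\<^sup>2) + L3" unfolding L3_def using pos by (simp add: field_simps)
      finally show "S (\<lambda>i. (w i t)\<^sup>2) \<le> L3 - G' t / k3" by simp
    qed
    have time: "S (\<lambda>i. (v i t - v i r)\<^sup>2) \<le> 2 * exp 1 * c3 * (t - r)" if rt: "e \<le> r" "r \<le> t" "t \<le> B" for r t
    proof (cases "r = t")
      case True then show ?thesis by (simp add: nsum_const)
    next
      case False
      define \<delta> where "\<delta> = t - r"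
      have del: "0 < \<delta>" unfolding \<delta>_def using rt False by simp
      define \<phi> where "\<phi> = (\<lambda>x. S (\<lambda>i. (v i x - v i r)\<^sup>2))"
      \<comment> \<open>This replaces Cauchy--Schwarz on a time integral of w. Young's inequality
        with the interval length \<delta> bounds the derivative of \<phi> by \<phi> / \<delta> plus
        \<delta> times the sum of w^2, and over an interval of that length the integrating factor
        costs only \<open>exp 1\<close>.\<close>
      define \<psi> where "\<psi> = (\<lambda>x. exp (- (x - r) / \<delta>) * \<phi> x - \<delta> * Z3 x)"
      define \<phi>' where "\<phi>' = (\<lambda>x. S (\<lambda>i. 2 * (v i x - v i r) * w i x))"
      define \<psi>' where "\<psi>' = (\<lambda>x. exp (- (x - r) / \<delta>) * (\<phi>' x - \<phi> x / \<delta>) - \<delta> * (L3 - G' x / k3))"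
      have "\<psi> t \<le> \<psi> r"
      proof (rule nonincreasing_from_deriv[where f = \<psi> and f' = \<psi>'])
        have sub: "{r..t} \<subseteq> {0..B}" using rt e by auto
        show "continuous_on {r..t} \<psi>"
          unfolding \<psi>_def \<phi>_def Z3_def using pos del
          by (intro continuous_intros cont_nsum continuous_on_subset[OF v_cont sub] continuous_on_subset[OF Gc sub]) auto
        fix x assume x: "r < x" "x < t"
        then have x': "0 < x" "x < B" "3 * \<epsilon> < x" using rt e eps by auto
        have d\<phi>: "(\<phi> has_real_derivative \<phi>' x) (at x)"
          unfolding \<phi>_def \<phi>'_def
          by (rule nsum_has_derivative) (auto intro!: derivative_eq_intros v_deriv x')
        show "(\<psi> has_real_derivative \<psi>' x) (at x)"
          unfolding \<psi>_def \<psi>'_def using del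
          by (auto intro!: derivative_eq_intros d\<phi> Z3d(1)[OF x'(3,2)] simp: field_simps)
        have "\<phi>' x \<le> S (\<lambda>i. (1 / \<delta>) * (v i x - v i r)\<^sup>2 + \<delta> * (w i x)\<^sup>2)"
          unfolding \<phi>'_def
        proof (rule nsum_mono)
          fix i
          have "0 \<le> ((v i x - v i r) - \<delta> * w i x)\<^sup>2 / \<delta>" using del by simp
          also have "\<dots> = (1 / \<delta>) * (v i x - v i r)\<^sup>2 + \<delta> * (w i x)\<^sup>2 - 2 * (v i x - v i r) * w i x"
            using del by (simp add: power2_eq_square field_simps)
          finally show "2 * (v i x - v i r) * w i x \<le> (1 / \<delta>) * (v i x - v i r)\<^sup>2 + \<delta> * (w i x)\<^sup>2" by simp
        qed (use h in auto)
        also have "\<dots> = \<phi> x / \<delta> + \<delta> * S (\<lambda>i. (w i x)\<^sup>2)" unfolding nsum_add nsum_cmult \<phi>_def by simp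
        finally have 1: "\<phi>' x - \<phi> x / \<delta> \<le> \<delta> * S (\<lambda>i. (w i x)\<^sup>2)" by simp
        have "exp (- (x - r) / \<delta>) * (\<phi>' x - \<phi> x / \<delta>) \<le> exp (- (x - r) / \<delta>) * (\<delta> * S (\<lambda>i. (w i x)\<^sup>2))"
          using 1 by (intro mult_left_mono) auto
        also have "\<dots> \<le> 1 * (\<delta> * S (\<lambda>i. (w i x)\<^sup>2))"
          using del x Sw0[of x] by (intro mult_right_mono) (auto simp: divide_nonpos_pos)
        also have "\<dots> \<le> \<delta> * (L3 - G' x / k3)" using Z3d(2)[OF x'(3,2)] del by simp
        finally show "\<psi>' x \<le> 0" unfolding \<psi>'_def by simp
      qed (use rt in auto)
      moreover have "\<psi> r = - \<delta> * Z3 r" unfolding \<psi>_def \<phi>_def by (simp add: nsum_const)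
      moreover have "- (t - r) / (t - r) = - 1" using False by (simp only: minus_divide_left[symmetric]) simp
      then have "\<psi> t = exp (- 1) * \<phi> t - \<delta> * Z3 t" unfolding \<psi>_def \<delta>_def by simp
      ultimately have "exp (- 1) * \<phi> t \<le> \<delta> * (Z3 t - Z3 r)" by (simp add: algebra_simps)
      also have "\<dots> \<le> \<delta> * (2 * c3)"
        using Z3[of t] Z3[of r] rt eps del by (intro mult_left_mono) auto
      finally have "exp 1 * (exp (- 1) * \<phi> t) \<le> exp 1 * (\<delta> * (2 * c3))" by (intro mult_left_mono) auto
      moreover have "exp 1 * (exp (- 1) * \<phi> t) = \<phi> t" by (simp add: mult.assoc[symmetric] exp_add[symmetric])
      ultimately have "\<phi> t \<le> exp 1 * (\<delta> * (2 * c3))" by (simp only:)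
      also have "\<dots> = 2 * exp 1 * c3 * \<delta>" by simp
      finally have "\<phi> t \<le> 2 * exp 1 * c3 * \<delta>" .
      then show ?thesis unfolding \<phi>_def \<delta>_def .
    qed
    show ?thesis
    proof (intro conjI ballI allI impI)
      fix t assume t: "t \<in> {e..B}"
      then have t3: "t \<in> {3 * \<epsilon>..B}" "t \<in> {2 * \<epsilon>..B}" using eps by auto
      show "D (\<lambda>i. u i t) \<le> 2 * c1 / e" using Du[OF t] .
      show Dv: "D (\<lambda>i. v i t) \<le> 2 * C3" using G[OF t3(1)] unfolding G_def by simp
      fix i assume i: "i \<le> n"
      have "(1 / a + 1) * S (\<lambda>i. (v i t)\<^sup>2) \<le> (1 / a + 1) * s" using S2[OF t3(2)] a by (intro mult_left_mono) auto
      then show "(v i t)\<^sup>2 \<le> (1 / a + 1) * s + 2 * C3" using sup_v[OF i, of t] Dv by linarith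
    qed (use time in auto)
  qed
  show ?thesis
  proof
    show "0 < K" unfolding K_def using parts by linarith
    fix n u assume lat: "lattice p a B lo hi n u"
    note m = main[OF lat]
    show "dir (lattice.h a n) n (\<lambda>i. u i t) \<le> K" if "t \<in> {e..B}" for t
    proof -
      have "dir (lattice.h a n) n (\<lambda>i. u i t) \<le> 2 * c1 / e" using m that by blast
      then show ?thesis unfolding K_def using parts by linarith
    qed
    show "dir (lattice.h a n) n (\<lambda>i. lattice.v p a n u i t) \<le> K" if "t \<in> {e..B}" for t
    proof -
      have "dir (lattice.h a n) n (\<lambda>i. lattice.v p a n u i t) \<le> 2 * C3" using m that by blast
      then show ?thesis unfolding K_def using parts by linarith
    qed
    show "\<bar>lattice.v p a n u i t\<bar> \<le> K" if "t \<in> {e..B}" "i \<le> n" for t i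
    proof -
      define y where "y = \<bar>lattice.v p a n u i t\<bar>"
      have "y\<^sup>2 \<le> (1 / a + 1) * s + 2 * C3" using m that unfolding y_def by simp
      \<comment> \<open>Passes from the bound on the square to one on the absolute value; the 1 is
        provided by the first summand of K.\<close>
      moreover have "y \<le> 1 + y\<^sup>2" using zero_le_power2[of "y - 1/2"] by (simp add: power2_eq_square algebra_simps)
      ultimately show ?thesis unfolding y_def[symmetric] K_def using parts by linarith
    qed
    show "nsum (lattice.h a n) n (\<lambda>i. (lattice.v p a n u i t - lattice.v p a n u i r)\<^sup>2) \<le> K * (t - r)"
      if "e \<le> r" "r \<le> t" "t \<le> B" for r t
    proof -
      have "nsum (lattice.h a n) n (\<lambda>i. (lattice.v p a n u i t - lattice.v p a n u i r)\<^sup>2) \<le> 2 * exp 1 * c3 * (t - r)"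
        using m that by blast
      also have "\<dots> \<le> K * (t - r)" unfolding K_def using parts that by (intro mult_right_mono) linarith+
      finally show ?thesis .
    qed
  qed
qed

section \<open>Passing to the limit in the mesh\<close>

text \<open>Midpoint of cell i. The end nodes lie half a mesh width inside the interval, so
  reflection at an end sends the end node to its missing neighbour.\<close>

definition node :: "real \<Rightarrow> nat \<Rightarrow> nat \<Rightarrow> real" where
  "node a n i = (real i + 1 / 2) * (a / real (Suc n))"

definition cell :: "real \<Rightarrow> nat \<Rightarrow> nat \<Rightarrow> real set" where
  "cell a n i = {real i * (a / real (Suc n)) .. real (Suc i) * (a / real (Suc n))}"

lemma cell_subset:
  assumes "0 < a" "i \<le> n"
  shows "cell a n i \<subseteq> {0..a}"
proof -
  have "real (Suc i) * (a / real (Suc n)) \<le> real (Suc n) * (a / real (Suc n))"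
    using assms by (intro mult_right_mono) auto
  also have "\<dots> = a" by simp
  finally show ?thesis unfolding cell_def using assms by auto
qed

lemma node_in_cell: "0 < a \<Longrightarrow> node a n i \<in> cell a n i"
proof -
  assume "0 < a"
  then have h: "0 \<le> a / real (Suc n)" by simp
  have "real i * (a / real (Suc n)) \<le> (real i + 1 / 2) * (a / real (Suc n))"
    "(real i + 1 / 2) * (a / real (Suc n)) \<le> real (Suc i) * (a / real (Suc n))"
    by (rule mult_right_mono[OF _ h], simp)+
  then show ?thesis unfolding node_def cell_def atLeastAtMost_iff by blast
qed

lemma cell_diam: "x \<in> cell a n i \<Longrightarrow> y \<in> cell a n i \<Longrightarrow> \<bar>x - y\<bar> \<le> a / real (Suc n)"
proof -
  define h where "h = a / real (Suc n)"
  assume "x \<in> cell a n i" "y \<in> cell a n i"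
  then have "real i * h \<le> x" "x \<le> real i * h + h" "real i * h \<le> y" "y \<le> real i * h + h"
    unfolding cell_def h_def[symmetric] by (auto simp: algebra_simps)
  then show ?thesis unfolding h_def[symmetric] by linarith
qed

lemma cell_exists:
  assumes a: "0 < a" and x: "x \<in> {0..a}"
  obtains i where "i \<le> n" "x \<in> cell a n i"
proof -
  define h where "h = a / real (Suc n)"
  have h: "0 < h" "real (Suc n) * h = a" unfolding h_def using a by auto
  show ?thesis
  proof (cases "x = a")
    case True
    have "real n * h \<le> real (Suc n) * h" using h by (intro mult_right_mono) auto
    then have "a \<in> cell a n n" unfolding cell_def h_def[symmetric] h(2) by simp
    then show ?thesis using that[of n] True by simp
  next
    case False
    define i where "i = nat \<lfloor>x / h\<rfloor>"
    have "real i \<le> x / h" "x / h < real i + 1" unfolding i_def using x h by (auto simp: le_floor_iff)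
    then have "real i * h \<le> x" "x < real (Suc i) * h" using h by (auto simp: field_simps)
    moreover have "x < real (Suc n) * h" using x False h by simp
    then have "real i * h < real (Suc n) * h" using \<open>real i * h \<le> x\<close> by linarith
    then have "i \<le> n" using h by simp
    ultimately show ?thesis using that[of i] unfolding cell_def h_def by auto
  qed
qed

text \<open>McShane extension for the modulus \<open>sqrt (K * r)\<close>. It turns functions on
  different grids into equi-Hoelder functions on one interval, to which \<open>Arzela_Ascoli\<close>
  applies, and it reproduces data that have this modulus on the grid.\<close>

definition mcshane :: "real \<Rightarrow> nat \<Rightarrow> real \<Rightarrow> (nat \<Rightarrow> real) \<Rightarrow> real \<Rightarrow> real" where
  "mcshane a n K f x = Min ((\<lambda>i. f i + sqrt (K * \<bar>x - node a n i\<bar>)) ` {..n})"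

lemma mcshane_le: "i \<le> n \<Longrightarrow> mcshane a n K f x \<le> f i + sqrt (K * \<bar>x - node a n i\<bar>)"
  unfolding mcshane_def by (intro Min_le) auto

lemma mcshane_attained: obtains i where "i \<le> n" "mcshane a n K f x = f i + sqrt (K * \<bar>x - node a n i\<bar>)"
proof -
  have "mcshane a n K f x \<in> (\<lambda>i. f i + sqrt (K * \<bar>x - node a n i\<bar>)) ` {..n}"
    unfolding mcshane_def by (intro Min_in) auto
  then show ?thesis using that by auto
qed

lemma mcshane_node:
  assumes "\<And>j. j \<le> n \<Longrightarrow> (f i - f j)\<^sup>2 \<le> K * \<bar>node a n i - node a n j\<bar>" and i: "i \<le> n"
  shows "mcshane a n K f (node a n i) = f i"
proof -
  obtain j where j: "j \<le> n" "mcshane a n K f (node a n i) = f j + sqrt (K * \<bar>node a n i - node a n j\<bar>)"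
    by (rule mcshane_attained)
  have "\<bar>f i - f j\<bar> \<le> sqrt (K * \<bar>node a n i - node a n j\<bar>)"
    using assms(1)[OF j(1)] by (simp add: real_le_rsqrt)
  then show ?thesis using j(2) mcshane_le[OF i, of a K f "node a n i"] by simp
qed

text \<open>The square root is subadditive, and a minimum of functions sharing a modulus of
  continuity has that modulus.\<close>

lemma mcshane_holder:
  assumes K: "0 \<le> K"
  shows "\<bar>mcshane a n K f x - mcshane a n K f y\<bar> \<le> sqrt (K * \<bar>x - y\<bar>)"
proof -
  have main: "mcshane a n K f x \<le> mcshane a n K f y + sqrt (K * \<bar>x - y\<bar>)" for x y
  proof -
    obtain j where j: "j \<le> n" "mcshane a n K f y = f j + sqrt (K * \<bar>y - node a n j\<bar>)"
      by (rule mcshane_attained)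
    have "sqrt (K * \<bar>x - node a n j\<bar>) \<le> sqrt (K * \<bar>x - y\<bar> + K * \<bar>y - node a n j\<bar>)"
      using K by (intro real_sqrt_le_mono) (simp add: distrib_left[symmetric] mult_left_mono)
    also have "\<dots> \<le> sqrt (K * \<bar>x - y\<bar>) + sqrt (K * \<bar>y - node a n j\<bar>)"
      using K by (intro sqrt_add_le_add_sqrt) auto
    finally show ?thesis using j mcshane_le[OF j(1), of a K f x] by linarith
  qed
  show ?thesis using main[of x y] main[of y x] by (simp add: abs_le_iff abs_minus_commute)
qed

lemma mcshane_diff:
  assumes "\<And>i. i \<le> n \<Longrightarrow> \<bar>f i - g i\<bar> \<le> d"
  shows "\<bar>mcshane a n K f x - mcshane a n K g x\<bar> \<le> d"
proof -
  have main: "mcshane a n K f x \<le> mcshane a n K g x + d" if "\<And>i. i \<le> n \<Longrightarrow> \<bar>f i - g i\<bar> \<le> d" for f g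
  proof -
    obtain j where j: "j \<le> n" "mcshane a n K g x = g j + sqrt (K * \<bar>x - node a n j\<bar>)"
      by (rule mcshane_attained)
    then show ?thesis using mcshane_le[OF j(1), of a K f x] that[OF j(1)] by linarith
  qed
  have "\<And>i. i \<le> n \<Longrightarrow> \<bar>g i - f i\<bar> \<le> d" using assms by (simp add: abs_minus_commute)
  from main[of g f, OF this] main[of f g, OF assms] show ?thesis by (simp add: abs_le_iff)
qed

text \<open>The grid value of a cell is compared with g at every point of the cell, so the limit can
  be evaluated anywhere without interpolation. Subsequences act on \<sigma>, which selects the
  mesh.\<close>

definition cell_lim ::
  "real \<Rightarrow> real set \<Rightarrow> (nat \<Rightarrow> nat \<Rightarrow> real \<Rightarrow> real) \<Rightarrow> (nat \<Rightarrow> nat) \<Rightarrow> (real \<Rightarrow> real \<Rightarrow> real) \<Rightarrow> bool" where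
  "cell_lim a I f \<sigma> g \<longleftrightarrow> (\<forall>e>0. \<forall>\<^sub>F k in sequentially.
     \<forall>t\<in>I. \<forall>i\<le>\<sigma> k. \<forall>x\<in>cell a (\<sigma> k) i. \<bar>f (\<sigma> k) i t - g t x\<bar> < e)"

lemma cell_lim_subseq:
  assumes "cell_lim a I f \<sigma> g" "strict_mono r"
  shows "cell_lim a I f (\<sigma> \<circ> r) g"
  unfolding cell_lim_def
proof (intro allI impI)
  fix e :: real assume "0 < e"
  then have "\<forall>\<^sub>F k in sequentially. \<forall>t\<in>I. \<forall>i\<le>\<sigma> k. \<forall>x\<in>cell a (\<sigma> k) i. \<bar>f (\<sigma> k) i t - g t x\<bar> < e"
    using assms(1) unfolding cell_lim_def by blast
  from eventually_subseq[OF assms(2) this]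
  show "\<forall>\<^sub>F k in sequentially. \<forall>t\<in>I. \<forall>i\<le>(\<sigma> \<circ> r) k. \<forall>x\<in>cell a ((\<sigma> \<circ> r) k) i. \<bar>f ((\<sigma> \<circ> r) k) i t - g t x\<bar> < e"
    by simp
qed

lemma mesh_small:
  assumes "filterlim \<sigma> at_top sequentially" "0 < d"
  shows "\<forall>\<^sub>F k in sequentially. a / real (Suc (\<sigma> k)) < d"
proof -
  have "filterlim (\<lambda>k. real (Suc (\<sigma> k))) at_top sequentially"
    by (rule filterlim_compose[OF filterlim_real_sequentially])
      (rule filterlim_compose[OF filterlim_Suc assms(1)])
  then have "(\<lambda>k. a / real (Suc (\<sigma> k))) \<longlonglongrightarrow> 0"
    by (rule real_tendsto_divide_at_top[OF tendsto_const])
  then show ?thesis using order_tendstoD(2)[of _ 0] assms(2) by blast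
qed

text \<open>The McShane extensions are equicontinuous in space by their modulus and in time by
  \<open>eq\<close>. Passing from the node to the rest of its cell costs the modulus of the limit
  over one mesh width.\<close>

lemma grid_compactness:
  fixes f :: "nat \<Rightarrow> nat \<Rightarrow> real \<Rightarrow> real" and s :: "nat \<Rightarrow> nat"
  assumes a: "0 < a" and K: "0 \<le> K" and s: "strict_mono s"
    and bd: "\<And>n i t. i \<le> n \<Longrightarrow> t \<in> {\<alpha>..\<beta>} \<Longrightarrow> \<bar>f n i t\<bar> \<le> Q"
    and hol: "\<And>n i j t. i \<le> n \<Longrightarrow> j \<le> n \<Longrightarrow> t \<in> {\<alpha>..\<beta>} \<Longrightarrow> (f n i t - f n j t)\<^sup>2 \<le> K * \<bar>node a n i - node a n j\<bar>"
    and eq: "\<And>e. 0 < e \<Longrightarrow> \<exists>d>0. \<forall>n i r t. i \<le> n \<longrightarrow> r \<in> {\<alpha>..\<beta>} \<longrightarrow> t \<in> {\<alpha>..\<beta>} \<longrightarrow> \<bar>r - t\<bar> < d \<longrightarrow> \<bar>f n i r - f n i t\<bar> < e"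
  obtains r g where "strict_mono r" "continuous_on ({\<alpha>..\<beta>} \<times> {0..a}) (\<lambda>(t, x). g t x)"
    "cell_lim a {\<alpha>..\<beta>} f (s \<circ> r) g"
proof -
  define S where "S = {\<alpha>..\<beta>} \<times> {0..a}"
  define F where "F = (\<lambda>k z. mcshane a (s k) K (\<lambda>i. f (s k) i (fst z)) (snd z))"
  have cS: "compact S" unfolding S_def by (intro compact_Times) auto
  have bound: "norm (F k z) \<le> Q + sqrt (K * a)" if z: "z \<in> S" for k z
  proof -
    obtain i where i: "i \<le> s k" "F k z = f (s k) i (fst z) + sqrt (K * \<bar>snd z - node a (s k) i\<bar>)"
      unfolding F_def by (rule mcshane_attained)
    have "node a (s k) i \<in> {0..a}" using node_in_cell[OF a] cell_subset[OF a i(1)] by blast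
    then have "\<bar>snd z - node a (s k) i\<bar> \<le> a" using z unfolding S_def by auto
    then have "sqrt (K * \<bar>snd z - node a (s k) i\<bar>) \<le> sqrt (K * a)" using K by (intro real_sqrt_le_mono mult_left_mono) auto
    moreover have "\<bar>f (s k) i (fst z)\<bar> \<le> Q" using bd[OF i(1)] z unfolding S_def by auto
    moreover have "0 \<le> sqrt (K * \<bar>snd z - node a (s k) i\<bar>)" using K by simp
    ultimately show ?thesis unfolding i(2) real_norm_def by linarith
  qed
  have equi: "\<exists>d>0. \<forall>k y. y \<in> S \<and> norm (z - y) < d \<longrightarrow> norm (F k z - F k y) < e" if z: "z \<in> S" and e: "0 < e" for z e
  proof -
    obtain d where d: "0 < d" "\<And>n i r t. i \<le> n \<Longrightarrow> r \<in> {\<alpha>..\<beta>} \<Longrightarrow> t \<in> {\<alpha>..\<beta>} \<Longrightarrow> \<bar>r - t\<bar> < d \<Longrightarrow> \<bar>f n i r - f n i t\<bar> < e / 3"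
      using eq[of "e/3"] e by auto
    \<comment> \<open>Inverts the Hoelder modulus at e / 3; K + 1 avoids dividing by K = 0.\<close>
    define d' where "d' = min d ((e / 3)\<^sup>2 / (K + 1))"
    have d': "0 < d'" unfolding d'_def using d(1) e K by simp
    show ?thesis
    proof (intro exI conjI allI impI)
      show "0 < d'" by fact
      fix k y assume y: "y \<in> S \<and> norm (z - y) < d'"
      have t: "\<bar>fst z - fst y\<bar> < d'" "\<bar>snd z - snd y\<bar> < d'"
        using y norm_fst_le[of "fst (z - y)" "snd (z - y)"] norm_snd_le[of "snd (z - y)" "fst (z - y)"] by (auto simp: minus_prod_def)
      have "\<bar>mcshane a (s k) K (\<lambda>i. f (s k) i (fst z)) (snd z) - mcshane a (s k) K (\<lambda>i. f (s k) i (fst y)) (snd z)\<bar> \<le> e / 3"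
        by (rule mcshane_diff) (use d(2)[of _ "s k" "fst z" "fst y"] z y t in \<open>fastforce simp: S_def d'_def\<close>)
      moreover have "\<bar>mcshane a (s k) K (\<lambda>i. f (s k) i (fst y)) (snd z) - mcshane a (s k) K (\<lambda>i. f (s k) i (fst y)) (snd y)\<bar> \<le> e / 3"
      proof -
        have "K * \<bar>snd z - snd y\<bar> \<le> (K + 1) * ((e / 3)\<^sup>2 / (K + 1))"
          using t K unfolding d'_def by (intro mult_mono) auto
        also have "\<dots> = (e / 3)\<^sup>2" using K by simp
        finally have "sqrt (K * \<bar>snd z - snd y\<bar>) \<le> sqrt ((e / 3)\<^sup>2)" by (rule real_sqrt_le_mono)
        also have "\<dots> = e / 3" using e by (subst real_sqrt_abs) simp
        finally have "sqrt (K * \<bar>snd z - snd y\<bar>) \<le> e / 3" .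
        then show ?thesis using mcshane_holder[OF K, of a "s k" "\<lambda>i. f (s k) i (fst y)" "snd z" "snd y"] by linarith
      qed
      ultimately show "norm (F k z - F k y) < e" unfolding F_def real_norm_def using e by linarith
    qed
  qed
  obtain G r where G: "continuous_on S G" and r: "strict_mono (r :: nat \<Rightarrow> nat)"
    and lim: "\<And>e. 0 < e \<Longrightarrow> \<exists>N. \<forall>k z. k \<ge> N \<and> z \<in> S \<longrightarrow> norm (F (r k) z - G z) < e"
    by (rule Arzela_Ascoli[OF cS, of F "Q + sqrt (K * a)"]) (use bound equi in auto)
  define g where "g = (\<lambda>t x. G (t, x))"
  have gc: "continuous_on ({\<alpha>..\<beta>} \<times> {0..a}) (\<lambda>(t, x). g t x)"
    using G unfolding S_def g_def by (simp add: case_prod_eta)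
  have sr: "filterlim (s \<circ> r) at_top sequentially"
    by (rule filterlim_subseq) (rule strict_mono_o[OF s r])
  have "cell_lim a {\<alpha>..\<beta>} f (s \<circ> r) g"
    unfolding cell_lim_def
  proof (intro allI impI)
    fix e :: real assume e: "0 < e"
    have "uniformly_continuous_on S G" by (rule compact_uniformly_continuous[OF G cS])
    then obtain d where d: "0 < d" "\<And>z y. z \<in> S \<Longrightarrow> y \<in> S \<Longrightarrow> dist y z < d \<Longrightarrow> dist (G y) (G z) < e / 2"
      unfolding uniformly_continuous_on_def using e by (metis half_gt_zero)
    obtain N where N: "\<And>k z. N \<le> k \<Longrightarrow> z \<in> S \<Longrightarrow> norm (F (r k) z - G z) < e / 2"
      using lim[of "e/2"] e by auto
    show "\<forall>\<^sub>F k in sequentially. \<forall>t\<in>{\<alpha>..\<beta>}. \<forall>i\<le>(s \<circ> r) k. \<forall>x\<in>cell a ((s \<circ> r) k) i. \<bar>f ((s \<circ> r) k) i t - g t x\<bar> < e"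
      using mesh_small[OF sr d(1), of a] eventually_ge_at_top[of N]
    proof eventually_elim
      case (elim k)
      show ?case
      proof (intro ballI allI impI)
        fix t i x assume t: "t \<in> {\<alpha>..\<beta>}" and i: "i \<le> (s \<circ> r) k" and x: "x \<in> cell a ((s \<circ> r) k) i"
        define n where "n = (s \<circ> r) k"
        have nd: "node a n i \<in> cell a n i" by (rule node_in_cell[OF a])
        have S: "(t, node a n i) \<in> S" "(t, x) \<in> S"
          using nd x t cell_subset[OF a, of i n] i unfolding S_def n_def by auto
        have "F (r k) (t, node a n i) = f n i t"
          unfolding F_def n_def using hol[of i "s (r k)" _ t] i t by (simp add: mcshane_node)
        then have 1: "\<bar>f n i t - g t (node a n i)\<bar> < e / 2" using N[OF elim(2) S(1)] unfolding g_def by simp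
        have "\<bar>node a n i - x\<bar> < d" using cell_diam[OF nd, of x] x elim(1) unfolding n_def by simp
        then have "dist (t, node a n i) (t, x) < d" by (simp add: dist_Pair_Pair dist_real_def)
        then have "\<bar>g t (node a n i) - g t x\<bar> < e / 2" using d(2)[OF S(2,1)] unfolding g_def dist_real_def by simp
        with 1 show "\<bar>f ((s \<circ> r) k) i t - g t x\<bar> < e" unfolding n_def by linarith
      qed
    qed
  qed
  then show ?thesis using that r gc by blast
qed

lemma cell_lim_pointwise:
  assumes a: "0 < a" and lim: "cell_lim a I f \<sigma> g" and t: "t \<in> I" and x: "x \<in> {0..a}"
    and idx: "\<And>n. idx n \<le> n" "\<And>n. x \<in> cell a n (idx n)"
  shows "(\<lambda>k. f (\<sigma> k) (idx (\<sigma> k)) t) \<longlonglongrightarrow> g t x"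
proof (rule tendstoI)
  fix e :: real assume "0 < e"
  then have "\<forall>\<^sub>F k in sequentially. \<forall>t\<in>I. \<forall>i\<le>\<sigma> k. \<forall>x\<in>cell a (\<sigma> k) i. \<bar>f (\<sigma> k) i t - g t x\<bar> < e"
    using lim unfolding cell_lim_def by blast
  then show "\<forall>\<^sub>F k in sequentially. dist (f (\<sigma> k) (idx (\<sigma> k)) t) (g t x) < e"
    by eventually_elim (use t idx in \<open>auto simp: dist_real_def\<close>)
qed

text \<open>The estimates degenerate as e tends to 0, so compactness is available only on the
  intervals \<open>[B / (m + 1), B]\<close>; a diagonal sequence serves all of them at once.\<close>

lemma grid_diagonal:
  fixes f :: "nat \<Rightarrow> nat \<Rightarrow> real \<Rightarrow> real" and s :: "nat \<Rightarrow> nat"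
  assumes a: "0 < a" and B: "0 < B" and s: "strict_mono s"
    and est: "\<And>e. 0 < e \<Longrightarrow> e \<le> B \<Longrightarrow> \<exists>K Q. 0 \<le> K \<and>
      (\<forall>n i t. i \<le> n \<longrightarrow> t \<in> {e..B} \<longrightarrow> \<bar>f n i t\<bar> \<le> Q) \<and>
      (\<forall>n i j t. i \<le> n \<longrightarrow> j \<le> n \<longrightarrow> t \<in> {e..B} \<longrightarrow> (f n i t - f n j t)\<^sup>2 \<le> K * \<bar>node a n i - node a n j\<bar>)"
    and eq: "\<And>e \<epsilon>. 0 < e \<Longrightarrow> e \<le> B \<Longrightarrow> 0 < \<epsilon> \<Longrightarrow>
      \<exists>d>0. \<forall>n i r t. i \<le> n \<longrightarrow> r \<in> {e..B} \<longrightarrow> t \<in> {e..B} \<longrightarrow> \<bar>r - t\<bar> < d \<longrightarrow> \<bar>f n i r - f n i t\<bar> < \<epsilon>"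
  obtains r g where "strict_mono r"
    "\<And>e. 0 < e \<Longrightarrow> e \<le> B \<Longrightarrow> continuous_on ({e..B} \<times> {0..a}) (\<lambda>(t, x). g t x)"
    "\<And>e. 0 < e \<Longrightarrow> e \<le> B \<Longrightarrow> cell_lim a {e..B} f (s \<circ> r) g"
proof -
  define w where "w = (\<lambda>m::nat. B / real (Suc m))"
  have w: "0 < w m" "w m \<le> B" for m
  proof -
    show "0 < w m" unfolding w_def using B by simp
    have "B / real (Suc m) \<le> B / 1" using B by (intro divide_left_mono) auto
    then show "w m \<le> B" unfolding w_def by simp
  qed
  define P where "P = (\<lambda>m (\<sigma> :: nat \<Rightarrow> nat). \<exists>g. continuous_on ({w m..B} \<times> {0..a}) (\<lambda>(t, x). g t x) \<and> cell_lim a {w m..B} f (s \<circ> \<sigma>) g)"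
  interpret subseqs P
  proof
    fix m and r :: "nat \<Rightarrow> nat" assume r: "strict_mono r"
    obtain K Q where K: "0 \<le> K" and bd: "\<And>n i t. i \<le> n \<Longrightarrow> t \<in> {w m..B} \<Longrightarrow> \<bar>f n i t\<bar> \<le> Q"
      and hol: "\<And>n i j t. i \<le> n \<Longrightarrow> j \<le> n \<Longrightarrow> t \<in> {w m..B} \<Longrightarrow> (f n i t - f n j t)\<^sup>2 \<le> K * \<bar>node a n i - node a n j\<bar>"
      using est[OF w] by metis
    obtain r' g where "strict_mono r'" "continuous_on ({w m..B} \<times> {0..a}) (\<lambda>(t, x). g t x)"
      "cell_lim a {w m..B} f ((s \<circ> r) \<circ> r') g"
      by (rule grid_compactness[OF a K strict_mono_o[OF s r] bd hol eq[OF w]])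
    then show "\<exists>r'. strict_mono r' \<and> P m (r \<circ> r')" unfolding P_def by (auto simp: comp_assoc)
  qed
  define d where "d = diagseq"
  have d: "strict_mono d" unfolding d_def by (rule subseq_diagseq)
  have Pd: "P m (d \<circ> (+) (Suc m))" for m
    unfolding d_def
  proof (rule diagseq_holds)
    fix r s' :: "nat \<Rightarrow> nat" and n assume "strict_mono r" "P n s'"
    then show "P n (s' \<circ> r)" unfolding P_def using cell_lim_subseq by (metis comp_assoc)
  qed
  have "\<exists>g. continuous_on ({w m..B} \<times> {0..a}) (\<lambda>(t, x). g t x) \<and> cell_lim a {w m..B} f (s \<circ> d) g" for m
  proof -
    obtain g where g: "continuous_on ({w m..B} \<times> {0..a}) (\<lambda>(t, x). g t x)"
      "cell_lim a {w m..B} f (s \<circ> (d \<circ> (+) (Suc m))) g"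
      using Pd[of m] unfolding P_def by auto
    \<comment> \<open>The diagonal sequence is controlled only from index m + 1 on, a shift that an
      eventual property does not notice.\<close>
    have "cell_lim a {w m..B} f (s \<circ> d) g"
      unfolding cell_lim_def
    proof (intro allI impI)
      fix e :: real assume "0 < e"
      then have "\<forall>\<^sub>F k in sequentially. \<forall>t\<in>{w m..B}. \<forall>i\<le>(s \<circ> d) (k + Suc m). \<forall>x\<in>cell a ((s \<circ> d) (k + Suc m)) i.
         \<bar>f ((s \<circ> d) (k + Suc m)) i t - g t x\<bar> < e"
        using g(2) unfolding cell_lim_def by (simp add: add.commute)
      then show "\<forall>\<^sub>F k in sequentially. \<forall>t\<in>{w m..B}. \<forall>i\<le>(s \<circ> d) k. \<forall>x\<in>cell a ((s \<circ> d) k) i. \<bar>f ((s \<circ> d) k) i t - g t x\<bar> < e"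
        by (rule eventually_sequentially_seg[THEN iffD1])
    qed
    with g show ?thesis by blast
  qed
  then obtain gg where gg: "\<And>m. continuous_on ({w m..B} \<times> {0..a}) (\<lambda>(t, x). gg m t x)"
    "\<And>m. cell_lim a {w m..B} f (s \<circ> d) (gg m)"
    by metis
  have "\<forall>x n. \<exists>i. x \<in> {0..a} \<longrightarrow> i \<le> n \<and> x \<in> cell a n i" using cell_exists[OF a] by metis
  then obtain idx where idx: "\<And>x n. x \<in> {0..a} \<Longrightarrow> idx x n \<le> n" "\<And>x n. x \<in> {0..a} \<Longrightarrow> x \<in> cell a n (idx x n)"
    by metis
  \<comment> \<open>Defined as a pointwise limit, so that the limits found on the different time
    intervals are restrictions of one function.\<close>
  define g where "g = (\<lambda>t x. lim (\<lambda>k. f ((s \<circ> d) k) (idx x ((s \<circ> d) k)) t))"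
  have g_eq: "g t x = gg m t x" if "t \<in> {w m..B}" "x \<in> {0..a}" for m t x
    unfolding g_def by (rule limI) (rule cell_lim_pointwise[OF a gg(2) that idx[OF that(2)]])
  have wm: "\<exists>m. w m \<le> e" if "0 < e" for e
  proof -
    obtain m :: nat where "B / e < real m" using reals_Archimedean2 by blast
    then have "B / real (Suc m) \<le> e" using that by (simp add: field_simps)
    then show ?thesis unfolding w_def by blast
  qed
  show ?thesis
  proof
    show "strict_mono d" by fact
    fix e assume e: "0 < e" "e \<le> B"
    obtain m where m: "w m \<le> e" using wm[OF e(1)] by blast
    have "continuous_on ({e..B} \<times> {0..a}) (\<lambda>(t, x). gg m t x)"
      by (rule continuous_on_subset[OF gg(1)[of m]]) (use m in auto)
    then show "continuous_on ({e..B} \<times> {0..a}) (\<lambda>(t, x). g t x)"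
      by (rule continuous_on_eq) (use g_eq[of _ m] m in auto)
    show "cell_lim a {e..B} f (s \<circ> d) g"
      unfolding cell_lim_def
    proof (intro allI impI)
      fix \<epsilon> :: real assume "0 < \<epsilon>"
      then have "\<forall>\<^sub>F k in sequentially. \<forall>t\<in>{w m..B}. \<forall>i\<le>(s \<circ> d) k. \<forall>x\<in>cell a ((s \<circ> d) k) i. \<bar>f ((s \<circ> d) k) i t - gg m t x\<bar> < \<epsilon>"
        using gg(2)[of m] unfolding cell_lim_def by blast
      then show "\<forall>\<^sub>F k in sequentially. \<forall>t\<in>{e..B}. \<forall>i\<le>(s \<circ> d) k. \<forall>x\<in>cell a ((s \<circ> d) k) i. \<bar>f ((s \<circ> d) k) i t - g t x\<bar> < \<epsilon>"
      proof eventually_elim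
        case (elim k)
        show ?case
        proof (intro ballI allI impI)
          fix t i x assume tix: "t \<in> {e..B}" "i \<le> (s \<circ> d) k" "x \<in> cell a ((s \<circ> d) k) i"
          then have "t \<in> {w m..B}" "x \<in> {0..a}" using m cell_subset[OF a tix(2)] by auto
          then show "\<bar>f ((s \<circ> d) k) i t - g t x\<bar> < \<epsilon>" using elim tix g_eq by metis
        qed
      qed
    qed
  qed
qed

section \<open>Riemann sums and the limit of the discrete Laplacian\<close>

definition grid_tendsto :: "real \<Rightarrow> (nat \<Rightarrow> nat) \<Rightarrow> (nat \<Rightarrow> nat \<Rightarrow> real) \<Rightarrow> (real \<Rightarrow> real) \<Rightarrow> bool" where
  "grid_tendsto a \<sigma> G g \<longleftrightarrow> (\<forall>e>0. \<forall>\<^sub>F k in sequentially. \<forall>i\<le>\<sigma> k. \<forall>x\<in>cell a (\<sigma> k) i. \<bar>G k i - g x\<bar> < e)"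

lemma cell_lim_grid_tendsto: "cell_lim a I f \<sigma> g \<Longrightarrow> t \<in> I \<Longrightarrow> grid_tendsto a \<sigma> (\<lambda>k i. f (\<sigma> k) i t) (g t)"
  unfolding cell_lim_def grid_tendsto_def by (force elim!: eventually_mono)

text \<open>All partial sums are covered because \<open>lap_limit\<close> needs the primitive at
  every cell edge and not only the full integral.\<close>

lemma riemann_cells:
  assumes a: "0 < a" and g: "continuous_on {0..a} g" and j: "j \<le> Suc n"
    and ap: "\<And>i x. i \<le> n \<Longrightarrow> x \<in> cell a n i \<Longrightarrow> \<bar>G i - g x\<bar> \<le> e"
  shows "\<bar>a / real (Suc n) * (\<Sum>i<j. G i) - integral {0..real j * (a / real (Suc n))} g\<bar> \<le> e * (real j * (a / real (Suc n)))"
  using j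
proof (induction j)
  case (Suc j)
  define h where "h = a / real (Suc n)"
  have h: "0 < h" unfolding h_def using a by simp
  define X where "X = real j * h"
  have X: "0 \<le> X" "real (Suc j) * h = X + h" unfolding X_def using h by (auto simp: algebra_simps)
  have jn: "j \<le> n" using Suc.prems by simp
  have cellj: "cell a n j = {X..X + h}" unfolding cell_def X_def h_def[symmetric] by (simp add: algebra_simps)
  have sub: "{X..X + h} \<subseteq> {0..a}" using cell_subset[OF a jn] cellj by simp
  have gi: "g integrable_on {0..X + h}"
    by (rule integrable_continuous_real, rule continuous_on_subset[OF g]) (use sub h X in auto)
  have gj: "g integrable_on {X..X + h}"
    by (rule integrable_continuous_real, rule continuous_on_subset[OF g]) (use sub in auto)
  have split: "integral {0..X} g + integral {X..X + h} g = integral {0..X + h} g"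
    by (rule Henstock_Kurzweil_Integration.integral_combine) (use X h gi in auto)
  have "integral {X..X + h} (\<lambda>x. G j) - integral {X..X + h} g = integral {X..X + h} (\<lambda>x. G j - g x)"
    by (rule Henstock_Kurzweil_Integration.integral_diff[symmetric]) (use gj in auto)
  also have "norm \<dots> \<le> e * (X + h - X)"
    by (rule integral_bound) (use h ap[OF jn] cellj in \<open>auto intro!: continuous_intros continuous_on_subset[OF g sub]\<close>)
  finally have 1: "\<bar>h * G j - integral {X..X + h} g\<bar> \<le> e * h" using h by (simp add: mult.commute)
  have IH: "\<bar>h * (\<Sum>i<j. G i) - integral {0..X} g\<bar> \<le> e * X" using Suc unfolding h_def X_def by simp
  have "h * (\<Sum>i<Suc j. G i) - integral {0..X + h} g = (h * (\<Sum>i<j. G i) - integral {0..X} g) + (h * G j - integral {X..X + h} g)"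
    using split by (simp add: algebra_simps)
  also have "\<bar>\<dots>\<bar> \<le> e * X + e * h" using IH 1 by linarith
  finally show ?case unfolding h_def[symmetric] X(2) by (simp add: algebra_simps)
qed simp

lemma grid_tendsto_eventually_le:
  assumes "grid_tendsto a \<sigma> G g" "0 < e"
  shows "\<forall>\<^sub>F k in sequentially. \<forall>i\<le>\<sigma> k. \<forall>x\<in>cell a (\<sigma> k) i. \<bar>G k i - g x\<bar> \<le> e"
  using assms unfolding grid_tendsto_def by (force elim!: eventually_mono intro: less_imp_le)

lemma riemann_sum_grid_tendsto:
  assumes a: "0 < a" and g: "continuous_on {0..a} g" and G: "grid_tendsto a \<sigma> G g" and e: "0 < e"
  shows "\<forall>\<^sub>F k in sequentially. \<forall>j\<le>Suc (\<sigma> k).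
    \<bar>a / real (Suc (\<sigma> k)) * (\<Sum>i<j. G k i) - integral {0..real j * (a / real (Suc (\<sigma> k)))} g\<bar> \<le> e"
proof -
  have "0 < e / a" using a e by simp
  from grid_tendsto_eventually_le[OF G this] show ?thesis
proof eventually_elim
  case (elim k)
  show ?case
  proof (intro allI impI)
    fix j assume j: "j \<le> Suc (\<sigma> k)"
    have "\<bar>a / real (Suc (\<sigma> k)) * (\<Sum>i<j. G k i) - integral {0..real j * (a / real (Suc (\<sigma> k)))} g\<bar>
       \<le> e / a * (real j * (a / real (Suc (\<sigma> k))))"
      by (rule riemann_cells[OF a g j]) (use elim in auto)
    also have "\<dots> \<le> e / a * (real (Suc (\<sigma> k)) * (a / real (Suc (\<sigma> k))))"
      using j a e by (intro mult_left_mono mult_right_mono) auto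
    also have "\<dots> = e" using a by simp
    finally show "\<bar>a / real (Suc (\<sigma> k)) * (\<Sum>i<j. G k i) - integral {0..real j * (a / real (Suc (\<sigma> k)))} g\<bar> \<le> e" .
  qed
qed
qed

lemma avg_tendsto_mean:
  assumes a: "0 < a" and g: "continuous_on {0..a} g" and G: "grid_tendsto a \<sigma> G g"
  shows "(\<lambda>k. avg (\<sigma> k) (G k)) \<longlonglongrightarrow> mean a g"
proof (rule tendstoI)
  fix e :: real assume e: "0 < e"
  have "0 < a * (e / 2)" using a e by simp
  from riemann_sum_grid_tendsto[OF a g G this] show "\<forall>\<^sub>F k in sequentially. dist (avg (\<sigma> k) (G k)) (mean a g) < e"
  proof eventually_elim
    case (elim k)
    then have "\<bar>a / real (Suc (\<sigma> k)) * (\<Sum>i<Suc (\<sigma> k). G k i) - integral {0..real (Suc (\<sigma> k)) * (a / real (Suc (\<sigma> k)))} g\<bar> \<le> a * (e / 2)"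
      by blast
    then have "\<bar>a * avg (\<sigma> k) (G k) - integral {0..a} g\<bar> \<le> a * (e / 2)"
      unfolding avg_def by (simp del: of_nat_Suc sum.lessThan_Suc add: lessThan_Suc_atMost)
    moreover have "a * avg (\<sigma> k) (G k) - integral {0..a} g = a * (avg (\<sigma> k) (G k) - mean a g)"
      unfolding mean_def using a by (simp add: algebra_simps)
    ultimately have "\<bar>avg (\<sigma> k) (G k) - mean a g\<bar> \<le> e / 2" using a by (simp add: abs_mult)
    then show ?case using e by (simp add: dist_real_def)
  qed
qed

text \<open>The fluxes telescope; at j = n only the vanishing outer flux is left.\<close>

lemma lap_partial_sum:
  assumes h: "0 < h" and j: "j \<le> n"
  shows "h * (\<Sum>i<Suc j. lap h n f i) = (if j < n then (f (Suc j) - f j) / h else 0)"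
  using j
proof (induction j)
  case 0
  then show ?case unfolding lap_def using h by (simp add: power2_eq_square)
next
  case (Suc j)
  then have "h * (\<Sum>i<Suc (Suc j). lap h n f i) = (f (Suc j) - f j) / h + h * lap h n f (Suc j)"
    by (simp add: distrib_left)
  then show ?case unfolding lap_def using h Suc.prems by (auto simp: power2_eq_square field_simps)
qed

text \<open>Summing the discrete Laplacian once gives the discrete derivative, whose value beyond the
  last edge is 0: this is where the Neumann condition at a comes from.\<close>
lemma lap_limit:
  assumes a: "0 < a" and \<sigma>: "filterlim \<sigma> at_top sequentially"
    and g: "continuous_on {0..a} g" and \<phi>: "continuous_on {0..a} \<phi>"
    and L: "grid_tendsto a \<sigma> (\<lambda>k. lap (a / real (Suc (\<sigma> k))) (\<sigma> k) (f k)) g"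
    and f: "grid_tendsto a \<sigma> f \<phi>"
  shows "integral {0..a} g = 0"
    "\<And>x. x \<in> {0..a} \<Longrightarrow> \<phi> x = \<phi> 0 + integral {0..x} (\<lambda>y. integral {0..y} g)"
proof -
  define H where "H = (\<lambda>y. integral {0..y} g)"
  define hh where "hh = (\<lambda>k. a / real (Suc (\<sigma> k)))"
  have hh: "0 < hh k" for k unfolding hh_def using a by simp
  have hhk: "a / real (Suc (\<sigma> k)) = hh k" for k unfolding hh_def ..
  \<comment> \<open>Difference quotient at the right edge of cell j, continued by the zero flux
    beyond the last edge.\<close>
  define Dk where "Dk = (\<lambda>k j. if j < \<sigma> k then (f k (Suc j) - f k j) / hh k else 0)"
  have Hc: "continuous_on {0..a} H"
    unfolding H_def by (intro indefinite_integral_continuous_1 integrable_continuous_real g)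
  have D: "\<forall>\<^sub>F k in sequentially. \<forall>j\<le>\<sigma> k. \<bar>Dk k j - H (real (Suc j) * hh k)\<bar> \<le> e" if e: "0 < e" for e
    using riemann_sum_grid_tendsto[OF a g L e]
  proof eventually_elim
    case (elim k)
    show ?case
    proof (intro allI impI)
      fix j assume j: "j \<le> \<sigma> k"
      then have "\<bar>hh k * (\<Sum>i<Suc j. lap (hh k) (\<sigma> k) (f k) i) - integral {0..real (Suc j) * hh k} g\<bar> \<le> e"
        using elim unfolding hh_def by (auto simp del: sum.lessThan_Suc of_nat_Suc)
      then show "\<bar>Dk k j - H (real (Suc j) * hh k)\<bar> \<le> e"
        unfolding lap_partial_sum[OF hh j] Dk_def H_def .
    qed
  qed
  have Ha: "\<bar>H a\<bar> \<le> e" if e: "0 < e" for e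
  proof -
    have "\<forall>\<^sub>F k in sequentially. \<bar>H a\<bar> \<le> e" using D[OF e]
    proof eventually_elim
      case (elim k)
      then have "\<bar>Dk k (\<sigma> k) - H (real (Suc (\<sigma> k)) * hh k)\<bar> \<le> e" by blast
      then show ?case unfolding Dk_def hh_def by simp
    qed
    then show ?thesis by simp
  qed
  have "\<bar>H a\<bar> \<le> 0" by (rule field_le_epsilon) (use Ha in auto)
  then show "integral {0..a} g = 0" unfolding H_def by simp
  have uc: "uniformly_continuous_on {0..a} H" by (rule compact_uniformly_continuous[OF Hc]) simp
  \<comment> \<open>The quotients approximate H at right edges; uniform continuity of H transfers
    this to all points of the cell.\<close>
  have DH: "grid_tendsto a \<sigma> Dk H"
    unfolding grid_tendsto_def
  proof (intro allI impI)
    fix e :: real assume e: "0 < e"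
    obtain d where d: "0 < d" "\<And>x y. x \<in> {0..a} \<Longrightarrow> y \<in> {0..a} \<Longrightarrow> dist y x < d \<Longrightarrow> dist (H y) (H x) < e / 2"
      using uc e unfolding uniformly_continuous_on_def by (metis half_gt_zero)
    have e2: "0 < e / 2" using e by simp
    show "\<forall>\<^sub>F k in sequentially. \<forall>i\<le>\<sigma> k. \<forall>x\<in>cell a (\<sigma> k) i. \<bar>Dk k i - H x\<bar> < e"
      using D[OF e2] mesh_small[OF \<sigma> d(1), of a]
    proof eventually_elim
      case (elim k)
      show ?case
      proof (intro allI impI ballI)
        fix i x assume i: "i \<le> \<sigma> k" and x: "x \<in> cell a (\<sigma> k) i"
        have r: "real (Suc i) * hh k \<in> cell a (\<sigma> k) i"
          unfolding cell_def hhk atLeastAtMost_iff using hh[of k] by (auto intro: mult_right_mono simp del: of_nat_Suc)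
        have "\<bar>real (Suc i) * hh k - x\<bar> < d" using cell_diam[OF r x] elim(2) by linarith
        then have "\<bar>H (real (Suc i) * hh k) - H x\<bar> < e / 2"
          using d(2)[OF subsetD[OF cell_subset[OF a i] x] subsetD[OF cell_subset[OF a i] r]] unfolding dist_real_def by blast
        moreover have "\<bar>Dk k i - H (real (Suc i) * hh k)\<bar> \<le> e / 2" using elim(1) i by blast
        ultimately show "\<bar>Dk k i - H x\<bar> < e" by linarith
      qed
    qed
  qed
  fix x assume x: "x \<in> {0..a}"
  define I where "I = (\<lambda>y. integral {0..y} H)"
  have Ic: "continuous_on {0..a} I"
    unfolding I_def by (intro indefinite_integral_continuous_1 integrable_continuous_real Hc)
  have ucI: "uniformly_continuous_on {0..a} I" by (rule compact_uniformly_continuous[OF Ic]) simp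
  have small: "\<bar>\<phi> x - (\<phi> 0 + I x)\<bar> \<le> e" if e: "0 < e" for e
  proof -
    have e4: "0 < e / 4" using e by simp
    obtain d where d: "0 < d" "\<And>x y. x \<in> {0..a} \<Longrightarrow> y \<in> {0..a} \<Longrightarrow> dist y x < d \<Longrightarrow> dist (I y) (I x) < e / 4"
      using ucI e4 unfolding uniformly_continuous_on_def by metis
    have fe: "\<forall>\<^sub>F k in sequentially. \<forall>i\<le>\<sigma> k. \<forall>x\<in>cell a (\<sigma> k) i. \<bar>f k i - \<phi> x\<bar> < e / 4"
      using f e4 unfolding grid_tendsto_def by blast
    have "\<forall>\<^sub>F k in sequentially. \<bar>\<phi> x - (\<phi> 0 + I x)\<bar> \<le> e"
      using fe riemann_sum_grid_tendsto[OF a Hc DH e4] mesh_small[OF \<sigma> d(1), of a]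
    proof eventually_elim
      case (elim k)
      obtain j where j: "j \<le> \<sigma> k" "x \<in> cell a (\<sigma> k) j" using cell_exists[OF a x] .
      have 0: "0 \<in> cell a (\<sigma> k) 0" unfolding cell_def using a by simp
      \<comment> \<open>A second summation recovers f from its difference quotients, so the Riemann
        sum argument applied to Dk gives the double integral.\<close>
      have tele: "hh k * (\<Sum>i<m. Dk k i) = f k m - f k 0" if "m \<le> \<sigma> k" for m
        using that
      proof (induction m)
        case (Suc m)
        then have "hh k * (\<Sum>i<Suc m. Dk k i) = f k m - f k 0 + hh k * Dk k m" by (simp add: distrib_left)
        then show ?case unfolding Dk_def using Suc.prems hh[of k] by simp
      qed simp
      have "\<bar>hh k * (\<Sum>i<j. Dk k i) - I (real j * hh k)\<bar> \<le> e / 4"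
      proof -
        have "j \<le> Suc (\<sigma> k)" using j(1) by simp
        with elim(2) show ?thesis unfolding hhk I_def by blast
      qed
      then have 1: "\<bar>f k j - f k 0 - I (real j * hh k)\<bar> \<le> e / 4" using tele[OF j(1)] by simp
      have r: "real j * hh k \<in> cell a (\<sigma> k) j"
        unfolding cell_def hhk atLeastAtMost_iff using hh[of k] by (auto intro: mult_right_mono simp del: of_nat_Suc)
      have "\<bar>real j * hh k - x\<bar> < d" using cell_diam[OF r j(2)] elim(3) by linarith
      then have 2: "\<bar>I (real j * hh k) - I x\<bar> < e / 4"
        using d(2)[OF subsetD[OF cell_subset[OF a j(1)] j(2)] subsetD[OF cell_subset[OF a j(1)] r]] unfolding dist_real_def by blast
      have 3: "\<bar>f k j - \<phi> x\<bar> < e / 4" "\<bar>f k 0 - \<phi> 0\<bar> < e / 4" using elim(1) j 0 by auto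
      show ?case using 1 2 3 by linarith
    qed
    then show ?thesis by simp
  qed
  have "\<bar>\<phi> x - (\<phi> 0 + I x)\<bar> \<le> 0"
    by (rule field_le_epsilon) (simp only: add_0_left small)
  then show "\<phi> x = \<phi> 0 + integral {0..x} (\<lambda>y. integral {0..y} g)" unfolding I_def H_def by simp
qed

section \<open>Smooth profiles compatible with the Neumann condition\<close>

lemma second_difference_bound:
  fixes \<phi> \<phi>' \<phi>'' :: "real \<Rightarrow> real"
  assumes d1: "\<And>x. (\<phi> has_real_derivative \<phi>' x) (at x)"
    and d2: "\<And>x. (\<phi>' has_real_derivative \<phi>'' x) (at x)"
    and b: "\<And>x. \<bar>\<phi>'' x\<bar> \<le> b" and h: "0 < h"
  shows "\<bar>\<phi> (x + h) - 2 * \<phi> x + \<phi> (x - h)\<bar> \<le> 2 * b * h\<^sup>2"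
proof -
  have b0: "0 \<le> b" using b[of 0] by linarith
  have "\<exists>z. 0 < z \<and> z < h \<and> (\<phi> (x + h) + \<phi> (x - h)) - (\<phi> (x + 0) + \<phi> (x - 0)) = (h - 0) * (\<phi>' (x + z) - \<phi>' (x - z))"
    by (rule MVT2[OF h]) (auto intro!: derivative_eq_intros DERIV_chain2[OF d1])
  then obtain z where z: "0 < z" "z < h"
    "(\<phi> (x + h) + \<phi> (x - h)) - (\<phi> (x + 0) + \<phi> (x - 0)) = (h - 0) * (\<phi>' (x + z) - \<phi>' (x - z))"
    by auto
  obtain y where y: "\<phi>' (x + z) - \<phi>' (x - z) = (x + z - (x - z)) * \<phi>'' y"
    using MVT2[of "x - z" "x + z" \<phi>' \<phi>''] d2 z by auto
  have "\<phi> (x + h) - 2 * \<phi> x + \<phi> (x - h) = h * (2 * z * \<phi>'' y)" using z(3) y by simp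
  also have "\<bar>\<dots>\<bar> = h * (2 * z * \<bar>\<phi>'' y\<bar>)" using h z by (simp add: abs_mult)
  also have "\<dots> \<le> h * (2 * h * b)" using h z b b0 by (intro mult_left_mono mult_mono) auto
  finally show ?thesis by (simp add: power2_eq_square ac_simps)
qed

text \<open>The missing neighbour of an end node is the reflection of that node at 0 or at a. For
  symmetric \<phi> the suppressed outer flux is therefore the true difference, and
  \<open>lap\<close> is the full second difference at every node.\<close>

lemma lap_symmetric_bound:
  assumes a: "0 < a" and i: "i \<le> n"
    and even: "\<And>x. \<phi> (- x) = \<phi> x" "\<And>x. \<phi> (2 * a - x) = \<phi> x"
    and b: "\<And>x h. 0 < h \<Longrightarrow> \<bar>\<phi> (x + h) - 2 * \<phi> x + \<phi> (x - h)\<bar> \<le> b * h\<^sup>2"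
  shows "\<bar>lap (a / real (Suc n)) n (\<lambda>j. \<phi> (node a n j)) i\<bar> \<le> b"
proof -
  define h where "h = a / real (Suc n)"
  have h: "0 < h" "real (Suc n) * h = a" unfolding h_def using a by auto
  define x where "x = node a n i"
  have xi: "x = (real i + 1 / 2) * h" unfolding x_def node_def h_def ..
  have right: "(if i < n then \<phi> (node a n (Suc i)) - \<phi> x else 0) = \<phi> (x + h) - \<phi> x"
  proof (cases "i < n")
    case True
    have "node a n (Suc i) = x + h" unfolding xi node_def h_def[symmetric] by (simp add: algebra_simps)
    then show ?thesis using True by simp
  next
    case False
    then have "i = n" using i by simp
    then have "x + h = 2 * a - x" unfolding xi h(2)[symmetric] by (simp add: algebra_simps)
    then show ?thesis using even(2)[of x] False by (simp only: if_False diff_self)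
  qed
  have left: "(if 0 < i then \<phi> x - \<phi> (node a n (i - 1)) else 0) = \<phi> x - \<phi> (x - h)"
  proof (cases "0 < i")
    case True
    then have "node a n (i - 1) = x - h" unfolding xi node_def h_def[symmetric] by (simp add: algebra_simps of_nat_diff)
    then show ?thesis using True by simp
  next
    case False
    then have "x - h = - x" unfolding xi by (simp add: algebra_simps)
    then show ?thesis using even(1)[of x] False by (simp only: if_False diff_self)
  qed
  have "lap h n (\<lambda>j. \<phi> (node a n j)) i = (\<phi> (x + h) - 2 * \<phi> x + \<phi> (x - h)) / h\<^sup>2"
    unfolding lap_def x_def[symmetric] right left by simp
  also have "\<bar>\<dots>\<bar> = \<bar>\<phi> (x + h) - 2 * \<phi> x + \<phi> (x - h)\<bar> / h\<^sup>2" by (simp add: abs_divide)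
  also have "\<dots> \<le> (b * h\<^sup>2) / h\<^sup>2" by (rule divide_right_mono[OF b[OF h(1)]]) simp
  also have "\<dots> = b" using h by simp
  finally show ?thesis unfolding h_def .
qed

text \<open>Polynomials in \<open>cos (pi x / a)\<close> are dense and compatible with the Neumann condition.\<close>
lemma neumann_approximation:
  assumes a: "0 < a" and u0: "continuous_on {0..a} u0" and e: "0 < e"
  obtains \<phi> b where "continuous_on {0..a} \<phi>" "0 \<le> b" "\<And>x. x \<in> {0..a} \<Longrightarrow> \<bar>u0 x - \<phi> x\<bar> < e"
    "\<And>n i. i \<le> n \<Longrightarrow> \<bar>lap (a / real (Suc n)) n (\<lambda>j. \<phi> (node a n j)) i\<bar> \<le> b"
proof -
  \<comment> \<open>In the variable \<open>y = cos (pi * x / a)\<close> the function u0 is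
    continuous on \<open>[-1, 1]\<close>, where Stone--Weierstrass applies. Composing back with the
    cosine makes the approximant even about both ends.\<close>
  define f where "f = (\<lambda>y. u0 (a / pi * arccos y))"
  have "continuous_on {-1..1} f"
    unfolding f_def
  proof (rule continuous_on_compose2[OF u0])
    show "continuous_on {-1..1} (\<lambda>y. a / pi * arccos y)" by (intro continuous_intros continuous_on_arccos')
    show "(\<lambda>y. a / pi * arccos y) ` {- 1..1} \<subseteq> {0..a}"
    proof
      fix x assume "x \<in> (\<lambda>y. a / pi * arccos y) ` {- 1..1}"
      then obtain y where y: "y \<in> {-1..1}" "x = a / pi * arccos y" by auto
      have "0 \<le> arccos y" "arccos y \<le> pi" using y arccos_lbound arccos_ubound by auto
      then have "0 \<le> a / pi * arccos y" "a / pi * arccos y \<le> a / pi * pi"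
        using a by (intro mult_nonneg_nonneg mult_left_mono; simp)+
      moreover have "a / pi * pi = a" by simp
      ultimately show "x \<in> {0..a}" unfolding y(2) by simp
    qed
  qed
  then obtain P where P: "real_polynomial_function P" "\<And>y. y \<in> {-1..1} \<Longrightarrow> \<bar>f y - P y\<bar> < e"
    using Stone_Weierstrass_real_polynomial_function[of "{-1..1}" f e] e by auto
  obtain P' where P': "real_polynomial_function P'" "\<And>x. (P has_real_derivative P' x) (at x)"
    using has_real_derivative_polynomial_function[OF P(1)] by blast
  obtain P'' where P'': "real_polynomial_function P''" "\<And>x. (P' has_real_derivative P'' x) (at x)"
    using has_real_derivative_polynomial_function[OF P'(1)] by blast
  have bdd: "\<exists>C. \<forall>y\<in>{-1..1}. \<bar>Q y\<bar> \<le> C" if "real_polynomial_function Q" for Q :: "real \<Rightarrow> real"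
  proof -
    have "continuous_on {-1..1} Q"
      using that by (meson continuous_on_polymonial_function real_polynomial_function_eq)
    then have "compact (Q ` {-1..1})" by (intro compact_continuous_image) auto
    then show ?thesis by (auto dest!: compact_imp_bounded simp: bounded_iff)
  qed
  obtain C1 where C1: "\<And>y. y \<in> {-1..1} \<Longrightarrow> \<bar>P' y\<bar> \<le> C1" using bdd[OF P'(1)] by blast
  obtain C2 where C2: "\<And>y. y \<in> {-1..1} \<Longrightarrow> \<bar>P'' y\<bar> \<le> C2" using bdd[OF P''(1)] by blast
  define w where "w = pi / a"
  define \<phi> where "\<phi> = (\<lambda>x. P (cos (w * x)))"
  define \<phi>' where "\<phi>' = (\<lambda>x. P' (cos (w * x)) * (- sin (w * x) * w))"
  define \<phi>'' where "\<phi>'' = (\<lambda>x. P'' (cos (w * x)) * (- sin (w * x) * w) * (- sin (w * x) * w) + P' (cos (w * x)) * (- cos (w * x) * w * w))"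
  have dcos: "((\<lambda>x. cos (w * x)) has_real_derivative - sin (w * x) * w) (at x)" for x
    by (auto intro!: derivative_eq_intros)
  have d1: "(\<phi> has_real_derivative \<phi>' x) (at x)" for x
    unfolding \<phi>_def \<phi>'_def by (rule DERIV_chain2[OF P'(2) dcos])
  have d2: "(\<phi>' has_real_derivative \<phi>'' x) (at x)" for x
    unfolding \<phi>'_def \<phi>''_def
    by (rule DERIV_cong[OF DERIV_mult[OF DERIV_chain2[OF P''(2) dcos]]]) (auto intro!: derivative_eq_intros)
  define b where "b = C2 * w\<^sup>2 + C1 * w\<^sup>2"
  have C0: "0 \<le> C1" "0 \<le> C2" using C1[of 0] C2[of 0] by auto
  have bnd: "\<bar>\<phi>'' x\<bar> \<le> b" for x
  proof -
    have c: "cos (w * x) \<in> {-1..1}" by simp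
    have "\<bar>P'' (cos (w * x)) * (- sin (w * x) * w) * (- sin (w * x) * w)\<bar> = \<bar>P'' (cos (w * x))\<bar> * ((sin (w * x))\<^sup>2 * w\<^sup>2)"
      by (simp add: abs_mult power2_eq_square mult.commute mult.left_commute)
    also have "\<dots> \<le> C2 * (1 * w\<^sup>2)"
      using C2[OF c] C0 by (intro mult_mono) (auto simp: abs_square_le_1)
    finally have 1: "\<bar>P'' (cos (w * x)) * (- sin (w * x) * w) * (- sin (w * x) * w)\<bar> \<le> C2 * w\<^sup>2" by simp
    have "\<bar>P' (cos (w * x)) * (- cos (w * x) * w * w)\<bar> = \<bar>P' (cos (w * x))\<bar> * (\<bar>cos (w * x)\<bar> * w\<^sup>2)"
      by (simp add: abs_mult power2_eq_square mult.commute mult.left_commute)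
    also have "\<dots> \<le> C1 * (1 * w\<^sup>2)"
      using C1[OF c] C0 by (intro mult_mono) auto
    finally show ?thesis using 1 unfolding \<phi>''_def b_def by linarith
  qed
  show ?thesis
  proof
    show "continuous_on {0..a} \<phi>"
      using d1 by (meson DERIV_continuous_on has_field_derivative_at_within)
    \<comment> \<open>The factor 2 is the one in \<open>second_difference_bound\<close>.\<close>
    show "0 \<le> 2 * b" unfolding b_def using C0 by simp
    show "\<bar>u0 x - \<phi> x\<bar> < e" if x: "x \<in> {0..a}" for x
    proof -
      have "0 < w" unfolding w_def using a by simp
      then have "0 \<le> w * x" "w * x \<le> w * a" using x by auto
      moreover have "w * a = pi" unfolding w_def using a by simp
      ultimately have r: "0 \<le> w * x" "w * x \<le> pi" by auto
      have "arccos (cos (w * x)) = w * x" using r by (simp add: arccos_cos)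
      then have "f (cos (w * x)) = u0 x" unfolding f_def w_def using a by simp
      then show ?thesis using P(2)[of "cos (w * x)"] unfolding \<phi>_def by simp
    qed
    fix n i :: nat assume i: "i \<le> n"
    show "\<bar>lap (a / real (Suc n)) n (\<lambda>j. \<phi> (node a n j)) i\<bar> \<le> 2 * b"
    proof (rule lap_symmetric_bound[OF a i])
      show "\<phi> (- x) = \<phi> x" for x unfolding \<phi>_def by simp
      show "\<phi> (2 * a - x) = \<phi> x" for x
      proof -
        have "w * (2 * a - x) = 2 * pi - w * x" unfolding w_def using a by (simp add: field_simps)
        then show ?thesis unfolding \<phi>_def by (simp add: cos_diff)
      qed
      show "\<bar>\<phi> (x + h) - 2 * \<phi> x + \<phi> (x - h)\<bar> \<le> 2 * b * h\<^sup>2" if "0 < h" for x h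
        by (rule second_difference_bound[OF d1 d2 bnd that])
    qed
  qed
qed

section \<open>Local existence\<close>

lemma continuous_on_local_time:
  fixes f :: "real \<times> real \<Rightarrow> 'b::topological_space"
  assumes "\<And>t. t \<in> I \<Longrightarrow> \<exists>J. open J \<and> t \<in> J \<and> continuous_on ((J \<inter> I) \<times> X) f"
  shows "continuous_on (I \<times> X) f"
  unfolding continuous_on_eq_continuous_within
proof
  fix z assume z: "z \<in> I \<times> X"
  then obtain J where J: "open J" "fst z \<in> J" "continuous_on ((J \<inter> I) \<times> X) f" using assms[of "fst z"] by auto
  have "at z within I \<times> X = at z within (J \<inter> I) \<times> X"
    by (rule at_within_nhd[of _ "J \<times> UNIV"]) (use J z in \<open>auto intro!: open_Times simp: mem_Times_iff\<close>)
  moreover have "continuous (at z within (J \<inter> I) \<times> X) f"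
    using J(3)[unfolded continuous_on_eq_continuous_within, rule_format, of z] J(2) z by (simp add: mem_Times_iff)
  ultimately show "continuous (at z within I \<times> X) f" by simp
qed

lemma continuous_on_param_integral:
  fixes g :: "real \<Rightarrow> real \<Rightarrow> real"
  assumes T: "compact T" and g: "continuous_on (T \<times> {0..a}) (\<lambda>(t, x). g t x)"
  shows "continuous_on (T \<times> {0..a}) (\<lambda>(t, x). integral {0..x} (g t))"
proof (cases "0 \<le> a")
  case a: True
  have cS: "compact (T \<times> {0..a})" by (intro compact_Times T) auto
  have gt: "continuous_on {0..a} (g t)" if "t \<in> T" for t
    using continuous_on_compose2[OF g, of "{0..a}" "\<lambda>x. (t, x)"] that by (force intro!: continuous_intros)
  have gi: "g t integrable_on {x..y}" if "t \<in> T" "0 \<le> x" "y \<le> a" for t x y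
    by (rule integrable_continuous_real, rule continuous_on_subset[OF gt]) (use that in auto)
  have "compact ((\<lambda>(t, x). g t x) ` (T \<times> {0..a}))" by (rule compact_continuous_image[OF g cS])
  then obtain C where C: "\<And>t x. t \<in> T \<Longrightarrow> x \<in> {0..a} \<Longrightarrow> \<bar>g t x\<bar> \<le> C"
    by (force dest!: compact_imp_bounded simp: bounded_iff)
  define C' where "C' = \<bar>C\<bar> + 1"
  have C': "0 < C'" "\<And>t x. t \<in> T \<Longrightarrow> x \<in> {0..a} \<Longrightarrow> \<bar>g t x\<bar> \<le> C'" using C unfolding C'_def by (force)+
  have ug: "uniformly_continuous_on (T \<times> {0..a}) (\<lambda>(t, x). g t x)"
    by (rule compact_uniformly_continuous[OF g cS])
  show ?thesis
    unfolding continuous_on_iff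
  proof (intro ballI allI impI)
    fix z e assume z: "z \<in> T \<times> {0..a}" and e: "(0::real) < e"
    define \<eta> where "\<eta> = e / (2 * (a + 1))"
    have eta: "0 < \<eta>" "a * \<eta> < e / 2" unfolding \<eta>_def using a e by (auto simp: field_simps)
    obtain d where d: "0 < d" "\<And>y y'. y \<in> T \<times> {0..a} \<Longrightarrow> y' \<in> T \<times> {0..a} \<Longrightarrow> dist y' y < d \<Longrightarrow> dist (g (fst y') (snd y')) (g (fst y) (snd y)) < \<eta>"
      using ug eta(1) unfolding uniformly_continuous_on_def case_prod_beta by metis
    define d' where "d' = min d (e / (2 * C'))"
    have d': "0 < d'" unfolding d'_def using d e C' by simp
    show "\<exists>d>0. \<forall>y\<in>T \<times> {0..a}. dist y z < d \<longrightarrow> dist (case y of (t, x) \<Rightarrow> integral {0..x} (g t)) (case z of (t, x) \<Rightarrow> integral {0..x} (g t)) < e"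
    proof (intro exI conjI ballI impI)
      show "0 < d'" by fact
      fix y assume y: "y \<in> T \<times> {0..a}" and yz: "dist y z < d'"
      obtain t x s w where eq: "y = (t, x)" "z = (s, w)" by (cases y; cases z)
      have tx: "t \<in> T" "s \<in> T" "0 \<le> x" "x \<le> a" "0 \<le> w" "w \<le> a" using y z eq by auto
      have dd: "\<bar>t - s\<bar> < d'" "\<bar>x - w\<bar> < d'"
        using yz dist_fst_le[of y z] dist_snd_le[of y z] unfolding eq by (auto simp: dist_real_def)
      have 1: "\<bar>integral {0..w} (g t) - integral {0..w} (g s)\<bar> \<le> a * \<eta>"
      proof -
        have "integral {0..w} (g t) - integral {0..w} (g s) = integral {0..w} (\<lambda>x. g t x - g s x)"
          by (rule Henstock_Kurzweil_Integration.integral_diff[symmetric]) (use gi tx in auto)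
        also have "norm \<dots> \<le> \<eta> * (w - 0)"
        proof (rule integral_bound)
          show "continuous_on {0..w} (\<lambda>x. g t x - g s x)"
            by (intro continuous_intros continuous_on_subset[OF gt]) (use tx in auto)
          fix r assume r: "r \<in> {0..w}"
          have "dist (t, r) (s, r) < d" using dd unfolding d'_def by (simp add: dist_Pair_Pair dist_real_def)
          then have "dist (g t r) (g s r) < \<eta>" using d(2)[of "(s, r)" "(t, r)"] r tx by auto
          then show "norm (g t r - g s r) \<le> \<eta>" by (simp add: dist_norm)
        qed (use tx in auto)
        also have "\<dots> \<le> a * \<eta>" using tx eta by (simp add: mult.commute mult_right_mono)
        finally show ?thesis by simp
      qed
      have bd: "\<bar>integral {r..q} (g t)\<bar> \<le> C' * (q - r)" if "0 \<le> r" "r \<le> q" "q \<le> a" for r q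
      proof -
        have "norm (integral {r..q} (g t)) \<le> C' * (q - r)"
          by (rule integral_bound) (use that C' tx in \<open>auto intro!: continuous_on_subset[OF gt]\<close>)
        then show ?thesis by simp
      qed
      have 2: "\<bar>integral {0..x} (g t) - integral {0..w} (g t)\<bar> \<le> C' * \<bar>x - w\<bar>"
      proof (cases "x \<le> w")
        case True
        have "integral {0..x} (g t) + integral {x..w} (g t) = integral {0..w} (g t)"
          by (rule Henstock_Kurzweil_Integration.integral_combine) (use True tx gi in auto)
        moreover have "\<bar>x - w\<bar> = w - x" using True by simp
        ultimately show ?thesis using bd[of x w] True tx by simp
      next
        case False
        have "integral {0..w} (g t) + integral {w..x} (g t) = integral {0..x} (g t)"
          by (rule Henstock_Kurzweil_Integration.integral_combine) (use False tx gi in auto)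
        moreover have "\<bar>x - w\<bar> = x - w" using False by simp
        ultimately show ?thesis using bd[of w x] False tx by simp
      qed
      have "C' * \<bar>x - w\<bar> < C' * (e / (2 * C'))" using dd C' unfolding d'_def by (intro mult_strict_left_mono) auto
      also have "\<dots> = e / 2" using C' by simp
      finally have 3: "C' * \<bar>x - w\<bar> < e / 2" .
      show "dist (case y of (t, x) \<Rightarrow> integral {0..x} (g t)) (case z of (t, x) \<Rightarrow> integral {0..x} (g t)) < e"
        unfolding eq prod.case dist_real_def using 1 2 3 eta(2) by linarith
    qed
  qed
qed simp

text \<open>The hypothesis is a non-strict inequality between values of f, so it survives pointwise
  limits; this is how the limit of the grid functions is differentiated in time.\<close>

lemma deriv_from_estimate:
  fixes f :: "real \<Rightarrow> real"
  assumes "\<And>e. 0 < e \<Longrightarrow> \<exists>d>0. \<forall>s. \<bar>s - t\<bar> < d \<longrightarrow> \<bar>f s - f t - (s - t) * D\<bar> \<le> e * \<bar>s - t\<bar>"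
  shows "(f has_real_derivative D) (at t)"
  unfolding DERIV_def
proof (rule LIM_I)
  fix r :: real assume r: "0 < r"
  obtain d where d: "0 < d" "\<And>s. \<bar>s - t\<bar> < d \<Longrightarrow> \<bar>f s - f t - (s - t) * D\<bar> \<le> r / 2 * \<bar>s - t\<bar>"
    using assms[of "r/2"] r by auto
  show "\<exists>s>0. \<forall>h. h \<noteq> 0 \<and> norm (h - 0) < s \<longrightarrow> norm ((f (t + h) - f t) / h - D) < r"
  proof (intro exI conjI allI impI)
    show "0 < d" by fact
    fix h :: real assume h: "h \<noteq> 0 \<and> norm (h - 0) < d"
    have "(f (t + h) - f t) / h - D = (f (t + h) - f t - h * D) / h" using h by (simp add: field_simps)
    also have "norm \<dots> \<le> r / 2"
      using d(2)[of "t + h"] h by (simp add: abs_divide field_simps)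
    finally show "norm ((f (t + h) - f t) / h - D) < r" using r by simp
  qed
qed

lemma grid_tendsto_compose2:
  fixes F :: "real \<times> real \<Rightarrow> real"
  assumes C: "compact C" and F: "continuous_on C F"
    and G: "grid_tendsto a \<sigma> G g" and H: "grid_tendsto a \<sigma> H h"
    and inG: "\<And>k i. i \<le> \<sigma> k \<Longrightarrow> (G k i, H k i) \<in> C"
    and inx: "\<And>k i x. i \<le> \<sigma> k \<Longrightarrow> x \<in> cell a (\<sigma> k) i \<Longrightarrow> (g x, h x) \<in> C"
  shows "grid_tendsto a \<sigma> (\<lambda>k i. F (G k i, H k i)) (\<lambda>x. F (g x, h x))"
  unfolding grid_tendsto_def
proof (intro allI impI)
  fix e :: real assume e: "0 < e"
  obtain d where d: "0 < d" "\<And>x y. x \<in> C \<Longrightarrow> y \<in> C \<Longrightarrow> dist y x < d \<Longrightarrow> dist (F y) (F x) < e"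
    using compact_uniformly_continuous[OF F C] e unfolding uniformly_continuous_on_def by metis
  have d2: "0 < d / 2" using d by simp
  have "\<forall>\<^sub>F k in sequentially. \<forall>i\<le>\<sigma> k. \<forall>x\<in>cell a (\<sigma> k) i. \<bar>G k i - g x\<bar> < d / 2"
    "\<forall>\<^sub>F k in sequentially. \<forall>i\<le>\<sigma> k. \<forall>x\<in>cell a (\<sigma> k) i. \<bar>H k i - h x\<bar> < d / 2"
    using G H d2 unfolding grid_tendsto_def by blast+
  then show "\<forall>\<^sub>F k in sequentially. \<forall>i\<le>\<sigma> k. \<forall>x\<in>cell a (\<sigma> k) i. \<bar>F (G k i, H k i) - F (g x, h x)\<bar> < e"
  proof eventually_elim
    case (elim k)
    show ?case
    proof (intro allI impI ballI)
      fix i x assume i: "i \<le> \<sigma> k" and x: "x \<in> cell a (\<sigma> k) i"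
      have "dist (G k i, H k i) (g x, h x) \<le> \<bar>G k i - g x\<bar> + \<bar>H k i - h x\<bar>"
        unfolding dist_Pair_Pair dist_real_def using sqrt_sum_squares_le_sum_abs by simp
      also have "\<dots> < d / 2 + d / 2" using elim i x by (intro add_strict_mono) auto
      finally have "dist (G k i, H k i) (g x, h x) < d" by simp
      from d(2)[OF inx[OF i x] inG[OF i] this] show "\<bar>F (G k i, H k i) - F (g x, h x)\<bar> < e"
        by (simp add: dist_real_def)
    qed
  qed
qed

lemma grid_tendsto_add_const:
  assumes "grid_tendsto a \<sigma> G g" "c \<longlonglongrightarrow> d"
  shows "grid_tendsto a \<sigma> (\<lambda>k i. G k i + c k) (\<lambda>x. g x + d)"
  unfolding grid_tendsto_def
proof (intro allI impI)
  fix e :: real assume e: "0 < e"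
  then have e2: "0 < e / 2" by simp
  have "\<forall>\<^sub>F k in sequentially. \<forall>i\<le>\<sigma> k. \<forall>x\<in>cell a (\<sigma> k) i. \<bar>G k i - g x\<bar> < e / 2"
    using assms(1) e2 unfolding grid_tendsto_def by blast
  moreover have "\<forall>\<^sub>F k in sequentially. dist (c k) d < e / 2" using assms(2) e2 by (rule tendstoD)
  ultimately show "\<forall>\<^sub>F k in sequentially. \<forall>i\<le>\<sigma> k. \<forall>x\<in>cell a (\<sigma> k) i. \<bar>G k i + c k - (g x + d)\<bar> < e"
  proof eventually_elim
    case (elim k)
    show ?case
    proof (intro allI impI ballI)
      fix i x assume "i \<le> \<sigma> k" "x \<in> cell a (\<sigma> k) i"
      then have "\<bar>G k i - g x\<bar> < e / 2" using elim(1) by blast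
      then show "\<bar>G k i + c k - (g x + d)\<bar> < e" using elim(2) unfolding dist_real_def by linarith
    qed
  qed
qed

lemma grid_tendsto_cong:
  assumes "\<And>k i. i \<le> \<sigma> k \<Longrightarrow> G k i = G' k i" "grid_tendsto a \<sigma> G g"
  shows "grid_tendsto a \<sigma> G' g"
  using assms unfolding grid_tendsto_def by (force elim!: eventually_mono)

lemma double_integral_derivs:
  assumes g: "continuous_on {0..a} g"
    and \<phi>: "\<And>x. x \<in> {0..a} \<Longrightarrow> \<phi> x = c + integral {0..x} (\<lambda>y. integral {0..y} g)" and x: "x \<in> {0..a}"
  shows "(\<phi> has_real_derivative integral {0..x} g) (at x within {0..a})"
    "((\<lambda>x. integral {0..x} g) has_real_derivative g x) (at x within {0..a})"
proof -
  show "((\<lambda>x. integral {0..x} g) has_real_derivative g x) (at x within {0..a})"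
    by (rule integral_has_real_derivative[OF g x])
  have "continuous_on {0..a} (\<lambda>y. integral {0..y} g)"
    by (intro indefinite_integral_continuous_1 integrable_continuous_real g)
  then have "((\<lambda>x. c + integral {0..x} (\<lambda>y. integral {0..y} g)) has_real_derivative integral {0..x} g) (at x within {0..a})"
    by (auto intro!: derivative_eq_intros integral_has_real_derivative x)
  then show "(\<phi> has_real_derivative integral {0..x} g) (at x within {0..a})"
    by (rule has_field_derivative_transform_within[where d = 1]) (use \<phi> x in auto)
qed

lemma times_ereal [simp]: "times (ereal B) = {0..<B}" "pos_times (ereal B) = {0<..<B}"
  unfolding times_def pos_times_def by auto

lemma dir_diff_le:
  assumes "0 < h"
  shows "dir h n (\<lambda>i. f i - g i) \<le> 2 * dir h n f + 2 * dir h n g"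
proof -
  have "(\<Sum>i<n. ((f (Suc i) - g (Suc i)) - (f i - g i))\<^sup>2) \<le> (\<Sum>i<n. 2 * (f (Suc i) - f i)\<^sup>2 + 2 * (g (Suc i) - g i)\<^sup>2)"
  proof (rule sum_mono)
    fix i
    show "((f (Suc i) - g (Suc i)) - (f i - g i))\<^sup>2 \<le> 2 * (f (Suc i) - f i)\<^sup>2 + 2 * (g (Suc i) - g i)\<^sup>2"
      using zero_le_power2[of "(f (Suc i) - f i) + (g (Suc i) - g i)"] by (simp add: power2_eq_square algebra_simps)
  qed
  then have "dir h n (\<lambda>i. f i - g i) \<le> (\<Sum>i<n. 2 * (f (Suc i) - f i)\<^sup>2 + 2 * (g (Suc i) - g i)\<^sup>2) / h"
    unfolding dir_def using assms by (intro divide_right_mono) auto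
  also have "\<dots> = 2 * dir h n f + 2 * dir h n g"
    unfolding dir_def by (simp add: sum.distrib sum_distrib_left add_divide_distrib)
  finally show ?thesis .
qed

context lattice
begin

lemma mean_value:
  assumes i: "i \<le> n" and r: "0 \<le> r" "r < t" "t \<le> B"
  obtains z where "r < z" "z < t" "u i t - u i r = (t - r) * v i z"
proof -
  have "continuous_on {r..t} (u i)" by (rule continuous_on_subset[OF u_cont[OF i]]) (use r in auto)
  moreover have "u i differentiable (at x)" if "r < x" "x < t" for x
    using u_deriv[OF i, of x] that r by (auto simp: real_differentiable_def)
  ultimately obtain l z where z: "r < z" "z < t" "DERIV (u i) z :> l" "u i t - u i r = (t - r) * l"
    using MVT[OF r(2)] by blast
  moreover have "l = v i z" using DERIV_unique[OF z(3)] u_deriv[OF i, of z] z r by auto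
  ultimately show ?thesis using that by blast
qed

end

text \<open>Interpolation by \<open>agmon\<close>: the squared L2 difference of v at two times is at
  most K times the time difference, and its Dirichlet energy is bounded. The choice of l makes the
  Dirichlet contribution \<open>\<epsilon>\<^sup>2 / 2\<close>, and then d makes the other one at
  most \<open>\<epsilon>\<^sup>2 / 4\<close>.\<close>

lemma lattice_equicontinuous:
  assumes p: "1 \<le> p" and a: "0 < a" and lo: "0 < lo" "lo \<le> hi" and B: "0 < B" and e: "0 < e" and eps: "0 < \<epsilon>"
  obtains d where "0 < d"
    "\<And>n u i r t. lattice p a B lo hi n u \<Longrightarrow> i \<le> n \<Longrightarrow> r \<in> {e..B} \<Longrightarrow> t \<in> {e..B} \<Longrightarrow> \<bar>r - t\<bar> < d \<Longrightarrow>
      \<bar>lattice.v p a n u i r - lattice.v p a n u i t\<bar> < \<epsilon>"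
proof -
  obtain K where K: "0 < K"
    "\<And>n u t. lattice p a B lo hi n u \<Longrightarrow> t \<in> {e..B} \<Longrightarrow> dir (lattice.h a n) n (\<lambda>i. lattice.v p a n u i t) \<le> K"
    "\<And>n u s t. lattice p a B lo hi n u \<Longrightarrow> e \<le> s \<Longrightarrow> s \<le> t \<Longrightarrow> t \<le> B \<Longrightarrow>
       nsum (lattice.h a n) n (\<lambda>i. (lattice.v p a n u i t - lattice.v p a n u i s)\<^sup>2) \<le> K * (t - s)"
    by (rule lattice_smoothing[OF p a lo B e]) blast
  define l where "l = 8 * K / \<epsilon>\<^sup>2"
  have l: "0 < l" unfolding l_def using K eps by simp
  define d where "d = \<epsilon>\<^sup>2 / (4 * K * (1 / a + l))"
  have al: "0 < 1 / a + l" using a l by (simp add: add_pos_pos)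
  have d: "0 < d" unfolding d_def using K eps al by simp
  have main: "\<bar>lattice.v p a n u i t - lattice.v p a n u i r\<bar> < \<epsilon>"
    if lat: "lattice p a B lo hi n u" and i: "i \<le> n" and r: "e \<le> r" "r \<le> t" "t \<le> B" "t - r < d" for n u i r t
  proof -
    interpret lattice p a B lo hi n u by fact
    define f where "f = (\<lambda>i. v i t - v i r)"
    have "(f i)\<^sup>2 \<le> (1 / (h * real (Suc n)) + l) * S (\<lambda>i. (f i)\<^sup>2) + D f / l"
      by (rule agmon[OF h l i])
    also have "\<dots> \<le> (1 / a + l) * (K * (t - r)) + (4 * K) / l"
    proof (rule add_mono)
      show "(1 / (h * real (Suc n)) + l) * S (\<lambda>i. (f i)\<^sup>2) \<le> (1 / a + l) * (K * (t - r))"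
        unfolding ha f_def using K(3)[OF lat r(1-3)] al by (intro mult_left_mono) auto
      have "D f \<le> 2 * K + 2 * K"
        unfolding f_def using dir_diff_le[OF h, of n "\<lambda>i. v i t" "\<lambda>i. v i r"] K(2)[OF lat, of t] K(2)[OF lat, of r] r by simp
      then show "D f / l \<le> (4 * K) / l" using l by (intro divide_right_mono) auto
    qed
    also have "\<dots> < (1 / a + l) * (K * d) + (4 * K) / l"
      using r K al by simp
    also have "(1 / a + l) * (K * d) = \<epsilon>\<^sup>2 / 4"
    proof -
      have "A * (K * (\<epsilon>\<^sup>2 / (4 * K * A))) = \<epsilon>\<^sup>2 / 4" if "0 < A" for A using K(1) that by simp
      then show ?thesis unfolding d_def using al by blast
    qed
    also have "(4 * K) / l = \<epsilon>\<^sup>2 / 2" unfolding l_def using K eps by simp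
    also have "\<epsilon>\<^sup>2 / 4 + \<epsilon>\<^sup>2 / 2 \<le> \<epsilon>\<^sup>2" by simp
    finally have "\<bar>f i\<bar> < \<epsilon>" using eps by (simp add: abs_square_less_1 power2_less_imp_less abs_le_square_iff[symmetric])
    then show ?thesis unfolding f_def .
  qed
  show ?thesis
  proof (rule that[OF d])
    fix n u i r t assume "lattice p a B lo hi n u" "i \<le> n" "r \<in> {e..B}" "t \<in> {e..B}" "\<bar>r - t\<bar> < d"
    then show "\<bar>lattice.v p a n u i r - lattice.v p a n u i t\<bar> < \<epsilon>"
      using main[of n u i r t] main[of n u i t r] by (cases "r \<le> t") (auto simp: abs_minus_commute)
  qed
qed

text \<open>The time \<tau> is fixed before u0 and sees it only through M. The minimum of u0 affects
  the lower barrier and the smoothing constants but not \<tau>, so a bounded solution can always be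
  continued, even if it comes close to 0.\<close>

theorem local_existence:
  assumes p: "1 \<le> p" and a: "0 < a" and M: "0 < M"
  obtains \<tau> where "0 < \<tau>"
    "\<And>u0. continuous_on {0..a} u0 \<Longrightarrow> (\<And>x. x \<in> {0..a} \<Longrightarrow> 0 < u0 x) \<Longrightarrow> (\<And>x. x \<in> {0..a} \<Longrightarrow> u0 x \<le> M) \<Longrightarrow>
      \<exists>u. is_solution p a u0 (ereal \<tau>) u"
proof
  define hi where "hi = 2 * M"
  define B where "B = M / ((2 * M) powr p * (2 * M) + 1)"
  show B: "0 < B" unfolding B_def using M by (simp add: add_nonneg_pos)
  fix u0 :: "real \<Rightarrow> real"
  assume u0: "continuous_on {0..a} u0" and u0p: "\<And>x. x \<in> {0..a} \<Longrightarrow> 0 < u0 x" and u0M: "\<And>x. x \<in> {0..a} \<Longrightarrow> u0 x \<le> M"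
  obtain x0 where x0: "x0 \<in> {0..a}" "\<And>x. x \<in> {0..a} \<Longrightarrow> u0 x0 \<le> u0 x"
    using continuous_attains_inf[OF _ _ u0] a by auto
  define c where "c = u0 x0"
  have c: "0 < c" "\<And>x. x \<in> {0..a} \<Longrightarrow> c \<le> u0 x" unfolding c_def using x0 u0p by auto
  define lo where "lo = c / 2 * exp (- ((2 * M) powr p + 1) * B)"
  have lo0: "0 < lo" unfolding lo_def using c by simp
  have node: "node a n i \<in> {0..a}" if "i \<le> n" for n i
    using node_in_cell[OF a] cell_subset[OF a that] by blast
  have "\<exists>u. lattice_sol p (a / real (Suc n)) n B lo hi u \<and> (\<forall>i\<le>n. u i 0 = u0 (node a n i))" for n
    unfolding hi_def
    by (rule lattice_sol_exists[OF p M c(1) _ _ _ B_def lo_def, of "a / real (Suc n)" n "\<lambda>i. u0 (node a n i)"])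
      (use a c u0M node in auto)
  then obtain U where U: "\<And>n. lattice_sol p (a / real (Suc n)) n B lo hi (U n)" "\<And>n i. i \<le> n \<Longrightarrow> U n i 0 = u0 (node a n i)"
    by metis
  have lohi: "lo \<le> hi"
  proof -
    have "lo \<le> U 0 0 0 \<and> U 0 0 0 \<le> hi" using U(1)[of 0] B unfolding lattice_sol_def by auto
    then show ?thesis by linarith
  qed
  have hi0: "0 < hi" using lo0 lohi by simp
  have lat: "lattice p a B lo hi n (U n)" for n
    by unfold_locales (use p a lo0 lohi B U in auto)
  define V where "V = (\<lambda>n. lattice.v p a n (U n))"
  have hol: "(f i - f j)\<^sup>2 \<le> K * \<bar>node a n i - node a n j\<bar>"
    if K: "dir (lattice.h a n) n f \<le> K" and ij: "i \<le> n" "j \<le> n" for n f i j K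
  proof -
    have hd: "lattice.h a n = a / real (Suc n)" using lattice.h_def[OF lat] .
    have h: "0 < a / real (Suc n)" using a by simp
    have "node a n i - node a n j = a / real (Suc n) * (real i - real j)"
      unfolding node_def by (simp add: algebra_simps diff_divide_distrib)
    then have eq: "\<bar>node a n i - node a n j\<bar> = a / real (Suc n) * \<bar>real i - real j\<bar>"
      using a by (simp add: abs_mult)
    have "(f i - f j)\<^sup>2 \<le> dir (a / real (Suc n)) n f * (a / real (Suc n) * \<bar>real i - real j\<bar>)"
      by (rule grid_holder[OF h ij])
    also have "\<dots> \<le> K * (a / real (Suc n) * \<bar>real i - real j\<bar>)"
      using K h unfolding hd by (intro mult_right_mono mult_nonneg_nonneg) (auto intro: less_imp_le)
    finally show ?thesis unfolding eq .
  qed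
  have Ubd: "lo \<le> U n i t" "U n i t \<le> hi" if "i \<le> n" "t \<in> {0..B}" for n i t
    using lattice.u_bd[OF lat that] by auto
  have smooth: "\<exists>K>0. (\<forall>n i t. i \<le> n \<longrightarrow> t \<in> {e..B} \<longrightarrow> \<bar>V n i t\<bar> \<le> K) \<and>
      (\<forall>n i j t. i \<le> n \<longrightarrow> j \<le> n \<longrightarrow> t \<in> {e..B} \<longrightarrow> (U n i t - U n j t)\<^sup>2 \<le> K * \<bar>node a n i - node a n j\<bar>) \<and>
      (\<forall>n i j t. i \<le> n \<longrightarrow> j \<le> n \<longrightarrow> t \<in> {e..B} \<longrightarrow> (V n i t - V n j t)\<^sup>2 \<le> K * \<bar>node a n i - node a n j\<bar>)"
    if e: "0 < e" for e
  proof -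
    obtain K where K: "0 < K"
      "\<And>n u t. lattice p a B lo hi n u \<Longrightarrow> t \<in> {e..B} \<Longrightarrow> dir (lattice.h a n) n (\<lambda>i. u i t) \<le> K"
      "\<And>n u t. lattice p a B lo hi n u \<Longrightarrow> t \<in> {e..B} \<Longrightarrow> dir (lattice.h a n) n (\<lambda>i. lattice.v p a n u i t) \<le> K"
      "\<And>n u t i. lattice p a B lo hi n u \<Longrightarrow> t \<in> {e..B} \<Longrightarrow> i \<le> n \<Longrightarrow> \<bar>lattice.v p a n u i t\<bar> \<le> K"
      by (rule lattice_smoothing[OF p a lo0 lohi B e]) blast
    show ?thesis
      unfolding V_def using K(1) K(4)[OF lat] hol[OF K(2)[OF lat]] hol[OF K(3)[OF lat]]
      by (intro exI[of _ K] conjI allI impI) blast+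
  qed
  have equiV: "\<exists>d>0. \<forall>n i r t. i \<le> n \<longrightarrow> r \<in> {e..B} \<longrightarrow> t \<in> {e..B} \<longrightarrow> \<bar>r - t\<bar> < d \<longrightarrow> \<bar>V n i r - V n i t\<bar> < \<epsilon>"
    if e: "0 < e" "0 < \<epsilon>" for e \<epsilon>
  proof -
    obtain d where d: "0 < d"
      "\<And>n u i r t. lattice p a B lo hi n u \<Longrightarrow> i \<le> n \<Longrightarrow> r \<in> {e..B} \<Longrightarrow> t \<in> {e..B} \<Longrightarrow> \<bar>r - t\<bar> < d \<Longrightarrow>
        \<bar>lattice.v p a n u i r - lattice.v p a n u i t\<bar> < \<epsilon>"
      by (rule lattice_equicontinuous[OF p a lo0 lohi B e]) blast
    show ?thesis
      unfolding V_def
    proof (intro exI conjI allI impI)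
      show "0 < d" by fact
      fix n i :: nat and r t :: real assume "i \<le> n" "r \<in> {e..B}" "t \<in> {e..B}" "\<bar>r - t\<bar> < d"
      then show "\<bar>lattice.v p a n (U n) i r - lattice.v p a n (U n) i t\<bar> < \<epsilon>" by (rule d(2)[OF lat])
    qed
  qed
  have equiU: "\<exists>d>0. \<forall>n i r t. i \<le> n \<longrightarrow> r \<in> {e..B} \<longrightarrow> t \<in> {e..B} \<longrightarrow> \<bar>r - t\<bar> < d \<longrightarrow> \<bar>U n i r - U n i t\<bar> < \<epsilon>"
    if e: "0 < e" and eps: "0 < \<epsilon>" for e \<epsilon>
  proof -
    obtain K where K': "0 < K" "\<forall>n i t. i \<le> n \<longrightarrow> t \<in> {e..B} \<longrightarrow> \<bar>V n i t\<bar> \<le> K"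
      using smooth[OF e] by (elim exE conjE) (rule that)
    then have K: "0 < K" "\<And>n i t. i \<le> n \<Longrightarrow> t \<in> {e..B} \<Longrightarrow> \<bar>V n i t\<bar> \<le> K" by auto
    have main: "\<bar>U n i t - U n i r\<bar> < \<epsilon>" if i: "i \<le> n" and rt: "e \<le> r" "r < t" "t \<le> B" "t - r < \<epsilon> / K" for n i r t
    proof -
      obtain z where z: "r < z" "z < t" "U n i t - U n i r = (t - r) * V n i z"
        using lattice.mean_value[OF lat i, of r t] rt e unfolding V_def by (metis order_trans less_imp_le)
      have "\<bar>U n i t - U n i r\<bar> = (t - r) * \<bar>V n i z\<bar>" using z rt by (simp add: abs_mult)
      also have "\<dots> \<le> (t - r) * K" using K(2)[OF i, of z] z rt by (intro mult_left_mono) auto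
      also have "\<dots> < \<epsilon>" using rt K by (simp add: field_simps)
      finally show ?thesis .
    qed
    show ?thesis
    proof (intro exI conjI allI impI)
      show "0 < \<epsilon> / K" using K eps by simp
      fix n i :: nat and r t :: real assume "i \<le> n" "r \<in> {e..B}" "t \<in> {e..B}" "\<bar>r - t\<bar> < \<epsilon> / K"
      then show "\<bar>U n i r - U n i t\<bar> < \<epsilon>"
        using main[of i n r t] main[of i n t r] eps by (cases r t rule: linorder_cases) (auto simp: abs_minus_commute)
    qed
  qed
  obtain r1 gu where r1: "strict_mono r1"
    and guc: "\<And>e. 0 < e \<Longrightarrow> e \<le> B \<Longrightarrow> continuous_on ({e..B} \<times> {0..a}) (\<lambda>(t, x). gu t x)"
    and gul0: "\<And>e. 0 < e \<Longrightarrow> e \<le> B \<Longrightarrow> cell_lim a {e..B} U (id \<circ> r1) gu"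
  proof (rule grid_diagonal[OF a B, of id U])
    show "strict_mono (id :: nat \<Rightarrow> nat)" by (simp add: strict_mono_def)
    fix e :: real assume e: "0 < e" "e \<le> B"
    obtain K where K: "0 < K" "\<forall>n i j t. i \<le> n \<longrightarrow> j \<le> n \<longrightarrow> t \<in> {e..B} \<longrightarrow> (U n i t - U n j t)\<^sup>2 \<le> K * \<bar>node a n i - node a n j\<bar>"
      using smooth[OF e(1)] by (elim exE conjE) (rule that)
    have "\<forall>n i t. i \<le> n \<longrightarrow> t \<in> {e..B} \<longrightarrow> \<bar>U n i t\<bar> \<le> hi"
    proof (intro allI impI)
      fix n i :: nat and t :: real assume "i \<le> n" "t \<in> {e..B}"
      then show "\<bar>U n i t\<bar> \<le> hi" using Ubd[of i n t] lo0 e by auto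
    qed
    with K show "\<exists>K Q. 0 \<le> K \<and>
      (\<forall>n i t. i \<le> n \<longrightarrow> t \<in> {e..B} \<longrightarrow> \<bar>U n i t\<bar> \<le> Q) \<and>
      (\<forall>n i j t. i \<le> n \<longrightarrow> j \<le> n \<longrightarrow> t \<in> {e..B} \<longrightarrow> (U n i t - U n j t)\<^sup>2 \<le> K * \<bar>node a n i - node a n j\<bar>)"
      by (intro exI[of _ K] exI[of _ hi]) auto
  qed (use equiU in auto)
  \<comment> \<open>Extracted from the first subsequence, so that U and V converge together.\<close>
  obtain r2 gv where r2: "strict_mono r2"
    and gvc: "\<And>e. 0 < e \<Longrightarrow> e \<le> B \<Longrightarrow> continuous_on ({e..B} \<times> {0..a}) (\<lambda>(t, x). gv t x)"
    and gvl: "\<And>e. 0 < e \<Longrightarrow> e \<le> B \<Longrightarrow> cell_lim a {e..B} V (r1 \<circ> r2) gv"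
  proof (rule grid_diagonal[OF a B r1, of V])
    fix e :: real assume e: "0 < e" "e \<le> B"
    obtain K where K: "0 < K" "\<forall>n i t. i \<le> n \<longrightarrow> t \<in> {e..B} \<longrightarrow> \<bar>V n i t\<bar> \<le> K"
      "\<forall>n i j t. i \<le> n \<longrightarrow> j \<le> n \<longrightarrow> t \<in> {e..B} \<longrightarrow> (V n i t - V n j t)\<^sup>2 \<le> K * \<bar>node a n i - node a n j\<bar>"
      using smooth[OF e(1)] by (elim exE conjE) (rule that)
    then show "\<exists>K Q. 0 \<le> K \<and>
      (\<forall>n i t. i \<le> n \<longrightarrow> t \<in> {e..B} \<longrightarrow> \<bar>V n i t\<bar> \<le> Q) \<and>
      (\<forall>n i j t. i \<le> n \<longrightarrow> j \<le> n \<longrightarrow> t \<in> {e..B} \<longrightarrow> (V n i t - V n j t)\<^sup>2 \<le> K * \<bar>node a n i - node a n j\<bar>)"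
      by (intro exI[of _ K]) auto
  qed (use equiV in auto)
  define \<sigma> where "\<sigma> = r1 \<circ> r2"
  have sm: "strict_mono \<sigma>" unfolding \<sigma>_def by (rule strict_mono_o[OF r1 r2])
  have sig: "filterlim \<sigma> at_top sequentially" by (rule filterlim_subseq[OF sm])
  have gul: "cell_lim a {e..B} U \<sigma> gu" if "0 < e" "e \<le> B" for e
    using cell_lim_subseq[OF gul0[OF that] r2] unfolding \<sigma>_def by (simp add: comp_assoc)
  note gvl' = gvl[folded \<sigma>_def]
  have "\<forall>x n. \<exists>i. x \<in> {0..a} \<longrightarrow> i \<le> n \<and> x \<in> cell a n i" using cell_exists[OF a] by metis
  then obtain idx where idx: "\<And>x n. x \<in> {0..a} \<Longrightarrow> idx x n \<le> n" "\<And>x n. x \<in> {0..a} \<Longrightarrow> x \<in> cell a n (idx x n)"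
    by metis
  have ulim: "(\<lambda>k. U (\<sigma> k) (idx x (\<sigma> k)) t) \<longlonglongrightarrow> gu t x" if "0 < t" "t \<le> B" "x \<in> {0..a}" for t x
    by (rule cell_lim_pointwise[OF a gul[OF that(1,2)] _ that(3) idx[OF that(3)]]) (use that in auto)
  have vlim: "(\<lambda>k. V (\<sigma> k) (idx x (\<sigma> k)) t) \<longlonglongrightarrow> gv t x" if "0 < t" "t \<le> B" "x \<in> {0..a}" for t x
    by (rule cell_lim_pointwise[OF a gvl'[OF that(1,2)] _ that(3) idx[OF that(3)]]) (use that in auto)
  have gubd: "lo \<le> gu t x" "gu t x \<le> hi" if "0 < t" "t \<le> B" "x \<in> {0..a}" for t x
    using LIMSEQ_le_const[OF ulim[OF that], of lo] LIMSEQ_le_const2[OF ulim[OF that], of hi]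
      Ubd[OF idx(1)[OF that(3)], of t] that by auto
  have gvbd: "\<bar>gv t x\<bar> \<le> K" if "0 < t" "t \<le> B" "x \<in> {0..a}" "\<And>n i. i \<le> n \<Longrightarrow> \<bar>V n i t\<bar> \<le> K" for t x K
    by (rule LIMSEQ_le_const2[OF tendsto_rabs[OF vlim[OF that(1-3)]]]) (use idx(1)[OF that(3)] that(4) in auto)
  \<comment> \<open>The equation solved for uxx, with gv in the role of ut. That g is the second
    derivative of gu follows from the limit of the discrete Laplacian.\<close>
  define g where "g = (\<lambda>t x. gv t x * gu t x powr (- p) - gu t x + mean a (gu t))"
  have gu_sec: "continuous_on {0..a} (gu t)" and "continuous_on {0..a} (gv t)" if "0 < t" "t \<le> B" for t
    using continuous_on_compose2[OF guc[OF that], of "{0..a}" "\<lambda>x. (t, x)"]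
      continuous_on_compose2[OF gvc[OF that], of "{0..a}" "\<lambda>x. (t, x)"] that
    by (force intro!: continuous_intros)+
  have meanc: "continuous_on {e..B} (\<lambda>t. mean a (gu t))" if "0 < e" "e \<le> B" for e
    unfolding mean_def using integral_continuous_on_param[of "{e..B}" 0 a gu] guc[OF that]
    by (intro continuous_intros) auto
  have gc: "continuous_on ({e..B} \<times> {0..a}) (\<lambda>(t, x). g t x)" if e: "0 < e" "e \<le> B" for e
  proof -
    have "continuous_on ({e..B} \<times> {0..a}) (\<lambda>z. gv (fst z) (snd z) * gu (fst z) (snd z) powr (- p) - gu (fst z) (snd z) + mean a (gu (fst z)))"
    proof (intro continuous_intros)
      show "continuous_on ({e..B} \<times> {0..a}) (\<lambda>z. gv (fst z) (snd z))" "continuous_on ({e..B} \<times> {0..a}) (\<lambda>z. gu (fst z) (snd z))"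
        using guc[OF e] gvc[OF e] by (simp_all add: case_prod_beta)
      then show "continuous_on ({e..B} \<times> {0..a}) (\<lambda>z. gu (fst z) (snd z))" by simp
      show "\<forall>x\<in>{e..B} \<times> {0..a}. gu (fst x) (snd x) \<noteq> 0"
        using gubd(1) lo0 e by (auto simp: mem_Times_iff) (metis atLeastAtMost_iff less_le_trans less_irrefl order_trans)
      show "continuous_on ({e..B} \<times> {0..a}) (\<lambda>z. mean a (gu (fst z)))"
        by (rule continuous_on_compose2[OF meanc[OF e]]) (auto intro!: continuous_intros)
    qed
    then show ?thesis unfolding g_def by (simp add: case_prod_beta)
  qed
  have gsec: "continuous_on {0..a} (g t)" if "0 < t" "t \<le> B" for t
    using continuous_on_compose2[OF gc[OF that], of "{0..a}" "\<lambda>x. (t, x)"] that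
    by (force intro!: continuous_intros)
  have lapg: "grid_tendsto a \<sigma> (\<lambda>k. lap (a / real (Suc (\<sigma> k))) (\<sigma> k) (\<lambda>j. U (\<sigma> k) j t)) (g t)" if t: "0 < t" "t < B" for t
  proof -
    have tB: "t \<le> B" "t \<in> {t..B}" "t \<in> {0..B}" using t by auto
    obtain K where K': "0 < K" "\<forall>n i r. i \<le> n \<longrightarrow> r \<in> {t..B} \<longrightarrow> \<bar>V n i r\<bar> \<le> K"
      using smooth[OF t(1)] by (elim exE conjE) (rule that)
    then have K: "0 < K" "\<And>n i. i \<le> n \<Longrightarrow> \<bar>V n i t\<bar> \<le> K" using tB(2) by auto
    \<comment> \<open>Values of U and V stay in this compact set, on which F is continuous because
      lo is positive; hence the nonlinear expression converges uniformly over the cells.\<close>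
    define C where "C = {lo..hi} \<times> {-K..K}"
    have Cc: "compact C" unfolding C_def by (intro compact_Times) auto
    define F where "F = (\<lambda>z::real\<times>real. snd z * fst z powr (- p) - fst z)"
    have Fc: "continuous_on C F" unfolding F_def C_def using lo0 by (intro continuous_intros) auto
    have s1: "grid_tendsto a \<sigma> (\<lambda>k i. U (\<sigma> k) i t) (gu t)" by (rule cell_lim_grid_tendsto[OF gul[OF t(1) tB(1)] tB(2)])
    have s2: "grid_tendsto a \<sigma> (\<lambda>k i. V (\<sigma> k) i t) (gv t)" by (rule cell_lim_grid_tendsto[OF gvl'[OF t(1) tB(1)] tB(2)])
    have "grid_tendsto a \<sigma> (\<lambda>k i. F (U (\<sigma> k) i t, V (\<sigma> k) i t)) (\<lambda>x. F (gu t x, gv t x))"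
    proof (rule grid_tendsto_compose2[OF Cc Fc s1 s2])
      fix k i assume i: "i \<le> \<sigma> k"
      show "(U (\<sigma> k) i t, V (\<sigma> k) i t) \<in> C" using Ubd[OF i tB(3)] K(2)[OF i] unfolding C_def by (simp add: abs_le_iff)
      fix x assume "x \<in> cell a (\<sigma> k) i"
      then have x: "x \<in> {0..a}" using cell_subset[OF a i] by blast
      show "(gu t x, gv t x) \<in> C"
        using gubd[OF t(1) tB(1) x] gvbd[OF t(1) tB(1) x K(2)] unfolding C_def by (simp add: abs_le_iff)
    qed
    from grid_tendsto_add_const[OF this avg_tendsto_mean[OF a gu_sec[OF t(1) tB(1)] s1]]
    have s3: "grid_tendsto a \<sigma> (\<lambda>k i. F (U (\<sigma> k) i t, V (\<sigma> k) i t) + avg (\<sigma> k) (\<lambda>i. U (\<sigma> k) i t)) (\<lambda>x. F (gu t x, gv t x) + mean a (gu t))" .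
    have "grid_tendsto a \<sigma> (\<lambda>k. lap (a / real (Suc (\<sigma> k))) (\<sigma> k) (\<lambda>j. U (\<sigma> k) j t)) (\<lambda>x. F (gu t x, gv t x) + mean a (gu t))"
    proof (rule grid_tendsto_cong[OF _ s3])
      fix k i assume i: "i \<le> \<sigma> k"
      have "U (\<sigma> k) i t powr (- p) * V (\<sigma> k) i t = lap (a / real (Suc (\<sigma> k))) (\<sigma> k) (\<lambda>j. U (\<sigma> k) j t) i + U (\<sigma> k) i t - avg (\<sigma> k) (\<lambda>j. U (\<sigma> k) j t)"
        unfolding V_def using lattice.v_div[OF lat i tB(3)] unfolding lattice.h_def[OF lat] .
      then show "F (U (\<sigma> k) i t, V (\<sigma> k) i t) + avg (\<sigma> k) (\<lambda>i. U (\<sigma> k) i t) = lap (a / real (Suc (\<sigma> k))) (\<sigma> k) (\<lambda>j. U (\<sigma> k) j t) i"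
        unfolding F_def by (simp add: mult.commute)
    qed
    then show ?thesis unfolding g_def F_def by simp
  qed
  have Neu: "integral {0..a} (g t) = 0"
    and repr: "\<And>x. x \<in> {0..a} \<Longrightarrow> gu t x = gu t 0 + integral {0..x} (\<lambda>y. integral {0..y} (g t))" if t: "0 < t" "t < B" for t
  proof -
    have tB: "t \<le> B" "t \<in> {t..B}" using t by auto
    note L = lap_limit[OF a sig gsec[OF t(1) tB(1)] gu_sec[OF t(1) tB(1)] lapg[OF t] cell_lim_grid_tendsto[OF gul[OF t(1) tB(1)] tB(2)]]
    show "integral {0..a} (g t) = 0" by (rule L(1))
    show "\<And>x. x \<in> {0..a} \<Longrightarrow> gu t x = gu t 0 + integral {0..x} (\<lambda>y. integral {0..y} (g t))" by (rule L(2))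
  qed
  have dx: "(gu t has_real_derivative integral {0..x} (g t)) (at x within {0..a})"
    and dxx: "((\<lambda>x. integral {0..x} (g t)) has_real_derivative g t x) (at x within {0..a})"
    if "0 < t" "t < B" "x \<in> {0..a}" for t x
    using double_integral_derivs[OF gsec repr that(3)] that by auto
  have dt: "((\<lambda>s. gu s x) has_real_derivative gv t x) (at t)" if t: "0 < t" "t < B" and x: "x \<in> {0..a}" for t x
  proof (rule deriv_from_estimate)
    fix \<epsilon> :: real assume eps: "0 < \<epsilon>"
    define e where "e = t / 2"
    have e: "0 < e" "e \<le> B" "e < t" unfolding e_def using t by auto
    obtain d where d': "0 < d" "\<forall>n i r s. i \<le> n \<longrightarrow> r \<in> {e..B} \<longrightarrow> s \<in> {e..B} \<longrightarrow> \<bar>r - s\<bar> < d \<longrightarrow> \<bar>V n i r - V n i s\<bar> < \<epsilon>"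
      using equiV[OF e(1) eps] by (elim exE conjE) (rule that)
    then have d: "0 < d" "\<And>n i r s. i \<le> n \<Longrightarrow> r \<in> {e..B} \<Longrightarrow> s \<in> {e..B} \<Longrightarrow> \<bar>r - s\<bar> < d \<Longrightarrow> \<bar>V n i r - V n i s\<bar> < \<epsilon>"
      by auto
    define d' where "d' = min d (min (t - e) (B - t))"
    show "\<exists>d>0. \<forall>s. \<bar>s - t\<bar> < d \<longrightarrow> \<bar>gu s x - gu t x - (s - t) * gv t x\<bar> \<le> \<epsilon> * \<bar>s - t\<bar>"
    proof (intro exI conjI allI impI)
      show "0 < d'" unfolding d'_def using d e t by auto
      fix s assume s: "\<bar>s - t\<bar> < d'"
      then have sB: "e \<le> s" "s \<le> B" "0 < s" "\<bar>s - t\<bar> < d" unfolding d'_def using e by auto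
      \<comment> \<open>Mean value theorem on the grid, where the time derivative is V, together
        with the equicontinuity of V in time that is uniform in n.\<close>
      have main: "\<bar>U n i s - U n i t - (s - t) * V n i t\<bar> \<le> \<epsilon> * \<bar>s - t\<bar>" if i: "i \<le> n" for n i
      proof (cases "s = t")
        case False
        obtain z where z: "\<bar>z - t\<bar> < d" "z \<in> {e..B}" "U n i s - U n i t = (s - t) * V n i z"
        proof (cases "s < t")
          case True
          obtain z where "s < z" "z < t" "U n i t - U n i s = (t - s) * V n i z"
            using lattice.mean_value[OF lat i, of s t] sB True t unfolding V_def by (metis less_imp_le)
          then show ?thesis using that[of z] sB t by (auto simp: algebra_simps)
        next
          case st: False
          obtain z where "t < z" "z < s" "U n i s - U n i t = (s - t) * V n i z"
            using lattice.mean_value[OF lat i, of t s] sB st False t unfolding V_def by (metis less_imp_le linorder_neqE_linordered_idom)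
          then show ?thesis using that[of z] sB e by auto
        qed
        have "U n i s - U n i t - (s - t) * V n i t = (s - t) * (V n i z - V n i t)" using z(3) by (simp add: algebra_simps)
        also have "\<bar>\<dots>\<bar> = \<bar>V n i z - V n i t\<bar> * \<bar>s - t\<bar>" by (simp add: abs_mult)
        also have "\<dots> \<le> \<epsilon> * \<bar>s - t\<bar>" using d(2)[OF i z(2), of t] z e t by (intro mult_right_mono) auto
        finally show ?thesis .
      qed simp
      have l: "(\<lambda>k. \<bar>U (\<sigma> k) (idx x (\<sigma> k)) s - U (\<sigma> k) (idx x (\<sigma> k)) t - (s - t) * V (\<sigma> k) (idx x (\<sigma> k)) t\<bar>)
          \<longlonglongrightarrow> \<bar>gu s x - gu t x - (s - t) * gv t x\<bar>"
        by (intro tendsto_intros ulim vlim) (use sB t x in auto)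
      show "\<bar>gu s x - gu t x - (s - t) * gv t x\<bar> \<le> \<epsilon> * \<bar>s - t\<bar>"
        by (rule LIMSEQ_le_const2[OF l]) (use main idx(1)[OF x] in auto)
    qed
  qed
  have init: "\<exists>K\<ge>0. \<forall>t x. 0 < t \<longrightarrow> t < B \<longrightarrow> x \<in> {0..a} \<longrightarrow> \<bar>gu t x - u0 x\<bar> \<le> \<epsilon> + K * t" if eps: "0 < \<epsilon>" for \<epsilon>
  proof -
    obtain \<phi> b where phi: "continuous_on {0..a} \<phi>" "0 \<le> b" "\<And>x. x \<in> {0..a} \<Longrightarrow> \<bar>u0 x - \<phi> x\<bar> < \<epsilon> / 2"
      "\<And>n i. i \<le> n \<Longrightarrow> \<bar>lap (a / real (Suc n)) n (\<lambda>j. \<phi> (node a n j)) i\<bar> \<le> b"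
      using neumann_approximation[OF a u0, of "\<epsilon>/2"] eps by auto
    \<comment> \<open>Barrier speed; it may be large because b depends on \<epsilon>, but it is
      multiplied by t.\<close>
    define K where "K = hi powr p * (b + hi) + 1"
    have K0: "0 \<le> K" unfolding K_def using phi(2) hi0 by (intro add_nonneg_nonneg mult_nonneg_nonneg) auto
    have "\<bar>gu t x - \<phi> x\<bar> \<le> \<epsilon> / 2 + K * t" if t: "0 < t" "t < B" and x: "x \<in> {0..a}" for t x
    proof -
      have nodes: "(\<lambda>k. node a (\<sigma> k) (idx x (\<sigma> k))) \<longlonglongrightarrow> x"
      proof (rule tendstoI)
        fix e :: real assume "0 < e"
        from mesh_small[OF sig this, of a] show "\<forall>\<^sub>F k in sequentially. dist (node a (\<sigma> k) (idx x (\<sigma> k))) x < e"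
        proof eventually_elim
          case (elim k)
          then show ?case using cell_diam[OF node_in_cell[OF a] idx(2)[OF x, of "\<sigma> k"]] by (simp add: dist_real_def)
        qed
      qed
      have "(\<lambda>k. \<phi> (node a (\<sigma> k) (idx x (\<sigma> k)))) \<longlonglongrightarrow> \<phi> x"
        by (rule continuous_on_tendsto_compose[OF phi(1) nodes x]) (use node idx(1)[OF x] in auto)
      then have l: "(\<lambda>k. \<bar>U (\<sigma> k) (idx x (\<sigma> k)) t - \<phi> (node a (\<sigma> k) (idx x (\<sigma> k)))\<bar>) \<longlonglongrightarrow> \<bar>gu t x - \<phi> x\<bar>"
        by (intro tendsto_intros ulim) (use t x in auto)
      have "\<bar>U n i t - \<phi> (node a n i)\<bar> \<le> \<epsilon> / 2 + K * t" if i: "i \<le> n" for n i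
        unfolding K_def
        by (rule lattice_barrier[OF U(1) _ lo0 lohi phi(2,4)])
          (use p i t U(2) phi(3)[OF node] in \<open>auto intro: less_imp_le\<close>)
      then show ?thesis by (intro LIMSEQ_le_const2[OF l]) (use idx(1)[OF x] in auto)
    qed
    then have "\<bar>gu t x - u0 x\<bar> \<le> \<epsilon> + K * t" if t: "0 < t" "t < B" and x: "x \<in> {0..a}" for t x
      using phi(3)[OF x] that by (smt (verit) field_sum_of_halves)
    then show ?thesis using K0 by blast
  qed
  \<comment> \<open>The limit is controlled for positive times only. The initial value is inserted,
    and \<open>init\<close> makes the junction continuous.\<close>
  define u where "u = (\<lambda>t x. if t \<le> 0 then u0 x else gu t x)"
  have uc: "continuous_on ({0..<B} \<times> {0..a}) (\<lambda>(t, x). u t x)"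
    unfolding continuous_on_eq_continuous_within
  proof
    fix z assume z: "z \<in> {0..<B} \<times> {0..a}"
    obtain t x where tx: "z = (t, x)" by (cases z)
    have t: "0 \<le> t" "t < B" and x: "x \<in> {0..a}" using z tx by auto
    show "continuous (at z within {0..<B} \<times> {0..a}) (\<lambda>(t, x). u t x)"
    proof (cases "t = 0")
      case False
      then have t0: "0 < t" using t by simp
      define e where "e = t / 2"
      have e: "0 < e" "e \<le> B" "e < t" unfolding e_def using t t0 by auto
      have "continuous_on ({e<..<B} \<times> {0..a}) (\<lambda>(t, x). gu t x)"
        by (rule continuous_on_subset[OF guc[OF e(1,2)]]) auto
      then have "continuous_on ({e<..<B} \<times> {0..a}) (\<lambda>(t, x). u t x)"
        by (rule continuous_on_eq) (use e in \<open>auto simp: u_def\<close>)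
      then have "continuous (at z within {e<..<B} \<times> {0..a}) (\<lambda>(t, x). u t x)"
        using e t x tx unfolding continuous_on_eq_continuous_within by auto
      moreover have "at z within {0..<B} \<times> {0..a} = at z within {e<..<B} \<times> {0..a}"
        by (rule at_within_nhd[of _ "{e<..<B} \<times> UNIV"]) (use e t tx in \<open>auto intro!: open_Times\<close>)
      ultimately show ?thesis by simp
    next
      case True
      show ?thesis
        unfolding continuous_within tx True prod.case
      proof (rule tendstoI)
        fix \<epsilon> :: real assume eps: "0 < \<epsilon>"
        obtain K where K: "0 \<le> K" "\<And>t x. 0 < t \<Longrightarrow> t < B \<Longrightarrow> x \<in> {0..a} \<Longrightarrow> \<bar>gu t x - u0 x\<bar> \<le> \<epsilon> / 4 + K * t"
          using init[of "\<epsilon> / 4"] eps by auto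
        obtain d where d: "0 < d" "\<And>y. y \<in> {0..a} \<Longrightarrow> dist y x < d \<Longrightarrow> dist (u0 y) (u0 x) < \<epsilon> / 4"
          using u0 x eps unfolding continuous_on_iff by (metis divide_pos_pos zero_less_numeral)
        define d' where "d' = min d (\<epsilon> / (4 * (K + 1)))"
        have d': "0 < d'" unfolding d'_def using d eps K by simp
        show "\<forall>\<^sub>F y in at (0, x) within {0..<B} \<times> {0..a}. dist (case y of (t, x) \<Rightarrow> u t x) (u 0 x) < \<epsilon>"
          unfolding eventually_at
        proof (intro exI conjI ballI impI)
          show "0 < d'" by fact
          fix y assume y: "y \<in> {0..<B} \<times> {0..a}" and yd: "y \<noteq> (0, x) \<and> dist y (0, x) < d'"
          obtain s w where sw: "y = (s, w)" by (cases y)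
          have s: "0 \<le> s" "s < B" "w \<in> {0..a}" using y sw by auto
          have ds: "\<bar>s\<bar> < d'" "dist w x < d'"
            using yd dist_fst_le[of y "(0, x)"] dist_snd_le[of y "(0, x)"] unfolding sw by (auto simp: dist_real_def)
          have 1: "\<bar>u0 w - u0 x\<bar> < \<epsilon> / 4" using d(2)[OF s(3)] ds unfolding d'_def dist_real_def by auto
          have "K * s \<le> (K + 1) * (\<epsilon> / (4 * (K + 1)))"
            using ds s K unfolding d'_def by (intro mult_mono) auto
          also have "\<dots> = \<epsilon> / 4" using K by (simp add: field_simps)
          finally have 2: "K * s \<le> \<epsilon> / 4" .
          have "\<bar>u s w - u0 w\<bar> \<le> \<epsilon> / 4 + \<epsilon> / 4"
          proof (cases "s = 0")
            case True then show ?thesis unfolding u_def using eps by simp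
          next
            case False
            then show ?thesis using K(2)[of s w] s 2 unfolding u_def by auto
          qed
          moreover have "u 0 x = u0 x" unfolding u_def by simp
          ultimately show "dist (case y of (t, x) \<Rightarrow> u t x) (u 0 x) < \<epsilon>"
            using 1 eps unfolding sw dist_real_def prod.case by linarith
        qed
      qed
    qed
  qed
  have local: "continuous_on ({0<..<B} \<times> {0..a}) f" if f: "\<And>e. 0 < e \<Longrightarrow> e \<le> B \<Longrightarrow> continuous_on ({e..B} \<times> {0..a}) f" for f :: "real \<times> real \<Rightarrow> real"
  proof (rule continuous_on_local_time)
    fix t assume t: "t \<in> {0<..<B}"
    have "continuous_on (({t/2<..} \<inter> {0<..<B}) \<times> {0..a}) f"
      by (rule continuous_on_subset[OF f[of "t/2"]]) (use t in auto)
    then show "\<exists>J. open J \<and> t \<in> J \<and> continuous_on ((J \<inter> {0<..<B}) \<times> {0..a}) f"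
      using t by (intro exI[of _ "{t/2<..}"]) auto
  qed
  have "is_solution p a u0 (ereal B) u"
    unfolding is_solution_def times_ereal
  proof (intro conjI)
    show "0 < ereal B" using B by simp
    show "continuous_on ({0..<B} \<times> {0..a}) (\<lambda>(t, x). u t x)" by fact
    show "\<forall>t\<in>{0..<B}. \<forall>x\<in>{0..a}. 0 < u t x"
      unfolding u_def using u0p gubd(1) lo0 by (force intro: less_le_trans)
    show "\<forall>x\<in>{0<..<a}. u 0 x = u0 x" unfolding u_def by simp
    show "\<exists>ut ux uxx :: real \<Rightarrow> real \<Rightarrow> real.
        continuous_on ({0<..<B} \<times> {0..a}) (\<lambda>(t, x). ut t x) \<and>
        continuous_on ({0<..<B} \<times> {0..a}) (\<lambda>(t, x). ux t x) \<and>
        continuous_on ({0<..<B} \<times> {0..a}) (\<lambda>(t, x). uxx t x) \<and>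
        (\<forall>t\<in>{0<..<B}. \<forall>x\<in>{0..a}.
           ((\<lambda>s. u s x) has_real_derivative ut t x) (at t) \<and>
           (u t has_real_derivative ux t x) (at x within {0..a}) \<and>
           (ux t has_real_derivative uxx t x) (at x within {0..a})) \<and>
        (\<forall>t\<in>{0<..<B}. \<forall>x\<in>{0<..<a}.
           ut t x = u t x powr p * (uxx t x + u t x - mean a (u t))) \<and>
        (\<forall>t\<in>{0<..<B}. ux t 0 = 0 \<and> ux t a = 0)"
    \<comment> \<open>Taking ux as the primitive of g makes the Neumann condition at 0 trivial; the
      one at a is \<open>Neu\<close>.\<close>
    proof (rule exI[of _ gv], rule exI[of _ "\<lambda>t x. integral {0..x} (g t)"], rule exI[of _ g], intro conjI ballI)
      show "continuous_on ({0<..<B} \<times> {0..a}) (\<lambda>(t, x). gv t x)" by (rule local[OF gvc])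
      show "continuous_on ({0<..<B} \<times> {0..a}) (\<lambda>(t, x). g t x)" by (rule local[OF gc])
      show "continuous_on ({0<..<B} \<times> {0..a}) (\<lambda>(t, x). integral {0..x} (g t))"
        by (rule local) (rule continuous_on_param_integral[OF _ gc], auto)
      fix t assume t: "t \<in> {0<..<B}"
      then have t': "0 < t" "t < B" by auto
      have ut: "u t = gu t" unfolding u_def using t' by auto
      show "integral {0..0} (g t) = 0" by simp
      show "integral {0..a} (g t) = 0" by (rule Neu[OF t'])
      show "(u t has_real_derivative integral {0..x} (g t)) (at x within {0..a})" if x: "x \<in> {0..a}" for x
        unfolding ut by (rule dx[OF t' x])
      show "((\<lambda>x. integral {0..x} (g t)) has_real_derivative g t x) (at x within {0..a})" if x: "x \<in> {0..a}" for x
        by (rule dxx[OF t' x])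
      show "((\<lambda>s. u s x) has_real_derivative gv t x) (at t)" if x: "x \<in> {0..a}" for x
        by (rule has_field_derivative_transform_within_open[OF dt[OF t' x], of "{0<..}"]) (use t' in \<open>auto simp: u_def\<close>)
      fix x assume "x \<in> {0<..<a}"
      then have x: "x \<in> {0..a}" by auto
      have "0 < gu t x" using gubd(1)[of t x] t' x lo0 by auto
      then show "gv t x = u t x powr p * (g t x + u t x - mean a (u t))"
        unfolding ut g_def by (simp add: powr_minus field_simps)
    qed
  qed
  then show "\<exists>u. is_solution p a u0 (ereal B) u" by blast
qed

section \<open>Classical solutions and their conserved quantities\<close>

lemma ftc_Icc:
  fixes F f :: "real \<Rightarrow> real"
  assumes "0 \<le> a" "\<And>x. x \<in> {0..a} \<Longrightarrow> (F has_real_derivative f x) (at x within {0..a})"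
  shows "(f has_integral (F a - F 0)) {0..a}" "integral {0..a} f = F a - F 0"
proof -
  show "(f has_integral (F a - F 0)) {0..a}"
    by (rule fundamental_theorem_of_calculus) (use assms in \<open>auto simp: has_real_derivative_iff_has_vector_derivative[symmetric]\<close>)
  then show "integral {0..a} f = F a - F 0" by (rule integral_unique)
qed

lemma integral_add_cont:
  fixes f g :: "real \<Rightarrow> real"
  assumes "continuous_on {a..b} f" "continuous_on {a..b} g"
  shows "integral {a..b} (\<lambda>x. f x + g x) = integral {a..b} f + integral {a..b} g"
  by (rule Henstock_Kurzweil_Integration.integral_add) (intro integrable_continuous_real assms)+

lemma integral_diff_cont:
  fixes f g :: "real \<Rightarrow> real"
  assumes "continuous_on {a..b} f" "continuous_on {a..b} g"
  shows "integral {a..b} (\<lambda>x. f x - g x) = integral {a..b} f - integral {a..b} g"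
  by (rule Henstock_Kurzweil_Integration.integral_diff) (intro integrable_continuous_real assms)+

lemma integral_mono_cont:
  fixes f g :: "real \<Rightarrow> real"
  assumes "continuous_on {a..b} f" "continuous_on {a..b} g" "\<And>x. x \<in> {a..b} \<Longrightarrow> f x \<le> g x"
  shows "integral {a..b} f \<le> integral {a..b} g"
  by (rule integral_le) (use assms in \<open>auto intro: integrable_continuous_real\<close>)

lemma integral_nonneg_cont:
  fixes f :: "real \<Rightarrow> real"
  assumes "continuous_on {a..b} f" "\<And>x. x \<in> {a..b} \<Longrightarrow> 0 \<le> f x"
  shows "0 \<le> integral {a..b} f"
  by (rule Henstock_Kurzweil_Integration.integral_nonneg) (use assms in \<open>auto intro: integrable_continuous_real\<close>)

lemma integral_square_expand:
  fixes f g :: "real \<Rightarrow> real"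
  assumes f: "continuous_on {a..b} f" and g: "continuous_on {a..b} g"
  shows "integral {a..b} (\<lambda>x. (f x - s * g x)\<^sup>2) =
    integral {a..b} (\<lambda>x. (f x)\<^sup>2) - 2 * s * integral {a..b} (\<lambda>x. f x * g x) + s\<^sup>2 * integral {a..b} (\<lambda>x. (g x)\<^sup>2)"
proof -
  have "integral {a..b} (\<lambda>x. (f x - s * g x)\<^sup>2) = integral {a..b} (\<lambda>x. ((f x)\<^sup>2 - (2 * s) * (f x * g x)) + s\<^sup>2 * (g x)\<^sup>2)"
    by (rule integral_cong) (simp add: power2_eq_square algebra_simps)
  also have "\<dots> = integral {a..b} (\<lambda>x. (f x)\<^sup>2 - (2 * s) * (f x * g x)) + integral {a..b} (\<lambda>x. s\<^sup>2 * (g x)\<^sup>2)"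
    by (rule integral_add_cont) (intro continuous_intros f g)+
  also have "integral {a..b} (\<lambda>x. (f x)\<^sup>2 - (2 * s) * (f x * g x)) = integral {a..b} (\<lambda>x. (f x)\<^sup>2) - integral {a..b} (\<lambda>x. (2 * s) * (f x * g x))"
    by (rule integral_diff_cont) (intro continuous_intros f g)+
  finally show ?thesis by simp
qed

lemma integral_Cauchy_Schwarz:
  fixes f g :: "real \<Rightarrow> real"
  assumes f: "continuous_on {a..b} f" and g: "continuous_on {a..b} g"
  shows "(integral {a..b} (\<lambda>x. f x * g x))\<^sup>2 \<le> integral {a..b} (\<lambda>x. (f x)\<^sup>2) * integral {a..b} (\<lambda>x. (g x)\<^sup>2)"
proof -
  define F P G where "F = integral {a..b} (\<lambda>x. (f x)\<^sup>2)" and "P = integral {a..b} (\<lambda>x. f x * g x)" and "G = integral {a..b} (\<lambda>x. (g x)\<^sup>2)"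
  have q: "0 \<le> F - 2 * s * P + s\<^sup>2 * G" for s
    unfolding F_def P_def G_def integral_square_expand[OF f g, symmetric]
    by (rule integral_nonneg_cont) (intro continuous_intros f g, simp)
  have G0: "0 \<le> G" unfolding G_def by (rule integral_nonneg_cont) (intro continuous_intros g, simp)
  have "P\<^sup>2 \<le> F * G"
  proof (cases "G = 0")
    case True
    have "P = 0"
    proof (rule ccontr)
      assume "P \<noteq> 0"
      then show False using q[of "(F + 1) / (2 * P)"] True by (simp add: field_simps)
    qed
    then show ?thesis using True by simp
  next
    case False
    then have G: "0 < G" using G0 by simp
    have "0 \<le> (F - 2 * (P / G) * P + (P / G)\<^sup>2 * G) * G" using q[of "P / G"] G by simp
    also have "\<dots> = F * G - P\<^sup>2" using G by (simp add: power2_eq_square field_simps)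
    finally show ?thesis by simp
  qed
  then show ?thesis unfolding F_def P_def G_def .
qed

lemma integral_abs_le_sqrt:
  fixes f :: "real \<Rightarrow> real"
  assumes f: "continuous_on {0..a} f" and x: "0 \<le> x" "x \<le> a"
  shows "\<bar>integral {0..x} f\<bar> \<le> sqrt (a * integral {0..a} (\<lambda>x. (f x)\<^sup>2))"
proof -
  have fx: "continuous_on {0..x} f" by (rule continuous_on_subset[OF f]) (use x in auto)
  have "(integral {0..x} (\<lambda>x. f x * 1))\<^sup>2 \<le> integral {0..x} (\<lambda>x. (f x)\<^sup>2) * integral {0..x} (\<lambda>x. 1\<^sup>2)"
    by (rule integral_Cauchy_Schwarz[OF fx]) (intro continuous_intros)
  also have "\<dots> = integral {0..x} (\<lambda>x. (f x)\<^sup>2) * x" using x by simp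
  also have "\<dots> \<le> integral {0..a} (\<lambda>x. (f x)\<^sup>2) * a"
  proof (rule mult_mono)
    show "integral {0..x} (\<lambda>x. (f x)\<^sup>2) \<le> integral {0..a} (\<lambda>x. (f x)\<^sup>2)"
      by (rule integral_subset_le) (use x in \<open>auto intro!: integrable_continuous_real continuous_intros f fx\<close>)
    show "0 \<le> integral {0..a} (\<lambda>x. (f x)\<^sup>2)" by (rule integral_nonneg_cont) (intro continuous_intros f, simp)
  qed (use x in auto)
  finally have "(integral {0..x} f)\<^sup>2 \<le> a * integral {0..a} (\<lambda>x. (f x)\<^sup>2)" by (simp add: mult.commute)
  then show ?thesis by (simp add: real_le_rsqrt)
qed

lemma times_Icc: "t \<in> times T \<Longrightarrow> {0..t} \<subseteq> times T"
proof
  fix s assume t: "t \<in> times T" and s: "s \<in> {0..t}"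
  have "ereal s \<le> ereal t" using s by simp
  also have "\<dots> < T" using t unfolding times_def by simp
  finally show "s \<in> times T" using s unfolding times_def by simp
qed

lemma pos_times_interval:
  "open (pos_times T)" "convex (pos_times T)"
proof -
  have "pos_times T = {} \<or> pos_times T = {0<..} \<or> (\<exists>r. pos_times T = {0<..<r})"
  proof (cases T)
    case (real r)
    then show ?thesis by auto
  next
    case PInf
    then have "pos_times T = {0<..}" unfolding pos_times_def by auto
    then show ?thesis by blast
  next
    case MInf
    then have "pos_times T = {}" unfolding pos_times_def by auto
    then show ?thesis by blast
  qed
  then consider "pos_times T = {}" | "pos_times T = {0<..}" | r where "pos_times T = {0<..<r}" by blast
  then have "open (pos_times T) \<and> convex (pos_times T)"
    by cases simp_all
  then show "open (pos_times T)" "convex (pos_times T)" by simp_all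
qed

lemma pos_times_subset: "pos_times T \<subseteq> times T"
  unfolding times_def pos_times_def by auto

lemma leibniz_time:
  fixes F Ft :: "real \<Rightarrow> real \<Rightarrow> real"
  assumes d: "\<And>t x. t \<in> pos_times T \<Longrightarrow> x \<in> {0..b} \<Longrightarrow> ((\<lambda>s. F s x) has_real_derivative Ft t x) (at t)"
    and F: "\<And>t. t \<in> pos_times T \<Longrightarrow> continuous_on {0..b} (F t)"
    and Ft: "continuous_on (pos_times T \<times> {0..b}) (\<lambda>(t, x). Ft t x)"
    and t: "t \<in> pos_times T"
  shows "((\<lambda>s. integral {0..b} (F s)) has_real_derivative integral {0..b} (Ft t)) (at t)"
proof -
  have "((\<lambda>s. integral (cbox 0 b) (F s)) has_field_derivative integral (cbox 0 b) (Ft t)) (at t within pos_times T)"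
    by (rule leibniz_rule_field_derivative[OF _ _ _ t pos_times_interval(2)])
      (use d F Ft in \<open>auto intro: has_field_derivative_at_within integrable_continuous_real\<close>)
  then show ?thesis using at_within_open[OF t pos_times_interval(1)] by simp
qed

lemma section_cont:
  assumes "continuous_on (I \<times> X) (\<lambda>(t, x). f t x)" "t \<in> I"
  shows "continuous_on X (f t)"
  using continuous_on_compose2[OF assms(1), of X "\<lambda>x. (t, x)"] assms(2) by (force intro!: continuous_intros)

text \<open>The differential part of \<open>is_solution\<close> on an arbitrary set of times and
  with named derivatives. On open sets it is local in time, which allows solutions to be shifted and
  glued.\<close>

definition classical_on ::
  "real \<Rightarrow> real \<Rightarrow> real set \<Rightarrow> (real \<Rightarrow> real \<Rightarrow> real) \<Rightarrow> (real \<Rightarrow> real \<Rightarrow> real) \<Rightarrow>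
    (real \<Rightarrow> real \<Rightarrow> real) \<Rightarrow> (real \<Rightarrow> real \<Rightarrow> real) \<Rightarrow> bool" where
  "classical_on p a I u ut ux uxx \<longleftrightarrow>
     continuous_on (I \<times> {0..a}) (\<lambda>(t, x). ut t x) \<and>
     continuous_on (I \<times> {0..a}) (\<lambda>(t, x). ux t x) \<and>
     continuous_on (I \<times> {0..a}) (\<lambda>(t, x). uxx t x) \<and>
     (\<forall>t\<in>I. \<forall>x\<in>{0..a}.
        ((\<lambda>s. u s x) has_real_derivative ut t x) (at t) \<and>
        (u t has_real_derivative ux t x) (at x within {0..a}) \<and>
        (ux t has_real_derivative uxx t x) (at x within {0..a})) \<and>
     (\<forall>t\<in>I. \<forall>x\<in>{0<..<a}. ut t x = u t x powr p * (uxx t x + u t x - mean a (u t))) \<and>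
     (\<forall>t\<in>I. ux t 0 = 0 \<and> ux t a = 0)"

lemma is_solution_iff_classical:
  "is_solution p a u0 T u \<longleftrightarrow>
     0 < T \<and> continuous_on (times T \<times> {0..a}) (\<lambda>(t, x). u t x) \<and>
     (\<forall>t\<in>times T. \<forall>x\<in>{0..a}. 0 < u t x) \<and> (\<forall>x\<in>{0<..<a}. u 0 x = u0 x) \<and>
     (\<exists>ut ux uxx. classical_on p a (pos_times T) u ut ux uxx)"
  unfolding is_solution_def classical_on_def ..

section \<open>Conservation laws of a classical solution\<close>

locale pde_sol =
  fixes p a :: real and T :: ereal and u ut ux uxx :: "real \<Rightarrow> real \<Rightarrow> real"
  assumes p: "1 < p" and a: "0 < a" and T0: "0 < T"
    and u_cont: "continuous_on (times T \<times> {0..a}) (\<lambda>(t, x). u t x)"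
    and u_pos: "\<And>t x. t \<in> times T \<Longrightarrow> x \<in> {0..a} \<Longrightarrow> 0 < u t x"
    and classical: "classical_on p a (pos_times T) u ut ux uxx"

lemma is_solution_pde_sol:
  assumes "is_solution p a u0 T u" "1 < p" "0 < a"
  obtains ut ux uxx where "pde_sol p a T u ut ux uxx"
  using assms unfolding is_solution_iff_classical pde_sol_def by blast

context pde_sol
begin

lemma ut_cont: "continuous_on (pos_times T \<times> {0..a}) (\<lambda>(t, x). ut t x)"
  and ux_cont: "continuous_on (pos_times T \<times> {0..a}) (\<lambda>(t, x). ux t x)"
  and uxx_cont: "continuous_on (pos_times T \<times> {0..a}) (\<lambda>(t, x). uxx t x)"
  and dt: "t \<in> pos_times T \<Longrightarrow> x \<in> {0..a} \<Longrightarrow> ((\<lambda>s. u s x) has_real_derivative ut t x) (at t)"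
  and dx: "t \<in> pos_times T \<Longrightarrow> x \<in> {0..a} \<Longrightarrow> (u t has_real_derivative ux t x) (at x within {0..a})"
  and dxx: "t \<in> pos_times T \<Longrightarrow> x \<in> {0..a} \<Longrightarrow> (ux t has_real_derivative uxx t x) (at x within {0..a})"
  and pde: "t \<in> pos_times T \<Longrightarrow> x \<in> {0<..<a} \<Longrightarrow> ut t x = u t x powr p * (uxx t x + u t x - mean a (u t))"
  and neumann: "t \<in> pos_times T \<Longrightarrow> ux t 0 = 0" "t \<in> pos_times T \<Longrightarrow> ux t a = 0"
  using classical unfolding classical_on_def by blast+

text \<open>Equals \<open>u powr (- p) * ut\<close>, and thus up to the factor 1 - p the time
  derivative of \<open>u powr (1 - p)\<close>.\<close>

definition "g t x = uxx t x + u t x - mean a (u t)"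

lemma u_cont': "continuous_on (pos_times T \<times> {0..a}) (\<lambda>(t, x). u t x)"
  by (rule continuous_on_subset[OF u_cont]) (use pos_times_subset in auto)

lemma u_pos': "t \<in> pos_times T \<Longrightarrow> x \<in> {0..a} \<Longrightarrow> 0 < u t x"
  using u_pos pos_times_subset by blast

lemma sec: assumes "t \<in> pos_times T"
  shows "continuous_on {0..a} (u t)" "continuous_on {0..a} (ut t)" "continuous_on {0..a} (ux t)" "continuous_on {0..a} (uxx t)"
  using section_cont[OF u_cont' assms] section_cont[OF ut_cont assms] section_cont[OF ux_cont assms] section_cont[OF uxx_cont assms] by auto

lemma sec_times: "t \<in> times T \<Longrightarrow> continuous_on {0..a} (u t)"
  using section_cont[OF u_cont] .

lemma g_sec: "t \<in> pos_times T \<Longrightarrow> continuous_on {0..a} (g t)"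
  unfolding g_def by (intro continuous_intros sec)

text \<open>The equation is given in the open interval; both sides are continuous up to the
  ends.\<close>

lemma ut_eq: assumes t: "t \<in> pos_times T" and x: "x \<in> {0..a}" shows "ut t x = u t x powr p * g t x"
proof -
  have cl: "closure {0<..<a} = {0..a}" using a by simp
  have "ut t x - u t x powr p * g t x = 0"
  proof (rule continuous_constant_on_closure[of "{0<..<a}" "\<lambda>x. ut t x - u t x powr p * g t x"])
    have "\<forall>x\<in>{0..a}. u t x \<noteq> 0" using u_pos'[OF t] by force
    then show "continuous_on (closure {0<..<a}) (\<lambda>x. ut t x - u t x powr p * g t x)"
      unfolding cl by (intro continuous_intros sec g_sec t)
    show "\<And>x. x \<in> {0<..<a} \<Longrightarrow> ut t x - u t x powr p * g t x = 0"
      using pde[OF t] unfolding g_def by simp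
    show "x \<in> closure {0<..<a}" using x cl by simp
  qed
  then show ?thesis by simp
qed

lemma g_eq: assumes t: "t \<in> pos_times T" and x: "x \<in> {0..a}" shows "g t x = u t x powr (- p) * ut t x"
  unfolding ut_eq[OF t x] using u_pos'[OF t x] by (simp add: mult.assoc[symmetric] powr_add[symmetric])

lemma g_cont: "continuous_on (pos_times T \<times> {0..a}) (\<lambda>(t, x). g t x)"
proof -
  have "continuous_on (pos_times T \<times> {0..a}) (\<lambda>z. u (fst z) (snd z) powr (- p) * ut (fst z) (snd z))"
    using u_cont' ut_cont u_pos' by (intro continuous_intros) (auto simp: case_prod_beta mem_Times_iff less_imp_neq[symmetric])
  then show ?thesis
    by (rule continuous_on_eq) (auto simp: g_eq)
qed

lemma mean_eq: "a * mean a f = integral {0..a} f"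
  unfolding mean_def using a by simp

lemma dW: assumes t: "t \<in> pos_times T" and x: "x \<in> {0..a}"
  shows "((\<lambda>s. u s x powr (1 - p)) has_real_derivative (1 - p) * g t x) (at t)"
  using DERIV_chain2[OF has_real_derivative_powr[OF u_pos'[OF t x]] dt[OF t x], of "1 - p"] g_eq[OF t x]
  by (simp add: mult.assoc)

lemma W_sec: "t \<in> times T \<Longrightarrow> continuous_on {0..a} (\<lambda>x. u t x powr q)"
  using u_pos by (intro continuous_intros sec_times) (auto simp: less_imp_neq[symmetric])

lemma weighted_deriv:
  assumes psi: "continuous_on {0..a} \<psi>" and t: "t \<in> pos_times T"
  shows "((\<lambda>s. integral {0..a} (\<lambda>x. u s x powr (1 - p) * \<psi> x)) has_real_derivative
     integral {0..a} (\<lambda>x. (1 - p) * g t x * \<psi> x)) (at t)"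
proof (rule leibniz_time[OF _ _ _ t])
  show "((\<lambda>s. u s x powr (1 - p) * \<psi> x) has_real_derivative (1 - p) * g s x * \<psi> x) (at s)"
    if "s \<in> pos_times T" "x \<in> {0..a}" for s x
    by (rule DERIV_cmult_right[OF dW[OF that]])
  show "continuous_on {0..a} (\<lambda>x. u s x powr (1 - p) * \<psi> x)" if "s \<in> pos_times T" for s
    by (intro continuous_intros W_sec psi) (use that pos_times_subset in auto)
  have "continuous_on (pos_times T \<times> {0..a}) (\<lambda>z. (1 - p) * g (fst z) (snd z) * \<psi> (snd z))"
    using g_cont by (intro continuous_intros continuous_on_compose2[OF psi]) (auto simp: case_prod_beta)
  then show "continuous_on (pos_times T \<times> {0..a}) (\<lambda>(t, x). (1 - p) * g t x * \<psi> x)"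
    by (simp add: case_prod_beta)
qed

lemma g_integral_zero: assumes t: "t \<in> pos_times T" shows "integral {0..a} (g t) = 0"
proof -
  have "integral {0..a} (uxx t) = 0"
    using ftc_Icc(2)[of a "ux t" "uxx t"] dxx[OF t] neumann[OF t] a by simp
  moreover have "integral {0..a} (g t) = integral {0..a} (uxx t) + integral {0..a} (u t) - integral {0..a} (\<lambda>x. mean a (u t))"
    unfolding g_def using sec[OF t]
    by (subst integral_diff_cont; (subst integral_add_cont)?) (auto intro!: continuous_intros)
  moreover have "integral {0..a} (\<lambda>x. mean a (u t)) = integral {0..a} (u t)"
    using a mean_eq by simp
  ultimately show ?thesis by simp
qed

text \<open>cos solves y'' + y = 0 with Neumann conditions at 0 and pi:
  \<open>ux * cos + u * sin\<close> is a primitive of \<open>(uxx + u) * cos\<close> and vanishes at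
  both ends, and the constant mean is orthogonal to cos.\<close>

lemma g_integral_cos: assumes t: "t \<in> pos_times T" and pi: "a = pi" shows "integral {0..a} (\<lambda>x. g t x * cos x) = 0"
proof -
  have "((\<lambda>x. (uxx t x + u t x) * cos x) has_integral (ux t a * cos a + u t a * sin a - (ux t 0 * cos 0 + u t 0 * sin 0))) {0..a}"
    by (rule ftc_Icc(1)) (use a in \<open>auto intro!: derivative_eq_intros dx[OF t] dxx[OF t] simp: algebra_simps\<close>)
  then have 1: "integral {0..a} (\<lambda>x. (uxx t x + u t x) * cos x) = 0"
    using neumann[OF t] pi by (simp add: integral_unique)
  have "((\<lambda>x. mean a (u t) * cos x) has_integral (mean a (u t) * sin a - mean a (u t) * sin 0)) {0..a}"
    by (rule ftc_Icc(1)) (use a in \<open>auto intro!: derivative_eq_intros\<close>)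
  then have 2: "integral {0..a} (\<lambda>x. mean a (u t) * cos x) = 0"
    using pi by (simp add: integral_unique)
  have "integral {0..a} (\<lambda>x. g t x * cos x) = integral {0..a} (\<lambda>x. (uxx t x + u t x) * cos x - mean a (u t) * cos x)"
    unfolding g_def by (simp add: algebra_simps)
  also have "\<dots> = integral {0..a} (\<lambda>x. (uxx t x + u t x) * cos x) - integral {0..a} (\<lambda>x. mean a (u t) * cos x)"
    using sec[OF t] by (intro integral_diff_cont continuous_intros)
  finally show ?thesis using 1 2 by simp
qed

lemma integral_cont_times:
  fixes F :: "real \<Rightarrow> real \<Rightarrow> real"
  assumes F: "continuous_on (times T \<times> {0..a}) (\<lambda>(t, x). F t x)"
  shows "continuous_on (times T) (\<lambda>t. integral {0..a} (F t))"
  using integral_continuous_on_param[of "times T" 0 a F] F by simp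

lemma W_cont: "continuous_on (times T \<times> {0..a}) (\<lambda>(t, x). u t x powr q)"
proof -
  have "continuous_on (times T \<times> {0..a}) (\<lambda>z. u (fst z) (snd z) powr q)"
    using u_cont u_pos by (intro continuous_intros) (auto simp: case_prod_beta mem_Times_iff less_imp_neq[symmetric])
  then show ?thesis by (simp add: case_prod_beta)
qed

text \<open>The weighted mass has zero derivative for positive times; continuity extends its
  constancy to time 0, where no derivatives are available.\<close>

lemma conserved_from_zero:
  assumes psi: "continuous_on {0..a} \<psi>" and z: "\<And>t. t \<in> pos_times T \<Longrightarrow> integral {0..a} (\<lambda>x. g t x * \<psi> x) = 0"
    and t: "t \<in> times T"
  shows "integral {0..a} (\<lambda>x. u t x powr (1 - p) * \<psi> x) = integral {0..a} (\<lambda>x. u 0 x powr (1 - p) * \<psi> x)"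
proof (cases "t = 0")
  case False
  define F where "F = (\<lambda>s. integral {0..a} (\<lambda>x. u s x powr (1 - p) * \<psi> x))"
  have t0: "0 < t" using t False unfolding times_def by simp
  have sub: "{0..t} \<subseteq> times T" by (rule times_Icc[OF t])
  have "continuous_on (times T \<times> {0..a}) (\<lambda>z. u (fst z) (snd z) powr (1 - p) * \<psi> (snd z))"
  proof (rule continuous_on_mult)
    show "continuous_on (times T \<times> {0..a}) (\<lambda>z. u (fst z) (snd z) powr (1 - p))"
      using W_cont[of "1 - p"] by (simp add: case_prod_beta)
    show "continuous_on (times T \<times> {0..a}) (\<lambda>z. \<psi> (snd z))"
      by (rule continuous_on_compose2[OF psi]) (auto intro!: continuous_intros)
  qed
  then have "continuous_on (times T) F"
    unfolding F_def by (intro integral_cont_times) (simp add: case_prod_beta)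
  then have c: "continuous_on {0..t} F" by (rule continuous_on_subset[OF _ sub])
  have d: "(F has_real_derivative 0) (at s)" if "0 < s" "s < t" for s
  proof -
    have "s \<in> {0..t}" using that by auto
    then have "s \<in> times T" using sub by blast
    then have s: "s \<in> pos_times T" using that unfolding times_def pos_times_def by simp
    have "integral {0..a} (\<lambda>x. (1 - p) * g s x * \<psi> x) = (1 - p) * integral {0..a} (\<lambda>x. g s x * \<psi> x)"
      by (simp add: mult.assoc)
    then show ?thesis using weighted_deriv[OF psi s] z[OF s] unfolding F_def by simp
  qed
  have "F t = F 0" by (rule DERIV_isconst2[OF t0 c d]) (use t0 in auto)
  then show ?thesis unfolding F_def .
qed simp

lemma conserved: "t \<in> times T \<Longrightarrow> integral {0..a} (\<lambda>x. u t x powr (1 - p)) = integral {0..a} (\<lambda>x. u 0 x powr (1 - p))"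
  using conserved_from_zero[of "\<lambda>x. 1" t] g_integral_zero by simp

lemma conserved_cos: "a = pi \<Longrightarrow> t \<in> times T \<Longrightarrow>
   integral {0..a} (\<lambda>x. u t x powr (1 - p) * cos x) = integral {0..a} (\<lambda>x. u 0 x powr (1 - p) * cos x)"
  using conserved_from_zero[of cos t] g_integral_cos by (simp add: continuous_intros)

end

lemma deriv_within_unique:
  fixes f :: "real \<Rightarrow> real"
  assumes "0 < a" "x \<in> {0..a}"
    "(f has_real_derivative D) (at x within {0..a})" "(f has_real_derivative E) (at x within {0..a})"
  shows "D = E"
  using vector_derivative_within_cbox[of 0 a x f D] vector_derivative_within_cbox[of 0 a x f E] assms
  by (simp add: has_real_derivative_iff_has_vector_derivative)

lemma pde_sol_restrict:
  assumes "pde_sol p a T u ut ux uxx" "0 < S" "S \<le> T"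
  shows "pde_sol p a S u ut ux uxx"
proof -
  have sub: "times S \<subseteq> times T" "pos_times S \<subseteq> pos_times T"
    using assms(3) unfolding times_def pos_times_def by (auto intro: less_le_trans)
  interpret pde_sol p a T u ut ux uxx by fact
  show ?thesis
  proof
    show "1 < p" "0 < a" "0 < S" using p a assms by auto
    show "continuous_on (times S \<times> {0..a}) (\<lambda>(t, x). u t x)"
      by (rule continuous_on_subset[OF u_cont]) (use sub in auto)
    show "\<And>t x. t \<in> times S \<Longrightarrow> x \<in> {0..a} \<Longrightarrow> 0 < u t x" using u_pos sub by blast
    have "\<And>f. continuous_on (pos_times T \<times> {0..a}) f \<Longrightarrow> continuous_on (pos_times S \<times> {0..a}) (f :: real \<times> real \<Rightarrow> real)"
      by (erule continuous_on_subset) (use sub in auto)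
    then show "classical_on p a (pos_times S) u ut ux uxx"
      using classical sub(2) unfolding classical_on_def by blast
  qed
qed

text \<open>The derivative \<open>(1 - p) * z powr (- p)\<close> is steepest near 0 and flattest at
  M, so the upper bound alone determines the constant: monotonicity improves where the equation
  degenerates.\<close>

lemma powr_neg_monotone:
  fixes p :: real
  assumes p: "1 < p" and x: "0 < x" "x \<le> M" and y: "0 < y" "y \<le> M"
  shows "(x powr (1 - p) - y powr (1 - p)) * (x - y) \<le> - ((p - 1) * M powr (- p)) * (x - y)\<^sup>2"
proof -
  have main: "(x powr (1 - p) - y powr (1 - p)) * (x - y) \<le> - ((p - 1) * M powr (- p)) * (x - y)\<^sup>2"
    if x: "x \<le> M" and y: "0 < y" and xy: "y < x" for x y
  proof -
    have "((\<lambda>x. x powr (1 - p)) has_real_derivative (1 - p) * z powr (1 - p - 1)) (at z)" if "y \<le> z" "z \<le> x" for z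
      using that y by (intro has_real_derivative_powr) linarith
    from MVT2[OF xy this] obtain z where z: "y < z" "z < x" "x powr (1 - p) - y powr (1 - p) = (x - y) * ((1 - p) * z powr (1 - p - 1))"
      by blast
    have "M powr (- p) \<le> z powr (- p)" using z y x p by (intro powr_mono2') auto
    then have "(p - 1) * M powr (- p) * (x - y)\<^sup>2 \<le> (p - 1) * z powr (- p) * (x - y)\<^sup>2"
      using p by (intro mult_right_mono mult_left_mono) auto
    moreover have "(x powr (1 - p) - y powr (1 - p)) * (x - y) = - ((p - 1) * z powr (- p) * (x - y)\<^sup>2)"
      unfolding z(3) by (simp add: power2_eq_square algebra_simps)
    ultimately show ?thesis by simp
  qed
  show ?thesis
  proof (cases x y rule: linorder_cases)
    case less
    then show ?thesis using main[OF y(2) x(1)] by (simp add: power2_commute algebra_simps)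
  next
    case greater
    then show ?thesis using main[OF x(2) y(1)] by simp
  qed simp
qed

section \<open>Uniqueness\<close>

lemma param_integral_local:
  fixes k :: "real \<Rightarrow> real \<Rightarrow> real"
  assumes I: "open I" and k: "continuous_on (I \<times> {0..a}) (\<lambda>(t, x). k t x)"
  shows "continuous_on (I \<times> {0..a}) (\<lambda>(t, x). integral {0..x} (k t))"
proof (rule continuous_on_local_time)
  fix t assume t: "t \<in> I"
  then obtain e where e: "0 < e" "cball t e \<subseteq> I" using I open_contains_cball by blast
  have "continuous_on ({t - e..t + e} \<times> {0..a}) (\<lambda>(t, x). integral {0..x} (k t))"
    by (rule continuous_on_param_integral, simp, rule continuous_on_subset[OF k])
      (use e in \<open>auto simp: cball_eq_atLeastAtMost\<close>)
  then have "continuous_on (({t - e<..<t + e} \<inter> I) \<times> {0..a}) (\<lambda>(t, x). integral {0..x} (k t))"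
    by (rule continuous_on_subset) auto
  then show "\<exists>J. open J \<and> t \<in> J \<and> continuous_on ((J \<inter> I) \<times> {0..a}) (\<lambda>(t, x). integral {0..x} (k t))"
    using e by (intro exI[of _ "{t - e<..<t + e}"]) auto
qed

text \<open>The squared distance in the dual of H1 of the conserved densities \<open>u powr (1 - p)\<close> satisfies a Gronwall
  inequality whose constants only involve an upper bound of the two solutions, so that no regularity
  at time 0 is needed.\<close>
lemma pde_sol_unique:
  assumes u: "pde_sol p a T u ut ux uxx" and v: "pde_sol p a T v vt vx vxx"
    and init: "\<And>x. x \<in> {0..a} \<Longrightarrow> u 0 x = v 0 x" and S: "S \<in> pos_times T" and x: "x \<in> {0..a}"
  shows "u S x = v S x"
proof -
  interpret U: pde_sol p a T u ut ux uxx by fact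
  interpret V: pde_sol p a T v vt vx vxx by fact
  note p = U.p and a = U.a
  have S0: "0 < S" using S unfolding pos_times_def by simp
  have St: "S \<in> times T" using S pos_times_subset by blast
  have sub: "{0..S} \<subseteq> times T" by (rule times_Icc[OF St])
  have posS: "t \<in> pos_times T" if "0 < t" "t < S" for t
  proof -
    have "t \<in> times T" using sub that by auto
    then show ?thesis using that unfolding times_def pos_times_def by simp
  qed
  have bdd: "\<exists>C. \<forall>t\<in>{0..S}. \<forall>x\<in>{0..a}. w t x \<le> C" if w: "continuous_on (times T \<times> {0..a}) (\<lambda>(t, x). w t x)" for w :: "real \<Rightarrow> real \<Rightarrow> real"
  proof -
    have "continuous_on ({0..S} \<times> {0..a}) (\<lambda>(t, x). w t x)"
      by (rule continuous_on_subset[OF w]) (use sub in auto)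
    then have "compact ((\<lambda>(t, x). w t x) ` ({0..S} \<times> {0..a}))"
      by (rule compact_continuous_image) (intro compact_Times compact_Icc)
    then obtain C where C: "\<forall>y\<in>(\<lambda>(t, x). w t x) ` ({0..S} \<times> {0..a}). norm y \<le> C"
      using compact_imp_bounded bounded_iff by metis
    have "w t x \<le> C" if "t \<in> {0..S}" "x \<in> {0..a}" for t x
    proof -
      have "(\<lambda>(t, x). w t x) (t, x) \<in> (\<lambda>(t, x). w t x) ` ({0..S} \<times> {0..a})" using that by blast
      from bspec[OF C this] show ?thesis by (simp add: abs_le_iff)
    qed
    then show ?thesis by blast
  qed
  obtain C1 C2 where C: "\<And>t x. t \<in> {0..S} \<Longrightarrow> x \<in> {0..a} \<Longrightarrow> u t x \<le> C1" "\<And>t x. t \<in> {0..S} \<Longrightarrow> x \<in> {0..a} \<Longrightarrow> v t x \<le> C2"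
    using bdd[OF U.u_cont] bdd[OF V.u_cont] by metis
  define M where "M = max 1 (max C1 C2)"
  have M: "0 < M" "\<And>t x. t \<in> {0..S} \<Longrightarrow> x \<in> {0..a} \<Longrightarrow> u t x \<le> M" "\<And>t x. t \<in> {0..S} \<Longrightarrow> x \<in> {0..a} \<Longrightarrow> v t x \<le> M"
  proof -
    have CM: "C1 \<le> M" "C2 \<le> M" unfolding M_def by simp_all
    show "0 < M" unfolding M_def by simp
    show "\<And>t x. t \<in> {0..S} \<Longrightarrow> x \<in> {0..a} \<Longrightarrow> u t x \<le> M" using C(1) CM(1) order_trans by blast
    show "\<And>t x. t \<in> {0..S} \<Longrightarrow> x \<in> {0..a} \<Longrightarrow> v t x \<le> M" using C(2) CM(2) order_trans by blast
  qed
  define \<kappa> where "\<kappa> = (p - 1) * M powr (- p)"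
  have kap: "0 < \<kappa>" unfolding \<kappa>_def using p M by simp
  \<comment> \<open>Weight for Young's inequality in the term Q: with it the cost
    \<open>a\<^sup>2 * d2 / c\<close> equals \<open>\<kappa> * d2\<close>, which the negative term P
    can pay.\<close>
  define c where "c = a\<^sup>2 / \<kappa>"
  have c: "0 < c" unfolding c_def using a kap by simp
  define e where "e = (\<lambda>t y. u t y powr (1 - p) - v t y powr (1 - p))"
  define k where "k = (\<lambda>t y. (1 - p) * (U.g t y - V.g t y))"
  \<comment> \<open>Conservation of mass makes \<Phi> vanish at both ends, so the L2 norm of this
    primitive is a dual norm of e.\<close>
  define \<Phi> where "\<Phi> = (\<lambda>t x. integral {0..x} (e t))"
  define \<Phi>t where "\<Phi>t = (\<lambda>t x. integral {0..x} (k t))"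
  define N where "N = (\<lambda>t. integral {0..a} (\<lambda>x. (\<Phi> t x)\<^sup>2))"
  have e_cont: "continuous_on (times T \<times> {0..a}) (\<lambda>(t, x). e t x)"
    unfolding e_def case_prod_beta using U.W_cont[of "1 - p"] V.W_cont[of "1 - p"] unfolding case_prod_beta by (rule continuous_on_diff)
  have e_sec: "continuous_on {0..a} (e t)" if "t \<in> times T" for t
    by (rule section_cont[OF e_cont that])
  have k_cont: "continuous_on (pos_times T \<times> {0..a}) (\<lambda>(t, x). k t x)"
    unfolding k_def case_prod_beta using U.g_cont V.g_cont unfolding case_prod_beta by (intro continuous_intros)
  have de: "((\<lambda>s. e s y) has_real_derivative k t y) (at t)" if "t \<in> pos_times T" "y \<in> {0..a}" for t y
    unfolding e_def k_def using DERIV_diff[OF U.dW[OF that] V.dW[OF that]] by (simp add: algebra_simps)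
  have d\<Phi>: "((\<lambda>s. \<Phi> s y) has_real_derivative \<Phi>t t y) (at t)" if t: "t \<in> pos_times T" and y: "y \<in> {0..a}" for t y
    unfolding \<Phi>_def \<Phi>t_def
  proof (rule leibniz_time[OF _ _ _ t])
    show "\<And>t x. t \<in> pos_times T \<Longrightarrow> x \<in> {0..y} \<Longrightarrow> ((\<lambda>s. e s x) has_real_derivative k t x) (at t)"
      using de y by auto
    show "\<And>t. t \<in> pos_times T \<Longrightarrow> continuous_on {0..y} (e t)"
      using continuous_on_subset[OF e_sec] pos_times_subset y by force
    show "continuous_on (pos_times T \<times> {0..y}) (\<lambda>(t, x). k t x)"
      by (rule continuous_on_subset[OF k_cont]) (use y in auto)
  qed
  have \<Phi>_cont: "continuous_on (pos_times T \<times> {0..a}) (\<lambda>(t, x). \<Phi> t x)"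
    unfolding \<Phi>_def
    by (rule param_integral_local[OF pos_times_interval(1)], rule continuous_on_subset[OF e_cont])
      (use pos_times_subset in auto)
  have \<Phi>t_cont: "continuous_on (pos_times T \<times> {0..a}) (\<lambda>(t, x). \<Phi>t t x)"
    unfolding \<Phi>t_def by (rule param_integral_local[OF pos_times_interval(1) k_cont])
  have \<Phi>_sec: "continuous_on {0..a} (\<Phi> t)" if "t \<in> times T" for t
    unfolding \<Phi>_def by (intro indefinite_integral_continuous_1 integrable_continuous_real e_sec that)
  have \<Phi>t_sec: "continuous_on {0..a} (\<Phi>t t)" if "t \<in> pos_times T" for t
    by (rule section_cont[OF \<Phi>t_cont that])
  have dN: "(N has_real_derivative integral {0..a} (\<lambda>x. 2 * \<Phi> t x * \<Phi>t t x)) (at t)" if t: "t \<in> pos_times T" for t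
    unfolding N_def
  proof (rule leibniz_time[OF _ _ _ t])
    show "((\<lambda>s. (\<Phi> s x)\<^sup>2) has_real_derivative 2 * \<Phi> s x * \<Phi>t s x) (at s)" if "s \<in> pos_times T" "x \<in> {0..a}" for s x
      using DERIV_power[OF d\<Phi>[OF that], of 2] by (simp add: mult.assoc mult.commute mult.left_commute)
    show "continuous_on {0..a} (\<lambda>x. (\<Phi> s x)\<^sup>2)" if "s \<in> pos_times T" for s
      by (intro continuous_intros \<Phi>_sec) (use that pos_times_subset in auto)
    show "continuous_on (pos_times T \<times> {0..a}) (\<lambda>(t, x). 2 * \<Phi> t x * \<Phi>t t x)"
      using \<Phi>_cont \<Phi>t_cont unfolding case_prod_beta by (intro continuous_intros)
  qed
  have N_cont: "continuous_on {0..S} N"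
  proof -
    have "continuous_on ({0..S} \<times> {0..a}) (\<lambda>(t, x). \<Phi> t x)"
      unfolding \<Phi>_def
      by (rule continuous_on_param_integral, simp, rule continuous_on_subset[OF e_cont]) (use sub in auto)
    then have "continuous_on ({0..S} \<times> {0..a}) (\<lambda>(t, x). (\<Phi> t x)\<^sup>2)"
      unfolding case_prod_beta by (intro continuous_intros)
    then show ?thesis unfolding N_def using integral_continuous_on_param[of "{0..S}" 0 a "\<lambda>t x. (\<Phi> t x)\<^sup>2"] by simp
  qed
  have \<Phi>a: "\<Phi> t a = 0" if t: "t \<in> times T" for t
  proof -
    have "\<Phi> t a = integral {0..a} (\<lambda>x. u t x powr (1 - p)) - integral {0..a} (\<lambda>x. v t x powr (1 - p))"
      unfolding \<Phi>_def e_def by (rule integral_diff_cont) (rule U.W_sec[OF t] V.W_sec[OF t])+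
    also have "integral {0..a} (\<lambda>x. u t x powr (1 - p)) = integral {0..a} (\<lambda>x. u 0 x powr (1 - p))"
      by (rule U.conserved[OF t])
    also have "\<dots> = integral {0..a} (\<lambda>x. v 0 x powr (1 - p))"
      by (rule integral_cong) (use init in auto)
    also have "\<dots> = integral {0..a} (\<lambda>x. v t x powr (1 - p))"
      by (rule V.conserved[OF t, symmetric])
    finally show ?thesis by simp
  qed
  have ineq: "integral {0..a} (\<lambda>x. 2 * \<Phi> t x * \<Phi>t t x) \<le> (p - 1) * c * N t" if t: "0 < t" "t < S" for t
  proof -
    have tp: "t \<in> pos_times T" and tt: "t \<in> times T" and tS: "t \<in> {0..S}"
      using posS[OF t] pos_times_subset t by auto
    define d where "d = (\<lambda>y. u t y - v t y)"
    define db where "db = mean a (u t) - mean a (v t)"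
    define Dd where "Dd = (\<lambda>x. integral {0..x} (\<lambda>y. d y - db))"
    have d_c: "continuous_on {0..a} d" unfolding d_def by (intro continuous_intros U.sec V.sec tp)
    have dd_c: "continuous_on {0..a} (\<lambda>y. d y - db)" by (intro continuous_intros d_c)
    have Dd_c: "continuous_on {0..a} Dd"
      unfolding Dd_def by (intro indefinite_integral_continuous_1 integrable_continuous_real dd_c)
    define dx where "dx = (\<lambda>y. ux t y - vx t y)"
    have dx_c: "continuous_on {0..a} dx" unfolding dx_def by (intro continuous_intros U.sec V.sec tp)
    have d_der: "(d has_real_derivative dx y) (at y within {0..a})" if "y \<in> {0..a}" for y
      unfolding d_def dx_def by (intro DERIV_diff U.dx V.dx tp that)
    \<comment> \<open>The difference of the equations integrated once in x, using the Neumann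
      condition at 0.\<close>
    have \<Phi>t_eq: "\<Phi>t t y = (1 - p) * (dx y + Dd y)" if y: "y \<in> {0..a}" for y
    proof -
      have uy: "0 \<le> y" and suby: "{0..y} \<subseteq> {0..a}" using y by auto
      have 1: "integral {0..y} (\<lambda>z. uxx t z - vxx t z) = dx y - dx 0"
      proof (rule ftc_Icc(2)[OF uy])
        fix z assume "z \<in> {0..y}"
        then have z: "z \<in> {0..a}" using suby by blast
        have "(dx has_real_derivative uxx t z - vxx t z) (at z within {0..a})"
          unfolding dx_def by (intro DERIV_diff U.dxx V.dxx tp z)
        then show "(dx has_real_derivative uxx t z - vxx t z) (at z within {0..y})"
          by (rule DERIV_subset[OF _ suby])
      qed
      have "\<Phi>t t y = (1 - p) * integral {0..y} (\<lambda>z. U.g t z - V.g t z)" unfolding \<Phi>t_def k_def by simp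
      also have "integral {0..y} (\<lambda>z. U.g t z - V.g t z) = integral {0..y} (\<lambda>z. (uxx t z - vxx t z) + (d z - db))"
        unfolding U.g_def V.g_def d_def db_def by (rule integral_cong) simp
      also have "\<dots> = integral {0..y} (\<lambda>z. uxx t z - vxx t z) + integral {0..y} (\<lambda>z. d z - db)"
        by (rule integral_add_cont; rule continuous_on_subset[OF _ suby]) (intro continuous_intros U.sec V.sec d_c tp)+
      also have "\<dots> = dx y + Dd y" unfolding 1 Dd_def using U.neumann(1)[OF tp] V.neumann(1)[OF tp] by (simp add: dx_def)
      finally show ?thesis .
    qed
    define P where "P = integral {0..a} (\<lambda>y. e t y * d y)"
    define Q where "Q = integral {0..a} (\<lambda>y. \<Phi> t y * Dd y)"
    define d2 where "d2 = integral {0..a} (\<lambda>y. (d y)\<^sup>2)"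
    \<comment> \<open>Integration by parts without boundary terms, since e is the derivative of
      \<Phi> and \<Phi> vanishes at 0 and a.\<close>
    have parts: "integral {0..a} (\<lambda>y. \<Phi> t y * dx y) = - P"
    proof -
      have "integral {0..a} (\<lambda>y. e t y * d y + \<Phi> t y * dx y) = \<Phi> t a * d a - \<Phi> t 0 * d 0"
      proof (rule ftc_Icc(2))
        fix y assume y: "y \<in> {0..a}"
        have 1: "(\<Phi> t has_real_derivative e t y) (at y within {0..a})"
          unfolding \<Phi>_def by (rule integral_has_real_derivative[OF e_sec[OF tt] y])
        show "((\<lambda>y. \<Phi> t y * d y) has_real_derivative e t y * d y + \<Phi> t y * dx y) (at y within {0..a})"
          using DERIV_mult[OF 1 d_der[OF y]] by (simp add: mult.commute)
      qed (use a in auto)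
      also have "\<dots> = 0" using \<Phi>a[OF tt] by (simp add: \<Phi>_def)
      finally have "integral {0..a} (\<lambda>y. e t y * d y + \<Phi> t y * dx y) = 0" .
      moreover have "integral {0..a} (\<lambda>y. e t y * d y + \<Phi> t y * dx y) = P + integral {0..a} (\<lambda>y. \<Phi> t y * dx y)"
        unfolding P_def by (rule integral_add_cont) (intro continuous_intros e_sec \<Phi>_sec tt d_c dx_c)+
      ultimately show ?thesis by simp
    qed
    have whole: "integral {0..a} (\<lambda>x. 2 * \<Phi> t x * \<Phi>t t x) = 2 * (p - 1) * (P - Q)"
    proof -
      have "integral {0..a} (\<lambda>x. 2 * \<Phi> t x * \<Phi>t t x) = integral {0..a} (\<lambda>x. (2 * (1 - p)) * (\<Phi> t x * dx x + \<Phi> t x * Dd x))"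
        by (rule integral_cong) (simp add: \<Phi>t_eq algebra_simps)
      also have "\<dots> = 2 * (1 - p) * integral {0..a} (\<lambda>x. \<Phi> t x * dx x + \<Phi> t x * Dd x)" by simp
      also have "integral {0..a} (\<lambda>x. \<Phi> t x * dx x + \<Phi> t x * Dd x) = - P + Q"
        unfolding Q_def parts[symmetric] by (rule integral_add_cont) (intro continuous_intros \<Phi>_sec tt dx_c Dd_c)+
      finally show ?thesis by (simp add: algebra_simps)
    qed
    have Pb: "P \<le> - \<kappa> * d2"
    proof -
      have "P \<le> integral {0..a} (\<lambda>y. - \<kappa> * (d y)\<^sup>2)"
        unfolding P_def
      proof (rule integral_mono_cont)
        fix y assume y: "y \<in> {0..a}"
        show "e t y * d y \<le> - \<kappa> * (d y)\<^sup>2"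
          unfolding e_def d_def \<kappa>_def
          by (rule powr_neg_monotone[OF p]) (use U.u_pos[OF tt y] V.u_pos[OF tt y] M(2)[OF tS y] M(3)[OF tS y] in auto)
      qed (intro continuous_intros e_sec tt d_c)+
      then show ?thesis unfolding d2_def by simp
    qed
    have dbI: "integral {0..a} d = a * db"
    proof -
      have "integral {0..a} d = integral {0..a} (u t) - integral {0..a} (v t)"
        unfolding d_def by (rule integral_diff_cont) (rule U.sec V.sec tp)+
      then show ?thesis unfolding db_def using U.mean_eq[of "u t"] U.mean_eq[of "v t"] by (simp add: algebra_simps)
    qed
    have var: "integral {0..a} (\<lambda>y. (d y - db)\<^sup>2) \<le> d2"
    proof -
      have "integral {0..a} (\<lambda>y. (d y - db)\<^sup>2) = d2 - 2 * db * integral {0..a} (\<lambda>y. d y * 1) + db\<^sup>2 * integral {0..a} (\<lambda>y. 1\<^sup>2)"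
        unfolding d2_def using integral_square_expand[OF d_c, of "\<lambda>y. 1" db] by (simp add: continuous_intros)
      also have "\<dots> = d2 - a * db\<^sup>2" using dbI a by (simp add: power2_eq_square)
      finally show ?thesis using a by simp
    qed
    have Ddb: "(Dd y)\<^sup>2 \<le> a * d2" if y: "y \<in> {0..a}" for y
    proof -
      have J: "0 \<le> integral {0..a} (\<lambda>y. (d y - db)\<^sup>2)" by (rule integral_nonneg_cont) (intro continuous_intros d_c, simp)
      have "\<bar>Dd y\<bar> \<le> sqrt (a * integral {0..a} (\<lambda>y. (d y - db)\<^sup>2))"
        unfolding Dd_def by (rule integral_abs_le_sqrt[OF dd_c]) (use y in auto)
      then have "(Dd y)\<^sup>2 \<le> (sqrt (a * integral {0..a} (\<lambda>y. (d y - db)\<^sup>2)))\<^sup>2"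
        by (metis abs_ge_zero power2_abs power_mono)
      also have "\<dots> = a * integral {0..a} (\<lambda>y. (d y - db)\<^sup>2)" using a J by simp
      also have "\<dots> \<le> a * d2" using var a by simp
      finally show ?thesis .
    qed
    have Qb: "- 2 * Q \<le> c * N t + a\<^sup>2 * d2 / c"
    proof -
      have "- 2 * Q = integral {0..a} (\<lambda>y. (- 2) * (\<Phi> t y * Dd y))" unfolding Q_def by simp
      also have "\<dots> \<le> integral {0..a} (\<lambda>y. c * (\<Phi> t y)\<^sup>2 + a * d2 / c)"
      proof (rule integral_mono_cont)
        fix y assume y: "y \<in> {0..a}"
        have "0 \<le> (c * \<Phi> t y + Dd y)\<^sup>2 / c" using c by simp
        also have "\<dots> = c * (\<Phi> t y)\<^sup>2 + 2 * (\<Phi> t y * Dd y) + (Dd y)\<^sup>2 / c" using c by (simp add: power2_eq_square field_simps)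
        also have "(Dd y)\<^sup>2 / c \<le> a * d2 / c" using Ddb[OF y] c by (intro divide_right_mono) auto
        finally show "(- 2) * (\<Phi> t y * Dd y) \<le> c * (\<Phi> t y)\<^sup>2 + a * d2 / c" by simp
      qed (intro continuous_intros \<Phi>_sec tt Dd_c)+
      also have "\<dots> = integral {0..a} (\<lambda>y. c * (\<Phi> t y)\<^sup>2) + integral {0..a} (\<lambda>y. a * d2 / c)"
        by (rule integral_add_cont) (intro continuous_intros \<Phi>_sec tt)+
      also have "\<dots> = c * N t + a\<^sup>2 * d2 / c" unfolding N_def using a by (simp add: power2_eq_square)
      finally show ?thesis .
    qed
    have "a\<^sup>2 * d2 / c = \<kappa> * d2" unfolding c_def using a kap by simp
    moreover have "0 \<le> d2" unfolding d2_def by (rule integral_nonneg_cont) (intro continuous_intros d_c, simp)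
    then have "0 \<le> \<kappa> * d2" using kap by simp
    ultimately have "2 * (P - Q) \<le> c * N t" using Pb Qb by simp
    then have "(p - 1) * (2 * (P - Q)) \<le> (p - 1) * (c * N t)" using p by (intro mult_left_mono) auto
    moreover have "2 * (p - 1) * (P - Q) = (p - 1) * (2 * (P - Q))" "(p - 1) * c * N t = (p - 1) * (c * N t)"
      by (simp_all only: ac_simps)
    ultimately show ?thesis unfolding whole by (simp only:)
  qed
  define K where "K = (p - 1) * c"
  \<comment> \<open>Gronwall's inequality; at time 0 only continuity of N is used.\<close>
  have "exp (- K * S) * N S \<le> exp (- K * 0) * N 0"
  proof (rule nonincreasing_from_deriv[where f = "\<lambda>t. exp (- K * t) * N t"
        and f' = "\<lambda>t. exp (- K * t) * (integral {0..a} (\<lambda>x. 2 * \<Phi> t x * \<Phi>t t x) - K * N t)"])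
    show "0 \<le> S" using S0 by simp
    show "continuous_on {0..S} (\<lambda>t. exp (- K * t) * N t)" by (intro continuous_intros N_cont)
    fix t assume t: "0 < t" "t < S"
    have "((\<lambda>t. exp (- K * t)) has_real_derivative exp (- K * t) * - K) (at t)"
      by (auto intro!: derivative_eq_intros)
    from DERIV_mult[OF this dN[OF posS[OF t]]]
    show "((\<lambda>t. exp (- K * t) * N t) has_real_derivative exp (- K * t) * (integral {0..a} (\<lambda>x. 2 * \<Phi> t x * \<Phi>t t x) - K * N t)) (at t)"
      by (simp add: algebra_simps)
    show "exp (- K * t) * (integral {0..a} (\<lambda>x. 2 * \<Phi> t x * \<Phi>t t x) - K * N t) \<le> 0"
      using ineq[OF t] unfolding K_def by (intro mult_nonneg_nonpos) auto
  qed
  moreover have "N 0 = 0"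
  proof -
    have "\<Phi> 0 y = 0" if y: "y \<in> {0..a}" for y
    proof -
      have "\<Phi> 0 y = integral {0..y} (\<lambda>z. 0)" unfolding \<Phi>_def
        by (rule integral_cong) (use init y in \<open>auto simp: e_def\<close>)
      then show ?thesis by simp
    qed
    then have "N 0 = integral {0..a} (\<lambda>x. 0)" unfolding N_def by (intro integral_cong) simp
    then show ?thesis by simp
  qed
  ultimately have "N S \<le> 0" by (simp add: mult_le_0_iff)
  moreover have "0 \<le> N S" unfolding N_def by (rule integral_nonneg_cont) (intro continuous_intros \<Phi>_sec St, simp)
  ultimately have "N S = 0" by simp
  then have "\<forall>x\<in>{0..a}. (\<Phi> S x)\<^sup>2 = 0"
    unfolding N_def using integral_eq_0_iff[of 0 a "\<lambda>x. (\<Phi> S x)\<^sup>2"] \<Phi>_sec[OF St] a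
    by (simp add: continuous_intros)
  then have z: "\<Phi> S y = 0" if "y \<in> {0..a}" for y using that by simp
  have "(\<Phi> S has_real_derivative e S x) (at x within {0..a})"
    unfolding \<Phi>_def by (rule integral_has_real_derivative[OF e_sec[OF St] x])
  moreover have "(\<Phi> S has_real_derivative 0) (at x within {0..a})"
    by (rule has_field_derivative_transform_within[where d = 1 and f = "\<lambda>x. 0"]) (use x z in auto)
  ultimately have "e S x = 0" using deriv_within_unique[OF a x] by blast
  then have eq: "u S x powr (1 - p) = v S x powr (1 - p)" unfolding e_def by simp
  have "(u S x powr (1 - p)) powr (1 / (1 - p)) = (v S x powr (1 - p)) powr (1 / (1 - p))" unfolding eq ..
  then show ?thesis using p U.u_pos[OF St x] V.u_pos[OF St x] by (simp add: powr_powr)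
qed

section \<open>Continuation and maximal solutions\<close>

text \<open>The derivatives of a solution are determined by the solution, which makes being classical a
  property that is local in time.\<close>

definition deriv_Icc :: "real \<Rightarrow> (real \<Rightarrow> real) \<Rightarrow> real \<Rightarrow> real" where
  "deriv_Icc a f x = vector_derivative f (at x within {0..a})"

lemma deriv_Icc_eq:
  assumes "0 < a" "x \<in> {0..a}" "(f has_real_derivative D) (at x within {0..a})"
  shows "deriv_Icc a f x = D"
  unfolding deriv_Icc_def using vector_derivative_within_closed_interval[of 0 a x f D] assms
  by (simp add: has_real_derivative_iff_has_vector_derivative)

lemma mean_cong: "(\<And>x. x \<in> {0..a} \<Longrightarrow> f x = g x) \<Longrightarrow> mean a f = mean a g"
  unfolding mean_def by (metis integral_cong)

lemma classical_on_canonical: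
  assumes a: "0 < a" and I: "open I" and cl: "classical_on p a I w wt wx wxx"
    and eq: "\<And>t x. t \<in> I \<Longrightarrow> x \<in> {0..a} \<Longrightarrow> u t x = w t x"
  shows "classical_on p a I u (\<lambda>t x. deriv (\<lambda>s. u s x) t) (\<lambda>t. deriv_Icc a (u t)) (\<lambda>t. deriv_Icc a (deriv_Icc a (u t)))"
proof -
  have W: "continuous_on (I \<times> {0..a}) (\<lambda>(t, x). wt t x)" "continuous_on (I \<times> {0..a}) (\<lambda>(t, x). wx t x)"
    "continuous_on (I \<times> {0..a}) (\<lambda>(t, x). wxx t x)"
    and d: "\<And>t x. t \<in> I \<Longrightarrow> x \<in> {0..a} \<Longrightarrow> ((\<lambda>s. w s x) has_real_derivative wt t x) (at t)"
      "\<And>t x. t \<in> I \<Longrightarrow> x \<in> {0..a} \<Longrightarrow> (w t has_real_derivative wx t x) (at x within {0..a})"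
      "\<And>t x. t \<in> I \<Longrightarrow> x \<in> {0..a} \<Longrightarrow> (wx t has_real_derivative wxx t x) (at x within {0..a})"
    and pde: "\<And>t x. t \<in> I \<Longrightarrow> x \<in> {0<..<a} \<Longrightarrow> wt t x = w t x powr p * (wxx t x + w t x - mean a (w t))"
    and neu: "\<And>t. t \<in> I \<Longrightarrow> wx t 0 = 0" "\<And>t. t \<in> I \<Longrightarrow> wx t a = 0"
    using cl unfolding classical_on_def by blast+
  have 1: "((\<lambda>s. u s x) has_real_derivative wt t x) (at t)" if "t \<in> I" "x \<in> {0..a}" for t x
    by (rule has_field_derivative_transform_within_open[OF d(1)[OF that] I that(1)]) (use eq that in auto)
  have 2: "(u t has_real_derivative wx t x) (at x within {0..a})" if "t \<in> I" "x \<in> {0..a}" for t x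
    by (rule has_field_derivative_transform_within[OF d(2)[OF that] zero_less_one that(2)]) (use eq that in auto)
  have e1: "deriv (\<lambda>s. u s x) t = wt t x" if "t \<in> I" "x \<in> {0..a}" for t x
    by (rule DERIV_imp_deriv[OF 1[OF that]])
  have e2: "deriv_Icc a (u t) x = wx t x" if "t \<in> I" "x \<in> {0..a}" for t x
    by (rule deriv_Icc_eq[OF a that(2) 2[OF that]])
  have 3: "(deriv_Icc a (u t) has_real_derivative wxx t x) (at x within {0..a})" if "t \<in> I" "x \<in> {0..a}" for t x
    by (rule has_field_derivative_transform_within[OF d(3)[OF that] zero_less_one that(2)]) (use e2 that in auto)
  have e3: "deriv_Icc a (deriv_Icc a (u t)) x = wxx t x" if "t \<in> I" "x \<in> {0..a}" for t x
    by (rule deriv_Icc_eq[OF a that(2) 3[OF that]])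
  show ?thesis
    unfolding classical_on_def
  proof (intro conjI ballI)
    show "continuous_on (I \<times> {0..a}) (\<lambda>(t, x). deriv (\<lambda>s. u s x) t)"
      by (rule continuous_on_eq[OF W(1)]) (auto simp: e1)
    show "continuous_on (I \<times> {0..a}) (\<lambda>(t, x). deriv_Icc a (u t) x)"
      by (rule continuous_on_eq[OF W(2)]) (auto simp: e2)
    show "continuous_on (I \<times> {0..a}) (\<lambda>(t, x). deriv_Icc a (deriv_Icc a (u t)) x)"
      by (rule continuous_on_eq[OF W(3)]) (auto simp: e3)
    fix t assume t: "t \<in> I"
    show "deriv_Icc a (u t) 0 = 0" "deriv_Icc a (u t) a = 0" using e2[OF t] neu[OF t] a by auto
    show "((\<lambda>s. u s x) has_real_derivative deriv (\<lambda>s. u s x) t) (at t)" if "x \<in> {0..a}" for x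
      unfolding e1[OF t that] by (rule 1[OF t that])
    show "(u t has_real_derivative deriv_Icc a (u t) x) (at x within {0..a})" if "x \<in> {0..a}" for x
      unfolding e2[OF t that] by (rule 2[OF t that])
    show "(deriv_Icc a (u t) has_real_derivative deriv_Icc a (deriv_Icc a (u t)) x) (at x within {0..a})" if "x \<in> {0..a}" for x
      unfolding e3[OF t that] by (rule 3[OF t that])
    fix x assume x: "x \<in> {0<..<a}"
    then have x': "x \<in> {0..a}" by auto
    have "mean a (u t) = mean a (w t)" by (rule mean_cong) (use eq t in auto)
    then show "deriv (\<lambda>s. u s x) t = u t x powr p * (deriv_Icc a (deriv_Icc a (u t)) x + u t x - mean a (u t))"
      using pde[OF t x] e1[OF t x'] e3[OF t x'] eq[OF t x'] by simp
  qed
qed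

text \<open>Each local piece is rewritten with the canonical derivatives of u itself. These agree on
  overlaps automatically, so gluing requires no comparison of witnesses.\<close>

lemma classical_on_Union:
  assumes a: "0 < a"
    and cov: "\<And>t. t \<in> I \<Longrightarrow> \<exists>J w wt wx wxx. open J \<and> t \<in> J \<and> J \<subseteq> I \<and> classical_on p a J w wt wx wxx \<and> (\<forall>t\<in>J. \<forall>x\<in>{0..a}. u t x = w t x)"
  shows "\<exists>ut ux uxx. classical_on p a I u ut ux uxx"
proof -
  define ut ux uxx where "ut = (\<lambda>t x. deriv (\<lambda>s. u s x) t)" and "ux = (\<lambda>t. deriv_Icc a (u t))" and "uxx = (\<lambda>t. deriv_Icc a (deriv_Icc a (u t)))"
  have loc: "\<exists>J. open J \<and> t \<in> J \<and> J \<subseteq> I \<and> classical_on p a J u ut ux uxx" if t: "t \<in> I" for t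
  proof -
    obtain J w wt wx wxx where J: "open J" "t \<in> J" "J \<subseteq> I" "classical_on p a J w wt wx wxx" "\<forall>t\<in>J. \<forall>x\<in>{0..a}. u t x = w t x"
      using cov[OF t] by blast
    have "classical_on p a J u ut ux uxx" unfolding ut_def ux_def uxx_def
      by (rule classical_on_canonical[OF a J(1,4)]) (use J(5) in blast)
    with J show ?thesis by blast
  qed
  have cont: "continuous_on (I \<times> {0..a}) f"
    if f: "\<And>J. classical_on p a J u ut ux uxx \<Longrightarrow> continuous_on (J \<times> {0..a}) f" for f :: "real \<times> real \<Rightarrow> real"
  proof (rule continuous_on_local_time)
    fix t assume "t \<in> I"
    then obtain J where J: "open J" "t \<in> J" "J \<subseteq> I" "classical_on p a J u ut ux uxx" using loc by blast
    have "J \<inter> I = J" using J(3) by blast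
    then show "\<exists>J. open J \<and> t \<in> J \<and> continuous_on ((J \<inter> I) \<times> {0..a}) f"
      using J f[OF J(4)] by (intro exI[of _ J]) simp
  qed
  have "classical_on p a I u ut ux uxx"
    unfolding classical_on_def
  proof (intro conjI)
    show "continuous_on (I \<times> {0..a}) (\<lambda>(t, x). ut t x)" "continuous_on (I \<times> {0..a}) (\<lambda>(t, x). ux t x)"
      "continuous_on (I \<times> {0..a}) (\<lambda>(t, x). uxx t x)"
      by (rule cont, simp add: classical_on_def)+
  qed (use loc in \<open>unfold classical_on_def, blast\<close>)+
  then show ?thesis by blast
qed

section \<open>Shifting, restarting and continuing solutions\<close>

lemma classical_on_shift:
  assumes "classical_on p a I w wt wx wxx"
  shows "classical_on p a {t. t - s \<in> I} (\<lambda>t. w (t - s)) (\<lambda>t. wt (t - s)) (\<lambda>t. wx (t - s)) (\<lambda>t. wxx (t - s))"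
proof -
  have c: "continuous_on ({t. t - s \<in> I} \<times> {0..a}) (\<lambda>(t, x). f (t - s) x)"
    if "continuous_on (I \<times> {0..a}) (\<lambda>(t, x). f t x)" for f :: "real \<Rightarrow> real \<Rightarrow> real"
  proof -
    have "continuous_on ({t. t - s \<in> I} \<times> {0..a}) (\<lambda>z. (\<lambda>(t, x). f t x) (fst z - s, snd z))"
      by (rule continuous_on_compose2[OF that]) (auto intro!: continuous_intros)
    then show ?thesis by (simp add: case_prod_beta)
  qed
  have d: "((\<lambda>r. w (r - s) x) has_real_derivative wt (t - s) x) (at t)" if "t - s \<in> I" "x \<in> {0..a}" for t x
  proof -
    have "((\<lambda>r. w r x) has_real_derivative wt (t - s) x) (at (t - s))"
      using assms that unfolding classical_on_def by blast
    moreover have "((\<lambda>r. r - s) has_real_derivative 1) (at t)" by (auto intro!: derivative_eq_intros)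
    ultimately show ?thesis
      using DERIV_chain2[where f = "\<lambda>r. w r x" and g = "\<lambda>r. r - s" and x = t and s = UNIV] by fastforce
  qed
  show ?thesis
    using assms c d unfolding classical_on_def mem_Collect_eq Ball_def by blast
qed

lemma classical_on_subset:
  "classical_on p a I u ut ux uxx \<Longrightarrow> J \<subseteq> I \<Longrightarrow> classical_on p a J u ut ux uxx"
proof -
  assume cl: "classical_on p a I u ut ux uxx" and sub: "J \<subseteq> I"
  have "continuous_on (J \<times> {0..a}) f" if "continuous_on (I \<times> {0..a}) f" for f :: "real \<times> real \<Rightarrow> real"
    by (rule continuous_on_subset[OF that]) (use sub in auto)
  then show ?thesis using cl sub unfolding classical_on_def by blast
qed

text \<open>\<open>is_solution\<close> prescribes the initial value in the open interval only;
  continuity of both functions adds the ends.\<close>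

lemma solution_init_closed:
  assumes sol: "is_solution p a u0 T u" and a: "0 < a" and u0: "continuous_on {0..a} u0" and x: "x \<in> {0..a}"
  shows "u 0 x = u0 x"
proof -
  have "0 \<in> times T" using sol unfolding is_solution_def times_def by (simp add: zero_ereal_def)
  then have c: "continuous_on {0..a} (u 0)" using section_cont sol unfolding is_solution_def by blast
  have cl: "closure {0<..<a} = {0..a}" using a by simp
  have "u 0 x - u0 x = 0"
    by (rule continuous_constant_on_closure[of "{0<..<a}" "\<lambda>x. u 0 x - u0 x"])
      (use sol x cl c u0 in \<open>auto simp: is_solution_def intro!: continuous_intros\<close>)
  then show ?thesis by simp
qed

lemma solution_unique:
  assumes u: "is_solution p a u0 T u" and v: "is_solution p a u0 T' v" and p: "1 < p" and a: "0 < a"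
    and u0: "continuous_on {0..a} u0"
    and t: "t \<in> times T" "t \<in> times T'" and x: "x \<in> {0..a}"
  shows "u t x = v t x"
proof -
  have init: "u 0 x = v 0 x" if "x \<in> {0..a}" for x
    using solution_init_closed[OF u a u0 that] solution_init_closed[OF v a u0 that] by simp
  show ?thesis
  proof (cases "t = 0")
    case False
    define S where "S = min T T'"
    have S: "0 < S" "S \<le> T" "S \<le> T'" using u v unfolding S_def is_solution_def by auto
    obtain ut ux uxx where U: "pde_sol p a T u ut ux uxx" using is_solution_pde_sol[OF u p a] .
    obtain vt vx vxx where V: "pde_sol p a T' v vt vx vxx" using is_solution_pde_sol[OF v p a] .
    show ?thesis
      by (rule pde_sol_unique[OF pde_sol_restrict[OF U S(1,2)] pde_sol_restrict[OF V S(1,3)] init _ x])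
        (use t False in \<open>auto simp: times_def pos_times_def S_def\<close>)
  qed (use init x in auto)
qed

lemma solution_shift:
  assumes sol: "is_solution p a u0 (ereal r) u" and s: "0 \<le> s" "s < r"
  shows "is_solution p a (u s) (ereal (r - s)) (\<lambda>t. u (t + s))"
proof -
  obtain ut ux uxx where cl: "classical_on p a {0<..<r} u ut ux uxx"
    and c: "continuous_on ({0..<r} \<times> {0..a}) (\<lambda>(t, x). u t x)"
    and pos: "\<forall>t\<in>{0..<r}. \<forall>x\<in>{0..a}. 0 < u t x"
    using sol unfolding is_solution_iff_classical times_ereal by blast
  have "continuous_on ({0..<r - s} \<times> {0..a}) (\<lambda>z. (\<lambda>(t, x). u t x) (fst z + s, snd z))"
    by (rule continuous_on_compose2[OF c]) (use s in \<open>auto intro!: continuous_intros\<close>)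
  then have c': "continuous_on ({0..<r - s} \<times> {0..a}) (\<lambda>(t, x). u (t + s) x)" by (simp add: case_prod_beta)
  have "classical_on p a {0<..<r - s} (\<lambda>t. u (t - - s)) (\<lambda>t. ut (t - - s)) (\<lambda>t. ux (t - - s)) (\<lambda>t. uxx (t - - s))"
    by (rule classical_on_subset[OF classical_on_shift[OF cl]]) (use s in auto)
  then show ?thesis
    unfolding is_solution_iff_classical times_ereal using s c' pos by (auto intro!: exI)
qed

text \<open>A solution restarted from \<open>u s\<close> lives for the time \<tau> belonging to the
  bound M, whatever s is; a restart closer than \<tau> to r therefore passes r.\<close>

lemma continuation:
  assumes sol: "is_solution p a u0 (ereal r) u" and p: "1 < p" and a: "0 < a"
    and bd: "\<And>t x. t \<in> {0..<r} \<Longrightarrow> x \<in> {0..a} \<Longrightarrow> u t x \<le> M" and M: "0 < M"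
  shows "\<exists>T v. ereal r < T \<and> is_solution p a u0 T v \<and> (\<forall>t\<in>times (ereal r). \<forall>x\<in>{0..a}. v t x = u t x)"
proof -
  have p1: "1 \<le> p" using p by simp
  obtain \<tau> where tau: "0 < \<tau>"
    "\<And>u0. continuous_on {0..a} u0 \<Longrightarrow> (\<And>x. x \<in> {0..a} \<Longrightarrow> 0 < u0 x) \<Longrightarrow> (\<And>x. x \<in> {0..a} \<Longrightarrow> u0 x \<le> M) \<Longrightarrow>
      \<exists>u. is_solution p a u0 (ereal \<tau>) u"
    using local_existence[OF p1 a M] by blast
  have r: "0 < r" using sol unfolding is_solution_def by simp
  \<comment> \<open>At most \<open>\<tau> / 2\<close> before r; the alternative r / 2 keeps s
    positive.\<close>
  define s where "s = max (r / 2) (r - \<tau> / 2)"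
  have s: "0 < s" "s < r" "r < s + \<tau>" unfolding s_def using r tau by auto
  obtain ut ux uxx where cl: "classical_on p a {0<..<r} u ut ux uxx"
    and c: "continuous_on ({0..<r} \<times> {0..a}) (\<lambda>(t, x). u t x)"
    and pos: "\<forall>t\<in>{0..<r}. \<forall>x\<in>{0..a}. 0 < u t x" and init: "\<forall>x\<in>{0<..<a}. u 0 x = u0 x"
    using sol unfolding is_solution_iff_classical times_ereal by blast
  have us: "continuous_on {0..a} (u s)" by (rule section_cont[OF c]) (use s in auto)
  obtain w where w: "is_solution p a (u s) (ereal \<tau>) w"
    using tau(2)[OF us] pos bd s by auto
  obtain wt wx wxx where wcl: "classical_on p a {0<..<\<tau>} w wt wx wxx"
    and wc: "continuous_on ({0..<\<tau>} \<times> {0..a}) (\<lambda>(t, x). w t x)"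
    and wpos: "\<forall>t\<in>{0..<\<tau>}. \<forall>x\<in>{0..a}. 0 < w t x"
    using w unfolding is_solution_iff_classical times_ereal by blast
  \<comment> \<open>By uniqueness the two solutions coincide on the overlap, so there is no matching
    of derivatives at r.\<close>
  have agree: "u t x = w (t - s) x" if "s \<le> t" "t < r" "x \<in> {0..a}" for t x
  proof -
    have "u (t - s + s) x = w (t - s) x"
      by (rule solution_unique[OF solution_shift[OF sol, of s] w p a us]) (use that s in auto)
    then show ?thesis by simp
  qed
  define v where "v = (\<lambda>t x. if t < r then u t x else w (t - s) x)"
  have v1: "v t x = u t x" if "t < r" for t x unfolding v_def using that by simp
  have v2: "v t x = w (t - s) x" if "s \<le> t" "x \<in> {0..a}" for t x unfolding v_def using agree that by auto
  define R where "R = s + \<tau>"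
  have "is_solution p a u0 (ereal R) v"
    unfolding is_solution_iff_classical times_ereal
  proof (intro conjI)
    show "0 < ereal R" unfolding R_def using s tau by simp
    show "\<forall>x\<in>{0<..<a}. v 0 x = u0 x" using init v1 r by simp
    show "\<forall>t\<in>{0..<R}. \<forall>x\<in>{0..a}. 0 < v t x"
    proof (intro ballI)
      fix t x assume t: "t \<in> {0..<R}" and x: "x \<in> {0..a}"
      show "0 < v t x"
      proof (cases "t < r")
        case True then show ?thesis using v1 pos t x by simp
      next
        case False then show ?thesis using v2[of t x] wpos t x s unfolding R_def by auto
      qed
    qed
    show "continuous_on ({0..<R} \<times> {0..a}) (\<lambda>(t, x). v t x)"
    proof (rule continuous_on_local_time)
      fix t assume t: "t \<in> {0..<R}"
      show "\<exists>J. open J \<and> t \<in> J \<and> continuous_on ((J \<inter> {0..<R}) \<times> {0..a}) (\<lambda>(t, x). v t x)"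
      proof (cases "t < r")
        case True
        have "continuous_on (({..<r} \<inter> {0..<R}) \<times> {0..a}) (\<lambda>(t, x). u t x)"
          by (rule continuous_on_subset[OF c]) auto
        then have "continuous_on (({..<r} \<inter> {0..<R}) \<times> {0..a}) (\<lambda>(t, x). v t x)"
          by (rule continuous_on_eq) (auto simp: v1)
        then show ?thesis using True by (intro exI[of _ "{..<r}"]) auto
      next
        case False
        have "continuous_on (({s<..} \<inter> {0..<R}) \<times> {0..a}) (\<lambda>z. (\<lambda>(t, x). w t x) (fst z - s, snd z))"
          by (rule continuous_on_compose2[OF wc]) (use s in \<open>auto intro!: continuous_intros simp: R_def\<close>)
        then have "continuous_on (({s<..} \<inter> {0..<R}) \<times> {0..a}) (\<lambda>(t, x). v t x)"
          by (rule continuous_on_eq) (auto simp: v2)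
        then show ?thesis using False s by (intro exI[of _ "{s<..}"]) auto
      qed
    qed
    show "\<exists>vt vx vxx. classical_on p a {0<..<R} v vt vx vxx"
    proof (rule classical_on_Union[OF a])
      fix t assume t: "t \<in> {0<..<R}"
      show "\<exists>J w wt wx wxx. open J \<and> t \<in> J \<and> J \<subseteq> {0<..<R} \<and> classical_on p a J w wt wx wxx \<and> (\<forall>t\<in>J. \<forall>x\<in>{0..a}. v t x = w t x)"
      proof (cases "t < r")
        case True
        then show ?thesis using cl t v1 s
          by (intro exI[of _ "{0<..<r}"] exI[of _ u] exI[of _ ut] exI[of _ ux] exI[of _ uxx]) (auto simp: R_def)
      next
        case False
        have J: "{t. t - s \<in> {0<..<\<tau>}} = {s<..<R}" unfolding R_def by auto
        have "classical_on p a {s<..<R} (\<lambda>t. w (t - s)) (\<lambda>t. wt (t - s)) (\<lambda>t. wx (t - s)) (\<lambda>t. wxx (t - s))"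
          using classical_on_shift[OF wcl, of s] unfolding J .
        moreover have "open {s<..<R}" "t \<in> {s<..<R}" "{s<..<R} \<subseteq> {0<..<R}" "\<forall>t\<in>{s<..<R}. \<forall>x\<in>{0..a}. v t x = w (t - s) x"
          using False t s v2 by auto
        ultimately show ?thesis by blast
      qed
    qed
  qed
  moreover have "ereal r < ereal R" unfolding R_def using s by simp
  ultimately show ?thesis using v1 by (metis atLeastLessThan_iff times_ereal(1))
qed

text \<open>By uniqueness any two solutions agree on their common interval, so together they define
  a solution up to the supremum of all existence times.\<close>

lemma maximal_solution_exists:
  assumes p: "1 < p" and a: "0 < a" and u0: "continuous_on {0..a} u0" and u0p: "\<And>x. x \<in> {0..a} \<Longrightarrow> 0 < u0 x"
  shows "\<exists>T u. maximal_solution p a u0 T u"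
proof -
  define TT where "TT = {T. \<exists>u. is_solution p a u0 T u}"
  have p1: "1 \<le> p" using p by simp
  obtain y where y: "y \<in> {0..a}" "\<And>x. x \<in> {0..a} \<Longrightarrow> u0 x \<le> u0 y"
    using continuous_attains_sup[OF _ _ u0] a by auto
  have "0 < u0 y" using u0p y by blast
  then obtain \<tau> where t0: "0 < \<tau>" and
    ex: "\<And>w. continuous_on {0..a} w \<Longrightarrow> (\<And>x. x \<in> {0..a} \<Longrightarrow> 0 < w x) \<Longrightarrow> (\<And>x. x \<in> {0..a} \<Longrightarrow> w x \<le> u0 y) \<Longrightarrow>
      \<exists>u. is_solution p a w (ereal \<tau>) u"
    using local_existence[OF p1 a] by blast
  have tau: "ereal \<tau> \<in> TT" "0 < \<tau>"
    unfolding TT_def using ex[OF u0 u0p y(2)] t0 by auto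
  have "\<forall>T\<in>TT. \<exists>u. is_solution p a u0 T u" unfolding TT_def by simp
  from bchoice[OF this] obtain w where w: "\<And>T. T \<in> TT \<Longrightarrow> is_solution p a u0 T (w T)" by blast
  define T where "T = Sup TT"
  have "\<forall>t. \<exists>R. t \<in> times T \<longrightarrow> R \<in> TT \<and> t \<in> times R"
    unfolding T_def times_def by (auto simp: less_Sup_iff)
  \<comment> \<open>An existence time beyond t, which selects the solution that defines u at time
    t.\<close>
  then obtain R where R: "\<And>t. t \<in> times T \<Longrightarrow> R t \<in> TT" "\<And>t. t \<in> times T \<Longrightarrow> t \<in> times (R t)" by metis
  have sub: "times S \<subseteq> times T" "pos_times S \<subseteq> pos_times T" if "S \<in> TT" for S
    using Sup_upper[OF that] unfolding times_def pos_times_def T_def by (auto intro: less_le_trans)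
  define u where "u = (\<lambda>t. w (R t) t)"
  have u_eq: "u t x = w S t x" if "S \<in> TT" "t \<in> times S" "x \<in> {0..a}" for S t x
    unfolding u_def using solution_unique[OF w[OF R(1)] w[OF that(1)] p a u0 R(2) that(2,3)] sub(1)[OF that(1)] that(2) by blast
  have "is_solution p a u0 T u"
    unfolding is_solution_iff_classical
  proof (intro conjI)
    have "0 < ereal \<tau>" using tau by simp
    also have "\<dots> \<le> T" unfolding T_def using tau by (intro Sup_upper)
    finally show "0 < T" .
    have 0: "0 \<in> times (ereal \<tau>)" using tau by simp
    show "\<forall>x\<in>{0<..<a}. u 0 x = u0 x"
      using u_eq[OF tau(1) 0] w[OF tau(1)] unfolding is_solution_def by auto
    show "\<forall>t\<in>times T. \<forall>x\<in>{0..a}. 0 < u t x"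
      unfolding u_def using w[OF R(1)] R(2) unfolding is_solution_def by blast
    show "continuous_on (times T \<times> {0..a}) (\<lambda>(t, x). u t x)"
    proof (rule continuous_on_local_time)
      fix t assume t: "t \<in> times T"
      define J where "J = {s. ereal s < R t}"
      have JT: "J \<inter> times T = times (R t)"
        using sub(1)[OF R(1)[OF t]] unfolding J_def times_def by auto
      have "continuous_on (times (R t) \<times> {0..a}) (\<lambda>(t, x). w (R t') t x)" if "t' = t" for t'
        using w[OF R(1)[OF t]] that unfolding is_solution_def by simp
      from this[OF refl] have "continuous_on (times (R t) \<times> {0..a}) (\<lambda>(s, x). u s x)"
        by (rule continuous_on_eq) (use u_eq[OF R(1)[OF t]] in auto)
      moreover have "open J"
        unfolding J_def by (intro open_Collect_less continuous_intros)
      moreover have "t \<in> J" using R(2)[OF t] unfolding J_def times_def by simp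
      ultimately show "\<exists>J. open J \<and> t \<in> J \<and> continuous_on ((J \<inter> times T) \<times> {0..a}) (\<lambda>(t, x). u t x)"
        using JT by auto
    qed
    show "\<exists>ut ux uxx. classical_on p a (pos_times T) u ut ux uxx"
    proof (rule classical_on_Union[OF a])
      fix t assume t: "t \<in> pos_times T"
      then have t': "t \<in> times T" using pos_times_subset by blast
      obtain wt wx wxx where "classical_on p a (pos_times (R t)) (w (R t)) wt wx wxx"
        using w[OF R(1)[OF t']] unfolding is_solution_iff_classical by blast
      moreover have "open (pos_times (R t))" by (rule pos_times_interval)
      moreover have "t \<in> pos_times (R t)" using R(2)[OF t'] t unfolding times_def pos_times_def by simp
      moreover have "pos_times (R t) \<subseteq> pos_times T" by (rule sub(2)[OF R(1)[OF t']])
      moreover have "\<forall>s\<in>pos_times (R t). \<forall>x\<in>{0..a}. u s x = w (R t) s x"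
        using u_eq[OF R(1)[OF t']] pos_times_subset by blast
      ultimately show "\<exists>J w wt wx wxx. open J \<and> t \<in> J \<and> J \<subseteq> pos_times T \<and> classical_on p a J w wt wx wxx \<and> (\<forall>t\<in>J. \<forall>x\<in>{0..a}. u t x = w t x)"
        by blast
    qed
  qed
  moreover have "\<not> (\<exists>T' v. T < T' \<and> is_solution p a u0 T' v \<and> (\<forall>t\<in>times T. \<forall>x\<in>{0..a}. v t x = u t x))"
  proof
    assume "\<exists>T' v. T < T' \<and> is_solution p a u0 T' v \<and> (\<forall>t\<in>times T. \<forall>x\<in>{0..a}. v t x = u t x)"
    then obtain T' where T': "T < T'" "T' \<in> TT" unfolding TT_def by blast
    have "T' \<le> T" unfolding T_def by (rule Sup_upper[OF T'(2)])
    with T'(1) show False by simp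
  qed
  ultimately show ?thesis unfolding maximal_solution_def by blast
qed

section \<open>Control by the excess of the Dirichlet energy\<close>

text \<open>The square of
  \<open>W' + l W tan (l (x - a / 2))\<close> integrates to the difference of both sides, with
  \<open>l < 1\<close> to avoid the poles of the tangent.\<close>
lemma dirichlet_poincare:
  fixes W W' :: "real \<Rightarrow> real"
  assumes a: "0 < a" "a \<le> pi"
    and dW: "\<And>x. x \<in> {0..a} \<Longrightarrow> (W has_real_derivative W' x) (at x within {0..a})"
    and W': "continuous_on {0..a} W'" and bc: "W 0 = 0" "W a = 0"
  shows "integral {0..a} (\<lambda>x. (W x)\<^sup>2) \<le> integral {0..a} (\<lambda>x. (W' x)\<^sup>2)"
proof -
  have Wc: "continuous_on {0..a} W" using dW by (rule DERIV_continuous_on)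
  show ?thesis
  \<comment> \<open>The inequality is shown with every factor z below 1; letting z tend to 1
    recovers the sharp constant, also for a = pi.\<close>
  proof (rule field_le_mult_one_interval)
    fix z :: real assume z: "0 < z" "z < 1"
    define l where "l = sqrt z"
    have l: "0 < l" "l < 1" "l\<^sup>2 = z" unfolding l_def using z by auto
    define T where "T = (\<lambda>x. tan (l * (x - a / 2)))"
    have cos0: "cos (l * (x - a / 2)) \<noteq> 0" if x: "x \<in> {0..a}" for x
    proof -
      have "0 \<le> x" "x \<le> a" using x by auto
      then have "\<bar>x - a / 2\<bar> \<le> pi / 2" using a(2) by linarith
      then have "\<bar>l * (x - a / 2)\<bar> \<le> l * (pi / 2)" using l by (simp add: abs_mult)
      also have "\<dots> < pi / 2" using l pi_gt_zero by simp
      finally have "- (pi / 2) < l * (x - a / 2)" "l * (x - a / 2) < pi / 2" by (auto simp: abs_less_iff)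
      then show ?thesis using cos_gt_zero_pi by fastforce
    qed
    have dT: "(T has_real_derivative l * (1 + (T x)\<^sup>2)) (at x within {0..a})" if x: "x \<in> {0..a}" for x
    proof -
      have "(T has_real_derivative inverse ((cos (l * (x - a / 2)))\<^sup>2) * l) (at x)"
        unfolding T_def
        by (rule DERIV_chain2[where g = "\<lambda>x. l * (x - a / 2)", OF DERIV_tan[OF cos0[OF x]]])
          (auto intro!: derivative_eq_intros)
      moreover have "inverse ((cos (l * (x - a / 2)))\<^sup>2) * l = l * (1 + (T x)\<^sup>2)"
        unfolding T_def tan_sec[OF cos0[OF x]] by (simp add: power_inverse mult.commute)
      ultimately show ?thesis by (simp only: has_field_derivative_at_within)
    qed
    have Tc: "continuous_on {0..a} T" using dT by (rule DERIV_continuous_on)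
    \<comment> \<open>The integrand is the derivative of \<open>(W x)\<^sup>2 * T x\<close>, and W
      vanishes at both ends.\<close>
    have "integral {0..a} (\<lambda>x. 2 * W x * W' x * T x + l * ((W x)\<^sup>2 * (1 + (T x)\<^sup>2))) = (W a)\<^sup>2 * T a - (W 0)\<^sup>2 * T 0"
    proof (rule ftc_Icc(2))
      fix x assume x: "x \<in> {0..a}"
      show "((\<lambda>x. (W x)\<^sup>2 * T x) has_real_derivative 2 * W x * W' x * T x + l * ((W x)\<^sup>2 * (1 + (T x)\<^sup>2))) (at x within {0..a})"
        by (auto intro!: derivative_eq_intros dW x dT simp: algebra_simps)
    qed (use a in simp)
    then have 0: "integral {0..a} (\<lambda>x. 2 * W x * W' x * T x + l * ((W x)\<^sup>2 * (1 + (T x)\<^sup>2))) = 0" using bc by simp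
    have "0 \<le> integral {0..a} (\<lambda>x. (W' x + l * W x * T x)\<^sup>2)"
      by (rule integral_nonneg_cont) (intro continuous_intros W' Wc Tc, simp)
    also have "\<dots> = integral {0..a} (\<lambda>x. ((W' x)\<^sup>2 - z * (W x)\<^sup>2) + l * (2 * W x * W' x * T x + l * ((W x)\<^sup>2 * (1 + (T x)\<^sup>2))))"
      by (rule integral_cong) (simp add: l(3)[symmetric] power2_eq_square algebra_simps)
    also have "\<dots> = integral {0..a} (\<lambda>x. (W' x)\<^sup>2 - z * (W x)\<^sup>2) + integral {0..a} (\<lambda>x. l * (2 * W x * W' x * T x + l * ((W x)\<^sup>2 * (1 + (T x)\<^sup>2))))"
      by (rule integral_add_cont) (intro continuous_intros W' Wc Tc)+
    also have "integral {0..a} (\<lambda>x. l * (2 * W x * W' x * T x + l * ((W x)\<^sup>2 * (1 + (T x)\<^sup>2)))) = 0" using 0 by simp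
    also have "integral {0..a} (\<lambda>x. (W' x)\<^sup>2 - z * (W x)\<^sup>2) = integral {0..a} (\<lambda>x. (W' x)\<^sup>2) - integral {0..a} (\<lambda>x. z * (W x)\<^sup>2)"
      by (rule integral_diff_cont) (intro continuous_intros W' Wc)+
    finally show "z * integral {0..a} (\<lambda>x. (W x)\<^sup>2) \<le> integral {0..a} (\<lambda>x. (W' x)\<^sup>2)" by simp
  qed
qed

definition excess :: "real \<Rightarrow> (real \<Rightarrow> real) \<Rightarrow> (real \<Rightarrow> real) \<Rightarrow> real" where
  "excess a f f' = integral {0..a} (\<lambda>x. (f' x)\<^sup>2) - integral {0..a} (\<lambda>x. (f x - mean a f)\<^sup>2)"

text \<open>With W the primitive of \<open>f - mean f\<close> and \<open>q = f' + W\<close> one has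
  \<open>W'' + W = q\<close> and the L2 norm of q is at most the excess; variation of constants then
  controls the distance of f to the solutions of \<open>y'' + y = mean f\<close>.\<close>
lemma excess_controls:
  fixes f f' :: "real \<Rightarrow> real"
  assumes a: "0 < a" "a \<le> pi"
    and df: "\<And>x. x \<in> {0..a} \<Longrightarrow> (f has_real_derivative f' x) (at x within {0..a})"
    and f'c: "continuous_on {0..a} f'"
  defines "m \<equiv> mean a f"
  defines "c \<equiv> f 0 - m"
  defines "R \<equiv> 2 * sqrt (a * excess a f f')"
  shows "0 \<le> excess a f f'"
    "x \<in> {0..a} \<Longrightarrow> \<bar>f x - m - c * cos x\<bar> \<le> R" "\<bar>c * sin a\<bar> \<le> R"
proof -
  have fc: "continuous_on {0..a} f" using df by (rule DERIV_continuous_on)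
  define W where "W = (\<lambda>x. integral {0..x} (\<lambda>y. f y - m))"
  define q where "q = (\<lambda>x. f' x + W x)"
  have mc: "continuous_on {0..a} (\<lambda>y. f y - m)" by (intro continuous_intros fc)
  have dW: "(W has_real_derivative f x - m) (at x within {0..a})" if "x \<in> {0..a}" for x
    unfolding W_def by (rule integral_has_real_derivative[OF mc that])
  have Wc: "continuous_on {0..a} W" using dW by (rule DERIV_continuous_on)
  have W0: "W 0 = 0" unfolding W_def by simp
  have Wa: "W a = 0"
  proof -
    have "W a = integral {0..a} f - integral {0..a} (\<lambda>x. m)"
      unfolding W_def by (rule integral_diff_cont) (intro continuous_intros fc)+
    then show ?thesis unfolding m_def mean_def using a by simp
  qed
  have qc: "continuous_on {0..a} q" unfolding q_def by (intro continuous_intros f'c Wc)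
  define D V F G where "D = integral {0..a} (\<lambda>x. (f' x)\<^sup>2)" and "V = integral {0..a} (\<lambda>x. (f x - m)\<^sup>2)"
    and "F = integral {0..a} (\<lambda>x. (W x)\<^sup>2)" and "G = integral {0..a} (\<lambda>x. f' x * W x)"
  have ex: "excess a f f' = D - V" unfolding excess_def D_def V_def m_def ..
  have FV: "F \<le> V" unfolding F_def V_def by (rule dirichlet_poincare[OF a dW mc W0 Wa])
  \<comment> \<open>By parts the mixed term is minus the variance. With the Wirtinger inequality for
    W the square of q then integrates to at most \<open>D - 2 * V + V\<close>, which is the
    excess.\<close>
  have GV: "G = - V"
  proof -
    have "integral {0..a} (\<lambda>x. f' x * W x + (f x - m)\<^sup>2) = (f a - m) * W a - (f 0 - m) * W 0"
    proof (rule ftc_Icc(2))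
      fix x assume x: "x \<in> {0..a}"
      show "((\<lambda>x. (f x - m) * W x) has_real_derivative f' x * W x + (f x - m)\<^sup>2) (at x within {0..a})"
        by (auto intro!: derivative_eq_intros df dW x simp: power2_eq_square algebra_simps)
    qed (use a in simp)
    moreover have "integral {0..a} (\<lambda>x. f' x * W x + (f x - m)\<^sup>2) = G + V"
      unfolding G_def V_def by (rule integral_add_cont) (intro continuous_intros f'c Wc fc)+
    ultimately show ?thesis using W0 Wa by simp
  qed
  have q2: "integral {0..a} (\<lambda>x. (q x)\<^sup>2) = D + 2 * G + F"
    using integral_square_expand[OF f'c Wc, of "-1"] unfolding q_def D_def G_def F_def by simp
  have q_le: "integral {0..a} (\<lambda>x. (q x)\<^sup>2) \<le> excess a f f'" unfolding q2 ex using GV FV by simp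
  have "0 \<le> integral {0..a} (\<lambda>x. (q x)\<^sup>2)" by (rule integral_nonneg_cont) (intro continuous_intros qc, simp)
  then show "0 \<le> excess a f f'" using q_le by simp
  have small: "\<bar>integral {0..x} (\<lambda>y. q y * s y)\<bar> \<le> sqrt (a * excess a f f')"
    if x: "x \<in> {0..a}" and s: "continuous_on {0..a} s" "\<And>y. \<bar>s y\<bar> \<le> 1" for x s
  proof -
    have "\<bar>integral {0..x} (\<lambda>y. q y * s y)\<bar> \<le> sqrt (a * integral {0..a} (\<lambda>y. (q y * s y)\<^sup>2))"
      by (rule integral_abs_le_sqrt) (use x in \<open>auto intro!: continuous_intros qc s\<close>)
    also have "\<dots> \<le> sqrt (a * excess a f f')"
    proof (intro real_sqrt_le_mono mult_left_mono)
      have "integral {0..a} (\<lambda>y. (q y * s y)\<^sup>2) \<le> integral {0..a} (\<lambda>y. (q y)\<^sup>2)"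
      proof (rule integral_mono_cont)
        fix y
        have "(s y)\<^sup>2 \<le> 1" using s(2)[of y] by (simp add: abs_square_le_1)
        then show "(q y * s y)\<^sup>2 \<le> (q y)\<^sup>2"
          using mult_left_mono[of "(s y)\<^sup>2" 1 "(q y)\<^sup>2"] by (simp add: power_mult_distrib)
      qed (intro continuous_intros qc s)+
      then show "integral {0..a} (\<lambda>y. (q y * s y)\<^sup>2) \<le> excess a f f'" using q_le by simp
    qed (use a in simp)
    finally show ?thesis .
  qed
  \<comment> \<open>With c = f 0 - m the function y solves y'' + y = q with zero initial data, and
    y' is the quantity to be bounded.\<close>
  define y y' where "y = (\<lambda>x. W x - c * sin x)" and "y' = (\<lambda>x. f x - m - c * cos x)"
  have dy: "(y has_real_derivative y' x) (at x within {0..a})" if "x \<in> {0..a}" for x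
    unfolding y_def y'_def by (auto intro!: derivative_eq_intros dW that)
  have dy': "(y' has_real_derivative f' x + c * sin x) (at x within {0..a})" if "x \<in> {0..a}" for x
    unfolding y'_def by (auto intro!: derivative_eq_intros df that)
  have y0: "y 0 = 0" "y' 0 = 0" unfolding y_def y'_def c_def using W0 by auto
  \<comment> \<open>Rotating (y', y) by the angle x removes the homogeneous dynamics: the two
    components are primitives of q cos and q sin.\<close>
  have P: "y' x * cos x + y x * sin x = integral {0..x} (\<lambda>y. q y * cos y)" if x: "x \<in> {0..a}" for x
  proof -
    have "integral {0..x} (\<lambda>z. q z * cos z) = (y' x * cos x + y x * sin x) - (y' 0 * cos 0 + y 0 * sin 0)"
    proof (rule ftc_Icc(2))
      fix z assume "z \<in> {0..x}"
      then have z: "z \<in> {0..a}" using x by auto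
      have "((\<lambda>x. y' x * cos x + y x * sin x) has_real_derivative
          (f' z + c * sin z) * cos z - y' z * sin z + (y' z * sin z + y z * cos z)) (at z within {0..a})"
        by (auto intro!: derivative_eq_intros dy dy' z simp: algebra_simps)
      moreover have "(f' z + c * sin z) * cos z - y' z * sin z + (y' z * sin z + y z * cos z) = q z * cos z"
        unfolding q_def y_def by (simp add: algebra_simps)
      ultimately have "((\<lambda>x. y' x * cos x + y x * sin x) has_real_derivative q z * cos z) (at z within {0..a})"
        by (simp only:)
      then show "((\<lambda>x. y' x * cos x + y x * sin x) has_real_derivative q z * cos z) (at z within {0..x})"
        by (rule DERIV_subset) (use x in auto)
    qed (use x in auto)
    then show ?thesis using y0 by simp
  qed
  have Q: "y' x * sin x - y x * cos x = integral {0..x} (\<lambda>y. q y * sin y)" if x: "x \<in> {0..a}" for x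
  proof -
    have "integral {0..x} (\<lambda>z. q z * sin z) = (y' x * sin x - y x * cos x) - (y' 0 * sin 0 - y 0 * cos 0)"
    proof (rule ftc_Icc(2))
      fix z assume "z \<in> {0..x}"
      then have z: "z \<in> {0..a}" using x by auto
      have "((\<lambda>x. y' x * sin x - y x * cos x) has_real_derivative
          (f' z + c * sin z) * sin z + y' z * cos z - (y' z * cos z - y z * sin z)) (at z within {0..a})"
        by (auto intro!: derivative_eq_intros dy dy' z simp: algebra_simps)
      moreover have "(f' z + c * sin z) * sin z + y' z * cos z - (y' z * cos z - y z * sin z) = q z * sin z"
        unfolding q_def y_def by (simp add: algebra_simps)
      ultimately have "((\<lambda>x. y' x * sin x - y x * cos x) has_real_derivative q z * sin z) (at z within {0..a})"
        by (simp only:)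
      then show "((\<lambda>x. y' x * sin x - y x * cos x) has_real_derivative q z * sin z) (at z within {0..x})"
        by (rule DERIV_subset) (use x in auto)
    qed (use x in auto)
    then show ?thesis using y0 by simp
  qed
  have PQ: "\<bar>y' x\<bar> \<le> R" "\<bar>y x\<bar> \<le> R" if x: "x \<in> {0..a}" for x
  proof -
    define P' Q' where "P' = y' x * cos x + y x * sin x" and "Q' = y' x * sin x - y x * cos x"
    have "\<bar>P'\<bar> \<le> sqrt (a * excess a f f')" unfolding P'_def P[OF x] by (rule small[OF x]) (intro continuous_intros, simp)
    moreover have "\<bar>Q'\<bar> \<le> sqrt (a * excess a f f')" unfolding Q'_def Q[OF x] by (rule small[OF x]) (intro continuous_intros, simp)
    moreover have "\<bar>P' * cos x\<bar> \<le> \<bar>P'\<bar>" "\<bar>P' * sin x\<bar> \<le> \<bar>P'\<bar>" "\<bar>Q' * cos x\<bar> \<le> \<bar>Q'\<bar>" "\<bar>Q' * sin x\<bar> \<le> \<bar>Q'\<bar>"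
      by (simp_all add: abs_mult mult_left_le)
    moreover have "y' x = P' * cos x + Q' * sin x"
    proof -
      have "P' * cos x + Q' * sin x = y' x * ((sin x)\<^sup>2 + (cos x)\<^sup>2)"
        unfolding P'_def Q'_def by algebra
      then show ?thesis by simp
    qed
    moreover have "y x = P' * sin x - Q' * cos x"
    proof -
      have "P' * sin x - Q' * cos x = y x * ((sin x)\<^sup>2 + (cos x)\<^sup>2)"
        unfolding P'_def Q'_def by algebra
      then show ?thesis by simp
    qed
    ultimately show "\<bar>y' x\<bar> \<le> R" "\<bar>y x\<bar> \<le> R" unfolding R_def by linarith+
  qed
  show "\<bar>f x - m - c * cos x\<bar> \<le> R" if "x \<in> {0..a}" using PQ(1)[OF that] unfolding y'_def .
  \<comment> \<open>W vanishes at a, so y is there the sine term alone. For a below pi this bounds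
    c; for a = pi it carries no information.\<close>
  have "y a = - (c * sin a)" unfolding y_def using Wa by simp
  then show "\<bar>c * sin a\<bar> \<le> R" using PQ(2)[of a] a by simp
qed

text \<open>Kernel of \<open>w \<mapsto> w'' + w - mean w\<close> with Neumann conditions modulo constants.\<close>
definition kmode :: "real \<Rightarrow> real \<Rightarrow> real" where
  "kmode a x = (if a = pi then cos x else 0)"

lemma kmode_cont: "continuous_on X (kmode a)"
  unfolding kmode_def by (cases "a = pi") (auto intro!: continuous_intros)

lemma kmode_bound: "\<bar>kmode a x\<bar> \<le> 1"
  unfolding kmode_def by simp

text \<open>For a below pi the amplitude c is itself controlled through \<open>c * sin a\<close> and
  is absorbed at the price of the factor \<open>1 + 1 / sin a\<close>; for a = pi it stays as a free
  coefficient.\<close>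

lemma excess_decomposition:
  assumes a: "0 < a" "a \<le> pi"
  obtains K where "0 \<le> K"
    "\<And>f f'. (\<And>x. x \<in> {0..a} \<Longrightarrow> (f has_real_derivative f' x) (at x within {0..a})) \<Longrightarrow> continuous_on {0..a} f' \<Longrightarrow>
      \<exists>c. (a \<noteq> pi \<longrightarrow> c = 0) \<and> (\<forall>x\<in>{0..a}. \<bar>f x - mean a f - c * kmode a x\<bar> \<le> K * sqrt (excess a f f'))"
proof (cases "a = pi")
  case True
  show ?thesis
  proof
    show "0 \<le> 2 * sqrt a" using a by simp
    fix f f' :: "real \<Rightarrow> real"
    assume "\<And>x. x \<in> {0..a} \<Longrightarrow> (f has_real_derivative f' x) (at x within {0..a})" "continuous_on {0..a} f'"
    from excess_controls(2)[OF a this] show "\<exists>c. (a \<noteq> pi \<longrightarrow> c = 0) \<and> (\<forall>x\<in>{0..a}. \<bar>f x - mean a f - c * kmode a x\<bar> \<le> 2 * sqrt a * sqrt (excess a f f'))"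
      using True unfolding kmode_def by (intro exI[of _ "f 0 - mean a f"]) (auto simp: real_sqrt_mult mult.assoc)
  qed
next
  case False
  then have s: "0 < sin a" using a by (intro sin_gt_zero) auto
  show ?thesis
  proof
    show "0 \<le> 2 * sqrt a * (1 + 1 / sin a)" using a s by simp
    fix f f' :: "real \<Rightarrow> real"
    assume df: "\<And>x. x \<in> {0..a} \<Longrightarrow> (f has_real_derivative f' x) (at x within {0..a})" "continuous_on {0..a} f'"
    define c where "c = f 0 - mean a f"
    define R where "R = 2 * sqrt (a * excess a f f')"
    have 1: "\<bar>f x - mean a f - c * cos x\<bar> \<le> R" if "x \<in> {0..a}" for x
      using excess_controls(2)[OF a df that] unfolding c_def R_def .
    have "\<bar>c * sin a\<bar> \<le> R" using excess_controls(3)[OF a df] unfolding c_def R_def .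
    then have "\<bar>c\<bar> * sin a \<le> R" using s by (simp add: abs_mult)
    then have 2: "\<bar>c\<bar> \<le> R / sin a" using s by (simp add: field_simps)
    have "\<bar>f x - mean a f\<bar> \<le> R * (1 + 1 / sin a)" if "x \<in> {0..a}" for x
    proof -
      have "\<bar>c * cos x\<bar> \<le> \<bar>c\<bar>" by (simp add: abs_mult mult_left_le)
      then have "\<bar>f x - mean a f\<bar> \<le> R + R / sin a" using 1[OF that] 2 by linarith
      then show ?thesis by (simp add: distrib_left)
    qed
    moreover have "R * (1 + 1 / sin a) = 2 * sqrt a * (1 + 1 / sin a) * sqrt (excess a f f')"
      unfolding R_def real_sqrt_mult by (simp only: ac_simps)
    ultimately show "\<exists>c. (a \<noteq> pi \<longrightarrow> c = 0) \<and> (\<forall>x\<in>{0..a}. \<bar>f x - mean a f - c * kmode a x\<bar> \<le> 2 * sqrt a * (1 + 1 / sin a) * sqrt (excess a f f'))"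
      by (intro exI[of _ 0]) simp
  qed
qed

text \<open>If the mean b were large while f stays at bounded distance from \<open>b + c \<psi>\<close>, then
  \<open>f powr (1 - p)\<close> would concentrate where \<open>\<psi>\<close> is close to 1.\<close>
lemma mean_bound_one_sided:
  fixes f \<psi> :: "real \<Rightarrow> real"
  assumes p: "1 < p" and a: "0 < a" and f: "continuous_on {0..a} f" and fp: "\<And>x. x \<in> {0..a} \<Longrightarrow> 0 < f x"
    and psi: "continuous_on {0..a} \<psi>" "\<And>x. \<bar>\<psi> x\<bar> \<le> 1"
    and C1: "integral {0..a} (\<lambda>x. f x powr (1 - p)) = C1" "0 < C1"
    and kap: "0 < \<kappa>" "\<kappa> \<le> integral {0..a} (\<lambda>x. f x powr (1 - p) * (1 - \<psi> x))"
    and near: "\<And>x. x \<in> {0..a} \<Longrightarrow> b + c * \<psi> x - R \<le> f x" and R: "0 \<le> R"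
    and c: "c \<le> 0" "- (b + R) \<le> c" and b: "0 \<le> b"
    and eta: "\<eta> = min 1 (\<kappa> / (2 * C1))"
  shows "b * \<eta> - 2 * R \<le> (\<kappa> / (4 * a)) powr (- (1 / (p - 1)))"
proof (rule ccontr)
  \<comment> \<open>Lower bound for f wherever \<open>1 - \<psi> x\<close> exceeds \<eta>.\<close>
  define X where "X = b * \<eta> - 2 * R"
  \<comment> \<open>Determined by \<open>B0 powr (1 - p) = \<kappa> / (4 * a)\<close>: if X is
    larger, the points with f \<ge> X contribute less than \<kappa> / 2 to the weighted
    integral.\<close>
  define B0 where "B0 = (\<kappa> / (4 * a)) powr (- (1 / (p - 1)))"
  assume "\<not> b * \<eta> - 2 * R \<le> (\<kappa> / (4 * a)) powr (- (1 / (p - 1)))"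
  then have X: "B0 < X" unfolding X_def B0_def by simp
  have ka: "0 < \<kappa> / (4 * a)" using kap a by simp
  have B0: "0 < B0" unfolding B0_def using kap a by simp
  have "B0 powr (1 - p) = (\<kappa> / (4 * a)) powr (- (1 / (p - 1)) * (1 - p))" unfolding B0_def by (rule powr_powr)
  also have "- (1 / (p - 1)) * (1 - p) = 1" using p by (simp add: field_simps)
  also have "(\<kappa> / (4 * a)) powr 1 = \<kappa> / (4 * a)" using ka by (intro powr_one less_imp_le)
  finally have B0p: "B0 powr (1 - p) = \<kappa> / (4 * a)" .
  have Xp: "X powr (1 - p) < \<kappa> / (4 * a)"
    unfolding B0p[symmetric] using X B0 p by (intro powr_less_mono2_neg) auto
  have eta': "0 < \<eta>" "\<eta> \<le> 1" "\<eta> * C1 \<le> \<kappa> / 2"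
  proof -
    show "0 < \<eta>" "\<eta> \<le> 1" unfolding eta using kap C1 by auto
    have "\<eta> * C1 \<le> \<kappa> / (2 * C1) * C1" unfolding eta using C1 by (intro mult_right_mono) auto
    then show "\<eta> * C1 \<le> \<kappa> / 2" using C1 by simp
  qed
  have Wc: "continuous_on {0..a} (\<lambda>x. f x powr (1 - p))"
    using fp by (intro continuous_intros f) (auto simp: less_imp_neq[symmetric])
  \<comment> \<open>Either the weight is at most \<eta>, and by the choice of \<eta> this part
    integrates to at most \<kappa> / 2, or f is at least X.\<close>
  have pt: "f x powr (1 - p) * (1 - \<psi> x) \<le> \<eta> * f x powr (1 - p) + 2 * X powr (1 - p)" if x: "x \<in> {0..a}" for x
  proof (cases "1 - \<psi> x \<le> \<eta>")
    case True
    then have "f x powr (1 - p) * (1 - \<psi> x) \<le> f x powr (1 - p) * \<eta>" by (intro mult_left_mono) auto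
    also have "\<dots> \<le> \<eta> * f x powr (1 - p) + 2 * X powr (1 - p)" by simp
    finally show ?thesis .
  next
    case False
    have psx: "- 1 \<le> \<psi> x" "\<psi> x \<le> 1" using psi(2)[of x] by (auto simp: abs_le_iff)
    have "X \<le> b + c * \<psi> x - R"
    proof (cases "0 \<le> \<psi> x")
      case True
      \<comment> \<open>Here the lower bound on c enters: it keeps b + c \<psi> above b (1 - \<psi>)
        up to an error R.\<close>
      have "- (b + R) * \<psi> x \<le> c * \<psi> x" using c True by (intro mult_right_mono) auto
      moreover have "R * \<psi> x \<le> R" using R psx True by (simp add: mult_left_le)
      moreover have "b * \<eta> \<le> b * (1 - \<psi> x)" using False b by (intro mult_left_mono) auto
      ultimately show ?thesis unfolding X_def by (simp add: algebra_simps)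
    next
      case neg: False
      have "0 \<le> c * \<psi> x" using c neg by (simp add: mult_nonpos_nonpos)
      moreover have "b * \<eta> \<le> b" using b eta' by (simp add: mult_left_le)
      ultimately show ?thesis unfolding X_def using R by linarith
    qed
    then have "X \<le> f x" using near[OF x] by simp
    then have "f x powr (1 - p) \<le> X powr (1 - p)" using X B0 p by (intro powr_mono2') auto
    then have "f x powr (1 - p) * (1 - \<psi> x) \<le> X powr (1 - p) * 2"
      using psx by (intro mult_mono) auto
    moreover have "0 \<le> \<eta> * f x powr (1 - p)" using eta' by simp
    ultimately show ?thesis by linarith
  qed
  have "\<kappa> \<le> integral {0..a} (\<lambda>x. \<eta> * f x powr (1 - p) + 2 * X powr (1 - p))"
    by (rule order_trans[OF kap(2)], rule integral_mono_cont) (intro continuous_intros Wc psi(1) pt; assumption)+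
  also have "\<dots> = integral {0..a} (\<lambda>x. \<eta> * f x powr (1 - p)) + integral {0..a} (\<lambda>x. 2 * X powr (1 - p))"
    by (rule integral_add_cont) (intro continuous_intros Wc)+
  also have "\<dots> = \<eta> * C1 + a * (2 * X powr (1 - p))" using C1 a by simp
  also have "\<dots> \<le> \<kappa> / 2 + a * (2 * X powr (1 - p))" using eta' by simp
  also have "\<dots> < \<kappa> / 2 + a * (2 * (\<kappa> / (4 * a)))" using Xp a by (intro add_strict_left_mono mult_strict_left_mono) auto
  also have "\<dots> = \<kappa>" using a by simp
  finally show False by simp
qed

text \<open>M is found before f and c. This makes it a bound for a whole trajectory, along which the
  three integrals are conserved and R can be kept fixed.\<close>

lemma sup_bound:
  assumes p: "1 < p" and a: "0 < a" and kap: "0 < \<kappa>" and C1: "0 < C1" and R: "0 \<le> R"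
  obtains M where "\<And>f c. continuous_on {0..a} f \<Longrightarrow> (\<And>x. x \<in> {0..a} \<Longrightarrow> 0 < f x) \<Longrightarrow>
      integral {0..a} (\<lambda>x. f x powr (1 - p)) = C1 \<Longrightarrow>
      \<kappa> \<le> integral {0..a} (\<lambda>x. f x powr (1 - p) * (1 - kmode a x)) \<Longrightarrow>
      \<kappa> \<le> integral {0..a} (\<lambda>x. f x powr (1 - p) * (1 + kmode a x)) \<Longrightarrow>
      (a \<noteq> pi \<longrightarrow> c = 0) \<Longrightarrow> (\<And>x. x \<in> {0..a} \<Longrightarrow> \<bar>f x - mean a f - c * kmode a x\<bar> \<le> R) \<Longrightarrow>
      (\<And>x. x \<in> {0..a} \<Longrightarrow> f x \<le> M)"
proof -
  define \<eta> where "\<eta> = min 1 (\<kappa> / (2 * C1))"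
  have eta: "0 < \<eta>" unfolding \<eta>_def using kap C1 by simp
  define B0 where "B0 = (\<kappa> / (4 * a)) powr (- (1 / (p - 1)))"
  \<comment> \<open>f is at most b + |c| + R, |c| is at most b + R, and b is at most
    \<open>(B0 + 2 * R) / \<eta>\<close>.\<close>
  define M where "M = 2 * ((B0 + 2 * R) / \<eta>) + 2 * R"
  have "f x \<le> M"
    if f: "continuous_on {0..a} f" "\<And>x. x \<in> {0..a} \<Longrightarrow> 0 < f x"
      and I: "integral {0..a} (\<lambda>x. f x powr (1 - p)) = C1"
      and k1: "\<kappa> \<le> integral {0..a} (\<lambda>x. f x powr (1 - p) * (1 - kmode a x))"
      and k2: "\<kappa> \<le> integral {0..a} (\<lambda>x. f x powr (1 - p) * (1 + kmode a x))"
      and c0: "a \<noteq> pi \<longrightarrow> c = 0" and near: "\<And>x. x \<in> {0..a} \<Longrightarrow> \<bar>f x - mean a f - c * kmode a x\<bar> \<le> R"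
      and x: "x \<in> {0..a}" for f c x
  proof -
    define b where "b = mean a f"
    have "0 \<le> integral {0..a} f" by (rule integral_nonneg_cont[OF f(1)]) (use f(2) in \<open>auto intro: less_imp_le\<close>)
    then have b: "0 \<le> b" unfolding b_def mean_def using a by simp
    have lo: "b + c * kmode a x - R \<le> f x" "f x \<le> b + c * kmode a x + R" if "x \<in> {0..a}" for x
      using near[OF that] unfolding b_def by (auto simp: abs_le_iff)
    \<comment> \<open>Positivity of f at the two ends, where for a = pi the mode takes the values 1
      and -1.\<close>
    have cb: "- (b + R) \<le> c" "c \<le> b + R"
    proof -
      have e: "0 \<in> {0..a}" "a \<in> {0..a}" using a by auto
      show "- (b + R) \<le> c" "c \<le> b + R"
        using lo(2)[OF e(1)] lo(2)[OF e(2)] f(2)[OF e(1)] f(2)[OF e(2)] c0 b R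
        by (cases "a = pi"; simp add: kmode_def)+
    qed
    have "b * \<eta> - 2 * R \<le> B0"
    proof (cases "c \<le> 0")
      case True
      show ?thesis unfolding B0_def
        by (rule mean_bound_one_sided[OF p a f kmode_cont kmode_bound I C1 kap k1 lo(1) R True cb(1) b \<eta>_def])
    next
      \<comment> \<open>Positive c is the previous case for the reflected mode; this is the purpose
        of the second weight \<open>1 + kmode\<close>.\<close>
      case False
      show ?thesis unfolding B0_def
      proof (rule mean_bound_one_sided[OF p a f _ _ I C1 kap _ _ R _ _ b \<eta>_def, where \<psi> = "\<lambda>x. - kmode a x" and c = "- c"])
        show "continuous_on {0..a} (\<lambda>x. - kmode a x)" by (intro continuous_intros kmode_cont)
        show "\<bar>- kmode a x\<bar> \<le> 1" for x using kmode_bound[of a x] by simp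
        show "\<kappa> \<le> integral {0..a} (\<lambda>x. f x powr (1 - p) * (1 - - kmode a x))" using k2 by simp
        show "\<And>x. x \<in> {0..a} \<Longrightarrow> b + - c * - kmode a x - R \<le> f x" using lo(1) by simp
      qed (use False cb in auto)
    qed
    then have "b \<le> (B0 + 2 * R) / \<eta>" using eta by (simp add: field_simps)
    moreover have "c * kmode a x \<le> b + R"
    proof -
      have "\<bar>c * kmode a x\<bar> \<le> \<bar>c\<bar>" using kmode_bound[of a x] by (simp add: abs_mult mult_left_le)
      then show ?thesis using cb by linarith
    qed
    ultimately show ?thesis unfolding M_def using lo(2)[OF x] by linarith
  qed
  then show ?thesis by (rule that)
qed

section \<open>Energy decay and convergence\<close>

lemma time_modulus:
  fixes f :: "real \<Rightarrow> real \<Rightarrow> real"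
  assumes f: "continuous_on (I \<times> {0..a}) (\<lambda>(t, x). f t x)" and I: "open I" and t: "t \<in> I" and e: "0 < e"
  obtains d where "0 < d" "\<And>s. \<bar>s - t\<bar> < d \<Longrightarrow> s \<in> I"
    "\<And>s x. \<bar>s - t\<bar> < d \<Longrightarrow> x \<in> {0..a} \<Longrightarrow> \<bar>f s x - f t x\<bar> < e"
proof -
  obtain r where r: "0 < r" "cball t r \<subseteq> I" using I t open_contains_cball by blast
  have cI: "{t - r..t + r} \<subseteq> I" using r by (simp add: cball_eq_atLeastAtMost)
  have "uniformly_continuous_on ({t - r..t + r} \<times> {0..a}) (\<lambda>(t, x). f t x)"
    by (rule compact_uniformly_continuous[OF continuous_on_subset[OF f]]) (use cI in \<open>auto intro!: compact_Times\<close>)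
  then obtain d where d: "0 < d" "\<And>z y. z \<in> {t - r..t + r} \<times> {0..a} \<Longrightarrow> y \<in> {t - r..t + r} \<times> {0..a} \<Longrightarrow> dist y z < d \<Longrightarrow>
      dist (f (fst y) (snd y)) (f (fst z) (snd z)) < e"
    using e unfolding uniformly_continuous_on_def case_prod_beta by metis
  show ?thesis
  proof
    show "0 < min d r" using d r by simp
    show "s \<in> I" if "\<bar>s - t\<bar> < min d r" for s using cI that by (auto simp: abs_less_iff)
    show "\<bar>f s x - f t x\<bar> < e" if s: "\<bar>s - t\<bar> < min d r" and x: "x \<in> {0..a}" for s x
    proof -
      have "dist (f (fst (s, x)) (snd (s, x))) (f (fst (t, x)) (snd (t, x))) < e"
        by (rule d(2)) (use s x r in \<open>auto simp: dist_Pair_Pair dist_real_def abs_less_iff\<close>)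
      then show ?thesis by (simp add: dist_real_def)
    qed
  qed
qed

lemma cauchy_at_top_convergent:
  fixes f :: "real \<Rightarrow> real"
  assumes c: "\<And>e. 0 < e \<Longrightarrow> \<exists>t0. \<forall>s t. t0 \<le> s \<longrightarrow> t0 \<le> t \<longrightarrow> \<bar>f s - f t\<bar> < e"
  obtains l where "(f \<longlongrightarrow> l) at_top"
proof -
  have "Cauchy (\<lambda>n. f (real n))"
    unfolding Cauchy_def
  proof (intro allI impI)
    fix e :: real assume "0 < e"
    then obtain t0 where t0: "\<forall>s t. t0 \<le> s \<longrightarrow> t0 \<le> t \<longrightarrow> \<bar>f s - f t\<bar> < e" using c by blast
    obtain M where M: "t0 \<le> real M" using real_arch_simple by blast
    show "\<exists>M. \<forall>m\<ge>M. \<forall>n\<ge>M. dist (f (real m)) (f (real n)) < e"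
    proof (intro exI allI impI)
      fix m n assume "M \<le> m" "M \<le> n"
      then have "t0 \<le> real m" "t0 \<le> real n" using M by (auto intro: order_trans)
      then show "dist (f (real m)) (f (real n)) < e" using t0 by (simp add: dist_real_def)
    qed
  qed
  then obtain l where l: "(\<lambda>n. f (real n)) \<longlonglongrightarrow> l"
    using real_Cauchy_convergent unfolding convergent_def by blast
  have "(f \<longlongrightarrow> l) at_top"
  proof (rule tendstoI)
    fix e :: real assume e: "0 < e"
    then obtain t0 where t0: "\<forall>s t. t0 \<le> s \<longrightarrow> t0 \<le> t \<longrightarrow> \<bar>f s - f t\<bar> < e / 2" using c[of "e/2"] by auto
    show "\<forall>\<^sub>F t in at_top. dist (f t) l < e"
      using eventually_ge_at_top[of t0]
    proof eventually_elim
      case (elim t)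
      have "\<forall>\<^sub>F n in sequentially. \<bar>f t - f (real n)\<bar> \<le> e / 2"
        using filterlim_real_sequentially[unfolded filterlim_at_top, rule_format, of t0]
        by eventually_elim (use t0 elim in \<open>force intro: less_imp_le\<close>)
      moreover have "(\<lambda>n. \<bar>f t - f (real n)\<bar>) \<longlonglongrightarrow> \<bar>f t - l\<bar>" by (intro tendsto_intros l)
      ultimately have "\<bar>f t - l\<bar> \<le> e / 2" by (intro tendsto_upperbound[OF _ _ sequentially_bot])
      then show ?case using e by (simp add: dist_real_def)
    qed
  qed
  then show ?thesis by (rule that)
qed

lemma kmode_integral:
  assumes "0 < a"
  shows "integral {0..a} (kmode a) = 0" "a = pi \<Longrightarrow> integral {0..a} (\<lambda>x. (kmode a x)\<^sup>2) = pi / 2"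
proof -
  show "integral {0..a} (kmode a) = 0"
  proof (cases "a = pi")
    case True
    have "integral {0..pi} (\<lambda>x. cos x) = sin pi - sin 0"
      by (rule ftc_Icc(2)) (auto intro!: derivative_eq_intros)
    then show ?thesis using True unfolding kmode_def by simp
  next
    case False
    then show ?thesis unfolding kmode_def by simp
  qed
  assume a: "a = pi"
  have "integral {0..pi} (\<lambda>x. (cos x)\<^sup>2) = (pi + sin pi * cos pi) / 2 - (0 + sin 0 * cos 0) / 2"
  proof (rule ftc_Icc(2))
    fix x :: real assume "x \<in> {0..pi}"
    have "((\<lambda>x. (x + sin x * cos x) / 2) has_real_derivative (1 + (cos x * cos x - sin x * sin x)) / 2) (at x within {0..pi})"
      by (auto intro!: derivative_eq_intros)
    moreover have "(1 + (cos x * cos x - sin x * sin x)) / 2 = (cos x)\<^sup>2"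
      using sin_cos_squared_add[of x] by (simp add: power2_eq_square)
    ultimately show "((\<lambda>x. (x + sin x * cos x) / 2) has_real_derivative (cos x)\<^sup>2) (at x within {0..pi})" by simp
  qed simp
  then show "integral {0..a} (\<lambda>x. (kmode a x)\<^sup>2) = pi / 2" unfolding kmode_def a by simp
qed

section \<open>Energy, dissipation and the a priori bound\<close>

context pde_sol
begin

text \<open>The excess with its square expanded, so that the terms can be differentiated in time one
  by one.\<close>

definition "En t = integral {0..a} (\<lambda>x. (ux t x)\<^sup>2) - integral {0..a} (\<lambda>x. (u t x)\<^sup>2) + (integral {0..a} (u t))\<^sup>2 / a"

lemma En_excess: assumes t: "t \<in> pos_times T" shows "En t = excess a (u t) (ux t)"
proof -
  have "integral {0..a} (\<lambda>x. (u t x - mean a (u t) * 1)\<^sup>2) =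
      integral {0..a} (\<lambda>x. (u t x)\<^sup>2) - 2 * mean a (u t) * integral {0..a} (\<lambda>x. u t x * 1) + (mean a (u t))\<^sup>2 * integral {0..a} (\<lambda>x. 1\<^sup>2)"
    by (rule integral_square_expand) (intro continuous_intros sec t)+
  also have "\<dots> = integral {0..a} (\<lambda>x. (u t x)\<^sup>2) - (integral {0..a} (u t))\<^sup>2 / a"
    unfolding mean_def using a by (simp add: power2_eq_square field_simps)
  finally show ?thesis unfolding En_def excess_def by simp
qed

lemma parts_u_g: assumes t: "t \<in> pos_times T" shows "integral {0..a} (\<lambda>x. u t x * g t x) = - En t"
proof -
  have 1: "integral {0..a} (\<lambda>x. (ux t x)\<^sup>2 + u t x * uxx t x) = u t a * ux t a - u t 0 * ux t 0"
  proof (rule ftc_Icc(2))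
    fix x assume x: "x \<in> {0..a}"
    show "((\<lambda>x. u t x * ux t x) has_real_derivative (ux t x)\<^sup>2 + u t x * uxx t x) (at x within {0..a})"
      using DERIV_mult[OF dx[OF t x] dxx[OF t x]] by (simp add: power2_eq_square mult.commute)
  qed (use a in simp)
  have 2: "integral {0..a} (\<lambda>x. (ux t x)\<^sup>2 + u t x * uxx t x) = integral {0..a} (\<lambda>x. (ux t x)\<^sup>2) + integral {0..a} (\<lambda>x. u t x * uxx t x)"
    by (rule integral_add_cont) (intro continuous_intros sec t)+
  have "integral {0..a} (\<lambda>x. u t x * g t x) = integral {0..a} (\<lambda>x. (u t x * uxx t x + (u t x)\<^sup>2) - mean a (u t) * u t x)"
    unfolding g_def by (rule integral_cong) (simp add: power2_eq_square algebra_simps)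
  also have "\<dots> = integral {0..a} (\<lambda>x. u t x * uxx t x + (u t x)\<^sup>2) - integral {0..a} (\<lambda>x. mean a (u t) * u t x)"
    by (rule integral_diff_cont) (intro continuous_intros sec t)+
  also have "integral {0..a} (\<lambda>x. u t x * uxx t x + (u t x)\<^sup>2) = integral {0..a} (\<lambda>x. u t x * uxx t x) + integral {0..a} (\<lambda>x. (u t x)\<^sup>2)"
    by (rule integral_add_cont) (intro continuous_intros sec t)+
  finally show ?thesis
    using 1 2 neumann[OF t] unfolding En_def by (simp add: mean_def power2_eq_square)
qed

lemma dir_deriv:
  assumes t: "t \<in> pos_times T"
  shows "((\<lambda>s. integral {0..a} (\<lambda>x. (ux s x)\<^sup>2)) has_real_derivative - 2 * integral {0..a} (\<lambda>x. uxx t x * ut t x)) (at t)"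
proof (rule deriv_from_estimate)
  fix e :: real assume e: "0 < e"
  define J where "J = (\<lambda>s. integral {0..a} (\<lambda>x. (ux s x)\<^sup>2))"
  have bdd: "\<exists>C\<ge>0. \<forall>x\<in>{0..a}. \<bar>f x\<bar> \<le> C" if "continuous_on {0..a} f" for f :: "real \<Rightarrow> real"
  proof -
    have "compact (f ` {0..a})" by (rule compact_continuous_image[OF that]) simp
    then obtain B where "\<forall>y\<in>f ` {0..a}. norm y \<le> B" using compact_imp_bounded bounded_iff by metis
    then have "\<forall>x\<in>{0..a}. \<bar>f x\<bar> \<le> max B 0" by auto
    then show ?thesis by (intro exI[of _ "max B 0"]) auto
  qed
  obtain A where A: "0 \<le> A" "\<And>x. x \<in> {0..a} \<Longrightarrow> \<bar>uxx t x\<bar> \<le> A" using bdd[OF sec(4)[OF t]] by blast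
  obtain B where B: "0 \<le> B" "\<And>x. x \<in> {0..a} \<Longrightarrow> \<bar>ut t x\<bar> \<le> B" using bdd[OF sec(2)[OF t]] by blast
  \<comment> \<open>The pointwise error is at most \<open>(B + 1 + 2 * A) * \<eta>\<close> times the
    time increment: B + 1 from the change of uxx, \<open>2 * A\<close> from the remainder of u.
    Integration adds the factor a.\<close>
  define \<eta> where "\<eta> = min 1 (e / (a * (B + 1 + 2 * A)))"
  have den: "0 < a * (B + 1 + 2 * A)" using a A B by simp
  have eta: "0 < \<eta>" "\<eta> \<le> 1" "a * (B + 1 + 2 * A) * \<eta> \<le> e"
  proof -
    show "0 < \<eta>" "\<eta> \<le> 1" unfolding \<eta>_def using e den by auto
    have "a * (B + 1 + 2 * A) * \<eta> \<le> a * (B + 1 + 2 * A) * (e / (a * (B + 1 + 2 * A)))"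
      unfolding \<eta>_def using den by (intro mult_left_mono) auto
    moreover have "X * (e / X) = e" if "0 < X" for X using that by simp
    ultimately show "a * (B + 1 + 2 * A) * \<eta> \<le> e" using den by metis
  qed
  obtain d1 where d1: "0 < d1" "\<And>s. \<bar>s - t\<bar> < d1 \<Longrightarrow> s \<in> pos_times T"
    "\<And>s x. \<bar>s - t\<bar> < d1 \<Longrightarrow> x \<in> {0..a} \<Longrightarrow> \<bar>uxx s x - uxx t x\<bar> < \<eta>"
    by (rule time_modulus[OF uxx_cont pos_times_interval(1) t eta(1)]) blast
  obtain d2 where d2: "0 < d2" "\<And>s. \<bar>s - t\<bar> < d2 \<Longrightarrow> s \<in> pos_times T"
    "\<And>s x. \<bar>s - t\<bar> < d2 \<Longrightarrow> x \<in> {0..a} \<Longrightarrow> \<bar>ut s x - ut t x\<bar> < \<eta>"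
    by (rule time_modulus[OF ut_cont pos_times_interval(1) t eta(1)]) blast
  have incr: "\<bar>u s x - u t x - (s - t) * ut t x\<bar> \<le> \<eta> * \<bar>s - t\<bar>"
    if s: "\<bar>s - t\<bar> < d2" and x: "x \<in> {0..a}" for s x
  proof -
    have "\<exists>z. \<bar>z - t\<bar> < d2 \<and> u s x - u t x = (s - t) * ut z x"
    proof (cases s t rule: linorder_cases)
      case less
      have "\<exists>z. s < z \<and> z < t \<and> u t x - u s x = (t - s) * ut z x"
        by (rule MVT2[OF less]) (use d2(2) s x in \<open>auto intro!: dt simp: abs_less_iff\<close>)
      then obtain z where "s < z" "z < t" "u t x - u s x = (t - s) * ut z x" by blast
      then show ?thesis using s by (intro exI[of _ z]) (auto simp: algebra_simps)
    next
      case greater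
      have "\<exists>z. t < z \<and> z < s \<and> u s x - u t x = (s - t) * ut z x"
        by (rule MVT2[OF greater]) (use d2(2) s x in \<open>auto intro!: dt simp: abs_less_iff\<close>)
      then obtain z where "t < z" "z < s" "u s x - u t x = (s - t) * ut z x" by blast
      then show ?thesis using s by (intro exI[of _ z]) auto
    next
      case equal
      then show ?thesis using d2(1) by (intro exI[of _ t]) simp
    qed
    then obtain z where z: "\<bar>z - t\<bar> < d2" "u s x - u t x = (s - t) * ut z x" by blast
    have "\<bar>u s x - u t x - (s - t) * ut t x\<bar> = \<bar>ut z x - ut t x\<bar> * \<bar>s - t\<bar>"
      unfolding z(2) abs_mult[symmetric] by (simp add: algebra_simps)
    also have "\<dots> \<le> \<eta> * \<bar>s - t\<bar>" using d2(3)[OF z(1) x] by (intro mult_right_mono) auto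
    finally show ?thesis .
  qed
  have main: "\<bar>J s - J t - (s - t) * (- 2 * integral {0..a} (\<lambda>x. uxx t x * ut t x))\<bar> \<le> e * \<bar>s - t\<bar>"
    if s: "\<bar>s - t\<bar> < min d1 d2" for s
  proof -
    have sp: "s \<in> pos_times T" using d1(2) s by simp
    note S = sec[OF sp] and T' = sec[OF t]
    define w where "w = (\<lambda>x. u s x - u t x)"
    have wc: "continuous_on {0..a} w" unfolding w_def by (intro continuous_intros S T')
    define z where "z = (\<lambda>x. (uxx s x + uxx t x) * w x)"
    have zc: "continuous_on {0..a} z" unfolding z_def by (intro continuous_intros S T' wc)
    have "integral {0..a} (\<lambda>x. ((ux s x)\<^sup>2 - (ux t x)\<^sup>2) + z x) = (ux s a + ux t a) * w a - (ux s 0 + ux t 0) * w 0"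
    proof (rule ftc_Icc(2))
      fix x assume x: "x \<in> {0..a}"
      have "((\<lambda>x. (ux s x + ux t x) * w x) has_real_derivative (uxx s x + uxx t x) * w x + (ux s x - ux t x) * (ux s x + ux t x)) (at x within {0..a})"
        unfolding w_def by (rule DERIV_mult[OF DERIV_add[OF dxx[OF sp x] dxx[OF t x]] DERIV_diff[OF dx[OF sp x] dx[OF t x]]])
      moreover have "(uxx s x + uxx t x) * w x + (ux s x - ux t x) * (ux s x + ux t x) = ((ux s x)\<^sup>2 - (ux t x)\<^sup>2) + z x"
        unfolding z_def by (simp add: power2_eq_square algebra_simps)
      ultimately show "((\<lambda>x. (ux s x + ux t x) * w x) has_real_derivative ((ux s x)\<^sup>2 - (ux t x)\<^sup>2) + z x) (at x within {0..a})" by simp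
    qed (use a in simp)
    moreover have "integral {0..a} (\<lambda>x. ((ux s x)\<^sup>2 - (ux t x)\<^sup>2) + z x) = integral {0..a} (\<lambda>x. (ux s x)\<^sup>2 - (ux t x)\<^sup>2) + integral {0..a} z"
      by (rule integral_add_cont) (intro continuous_intros S T' zc)+
    moreover have "integral {0..a} (\<lambda>x. (ux s x)\<^sup>2 - (ux t x)\<^sup>2) = J s - J t"
      unfolding J_def by (rule integral_diff_cont) (intro continuous_intros S T')+
    ultimately have 1: "J s - J t = - integral {0..a} z" using neumann[OF sp] neumann[OF t] by simp
    define D where "D = (\<lambda>x. 2 * (s - t) * (uxx t x * ut t x))"
    have Dc: "continuous_on {0..a} D" unfolding D_def by (intro continuous_intros T')
    have "J s - J t - (s - t) * (- 2 * integral {0..a} (\<lambda>x. uxx t x * ut t x)) = - (integral {0..a} z - integral {0..a} D)"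
      unfolding 1 D_def by simp
    also have "\<dots> = - integral {0..a} (\<lambda>x. z x - D x)" using integral_diff_cont[OF zc Dc] by simp
    also have "\<bar>\<dots>\<bar> \<le> ((B + 1 + 2 * A) * \<eta> * \<bar>s - t\<bar>) * (a - 0)"
    proof -
      have "norm (integral {0..a} (\<lambda>x. z x - D x)) \<le> ((B + 1 + 2 * A) * \<eta> * \<bar>s - t\<bar>) * (a - 0)"
      proof (rule integral_bound)
        show "0 \<le> a" using a by simp
        show "continuous_on {0..a} (\<lambda>x. z x - D x)" by (intro continuous_intros zc Dc)
        fix x assume x: "x \<in> {0..a}"
        define r where "r = u s x - u t x - (s - t) * ut t x"
        have r: "\<bar>r\<bar> \<le> \<eta> * \<bar>s - t\<bar>" unfolding r_def using incr[OF _ x] s by simp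
        have wb: "\<bar>w x\<bar> \<le> (B + 1) * \<bar>s - t\<bar>"
        proof -
          have "w x = (s - t) * ut t x + r" unfolding w_def r_def by simp
          then have "\<bar>w x\<bar> \<le> \<bar>s - t\<bar> * \<bar>ut t x\<bar> + \<bar>r\<bar>" by (metis abs_mult abs_triangle_ineq)
          also have "\<dots> \<le> \<bar>s - t\<bar> * B + 1 * \<bar>s - t\<bar>"
            using B(2)[OF x] r eta mult_right_mono[of \<eta> 1 "\<bar>s - t\<bar>"] by (intro add_mono mult_left_mono) auto
          finally show ?thesis by (simp add: algebra_simps)
        qed
        have "z x - D x = (uxx s x - uxx t x) * w x + 2 * (uxx t x * r)"
          unfolding z_def D_def r_def w_def by (simp add: algebra_simps)
        then have "norm (z x - D x) \<le> \<bar>uxx s x - uxx t x\<bar> * \<bar>w x\<bar> + 2 * (\<bar>uxx t x\<bar> * \<bar>r\<bar>)"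
          by (metis abs_mult abs_numeral abs_triangle_ineq real_norm_def)
        also have "\<dots> \<le> \<eta> * ((B + 1) * \<bar>s - t\<bar>) + 2 * (A * (\<eta> * \<bar>s - t\<bar>))"
          using d1(3)[OF _ x, of s] s wb A(2)[OF x] r A(1) eta by (intro add_mono mult_mono) auto
        finally show "norm (z x - D x) \<le> (B + 1 + 2 * A) * \<eta> * \<bar>s - t\<bar>" by (simp add: algebra_simps)
      qed
      then show ?thesis by simp
    qed
    also have "\<dots> = (a * (B + 1 + 2 * A) * \<eta>) * \<bar>s - t\<bar>" by simp
    also have "\<dots> \<le> e * \<bar>s - t\<bar>" using eta(3) by (intro mult_right_mono) auto
    finally show ?thesis .
  qed
  show "\<exists>d>0. \<forall>s. \<bar>s - t\<bar> < d \<longrightarrow> \<bar>integral {0..a} (\<lambda>x. (ux s x)\<^sup>2) - integral {0..a} (\<lambda>x. (ux t x)\<^sup>2)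
      - (s - t) * (- 2 * integral {0..a} (\<lambda>x. uxx t x * ut t x))\<bar> \<le> e * \<bar>s - t\<bar>"
    using main d1(1) d2(1) unfolding J_def by (intro exI[of _ "min d1 d2"]) auto
qed

definition "Diss t = integral {0..a} (\<lambda>x. u t x powr p * (g t x)\<^sup>2)"

text \<open>The three terms of the energy differentiate to integrals against ut, which combine to -2
  times the integral of \<open>g * ut\<close>; the equation turns this into a weighted
  square.\<close>

lemma En_deriv: assumes t: "t \<in> pos_times T" shows "(En has_real_derivative - 2 * Diss t) (at t)"
proof -
  have 1: "((\<lambda>s. integral {0..a} (\<lambda>x. (u s x)\<^sup>2)) has_real_derivative integral {0..a} (\<lambda>x. 2 * (u t x * ut t x))) (at t)"
  proof (rule leibniz_time[OF _ _ _ t])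
    show "((\<lambda>s. (u s x)\<^sup>2) has_real_derivative 2 * (u s x * ut s x)) (at s)" if "s \<in> pos_times T" "x \<in> {0..a}" for s x
      using DERIV_power[OF dt[OF that], of 2] by (simp add: mult.commute)
    show "continuous_on (pos_times T \<times> {0..a}) (\<lambda>(t, x). 2 * (u t x * ut t x))"
      using u_cont' ut_cont unfolding case_prod_beta by (intro continuous_intros)
  qed (intro continuous_intros sec)
  have 2: "((\<lambda>s. integral {0..a} (u s)) has_real_derivative integral {0..a} (ut t)) (at t)"
    by (rule leibniz_time[OF dt sec(1) ut_cont t])
  have 3: "(En has_real_derivative - 2 * integral {0..a} (\<lambda>x. uxx t x * ut t x) - integral {0..a} (\<lambda>x. 2 * (u t x * ut t x))
      + (2 * integral {0..a} (u t) * integral {0..a} (ut t)) / a) (at t)"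
    unfolding En_def[abs_def] using DERIV_power[OF 2, of 2]
    by (intro DERIV_add DERIV_diff DERIV_cdivide dir_deriv[OF t] 1) (simp add: mult.assoc mult.commute mult.left_commute)
  have "Diss t = integral {0..a} (\<lambda>x. (uxx t x * ut t x + u t x * ut t x) - mean a (u t) * ut t x)"
    unfolding Diss_def
  proof (rule integral_cong)
    fix x assume x: "x \<in> {0..a}"
    have "u t x powr p * (g t x)\<^sup>2 = g t x * ut t x" unfolding ut_eq[OF t x] by (simp add: power2_eq_square)
    then show "u t x powr p * (g t x)\<^sup>2 = (uxx t x * ut t x + u t x * ut t x) - mean a (u t) * ut t x"
      unfolding g_def by (simp add: algebra_simps)
  qed
  also have "\<dots> = integral {0..a} (\<lambda>x. uxx t x * ut t x + u t x * ut t x) - integral {0..a} (\<lambda>x. mean a (u t) * ut t x)"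
    by (rule integral_diff_cont) (intro continuous_intros sec t)+
  also have "integral {0..a} (\<lambda>x. uxx t x * ut t x + u t x * ut t x) = integral {0..a} (\<lambda>x. uxx t x * ut t x) + integral {0..a} (\<lambda>x. u t x * ut t x)"
    by (rule integral_add_cont) (intro continuous_intros sec t)+
  finally have "- 2 * Diss t = - 2 * integral {0..a} (\<lambda>x. uxx t x * ut t x) - integral {0..a} (\<lambda>x. 2 * (u t x * ut t x))
      + (2 * integral {0..a} (u t) * integral {0..a} (ut t)) / a"
    by (simp add: mean_def)
  with 3 show ?thesis by simp
qed

lemma Diss_nonneg: assumes t: "t \<in> pos_times T" shows "0 \<le> Diss t"
  unfolding Diss_def
  by (rule integral_nonneg_cont) (intro continuous_intros W_sec g_sec t, use pos_times_subset t in auto)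

lemma pos_times_between: "s \<in> pos_times T \<Longrightarrow> t \<in> pos_times T \<Longrightarrow> s \<le> r \<Longrightarrow> r \<le> t \<Longrightarrow> r \<in> pos_times T"
proof -
  assume s: "s \<in> pos_times T" and t: "t \<in> pos_times T" and r: "s \<le> r" "r \<le> t"
  have "ereal r \<le> ereal t" using r by simp
  also have "\<dots> < T" using t unfolding pos_times_def by simp
  finally show ?thesis using s r unfolding pos_times_def by simp
qed

lemma En_mono: assumes "s \<in> pos_times T" "t \<in> pos_times T" "s \<le> t" shows "En t \<le> En s"
proof (rule nonincreasing_from_deriv[where f = En and f' = "\<lambda>r. - 2 * Diss r"])
  have I: "r \<in> pos_times T" if "s \<le> r" "r \<le> t" for r using pos_times_between assms that by blast
  show "continuous_on {s..t} En"
    by (rule DERIV_continuous_on, rule has_field_derivative_at_within, rule En_deriv) (use I in auto)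
  fix r assume "s < r" "r < t"
  then have r: "r \<in> pos_times T" using I by simp
  show "(En has_real_derivative - 2 * Diss r) (at r)" by (rule En_deriv[OF r])
  show "- 2 * Diss r \<le> 0" using Diss_nonneg[OF r] by simp
qed (use assms in simp)

definition "mass = integral {0..a} (\<lambda>x. u 0 x powr (1 - p))"

lemma zero_in_times: "0 \<in> times T"
  unfolding times_def using T0 by (simp add: zero_ereal_def)

text \<open>By continuity one point of positive weight suffices. The midpoint serves
  \<open>1 - kmode\<close> and \<open>1 + kmode\<close> alike, because the mode vanishes
  there.\<close>

lemma weighted_mass_pos:
  assumes psi: "continuous_on {0..a} \<psi>" "\<And>x. x \<in> {0..a} \<Longrightarrow> 0 \<le> \<psi> x" "0 < \<psi> (a / 2)"
  shows "0 < integral {0..a} (\<lambda>x. u 0 x powr (1 - p) * \<psi> x)"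
proof -
  define F where "F = (\<lambda>x. u 0 x powr (1 - p) * \<psi> x)"
  have c: "continuous_on {0..a} F" unfolding F_def by (intro continuous_intros W_sec[OF zero_in_times] psi(1))
  have n: "0 \<le> F x" if "x \<in> {0..a}" for x unfolding F_def using psi(2)[OF that] by simp
  have m: "a / 2 \<in> {0..a}" using a by simp
  have "F (a / 2) \<noteq> 0" unfolding F_def using psi(3) u_pos[OF zero_in_times m] by simp
  then have "integral {0..a} F \<noteq> 0" using integral_eq_0_iff[OF c] n a m by auto
  moreover have "0 \<le> integral {0..a} F" by (rule integral_nonneg_cont[OF c n])
  ultimately show ?thesis unfolding F_def by simp
qed

lemma mass_pos: "0 < mass"
  unfolding mass_def using weighted_mass_pos[of "\<lambda>x. 1"] by simp

lemma kmode_conserved: assumes t: "t \<in> times T"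
  shows "integral {0..a} (\<lambda>x. u t x powr (1 - p) * kmode a x) = integral {0..a} (\<lambda>x. u 0 x powr (1 - p) * kmode a x)"
  using conserved_cos[OF _ t] unfolding kmode_def by (cases "a = pi") auto

text \<open>The energy decreases, so its value at t0 fixes one radius R for all later times, and the
  weighted masses in \<open>sup_bound\<close> are conserved. The start t0 is positive because the
  energy contains ux.\<close>

lemma sup_bounded_late:
  assumes api: "a \<le> pi" and t0: "t0 \<in> pos_times T"
  obtains M where "\<And>t x. t \<in> times T \<Longrightarrow> t0 \<le> t \<Longrightarrow> x \<in> {0..a} \<Longrightarrow> u t x \<le> M"
proof -
  obtain K where K: "0 \<le> K"
    "\<And>f f'. (\<And>x. x \<in> {0..a} \<Longrightarrow> (f has_real_derivative f' x) (at x within {0..a})) \<Longrightarrow> continuous_on {0..a} f' \<Longrightarrow>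
      \<exists>c. (a \<noteq> pi \<longrightarrow> c = 0) \<and> (\<forall>x\<in>{0..a}. \<bar>f x - mean a f - c * kmode a x\<bar> \<le> K * sqrt (excess a f f'))"
    by (rule excess_decomposition[OF a api]) blast
  define k1 k2 where "k1 = integral {0..a} (\<lambda>x. u 0 x powr (1 - p) * (1 - kmode a x))"
    and "k2 = integral {0..a} (\<lambda>x. u 0 x powr (1 - p) * (1 + kmode a x))"
  have half: "kmode a (a / 2) = 0" unfolding kmode_def by simp
  have kb: "0 \<le> 1 + kmode a x" "0 \<le> 1 - kmode a x" for x using kmode_bound[of a x] by (auto simp: abs_le_iff)
  have k: "0 < k1" "0 < k2"
    unfolding k1_def k2_def
    by (rule weighted_mass_pos; use half kb in \<open>auto intro!: continuous_intros kmode_cont simp del: diff_ge_0_iff_ge\<close>)+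
  define \<kappa> where "\<kappa> = min k1 k2"
  have kap: "0 < \<kappa>" unfolding \<kappa>_def using k by simp
  have E0: "0 \<le> En t0" using excess_controls(1)[OF a api dx[OF t0] sec(3)[OF t0]] En_excess[OF t0] by simp
  define R where "R = K * sqrt (En t0)"
  have R: "0 \<le> R" unfolding R_def using K E0 by simp
  obtain M where M: "\<And>f c x. continuous_on {0..a} f \<Longrightarrow> (\<And>x. x \<in> {0..a} \<Longrightarrow> 0 < f x) \<Longrightarrow>
      integral {0..a} (\<lambda>x. f x powr (1 - p)) = mass \<Longrightarrow>
      \<kappa> \<le> integral {0..a} (\<lambda>x. f x powr (1 - p) * (1 - kmode a x)) \<Longrightarrow>
      \<kappa> \<le> integral {0..a} (\<lambda>x. f x powr (1 - p) * (1 + kmode a x)) \<Longrightarrow>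
      (a \<noteq> pi \<longrightarrow> c = 0) \<Longrightarrow> (\<And>x. x \<in> {0..a} \<Longrightarrow> \<bar>f x - mean a f - c * kmode a x\<bar> \<le> R) \<Longrightarrow>
      x \<in> {0..a} \<Longrightarrow> f x \<le> M"
    by (rule sup_bound[OF p a kap mass_pos R]) blast
  have cons: "integral {0..a} (\<lambda>x. u t x powr (1 - p) * (1 + s * kmode a x)) = integral {0..a} (\<lambda>x. u 0 x powr (1 - p) * (1 + s * kmode a x))"
    if t: "t \<in> times T" for t s
  proof -
    have e: "integral {0..a} (\<lambda>x. u t x powr (1 - p) * (1 + s * kmode a x)) =
      integral {0..a} (\<lambda>x. u t x powr (1 - p)) + s * integral {0..a} (\<lambda>x. u t x powr (1 - p) * kmode a x)"
      if t: "t \<in> times T" for t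
    proof -
      have "integral {0..a} (\<lambda>x. u t x powr (1 - p) * (1 + s * kmode a x)) = integral {0..a} (\<lambda>x. u t x powr (1 - p) + s * (u t x powr (1 - p) * kmode a x))"
        by (rule integral_cong) (simp add: algebra_simps)
      also have "\<dots> = integral {0..a} (\<lambda>x. u t x powr (1 - p)) + integral {0..a} (\<lambda>x. s * (u t x powr (1 - p) * kmode a x))"
        by (rule integral_add_cont) (intro continuous_intros W_sec t kmode_cont)+
      finally show ?thesis by simp
    qed
    show ?thesis unfolding e[OF t] e[OF zero_in_times] using conserved[OF t] kmode_conserved[OF t] by simp
  qed
  have "u t x \<le> M" if t: "t \<in> times T" "t0 \<le> t" and x: "x \<in> {0..a}" for t x
  proof -
    have tp: "t \<in> pos_times T" using t t0 unfolding times_def pos_times_def by auto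
    obtain c where c: "a \<noteq> pi \<longrightarrow> c = 0" "\<And>x. x \<in> {0..a} \<Longrightarrow> \<bar>u t x - mean a (u t) - c * kmode a x\<bar> \<le> K * sqrt (excess a (u t) (ux t))"
      using K(2)[OF dx[OF tp] sec(3)[OF tp]] by blast
    have "K * sqrt (excess a (u t) (ux t)) \<le> R"
      unfolding R_def En_excess[OF tp, symmetric] using K En_mono[OF t0 tp t(2)] by (intro mult_left_mono) auto
    then have c2: "\<bar>u t x - mean a (u t) - c * kmode a x\<bar> \<le> R" if "x \<in> {0..a}" for x
      using c(2)[OF that] by simp
    show ?thesis
    proof (rule M[OF sec_times[OF t(1)] u_pos[OF t(1)] _ _ _ c(1) c2 x])
      show "integral {0..a} (\<lambda>x. u t x powr (1 - p)) = mass" unfolding mass_def by (rule conserved[OF t(1)])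
      show "\<kappa> \<le> integral {0..a} (\<lambda>x. u t x powr (1 - p) * (1 - kmode a x))"
        using cons[OF t(1), of "-1"] unfolding \<kappa>_def k1_def by simp
      show "\<kappa> \<le> integral {0..a} (\<lambda>x. u t x powr (1 - p) * (1 + kmode a x))"
        using cons[OF t(1), of "1"] unfolding \<kappa>_def k2_def by simp
    qed
  qed
  then show ?thesis by (rule that)
qed

text \<open>The late bound covers times after t0; before t0 the space-time domain is compact and u
  is continuous up to time 0.\<close>

lemma sup_bounded:
  assumes api: "a \<le> pi"
  obtains M where "0 < M" "\<And>t x. t \<in> times T \<Longrightarrow> x \<in> {0..a} \<Longrightarrow> u t x \<le> M"
proof -
  obtain t0 where t0: "t0 \<in> pos_times T"
    using T0 ereal_dense2[of 0 T] unfolding pos_times_def by (auto simp: zero_ereal_def)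
  obtain M1 where M1: "\<And>t x. t \<in> times T \<Longrightarrow> t0 \<le> t \<Longrightarrow> x \<in> {0..a} \<Longrightarrow> u t x \<le> M1"
    by (rule sup_bounded_late[OF api t0]) blast
  have "t0 \<in> times T" using t0 pos_times_subset by blast
  then have "continuous_on ({0..t0} \<times> {0..a}) (\<lambda>(t, x). u t x)"
    by (intro continuous_on_subset[OF u_cont]) (use times_Icc in blast)
  then have "compact ((\<lambda>(t, x). u t x) ` ({0..t0} \<times> {0..a}))"
    by (rule compact_continuous_image) (intro compact_Times compact_Icc)
  then obtain M2 where M2: "\<forall>y\<in>(\<lambda>(t, x). u t x) ` ({0..t0} \<times> {0..a}). norm y \<le> M2"
    using compact_imp_bounded bounded_iff by metis
  have M2': "u t x \<le> M2" if "t \<in> {0..t0}" "x \<in> {0..a}" for t x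
  proof -
    have "(\<lambda>(t, x). u t x) (t, x) \<in> (\<lambda>(t, x). u t x) ` ({0..t0} \<times> {0..a})" using that by blast
    from bspec[OF M2 this] show ?thesis by (simp add: abs_le_iff)
  qed
  show ?thesis
  proof
    show "0 < max 1 (max M1 M2)" by simp
    fix t x assume t: "t \<in> times T" and x: "x \<in> {0..a}"
    show "u t x \<le> max 1 (max M1 M2)"
    proof (cases "t0 \<le> t")
      case True
      from M1[OF t this x] show ?thesis by simp
    next
      case False
      then have "t \<in> {0..t0}" using t unfolding times_def by simp
      from M2'[OF this x] show ?thesis by simp
    qed
  qed
qed

text \<open>Cauchy--Schwarz in \<open>En t = - \<integral> u g\<close> with weights \<open>u powr (p / 2)\<close> and
  \<open>u powr (1 - p / 2)\<close>, and \<open>u powr (2 - p) \<le> M * u powr (1 - p)\<close>.\<close>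
lemma En_square_le:
  assumes t: "t \<in> pos_times T" and M: "\<And>x. x \<in> {0..a} \<Longrightarrow> u t x \<le> M"
  shows "(En t)\<^sup>2 \<le> Diss t * (M * mass)"
proof -
  have tt: "t \<in> times T" using t pos_times_subset by blast
  have pos: "0 < u t x" if "x \<in> {0..a}" for x using u_pos[OF tt that] .
  have "(integral {0..a} (\<lambda>x. (u t x powr (p / 2) * g t x) * u t x powr (1 - p / 2)))\<^sup>2 \<le>
     integral {0..a} (\<lambda>x. (u t x powr (p / 2) * g t x)\<^sup>2) * integral {0..a} (\<lambda>x. (u t x powr (1 - p / 2))\<^sup>2)"
    by (rule integral_Cauchy_Schwarz) (intro continuous_intros W_sec tt g_sec t)+
  moreover have "integral {0..a} (\<lambda>x. (u t x powr (p / 2) * g t x) * u t x powr (1 - p / 2)) = - En t"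
    unfolding parts_u_g[OF t, symmetric]
  proof (rule integral_cong)
    fix x assume x: "x \<in> {0..a}"
    have "u t x powr (p / 2) * u t x powr (1 - p / 2) = u t x" using pos[OF x] by (simp add: powr_add[symmetric])
    then show "(u t x powr (p / 2) * g t x) * u t x powr (1 - p / 2) = u t x * g t x"
      by (metis mult.commute mult.assoc)
  qed
  moreover have "integral {0..a} (\<lambda>x. (u t x powr (p / 2) * g t x)\<^sup>2) = Diss t"
    unfolding Diss_def
    by (rule integral_cong) (use pos in \<open>simp add: power_mult_distrib power2_eq_square powr_add[symmetric]\<close>)
  moreover have "integral {0..a} (\<lambda>x. (u t x powr (1 - p / 2))\<^sup>2) \<le> M * mass"
  proof -
    have "integral {0..a} (\<lambda>x. (u t x powr (1 - p / 2))\<^sup>2) \<le> integral {0..a} (\<lambda>x. M * u t x powr (1 - p))"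
    proof (rule integral_mono_cont)
      fix x assume x: "x \<in> {0..a}"
      have "(u t x powr (1 - p / 2))\<^sup>2 = u t x powr (1 + (1 - p))"
        using pos[OF x] by (simp add: power2_eq_square powr_add[symmetric])
      also have "\<dots> = u t x * u t x powr (1 - p)" using pos[OF x] by (subst powr_add) simp
      also have "\<dots> \<le> M * u t x powr (1 - p)" using M[OF x] by (intro mult_right_mono) auto
      finally show "(u t x powr (1 - p / 2))\<^sup>2 \<le> M * u t x powr (1 - p)" .
    qed (intro continuous_intros W_sec tt)+
    also have "\<dots> = M * mass" unfolding mass_def conserved[OF tt, symmetric] by simp
    finally show ?thesis .
  qed
  ultimately show ?thesis using mult_left_mono[OF _ Diss_nonneg[OF t]] by (smt (verit) power2_minus)
qed

end

section \<open>Global solutions: decay of the energy and convergence\<close>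

locale pde_global = pde_sol p a \<infinity> u ut ux uxx for p a u ut ux uxx +
  assumes api: "a \<le> pi"
begin

lemma times_inf: "t \<in> times \<infinity> \<longleftrightarrow> 0 \<le> t" "t \<in> pos_times \<infinity> \<longleftrightarrow> 0 < t"
  unfolding times_def pos_times_def by auto

lemma En_nonneg: "0 < t \<Longrightarrow> 0 \<le> En t"
  using excess_controls(1)[OF a api dx sec(3)] En_excess times_inf by simp

text \<open>While En is at least \<delta>, the dissipation is at least \<delta>^2 / (M * mass), so
  En would fall linearly below 0. Once it is under \<delta> it remains there by
  monotonicity.\<close>

lemma En_tendsto: "(En \<longlongrightarrow> 0) at_top"
proof (rule tendstoI)
  fix \<delta> :: real assume del: "0 < \<delta>"
  obtain M where M: "0 < M" "\<And>t x. t \<in> times \<infinity> \<Longrightarrow> x \<in> {0..a} \<Longrightarrow> u t x \<le> M"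
    by (rule sup_bounded[OF api]) blast
  have Mm: "0 < M * mass" using M mass_pos by simp
  have "\<exists>t1\<ge>1. En t1 < \<delta>"
  proof (rule ccontr)
    assume "\<not> (\<exists>t1\<ge>1. En t1 < \<delta>)"
    then have big: "\<delta> \<le> En t" if "1 \<le> t" for t using that by force
    define k where "k = 2 * (\<delta>\<^sup>2 / (M * mass))"
    have k: "0 < k" unfolding k_def using del Mm by simp
    \<comment> \<open>By this time the linear decrease would have brought En down to -1.\<close>
    define t where "t = 1 + (En 1 + 1) / k"
    have E1: "0 \<le> En 1" by (rule En_nonneg) simp
    have t1: "1 \<le> t" unfolding t_def using E1 k by simp
    have "En t + k * t \<le> En 1 + k * 1"
    proof (rule nonincreasing_from_deriv[where f = "\<lambda>r. En r + k * r" and f' = "\<lambda>r. - 2 * Diss r + k"])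
      have "continuous_on {1..t} En"
        by (rule DERIV_continuous_on, rule has_field_derivative_at_within, rule En_deriv) (simp add: times_inf)
      then show "continuous_on {1..t} (\<lambda>r. En r + k * r)" by (intro continuous_intros)
      fix r assume r: "1 < r" "r < t"
      then have rp: "r \<in> pos_times \<infinity>" "r \<in> times \<infinity>" by (simp_all add: times_inf)
      show "((\<lambda>r. En r + k * r) has_real_derivative - 2 * Diss r + k) (at r)"
        by (intro DERIV_add En_deriv rp) (auto intro!: derivative_eq_intros)
      have "\<delta>\<^sup>2 \<le> (En r)\<^sup>2" using big[of r] r del by (intro power_mono) auto
      also have "\<dots> \<le> Diss r * (M * mass)" by (rule En_square_le[OF rp(1) M(2)[OF rp(2)]])
      finally have "\<delta>\<^sup>2 / (M * mass) \<le> Diss r" using Mm by (simp add: pos_divide_le_eq)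
      then show "- 2 * Diss r + k \<le> 0" unfolding k_def by simp
    qed (use t1 in simp)
    then have "En t \<le> En 1 - k * (t - 1)" by (simp add: algebra_simps)
    also have "\<dots> = - 1" unfolding t_def using k by simp
    finally show False using En_nonneg[of t] t1 by simp
  qed
  then obtain t1 where t1: "1 \<le> t1" "En t1 < \<delta>" by blast
  show "\<forall>\<^sub>F t in at_top. dist (En t) 0 < \<delta>"
    using eventually_ge_at_top[of t1]
  proof eventually_elim
    case (elim t)
    have "En t \<le> En t1" by (rule En_mono) (use t1 elim in \<open>auto simp: times_inf\<close>)
    then show ?case using En_nonneg[of t] t1 elim by (simp add: dist_real_def)
  qed
qed

text \<open>Testing the difference of the conserved densities at two times with the difference of the
  solutions only sees the remainders, because 1 and the kernel mode are conserved weights.\<close>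
lemma converges:
  obtains v where "nonneg_steady_state p a v" "uniform_limit {0..a} u v at_top"
proof -
  obtain M where M: "0 < M" "\<And>t x. t \<in> times \<infinity> \<Longrightarrow> x \<in> {0..a} \<Longrightarrow> u t x \<le> M"
    by (rule sup_bounded[OF api]) blast
  obtain K where K: "0 \<le> K"
    "\<And>f f'. (\<And>x. x \<in> {0..a} \<Longrightarrow> (f has_real_derivative f' x) (at x within {0..a})) \<Longrightarrow> continuous_on {0..a} f' \<Longrightarrow>
      \<exists>c. (a \<noteq> pi \<longrightarrow> c = 0) \<and> (\<forall>x\<in>{0..a}. \<bar>f x - mean a f - c * kmode a x\<bar> \<le> K * sqrt (excess a f f'))"
    by (rule excess_decomposition[OF a api]) blast
  define b where "b = (\<lambda>t. mean a (u t))"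
  define \<rho> where "\<rho> = (\<lambda>t. K * sqrt (En t))"
  have "\<forall>t. \<exists>c. 0 < t \<longrightarrow> (a \<noteq> pi \<longrightarrow> c = 0) \<and> (\<forall>x\<in>{0..a}. \<bar>u t x - b t - c * kmode a x\<bar> \<le> \<rho> t)"
  proof
    fix t
    show "\<exists>c. 0 < t \<longrightarrow> (a \<noteq> pi \<longrightarrow> c = 0) \<and> (\<forall>x\<in>{0..a}. \<bar>u t x - b t - c * kmode a x\<bar> \<le> \<rho> t)"
    proof (cases "0 < t")
      case True
      then have t: "t \<in> pos_times \<infinity>" by (simp add: times_inf)
      from K(2)[OF dx[OF t] sec(3)[OF t]] show ?thesis unfolding b_def \<rho>_def En_excess[OF t] by blast
    qed simp
  qed
  \<comment> \<open>The coefficients are merely chosen for each time, without any regularity in t;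
    their convergence is obtained from increments below.\<close>
  from choice[OF this] obtain c where c: "\<And>t. 0 < t \<Longrightarrow> a \<noteq> pi \<Longrightarrow> c t = 0"
    "\<And>t x. 0 < t \<Longrightarrow> x \<in> {0..a} \<Longrightarrow> \<bar>u t x - b t - c t * kmode a x\<bar> \<le> \<rho> t"
    by blast
  have rho_lim: "(\<rho> \<longlongrightarrow> 0) at_top"
  proof -
    have "((\<lambda>t. K * sqrt (En t)) \<longlongrightarrow> K * sqrt 0) at_top" by (intro tendsto_intros En_tendsto)
    then show ?thesis unfolding \<rho>_def by simp
  qed
  have rho0: "0 \<le> \<rho> t" if "0 < t" for t unfolding \<rho>_def using K(1) En_nonneg[OF that] by simp
  define \<kappa> where "\<kappa> = (p - 1) * M powr (- p)"
  have kap: "0 < \<kappa>" unfolding \<kappa>_def using p M by simp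
  \<comment> \<open>Quotient of the L1 bound \<open>2 * mass\<close> for an increment of the
    densities and the monotonicity constant.\<close>
  define A where "A = 2 * mass / \<kappa>"
  have A: "0 < A" unfolding A_def using mass_pos kap by simp
  define L where "L = (\<lambda>s t. integral {0..a} (\<lambda>x. (u s x - u t x)\<^sup>2))"
  have L_bound: "L s t \<le> A * (\<rho> s + \<rho> t)" if st: "0 < s" "0 < t" for s t
  proof -
    have ts: "s \<in> times \<infinity>" "t \<in> times \<infinity>" using st by (simp_all add: times_inf)
    define w where "w = (\<lambda>x. u s x powr (1 - p) - u t x powr (1 - p))"
    define W where "W = (\<lambda>x. u s x powr (1 - p) + u t x powr (1 - p))"
    have wc: "continuous_on {0..a} w" unfolding w_def by (intro continuous_intros W_sec ts)
    have Wc: "continuous_on {0..a} W" unfolding W_def by (intro continuous_intros W_sec ts)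
    define r where "r = (\<lambda>x. (u s x - b s - c s * kmode a x) - (u t x - b t - c t * kmode a x))"
    have rc: "continuous_on {0..a} r" unfolding r_def by (intro continuous_intros sec_times ts kmode_cont)
    have w1: "integral {0..a} w = 0"
      unfolding w_def using integral_diff_cont[OF W_sec[OF ts(1), of "1 - p"] W_sec[OF ts(2), of "1 - p"]]
        conserved[OF ts(1)] conserved[OF ts(2)] by simp
    have wk: "integral {0..a} (\<lambda>x. w x * kmode a x) = 0"
    proof -
      have "integral {0..a} (\<lambda>x. w x * kmode a x) = integral {0..a} (\<lambda>x. u s x powr (1 - p) * kmode a x - u t x powr (1 - p) * kmode a x)"
        unfolding w_def by (rule integral_cong) (simp add: algebra_simps)
      also have "\<dots> = integral {0..a} (\<lambda>x. u s x powr (1 - p) * kmode a x) - integral {0..a} (\<lambda>x. u t x powr (1 - p) * kmode a x)"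
        by (rule integral_diff_cont) (intro continuous_intros W_sec ts kmode_cont)+
      finally show ?thesis using kmode_conserved[OF ts(1)] kmode_conserved[OF ts(2)] by simp
    qed
    have "integral {0..a} (\<lambda>x. w x * (u s x - u t x)) = integral {0..a} (\<lambda>x. ((b s - b t) * w x + (c s - c t) * (w x * kmode a x)) + w x * r x)"
      unfolding r_def by (rule integral_cong) (simp add: algebra_simps)
    also have "\<dots> = integral {0..a} (\<lambda>x. (b s - b t) * w x + (c s - c t) * (w x * kmode a x)) + integral {0..a} (\<lambda>x. w x * r x)"
      by (rule integral_add_cont) (intro continuous_intros wc rc kmode_cont)+
    also have "integral {0..a} (\<lambda>x. (b s - b t) * w x + (c s - c t) * (w x * kmode a x))
       = integral {0..a} (\<lambda>x. (b s - b t) * w x) + integral {0..a} (\<lambda>x. (c s - c t) * (w x * kmode a x))"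
      by (rule integral_add_cont) (intro continuous_intros wc kmode_cont)+
    finally have eq: "integral {0..a} (\<lambda>x. w x * (u s x - u t x)) = integral {0..a} (\<lambda>x. w x * r x)"
      using w1 wk by simp
    \<comment> \<open>Only the L1 size of w enters, and the conserved mass bounds it; pointwise the
      densities may be large where u is small.\<close>
    have "integral {0..a} (\<lambda>x. (- (\<rho> s + \<rho> t)) * W x) \<le> integral {0..a} (\<lambda>x. w x * r x)"
    proof (rule integral_mono_cont)
      fix x assume x: "x \<in> {0..a}"
      have "\<bar>r x\<bar> \<le> \<rho> s + \<rho> t" unfolding r_def using c(2)[OF st(1) x] c(2)[OF st(2) x] by linarith
      moreover have "\<bar>w x\<bar> \<le> W x" unfolding w_def W_def using abs_triangle_ineq4[of "u s x powr (1 - p)" "u t x powr (1 - p)"] by simp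
      ultimately have "\<bar>w x\<bar> * \<bar>r x\<bar> \<le> W x * (\<rho> s + \<rho> t)"
        by (intro mult_mono) (auto simp: W_def)
      then show "(- (\<rho> s + \<rho> t)) * W x \<le> w x * r x"
        by (simp add: abs_mult[symmetric] abs_le_iff algebra_simps)
    qed (intro continuous_intros wc Wc rc)+
    moreover have "integral {0..a} W = 2 * mass"
      unfolding W_def mass_def using integral_add_cont[OF W_sec[OF ts(1), of "1 - p"] W_sec[OF ts(2), of "1 - p"]]
        conserved[OF ts(1)] conserved[OF ts(2)] by simp
    moreover have "integral {0..a} (\<lambda>x. w x * (u s x - u t x)) \<le> integral {0..a} (\<lambda>x. - \<kappa> * (u s x - u t x)\<^sup>2)"
    proof (rule integral_mono_cont)
      fix x assume x: "x \<in> {0..a}"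
      show "w x * (u s x - u t x) \<le> - \<kappa> * (u s x - u t x)\<^sup>2"
        unfolding w_def \<kappa>_def
        by (rule powr_neg_monotone[OF p]) (use u_pos ts x M(2) in auto)
    qed (intro continuous_intros wc sec_times ts)+
    moreover have "integral {0..a} (\<lambda>x. - \<kappa> * (u s x - u t x)\<^sup>2) = - (\<kappa> * L s t)"
      unfolding L_def by simp
    moreover have "integral {0..a} (\<lambda>x. (- (\<rho> s + \<rho> t)) * W x) = - ((\<rho> s + \<rho> t) * integral {0..a} W)"
      by (simp only: integral_mult_right)
    ultimately have "\<kappa> * L s t \<le> (\<rho> s + \<rho> t) * (2 * mass)"
      using eq by (metis neg_le_iff_le order_trans)
    then show ?thesis unfolding A_def using kap by (simp add: field_simps)
  qed
  have L0: "0 \<le> L s t" if "0 < s" "0 < t" for s t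
    unfolding L_def by (rule integral_nonneg_cont) (use that in \<open>auto intro!: continuous_intros sec_times simp: times_inf\<close>)
  have small: "\<exists>t0>0. \<forall>t\<ge>t0. \<rho> t < e" if e: "0 < e" for e
  proof -
    have "\<forall>\<^sub>F t in at_top. \<rho> t < e" using order_tendstoD(2)[OF rho_lim e] .
    then obtain N where N: "\<And>t. N \<le> t \<Longrightarrow> \<rho> t < e" unfolding eventually_at_top_linorder by blast
    show ?thesis by (rule exI[of _ "max 1 N"]) (use N in auto)
  qed
  have b_diff: "a * \<bar>b s - b t\<bar> \<le> sqrt (a * L s t)" if st: "0 < s" "0 < t" for s t
  proof -
    have ts: "s \<in> times \<infinity>" "t \<in> times \<infinity>" using st by (simp_all add: times_inf)
    have "\<bar>integral {0..a} (\<lambda>x. u s x - u t x)\<bar> \<le> sqrt (a * L s t)"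
      unfolding L_def by (rule integral_abs_le_sqrt) (use a in \<open>auto intro!: continuous_intros sec_times ts\<close>)
    moreover have "integral {0..a} (\<lambda>x. u s x - u t x) = a * (b s - b t)"
      using integral_diff_cont[OF sec_times[OF ts(1)] sec_times[OF ts(2)]] mean_eq[of "u s"] mean_eq[of "u t"]
      unfolding b_def by (simp add: right_diff_distrib)
    ultimately show ?thesis using a by (simp add: abs_mult)
  qed
  \<comment> \<open>Projection on the mode, whose square integrates to pi / 2; the increment of the
    mean is orthogonal to it and drops out.\<close>
  have c_diff: "\<bar>c s - c t\<bar> * (pi / 2) \<le> sqrt (a * L s t) + a * (\<rho> s + \<rho> t)" if st: "0 < s" "0 < t" for s t
  proof (cases "a = pi")
    case False
    then have "c s = 0" "c t = 0" using c(1) st by auto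
    moreover have "0 \<le> sqrt (a * L s t)" using a L0[OF st] by simp
    moreover have "0 \<le> a * (\<rho> s + \<rho> t)" using a rho0 st by simp
    ultimately show ?thesis by simp
  next
    case True
    have ts: "s \<in> times \<infinity>" "t \<in> times \<infinity>" using st by (simp_all add: times_inf)
    define r where "r = (\<lambda>x. (u s x - b s - c s * kmode a x) - (u t x - b t - c t * kmode a x))"
    have rc: "continuous_on {0..a} r" unfolding r_def by (intro continuous_intros sec_times ts kmode_cont)
    define d where "d = (\<lambda>x. (u s x - u t x) * kmode a x)"
    have dc: "continuous_on {0..a} d" unfolding d_def by (intro continuous_intros sec_times ts kmode_cont)
    have "integral {0..a} d = integral {0..a} (\<lambda>x. ((b s - b t) * kmode a x + (c s - c t) * (kmode a x)\<^sup>2) + r x * kmode a x)"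
      unfolding d_def r_def by (rule integral_cong) (simp add: power2_eq_square algebra_simps)
    also have "\<dots> = integral {0..a} (\<lambda>x. (b s - b t) * kmode a x + (c s - c t) * (kmode a x)\<^sup>2) + integral {0..a} (\<lambda>x. r x * kmode a x)"
      by (rule integral_add_cont) (intro continuous_intros rc kmode_cont)+
    also have "integral {0..a} (\<lambda>x. (b s - b t) * kmode a x + (c s - c t) * (kmode a x)\<^sup>2)
      = integral {0..a} (\<lambda>x. (b s - b t) * kmode a x) + integral {0..a} (\<lambda>x. (c s - c t) * (kmode a x)\<^sup>2)"
      by (rule integral_add_cont) (intro continuous_intros kmode_cont)+
    finally have eq: "(c s - c t) * (pi / 2) = integral {0..a} d - integral {0..a} (\<lambda>x. r x * kmode a x)"
      using kmode_integral[OF a] True by simp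
    have 1: "\<bar>integral {0..a} d\<bar> \<le> sqrt (a * L s t)"
    proof -
      have "\<bar>integral {0..a} d\<bar> \<le> sqrt (a * integral {0..a} (\<lambda>x. (d x)\<^sup>2))"
        by (rule integral_abs_le_sqrt[OF dc]) (use a in auto)
      also have "\<dots> \<le> sqrt (a * L s t)"
      proof (intro real_sqrt_le_mono mult_left_mono)
        show "integral {0..a} (\<lambda>x. (d x)\<^sup>2) \<le> L s t"
          unfolding L_def
        proof (rule integral_mono_cont)
          fix x
          have "(kmode a x)\<^sup>2 \<le> 1" using kmode_bound[of a x] by (simp add: abs_square_le_1)
          then show "(d x)\<^sup>2 \<le> (u s x - u t x)\<^sup>2"
            unfolding d_def using mult_left_mono[of "(kmode a x)\<^sup>2" 1 "(u s x - u t x)\<^sup>2"] by (simp add: power_mult_distrib)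
        qed (intro continuous_intros dc sec_times ts)+
      qed (use a in simp)
      finally show ?thesis .
    qed
    have 2: "\<bar>integral {0..a} (\<lambda>x. r x * kmode a x)\<bar> \<le> a * (\<rho> s + \<rho> t)"
    proof -
      have "norm (integral {0..a} (\<lambda>x. r x * kmode a x)) \<le> (\<rho> s + \<rho> t) * (a - 0)"
      proof (rule integral_bound)
        fix x assume x: "x \<in> {0..a}"
        have "\<bar>r x\<bar> \<le> \<rho> s + \<rho> t" unfolding r_def using c(2)[OF st(1) x] c(2)[OF st(2) x] by linarith
        then have "\<bar>r x\<bar> * \<bar>kmode a x\<bar> \<le> (\<rho> s + \<rho> t) * 1"
          using kmode_bound[of a x] rho0 st by (intro mult_mono) auto
        then show "norm (r x * kmode a x) \<le> \<rho> s + \<rho> t" by (simp add: abs_mult)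
      qed (use a in \<open>auto intro!: continuous_intros rc kmode_cont\<close>)
      then show ?thesis by (simp add: mult.commute)
    qed
    have "\<bar>c s - c t\<bar> * (pi / 2) = \<bar>(c s - c t) * (pi / 2)\<bar>" by (simp add: abs_mult)
    then show ?thesis unfolding eq using 1 2 by linarith
  qed
  have sqrt_small: "\<exists>t0>0. \<forall>s t. t0 \<le> s \<longrightarrow> t0 \<le> t \<longrightarrow> sqrt (a * L s t) < e" if e: "0 < e" for e
  proof -
    have "0 < e\<^sup>2 / (2 * a * A)" using e a A by simp
    then obtain t0 where t0: "0 < t0" "\<And>t. t0 \<le> t \<Longrightarrow> \<rho> t < e\<^sup>2 / (2 * a * A)" using small by blast
    have "sqrt (a * L s t) < e" if "t0 \<le> s" "t0 \<le> t" for s t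
    proof -
      have "a * L s t \<le> a * (A * (\<rho> s + \<rho> t))" using L_bound[of s t] that t0 a by (intro mult_left_mono) auto
      also have "\<dots> < a * (A * (e\<^sup>2 / (2 * a * A) + e\<^sup>2 / (2 * a * A)))"
        using t0(2)[OF that(1)] t0(2)[OF that(2)] a A by (intro mult_strict_left_mono add_strict_mono)
      also have "\<dots> = e\<^sup>2" using a A by (simp add: field_simps)
      finally show ?thesis using e by (simp add: real_less_lsqrt)
    qed
    then show ?thesis using t0(1) by blast
  qed
  obtain bl where bl: "(b \<longlongrightarrow> bl) at_top"
  proof (rule cauchy_at_top_convergent)
    fix e :: real assume e: "0 < e"
    then have "0 < a * e" using a by simp
    then obtain t0 where t0: "0 < t0" "\<And>s t. t0 \<le> s \<Longrightarrow> t0 \<le> t \<Longrightarrow> sqrt (a * L s t) < a * e" using sqrt_small by blast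
    have "\<bar>b s - b t\<bar> < e" if "t0 \<le> s" "t0 \<le> t" for s t
    proof -
      have "a * \<bar>b s - b t\<bar> < a * e" using b_diff[of s t] t0(2)[OF that] that t0(1) by linarith
      then show ?thesis using a by simp
    qed
    then show "\<exists>t0. \<forall>s t. t0 \<le> s \<longrightarrow> t0 \<le> t \<longrightarrow> \<bar>b s - b t\<bar> < e" by blast
  qed
  obtain cl where cl: "(c \<longlongrightarrow> cl) at_top"
  proof (rule cauchy_at_top_convergent)
    fix e :: real assume e: "0 < e"
    have "0 < e * (pi / 4)" using e by simp
    then obtain t0 where t0: "0 < t0" "\<And>s t. t0 \<le> s \<Longrightarrow> t0 \<le> t \<Longrightarrow> sqrt (a * L s t) < e * (pi / 4)" using sqrt_small by blast
    have "0 < e * (pi / 8) / a" using e a by simp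
    then obtain t1 where t1: "0 < t1" "\<And>t. t1 \<le> t \<Longrightarrow> \<rho> t < e * (pi / 8) / a" using small by blast
    have "\<bar>c s - c t\<bar> < e" if "max t0 t1 \<le> s" "max t0 t1 \<le> t" for s t
    proof -
      have st: "0 < s" "0 < t" "t0 \<le> s" "t0 \<le> t" "t1 \<le> s" "t1 \<le> t" using that t0(1) by auto
      have "\<rho> s + \<rho> t < e * (pi / 8) / a + e * (pi / 8) / a" using t1(2) st by (intro add_strict_mono) auto
      then have "a * (\<rho> s + \<rho> t) < a * (e * (pi / 8) / a + e * (pi / 8) / a)" using a by (intro mult_strict_left_mono)
      also have "\<dots> = e * (pi / 4)" using a by (simp add: field_simps)
      finally have "a * (\<rho> s + \<rho> t) < e * (pi / 4)" .
      moreover have "e * (pi / 2) = e * (pi / 4) + e * (pi / 4)" by simp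
      ultimately have "\<bar>c s - c t\<bar> * (pi / 2) < e * (pi / 2)"
        using c_diff[OF st(1,2)] t0(2)[OF st(3,4)] by linarith
      then show ?thesis by simp
    qed
    then show "\<exists>t0. \<forall>s t. t0 \<le> s \<longrightarrow> t0 \<le> t \<longrightarrow> \<bar>c s - c t\<bar> < e" by blast
  qed
  define v where "v = (\<lambda>x. bl + cl * kmode a x)"
  have lim: "uniform_limit {0..a} u v at_top"
  proof (rule uniform_limitI)
    fix e :: real assume e: "0 < e"
    then have e3: "0 < e / 3" by simp
    show "\<forall>\<^sub>F t in at_top. \<forall>x\<in>{0..a}. dist (u t x) (v x) < e"
      using tendstoD[OF bl e3] tendstoD[OF cl e3] order_tendstoD(2)[OF rho_lim e3] eventually_gt_at_top[of 0]
    proof eventually_elim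
      case (elim t)
      show ?case
      proof
        fix x assume x: "x \<in> {0..a}"
        have "\<bar>(c t - cl) * kmode a x\<bar> \<le> \<bar>c t - cl\<bar>" using kmode_bound[of a x] by (simp add: abs_mult mult_left_le)
        moreover have "u t x - v x = (u t x - b t - c t * kmode a x) + (b t - bl) + (c t - cl) * kmode a x"
          unfolding v_def by (simp add: algebra_simps)
        ultimately show "dist (u t x) (v x) < e"
          using c(2)[OF elim(4) x] elim(1-3) unfolding dist_real_def by linarith
      qed
    qed
  qed
  have v0: "0 \<le> v x" if x: "x \<in> {0..a}" for x
  proof (rule tendsto_lowerbound)
    show "((\<lambda>t. u t x) \<longlongrightarrow> v x) at_top" by (rule tendsto_uniform_limitI[OF lim x])
    show "\<forall>\<^sub>F t in at_top. 0 \<le> u t x"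
      using eventually_ge_at_top[of 0] by eventually_elim (use u_pos x in \<open>auto simp: times_inf intro: less_imp_le\<close>)
  qed simp
  have mean_v: "mean a v = bl"
  proof -
    have "integral {0..a} v = integral {0..a} (\<lambda>x. bl) + integral {0..a} (\<lambda>x. cl * kmode a x)"
      unfolding v_def by (rule integral_add_cont) (intro continuous_intros kmode_cont)+
    also have "\<dots> = a * bl" using kmode_integral(1)[OF a] a by simp
    finally show ?thesis unfolding mean_def using a by simp
  qed
  have "nonneg_steady_state p a v"
    unfolding nonneg_steady_state_def
  proof (intro conjI ballI v0 exI)
    \<comment> \<open>Writing the limit with cos x and a coefficient that vanishes unless a = pi
      makes the derivative \<open>- w * sin x\<close> vanish at a in both cases.\<close>
    define w where "w = (if a = pi then cl else 0)"
    have v_eq: "v = (\<lambda>x. bl + w * cos x)" unfolding v_def w_def kmode_def by auto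
    show "(v has_real_derivative - w * sin x) (at x within {0..a})" for x
      unfolding v_eq by (auto intro!: derivative_eq_intros)
    show "((\<lambda>x. - w * sin x) has_real_derivative - w * cos x) (at x within {0..a})" for x
      by (auto intro!: derivative_eq_intros)
    show "continuous_on {0..a} (\<lambda>x. - w * cos x)" by (intro continuous_intros)
    \<comment> \<open>The bracket vanishes identically, also at points where v is 0.\<close>
    show "v x powr p * (- w * cos x + v x - mean a v) = 0" for x
      unfolding mean_v by (simp add: v_eq)
    show "- w * sin 0 = 0" by simp
    show "- w * sin a = 0" unfolding w_def by simp
  qed
  then show ?thesis using lim by (rule that)
qed

end

theorem proposition1p4:
  fixes p a :: real
  assumes "(1 < p \<and> p \<le> 2 \<and> 0 < a \<and> a \<le> pi) \<or> (p > 2 \<and> 0 < a \<and> a < pi)"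
  shows "\<forall>u0 :: real \<Rightarrow> real. continuous_on {0..a} u0 \<and> (\<forall>x\<in>{0..a}. 0 < u0 x) \<longrightarrow>
           (\<exists>T u. maximal_solution p a u0 T u) \<and>
           (\<forall>T u. maximal_solution p a u0 T u \<longrightarrow>
              T = \<infinity> \<and>
              (\<exists>v. nonneg_steady_state p a v \<and> uniform_limit {0..a} u v at_top))"
proof (intro allI impI conjI)
  have p: "1 < p" and a: "0 < a" "a \<le> pi" using assms by auto
  fix u0 :: "real \<Rightarrow> real"
  assume u0: "continuous_on {0..a} u0 \<and> (\<forall>x\<in>{0..a}. 0 < u0 x)"
  show "\<exists>T u. maximal_solution p a u0 T u"
    using maximal_solution_exists[OF p a(1)] u0 by blast
  fix T u assume max: "maximal_solution p a u0 T u"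
  then have sol: "is_solution p a u0 T u" unfolding maximal_solution_def by blast
  obtain ut ux uxx where ps: "pde_sol p a T u ut ux uxx" using is_solution_pde_sol[OF sol p a(1)] .
  show T: "T = \<infinity>"
  \<comment> \<open>If T were finite, the a priori bound would allow a continuation beyond T,
    against maximality.\<close>
  proof (rule ccontr)
    assume "T \<noteq> \<infinity>"
    moreover have "0 < T" using sol unfolding is_solution_def by simp
    ultimately obtain r where r: "T = ereal r" by (cases T) auto
    obtain M where M: "0 < M" "\<And>t x. t \<in> times T \<Longrightarrow> x \<in> {0..a} \<Longrightarrow> u t x \<le> M"
      by (rule pde_sol.sup_bounded[OF ps a(2)]) blast
    from continuation[OF sol[unfolded r] p a(1) _ M(1)] M(2)
    have "\<exists>T' v. ereal r < T' \<and> is_solution p a u0 T' v \<and> (\<forall>t\<in>times (ereal r). \<forall>x\<in>{0..a}. v t x = u t x)"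
      unfolding r by simp
    then show False using max unfolding maximal_solution_def r by blast
  qed
  have "pde_global p a u ut ux uxx"
    using ps a(2) unfolding T pde_global_def pde_global_axioms_def by simp
  then show "\<exists>v. nonneg_steady_state p a v \<and> uniform_limit {0..a} u v at_top"
    by (rule pde_global.converges) blast
qed

end
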